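(* Let $p$ be a prime, $G$ a profinite group, $\chi\colon G\to A$ a surjective continuous homomorphism onto a nonzero quotient $A$ of $\mathbb{Z}_p$, $n\ge1$, and $R$ a nonzero quotient of $A$ with $A=\mathbb{Z}_p$ or $n|R|<p|A|$. Let $H$ be the coimage of $\chi$, $\Omega=R[[H]]$, $I$ its augmentation ideal, $h\in H$ the element with $\chi(h)=1$, $x=[h]-1$ (so $\Omega/I^j\cong R[x]/(x^j)$ for $j\le n+1$ and $I^n/I^{n+1}=Rx^n$). Let $T$ be a compact $R[[G]]$-module finitely generated over $R$, and $f=\sum_{k=0}^{n-1}\lambda_kx^k\in Z^1(G,T\otimes_R\Omega/I^n)$ with $\lambda_k\colon G\to T$, and $\lambda=\lambda_0$ (the image of $f$ in $Z^1(G,T)$). Then $$\Psi^{(n)}([f])=(\chi^{(n)},\lambda)_{\rho_{x^n}}\cdot x^n,$$ where $\rho_{x^n}$ is the proper defining system relative to $\binom{\chi}{n}^{\mathrm{mat}}$ attached to $f$.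
   Context: $G$ acts on $\Omega$ through $H$ by left multiplication and on $T\otimes_R\Omega/I^m$ diagonally. $\Psi^{(n)}\colon H^1(G,T\otimes_R\Omega/I^n)\to H^2(G,T)\otimes_RI^n/I^{n+1}$ is the connecting map of $0\to T\otimes I^n/I^{n+1}\to T\otimes\Omega/I^{n+1}\to T\otimes\Omega/I^n\to0$, identifying $H^2(G,T\otimes Rx^n)$ with $H^2(G,T)\cdot x^n$. $\binom{c}{n}^{\mathrm{mat}}$ is the $(n+1)\times(n+1)$ upper-triangular matrix over $R$ with $(i,j)$-entry $\binom{c}{j-i}$; $\binom{\chi}{n}^{\mathrm{mat}}\colon G\to\mathrm{U}_{n+1}(R)$, $g\mapsto\binom{\chi(g)}{n}^{\mathrm{mat}}$ is a well-defined homomorphism under the hypotheses. Let $\mathcal U$ be the group of $(n+2)\times(n+2)$ matrices $\begin{pmatrix}P&v\\0&1\end{pmatrix}$, $P\in\mathrm{U}_{n+1}(R)$, $v\in T^{n+1}$ (a column), $G$ acting on $v$, and $\mathcal U'$ its quotient by the matrices with $P=1$ and $v$ zero outside its first entry. The proper defining system relative to $\binom{\chi}{n}^{\mathrm{mat}}$ attached to $f$ is the $1$-cocycle $\rho_{x^n}\colon G\to\mathcal U'$ (i.e. $\rho(gh)=\rho(g)\cdot g\rho(h)$) with upper-left block $\binom{\chi}{n}^{\mathrm{mat}}$ and $(n+1-k,n+2)$-entry $\lambda_k$ for $0\le k\le n-1$. For such $\rho$ with lift $\tilde\rho$ having $(1,n+2)$-entry $0$ and entries $\rho_{i,j}$,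 the Massey product $(\chi^{(n)},\lambda)_\rho$ ($n$ copies of $\chi$, then $\lambda=\rho_{n+1,n+2}$) is the class in $H^2(G,T)$ of $(g,h)\mapsto\sum_{i=2}^{n+1}\rho_{1,i}(g)\,g\rho_{i,n+2}(h)$. *)

theory Defs
  imports "HOL-Analysis.Analysis" "HOL-Algebra.Module" "HOL-Algebra.QuotRing"
    "HOL-Algebra.Ideal_Product"
begin

section \<open>Topological groups, rings and modules\<close>

record 'g topgroup = "'g monoid" +
  grp_top :: "'g topology"

record 'r topring = "'r ring" +
  ring_top :: "'r topology"

record ('r, 'm) topmodule = "('r, 'm) module" +
  mod_top :: "'m topology"

record ('r, 'm, 'g) gmodule = "('r, 'm) topmodule" +
  act :: "'g \<Rightarrow> 'm \<Rightarrow> 'm"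

definition profinite_group :: "('g, 'x) topgroup_scheme \<Rightarrow> bool" where
  "profinite_group G \<longleftrightarrow> group G \<and> topspace (grp_top G) = carrier G \<and>
     continuous_map (prod_topology (grp_top G) (grp_top G)) (grp_top G) (\<lambda>(g, h). g \<otimes>\<^bsub>G\<^esub> h) \<and>
     continuous_map (grp_top G) (grp_top G) (\<lambda>g. inv\<^bsub>G\<^esub> g) \<and>
     compact_space (grp_top G) \<and> Hausdorff_space (grp_top G) \<and>
     (\<forall>S. connectedin (grp_top G) S \<longrightarrow> (\<exists>a. S \<subseteq> {a}))"

definition quot_topology :: "'a topology \<Rightarrow> ('a \<Rightarrow> 'b) \<Rightarrow> 'b topology" where
  "quot_topology X f =
     topology (\<lambda>U. U \<subseteq> f ` topspace X \<and> openin X {x \<in> topspace X. f x \<in> U})"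

definition quot_topgroup :: "('g, 'x) topgroup_scheme \<Rightarrow> 'g set \<Rightarrow> 'g set topgroup" where
  "quot_topgroup G K =
     \<lparr>carrier = carrier (G Mod K), mult = mult (G Mod K), one = one (G Mod K),
      grp_top = quot_topology (grp_top G) (\<lambda>g. K #>\<^bsub>G\<^esub> g)\<rparr>"

text \<open>\<open>C\<close> is, via \<open>q\<close>, a quotient of the topological ring \<open>B\<close>.\<close>

definition topring_quotient ::
    "('b, 'x) topring_scheme \<Rightarrow> ('c, 'y) topring_scheme \<Rightarrow> ('b \<Rightarrow> 'c) \<Rightarrow> bool" where
  "topring_quotient B C q \<longleftrightarrow> cring C \<and> topspace (ring_top C) = carrier C \<and>
     q \<in> ring_hom B C \<and> quotient_map (ring_top B) (ring_top C) q"

text \<open>Compact left modules over a (not necessarily commutative) topological ring; the library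
  locale for modules is restricted to commutative rings.\<close>

definition compact_module ::
    "('r, 'x) topring_scheme \<Rightarrow> ('r, 'm, 'y) topmodule_scheme \<Rightarrow> bool" where
  "compact_module S M \<longleftrightarrow> abelian_group M \<and>
     (\<forall>a\<in>carrier S. \<forall>m\<in>carrier M. a \<odot>\<^bsub>M\<^esub> m \<in> carrier M) \<and>
     (\<forall>a\<in>carrier S. \<forall>b\<in>carrier S. \<forall>m\<in>carrier M.
        (a \<oplus>\<^bsub>S\<^esub> b) \<odot>\<^bsub>M\<^esub> m = (a \<odot>\<^bsub>M\<^esub> m) \<oplus>\<^bsub>M\<^esub> (b \<odot>\<^bsub>M\<^esub> m)) \<and>
     (\<forall>a\<in>carrier S. \<forall>m\<in>carrier M. \<forall>m'\<in>carrier M.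
        a \<odot>\<^bsub>M\<^esub> (m \<oplus>\<^bsub>M\<^esub> m') = (a \<odot>\<^bsub>M\<^esub> m) \<oplus>\<^bsub>M\<^esub> (a \<odot>\<^bsub>M\<^esub> m')) \<and>
     (\<forall>a\<in>carrier S. \<forall>b\<in>carrier S. \<forall>m\<in>carrier M.
        (a \<otimes>\<^bsub>S\<^esub> b) \<odot>\<^bsub>M\<^esub> m = a \<odot>\<^bsub>M\<^esub> (b \<odot>\<^bsub>M\<^esub> m)) \<and>
     (\<forall>m\<in>carrier M. \<one>\<^bsub>S\<^esub> \<odot>\<^bsub>M\<^esub> m = m) \<and>
     topspace (mod_top M) = carrier M \<and>
     continuous_map (prod_topology (mod_top M) (mod_top M)) (mod_top M) (\<lambda>(m, m'). m \<oplus>\<^bsub>M\<^esub> m') \<and>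
     continuous_map (mod_top M) (mod_top M) (\<lambda>m. \<ominus>\<^bsub>M\<^esub> m) \<and>
     continuous_map (prod_topology (ring_top S) (mod_top M)) (mod_top M) (\<lambda>(a, m). a \<odot>\<^bsub>M\<^esub> m) \<and>
     compact_space (mod_top M) \<and> Hausdorff_space (mod_top M)"

definition fin_gen_over :: "('r, 'x) ring_scheme \<Rightarrow> ('r, 'm, 'y) module_scheme \<Rightarrow> bool" where
  "fin_gen_over R M \<longleftrightarrow> (\<exists>S. finite S \<and> S \<subseteq> carrier M \<and>
     (\<forall>m\<in>carrier M. \<exists>r\<in>S \<rightarrow> carrier R. m = (\<Oplus>\<^bsub>M\<^esub>s\<in>S. r s \<odot>\<^bsub>M\<^esub> s)))"


section \<open>The \<open>p\<close>-adic integers and binomial coefficients\<close>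

text \<open>\<open>Zp p\<close> is the inverse limit of the rings of residues \<open>{0..<p^k}\<close>.\<close>

definition Zp_carrier :: "nat \<Rightarrow> (nat \<Rightarrow> int) set" where
  "Zp_carrier p = {a. \<forall>k. a k \<in> {0..<int p ^ k} \<and> a (Suc k) mod int p ^ k = a k}"

definition Zp :: "nat \<Rightarrow> (nat \<Rightarrow> int) topring" where
  "Zp p = \<lparr>carrier = Zp_carrier p,
     mult = (\<lambda>a b k. (a k * b k) mod int p ^ k), one = (\<lambda>k. 1 mod int p ^ k),
     zero = (\<lambda>k. 0), add = (\<lambda>a b k. (a k + b k) mod int p ^ k),
     ring_top = subtopology (product_topology (\<lambda>_. discrete_topology UNIV) UNIV) (Zp_carrier p)\<rparr>"

text \<open>The \<open>p\<close>-adic integer \<open>c (c - 1) \<dots> (c - k + 1) / k!\<close>.\<close>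

definition Zp_binom :: "nat \<Rightarrow> (nat \<Rightarrow> int) \<Rightarrow> nat \<Rightarrow> (nat \<Rightarrow> int)" where
  "Zp_binom p c k = (THE b. b \<in> carrier (Zp p) \<and>
     [(fact k :: nat)] \<cdot>\<^bsub>Zp p\<^esub> b =
       (\<Otimes>\<^bsub>Zp p\<^esub>i\<in>{..<k}. c \<ominus>\<^bsub>Zp p\<^esub> ([i] \<cdot>\<^bsub>Zp p\<^esub> \<one>\<^bsub>Zp p\<^esub>)))"

text \<open>For quotients \<open>q: Zp \<rightarrow> A\<close> and \<open>\<pi>: A \<rightarrow> R\<close>, the common image in \<open>R\<close> of the
  binomial coefficients of all \<open>p\<close>-adic lifts of \<open>c \<in> A\<close>.\<close>

definition quot_binom ::
    "nat \<Rightarrow> ((nat \<Rightarrow> int) \<Rightarrow> 'a) \<Rightarrow> ('a \<Rightarrow> 'r) \<Rightarrow> 'a \<Rightarrow> nat \<Rightarrow> 'r" where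
  "quot_binom p q \<pi> c k =
     the_elem ((\<lambda>z. \<pi> (q (Zp_binom p z k))) ` {z \<in> carrier (Zp p). q z = c})"

definition binom_mat ::
    "('r, 'x) ring_scheme \<Rightarrow> nat \<Rightarrow> ((nat \<Rightarrow> int) \<Rightarrow> 'a) \<Rightarrow> ('a \<Rightarrow> 'r) \<Rightarrow> nat \<Rightarrow> 'a
       \<Rightarrow> (nat \<times> nat \<Rightarrow> 'r)" where
  "binom_mat R p q \<pi> n c = (\<lambda>(i, j) \<in> {1..n+1} \<times> {1..n+1}.
     if i \<le> j then quot_binom p q \<pi> c (j - i) else \<zero>\<^bsub>R\<^esub>)"


section \<open>Completed group rings\<close>

text \<open>The group ring of a finite group.\<close>

definition group_ring :: "('r, 'x) ring_scheme \<Rightarrow> ('q, 'y) monoid_scheme \<Rightarrow> ('q \<Rightarrow> 'r) ring" where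
  "group_ring R Q =
     \<lparr>carrier = carrier Q \<rightarrow>\<^sub>E carrier R,
      mult = (\<lambda>a b. \<lambda>u\<in>carrier Q. \<Oplus>\<^bsub>R\<^esub>v\<in>carrier Q. a v \<otimes>\<^bsub>R\<^esub> b (inv\<^bsub>Q\<^esub> v \<otimes>\<^bsub>Q\<^esub> u)),
      one = (\<lambda>u\<in>carrier Q. if u = \<one>\<^bsub>Q\<^esub> then \<one>\<^bsub>R\<^esub> else \<zero>\<^bsub>R\<^esub>),
      zero = (\<lambda>u\<in>carrier Q. \<zero>\<^bsub>R\<^esub>),
      add = (\<lambda>a b. \<lambda>u\<in>carrier Q. a u \<oplus>\<^bsub>R\<^esub> b u)\<rparr>"

definition open_normals :: "('g, 'x) topgroup_scheme \<Rightarrow> 'g set set" where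
  "open_normals G = {N. normal N G \<and> openin (grp_top G) N}"

text \<open>\<open>R[[G]]\<close> as the inverse limit of the rings \<open>R[G/N]\<close> over the open normal subgroups \<open>N\<close>.
  For \<open>N \<subseteq> M\<close> the transition map \<open>R[G/N] \<rightarrow> R[G/M]\<close> adds up the coefficients of the
  cosets of \<open>N\<close> lying in a given coset of \<open>M\<close>.\<close>

definition cgr_carrier ::
    "('r, 'x) topring_scheme \<Rightarrow> ('g, 'y) topgroup_scheme \<Rightarrow> ('g set \<Rightarrow> 'g set \<Rightarrow> 'r) set" where
  "cgr_carrier R G = {a \<in> (\<Pi>\<^sub>E N\<in>open_normals G. carrier (group_ring R (G Mod N))).
     \<forall>N\<in>open_normals G. \<forall>M\<in>open_normals G. N \<subseteq> M \<longrightarrow>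
       (\<forall>C\<in>carrier (G Mod M). a M C = (\<Oplus>\<^bsub>R\<^esub>D\<in>{D \<in> carrier (G Mod N). D \<subseteq> C}. a N D))}"

definition completed_group_ring ::
    "('r, 'x) topring_scheme \<Rightarrow> ('g, 'y) topgroup_scheme \<Rightarrow> ('g set \<Rightarrow> 'g set \<Rightarrow> 'r) topring" where
  "completed_group_ring R G =
     \<lparr>carrier = cgr_carrier R G,
      mult = (\<lambda>a b. \<lambda>N\<in>open_normals G. a N \<otimes>\<^bsub>group_ring R (G Mod N)\<^esub> b N),
      one = (\<lambda>N\<in>open_normals G. \<one>\<^bsub>group_ring R (G Mod N)\<^esub>),
      zero = (\<lambda>N\<in>open_normals G. \<zero>\<^bsub>group_ring R (G Mod N)\<^esub>),
      add = (\<lambda>a b. \<lambda>N\<in>open_normals G. a N \<oplus>\<^bsub>group_ring R (G Mod N)\<^esub> b N),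
      ring_top = subtopology
        (product_topology (\<lambda>N. product_topology (\<lambda>_. ring_top R) (carrier (G Mod N))) (open_normals G))
        (cgr_carrier R G)\<rparr>"

definition cgr_elt ::
    "('r, 'x) topring_scheme \<Rightarrow> ('g, 'y) topgroup_scheme \<Rightarrow> 'g \<Rightarrow> ('g set \<Rightarrow> 'g set \<Rightarrow> 'r)" where
  "cgr_elt R G g = (\<lambda>N\<in>open_normals G. \<lambda>C\<in>carrier (G Mod N).
     if C = N #>\<^bsub>G\<^esub> g then \<one>\<^bsub>R\<^esub> else \<zero>\<^bsub>R\<^esub>)"

definition cgr_const ::
    "('r, 'x) topring_scheme \<Rightarrow> ('g, 'y) topgroup_scheme \<Rightarrow> 'r \<Rightarrow> ('g set \<Rightarrow> 'g set \<Rightarrow> 'r)" where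
  "cgr_const R G r = (\<lambda>N\<in>open_normals G. \<lambda>C\<in>carrier (G Mod N). if C = N then r else \<zero>\<^bsub>R\<^esub>)"

text \<open>The augmentation of \<open>a\<close> is its component at \<open>N = G\<close>, an element of \<open>R[G/G] = R\<close>.\<close>

definition aug_ideal ::
    "('r, 'x) topring_scheme \<Rightarrow> ('g, 'y) topgroup_scheme \<Rightarrow> ('g set \<Rightarrow> 'g set \<Rightarrow> 'r) set" where
  "aug_ideal R G =
     {a \<in> carrier (completed_group_ring R G). a (carrier G) (carrier G) = \<zero>\<^bsub>R\<^esub>}"

primrec ideal_pow :: "('a, 'x) ring_scheme \<Rightarrow> 'a set \<Rightarrow> nat \<Rightarrow> 'a set" where
  "ideal_pow S I 0 = carrier S"
| "ideal_pow S I (Suc k) = ideal_prod S (ideal_pow S I k) I"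

abbreviation aug_pow ::
    "('r, 'x) topring_scheme \<Rightarrow> ('g, 'y) topgroup_scheme \<Rightarrow> nat \<Rightarrow> ('g set \<Rightarrow> 'g set \<Rightarrow> 'r) set" where
  "aug_pow R G j \<equiv> ideal_pow (completed_group_ring R G) (aug_ideal R G) j"

text \<open>\<open>\<Omega>/I^j\<close> and its submodule \<open>I^n/I^(n+1) \<subseteq> \<Omega>/I^(n+1)\<close> as \<open>R\<close>-modules,
  where \<open>\<Omega> = R[[H]]\<close>.\<close>

definition omega_quot ::
    "('r, 'x) topring_scheme \<Rightarrow> ('h, 'y) topgroup_scheme \<Rightarrow> nat
       \<Rightarrow> ('r, ('h set \<Rightarrow> 'h set \<Rightarrow> 'r) set) module" where
  "omega_quot R H j = (let \<Omega> = completed_group_ring R H; J = aug_pow R H j in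
     \<lparr>carrier = carrier (\<Omega> Quot J), mult = mult (\<Omega> Quot J), one = one (\<Omega> Quot J),
      zero = zero (\<Omega> Quot J), add = add (\<Omega> Quot J),
      smult = (\<lambda>r X. (J +>\<^bsub>\<Omega>\<^esub> cgr_const R H r) \<otimes>\<^bsub>\<Omega> Quot J\<^esub> X)\<rparr>)"

definition aug_graded ::
    "('r, 'x) topring_scheme \<Rightarrow> ('h, 'y) topgroup_scheme \<Rightarrow> nat
       \<Rightarrow> ('r, ('h set \<Rightarrow> 'h set \<Rightarrow> 'r) set) module" where
  "aug_graded R H n = (omega_quot R H (Suc n))
     \<lparr>carrier := (\<lambda>w. aug_pow R H (Suc n) +>\<^bsub>completed_group_ring R H\<^esub> w) ` aug_pow R H n\<rparr>"

text \<open>\<open>g \<in> G\<close> acts on \<open>\<Omega>/I^j\<close>, for \<open>H = G/K\<close>, by multiplication by the class of \<open>gK\<close>.\<close>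

definition omega_act ::
    "('r, 'x) topring_scheme \<Rightarrow> ('g, 'y) topgroup_scheme \<Rightarrow> 'g set \<Rightarrow> nat \<Rightarrow> 'g
       \<Rightarrow> ('g set set \<Rightarrow> 'g set set \<Rightarrow> 'r) set \<Rightarrow> ('g set set \<Rightarrow> 'g set set \<Rightarrow> 'r) set" where
  "omega_act R G K j g X =
     (let H = quot_topgroup G K; \<Omega> = completed_group_ring R H; J = aug_pow R H j in
       (J +>\<^bsub>\<Omega>\<^esub> cgr_elt R H (K #>\<^bsub>G\<^esub> g)) \<otimes>\<^bsub>\<Omega> Quot J\<^esub> X)"

text \<open>An \<open>R[[G]]\<close>-module viewed as an \<open>R\<close>-module with \<open>G\<close>-action.\<close>

definition coeff_module ::
    "('r, 'x) topring_scheme \<Rightarrow> ('g, 'y) topgroup_scheme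
       \<Rightarrow> ('g set \<Rightarrow> 'g set \<Rightarrow> 'r, 'm, 'z) topmodule_scheme \<Rightarrow> ('r, 'm, 'g) gmodule" where
  "coeff_module R G M =
     \<lparr>carrier = carrier M, mult = mult M, one = one M, zero = zero M, add = add M,
      smult = (\<lambda>r m. cgr_const R G r \<odot>\<^bsub>M\<^esub> m), mod_top = mod_top M,
      act = (\<lambda>g m. cgr_elt R G g \<odot>\<^bsub>M\<^esub> m)\<rparr>"


section \<open>Quotient modules and tensor products\<close>

definition quot_module :: "('r, 'm, 'x) module_scheme \<Rightarrow> 'm set \<Rightarrow> ('r, 'm set) module" where
  "quot_module M N =
     \<lparr>carrier = a_rcosets\<^bsub>M\<^esub> N, mult = undefined, one = undefined, zero = N, add = set_add M,
      smult = (\<lambda>r X. \<Union>x\<in>X. N +>\<^bsub>M\<^esub> (r \<odot>\<^bsub>M\<^esub> x))\<rparr>"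

definition free_module :: "('r, 'x) ring_scheme \<Rightarrow> 's set \<Rightarrow> ('r, 's \<Rightarrow> 'r) module" where
  "free_module R S =
     \<lparr>carrier = {a \<in> S \<rightarrow>\<^sub>E carrier R. finite {s \<in> S. a s \<noteq> \<zero>\<^bsub>R\<^esub>}},
      mult = undefined, one = undefined, zero = (\<lambda>s\<in>S. \<zero>\<^bsub>R\<^esub>),
      add = (\<lambda>a b. \<lambda>s\<in>S. a s \<oplus>\<^bsub>R\<^esub> b s),
      smult = (\<lambda>r a. \<lambda>s\<in>S. r \<otimes>\<^bsub>R\<^esub> a s)\<rparr>"

definition free_gen :: "('r, 'x) ring_scheme \<Rightarrow> 's set \<Rightarrow> 's \<Rightarrow> 's \<Rightarrow> 'r" where
  "free_gen R S s = (\<lambda>u\<in>S. if u = s then \<one>\<^bsub>R\<^esub> else \<zero>\<^bsub>R\<^esub>)"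

definition tensor_relators ::
    "('r, 'x) ring_scheme \<Rightarrow> ('r, 'm, 'y) module_scheme \<Rightarrow> ('r, 'n, 'z) module_scheme
       \<Rightarrow> ('m \<times> 'n \<Rightarrow> 'r) set" where
  "tensor_relators R M N =
     (let S = carrier M \<times> carrier N; F = free_module R S; e = free_gen R S in
       {e (m \<oplus>\<^bsub>M\<^esub> m', n) \<ominus>\<^bsub>F\<^esub> (e (m, n) \<oplus>\<^bsub>F\<^esub> e (m', n)) | m m' n.
          m \<in> carrier M \<and> m' \<in> carrier M \<and> n \<in> carrier N} \<union>
       {e (m, n \<oplus>\<^bsub>N\<^esub> n') \<ominus>\<^bsub>F\<^esub> (e (m, n) \<oplus>\<^bsub>F\<^esub> e (m, n')) | m n n'.
          m \<in> carrier M \<and> n \<in> carrier N \<and> n' \<in> carrier N} \<union>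
       {e (r \<odot>\<^bsub>M\<^esub> m, n) \<ominus>\<^bsub>F\<^esub> (r \<odot>\<^bsub>F\<^esub> e (m, n)) | r m n.
          r \<in> carrier R \<and> m \<in> carrier M \<and> n \<in> carrier N} \<union>
       {e (m, r \<odot>\<^bsub>N\<^esub> n) \<ominus>\<^bsub>F\<^esub> (r \<odot>\<^bsub>F\<^esub> e (m, n)) | r m n.
          r \<in> carrier R \<and> m \<in> carrier M \<and> n \<in> carrier N})"

definition tensor_kernel ::
    "('r, 'x) ring_scheme \<Rightarrow> ('r, 'm, 'y) module_scheme \<Rightarrow> ('r, 'n, 'z) module_scheme
       \<Rightarrow> ('m \<times> 'n \<Rightarrow> 'r) set" where
  "tensor_kernel R M N =
     \<Inter>{S. submodule S R (free_module R (carrier M \<times> carrier N)) \<and> tensor_relators R M N \<subseteq> S}"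

definition tensor ::
    "('r, 'x) ring_scheme \<Rightarrow> ('r, 'm, 'y) module_scheme \<Rightarrow> ('r, 'n, 'z) module_scheme
       \<Rightarrow> ('r, ('m \<times> 'n \<Rightarrow> 'r) set) module" where
  "tensor R M N = quot_module (free_module R (carrier M \<times> carrier N)) (tensor_kernel R M N)"

definition pure_tensor ::
    "('r, 'x) ring_scheme \<Rightarrow> ('r, 'm, 'y) module_scheme \<Rightarrow> ('r, 'n, 'z) module_scheme
       \<Rightarrow> 'm \<Rightarrow> 'n \<Rightarrow> ('m \<times> 'n \<Rightarrow> 'r) set" where
  "pure_tensor R M N m n = tensor_kernel R M N
     +>\<^bsub>free_module R (carrier M \<times> carrier N)\<^esub> free_gen R (carrier M \<times> carrier N) (m, n)"

text \<open>The homomorphism \<open>M \<otimes> N \<rightarrow> K\<close> induced by a bilinear map \<open>\<beta>\<close>.\<close>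

definition tensor_lift ::
    "('r, 'x) ring_scheme \<Rightarrow> ('r, 'm, 'y) module_scheme \<Rightarrow> ('r, 'n, 'z) module_scheme
       \<Rightarrow> ('r, 'k, 'w) module_scheme \<Rightarrow> ('m \<Rightarrow> 'n \<Rightarrow> 'k) \<Rightarrow> ('m \<times> 'n \<Rightarrow> 'r) set \<Rightarrow> 'k" where
  "tensor_lift R M N K \<beta> = (THE \<phi>. \<phi> \<in> extensional (carrier (tensor R M N)) \<and>
     \<phi> \<in> hom (add_monoid (tensor R M N)) (add_monoid K) \<and>
     (\<forall>m\<in>carrier M. \<forall>n\<in>carrier N. \<phi> (pure_tensor R M N m n) = \<beta> m n))"

text \<open>For \<open>N\<close> finitely generated over \<open>R\<close>, the tensor product carries the quotient topology
  from the surjection \<open>T^k \<rightarrow> T \<otimes> N\<close> given by any \<open>k\<close> generators of \<open>N\<close>. Independently of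
  generators, it is the finest topology making all the maps
  \<open>T^k \<rightarrow> T \<otimes> N\<close>, \<open>t \<mapsto> \<Sum> t_i \<otimes> \<nu>_i\<close>, continuous.\<close>

definition tensor_topology ::
    "('r, 'x) ring_scheme \<Rightarrow> ('r, 'm, 'y) topmodule_scheme \<Rightarrow> ('r, 'n, 'z) module_scheme
       \<Rightarrow> ('m \<times> 'n \<Rightarrow> 'r) set topology" where
  "tensor_topology R T N = topology (\<lambda>U. U \<subseteq> carrier (tensor R T N) \<and>
     (\<forall>k::nat. \<forall>\<nu>\<in>{..<k} \<rightarrow> carrier N.
        openin (product_topology (\<lambda>_. mod_top T) {..<k})
          {t \<in> {..<k} \<rightarrow>\<^sub>E topspace (mod_top T).
             (\<Oplus>\<^bsub>tensor R T N\<^esub>i\<in>{..<k}. pure_tensor R T N (t i) (\<nu> i)) \<in> U}))"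

text \<open>\<open>T \<otimes> N\<close> with the diagonal action, where \<open>a\<close> is the action on \<open>N\<close>.\<close>

definition tensor_gmodule ::
    "('r, 'x) ring_scheme \<Rightarrow> ('r, 'm, 'g, 'y) gmodule_scheme \<Rightarrow> ('r, 'n, 'z) module_scheme
       \<Rightarrow> ('g \<Rightarrow> 'n \<Rightarrow> 'n) \<Rightarrow> ('r, ('m \<times> 'n \<Rightarrow> 'r) set, 'g) gmodule" where
  "tensor_gmodule R T N a =
     \<lparr>carrier = carrier (tensor R T N), mult = undefined, one = undefined,
      zero = zero (tensor R T N), add = add (tensor R T N), smult = smult (tensor R T N),
      mod_top = tensor_topology R T N,
      act = (\<lambda>g. tensor_lift R T N (tensor R T N) (\<lambda>t n. pure_tensor R T N (act T g t) (a g n)))\<rparr>"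


section \<open>Continuous cohomology\<close>

definition C1 :: "('g, 'x) topgroup_scheme \<Rightarrow> ('r, 'm, 'g, 'y) gmodule_scheme \<Rightarrow> ('g \<Rightarrow> 'm) set" where
  "C1 G M = {f \<in> extensional (carrier G). continuous_map (grp_top G) (mod_top M) f}"

definition C2 ::
    "('g, 'x) topgroup_scheme \<Rightarrow> ('r, 'm, 'g, 'y) gmodule_scheme \<Rightarrow> ('g \<times> 'g \<Rightarrow> 'm) set" where
  "C2 G M = {c \<in> extensional (carrier G \<times> carrier G).
     continuous_map (prod_topology (grp_top G) (grp_top G)) (mod_top M) c}"

definition coboundary0 ::
    "('g, 'x) topgroup_scheme \<Rightarrow> ('r, 'm, 'g, 'y) gmodule_scheme \<Rightarrow> 'm \<Rightarrow> 'g \<Rightarrow> 'm" where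
  "coboundary0 G M m = (\<lambda>g\<in>carrier G. act M g m \<ominus>\<^bsub>M\<^esub> m)"

definition coboundary1 ::
    "('g, 'x) topgroup_scheme \<Rightarrow> ('r, 'm, 'g, 'y) gmodule_scheme \<Rightarrow> ('g \<Rightarrow> 'm) \<Rightarrow> 'g \<times> 'g \<Rightarrow> 'm" where
  "coboundary1 G M f = (\<lambda>(g, h)\<in>carrier G \<times> carrier G.
     (act M g (f h) \<ominus>\<^bsub>M\<^esub> f (g \<otimes>\<^bsub>G\<^esub> h)) \<oplus>\<^bsub>M\<^esub> f g)"

definition Z1 :: "('g, 'x) topgroup_scheme \<Rightarrow> ('r, 'm, 'g, 'y) gmodule_scheme \<Rightarrow> ('g \<Rightarrow> 'm) set" where
  "Z1 G M = {f \<in> C1 G M. \<forall>g\<in>carrier G. \<forall>h\<in>carrier G.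
     f (g \<otimes>\<^bsub>G\<^esub> h) = f g \<oplus>\<^bsub>M\<^esub> act M g (f h)}"

definition Z2 ::
    "('g, 'x) topgroup_scheme \<Rightarrow> ('r, 'm, 'g, 'y) gmodule_scheme \<Rightarrow> ('g \<times> 'g \<Rightarrow> 'm) set" where
  "Z2 G M = {c \<in> C2 G M. \<forall>g\<in>carrier G. \<forall>h\<in>carrier G. \<forall>k\<in>carrier G.
     act M g (c (h, k)) \<oplus>\<^bsub>M\<^esub> c (g, h \<otimes>\<^bsub>G\<^esub> k) = c (g \<otimes>\<^bsub>G\<^esub> h, k) \<oplus>\<^bsub>M\<^esub> c (g, h)}"

definition fun_module :: "('r, 'm, 'x) module_scheme \<Rightarrow> 's set \<Rightarrow> ('s \<Rightarrow> 'm) set \<Rightarrow> ('r, 's \<Rightarrow> 'm) module" where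
  "fun_module M S F =
     \<lparr>carrier = F, mult = undefined, one = undefined, zero = (\<lambda>s\<in>S. \<zero>\<^bsub>M\<^esub>),
      add = (\<lambda>f f'. \<lambda>s\<in>S. f s \<oplus>\<^bsub>M\<^esub> f' s), smult = (\<lambda>r f. \<lambda>s\<in>S. r \<odot>\<^bsub>M\<^esub> f s)\<rparr>"

definition B1 :: "('g, 'x) topgroup_scheme \<Rightarrow> ('r, 'm, 'g, 'y) gmodule_scheme \<Rightarrow> ('g \<Rightarrow> 'm) set" where
  "B1 G M = coboundary0 G M ` carrier M"

definition B2 ::
    "('g, 'x) topgroup_scheme \<Rightarrow> ('r, 'm, 'g, 'y) gmodule_scheme \<Rightarrow> ('g \<times> 'g \<Rightarrow> 'm) set" where
  "B2 G M = coboundary1 G M ` C1 G M"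

definition H2 ::
    "('g, 'x) topgroup_scheme \<Rightarrow> ('r, 'm, 'g, 'y) gmodule_scheme \<Rightarrow> ('r, ('g \<times> 'g \<Rightarrow> 'm) set) module" where
  "H2 G M = quot_module (fun_module M (carrier G \<times> carrier G) (Z2 G M)) (B2 G M)"

definition class1 ::
    "('g, 'x) topgroup_scheme \<Rightarrow> ('r, 'm, 'g, 'y) gmodule_scheme \<Rightarrow> ('g \<Rightarrow> 'm) \<Rightarrow> ('g \<Rightarrow> 'm) set" where
  "class1 G M f = B1 G M +>\<^bsub>fun_module M (carrier G) (Z1 G M)\<^esub> f"

definition class2 ::
    "('g, 'x) topgroup_scheme \<Rightarrow> ('r, 'm, 'g, 'y) gmodule_scheme
       \<Rightarrow> ('g \<times> 'g \<Rightarrow> 'm) \<Rightarrow> ('g \<times> 'g \<Rightarrow> 'm) set" where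
  "class2 G M c = B2 G M +>\<^bsub>fun_module M (carrier G \<times> carrier G) (Z2 G M)\<^esub> c"

definition H2_map ::
    "('g, 'x) topgroup_scheme \<Rightarrow> ('r, 'k, 'g, 'z) gmodule_scheme
       \<Rightarrow> ('m \<Rightarrow> 'k) \<Rightarrow> ('g \<times> 'g \<Rightarrow> 'm) set \<Rightarrow> ('g \<times> 'g \<Rightarrow> 'k) set" where
  "H2_map G K \<phi> X = the_elem ((\<lambda>c. class2 G K (\<lambda>s\<in>carrier G \<times> carrier G. \<phi> (c s))) ` X)"

text \<open>The connecting map \<open>H^1(G, M'') \<rightarrow> H^2(G, M')\<close> of an exact sequence
  \<open>0 \<rightarrow> M' \<rightarrow> M \<rightarrow> M'' \<rightarrow> 0\<close> with maps \<open>i\<close> and \<open>j\<close>: lift a cocycle in the class \<open>z\<close> to a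
  continuous cochain \<open>b\<close> in \<open>M\<close> and pull its coboundary back to \<open>M'\<close>.\<close>

definition connecting ::
    "('g, 'x) topgroup_scheme \<Rightarrow> ('r, 'm1, 'g, 'y1) gmodule_scheme \<Rightarrow> ('r, 'm, 'g, 'y) gmodule_scheme
       \<Rightarrow> ('m1 \<Rightarrow> 'm) \<Rightarrow> ('m \<Rightarrow> 'm2) \<Rightarrow> ('g \<Rightarrow> 'm2) set \<Rightarrow> ('g \<times> 'g \<Rightarrow> 'm1) set" where
  "connecting G M' M i j z = the_elem {class2 G M' a | a b.
     a \<in> Z2 G M' \<and> b \<in> C1 G M \<and> (\<lambda>g\<in>carrier G. j (b g)) \<in> z \<and>
     (\<lambda>s\<in>carrier G \<times> carrier G. i (a s)) = coboundary1 G M b}"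


section \<open>The connecting map \<open>\<Psi>^(n)\<close>\<close>

text \<open>\<open>T \<otimes> \<Omega>/I^j\<close> and \<open>T \<otimes> I^n/I^(n+1)\<close> for \<open>\<Omega> = R[[G/K]]\<close>.\<close>

abbreviation T_omega ::
    "('r, 'x) topring_scheme \<Rightarrow> ('g, 'y) topgroup_scheme \<Rightarrow> 'g set \<Rightarrow> ('r, 'm, 'g, 'z) gmodule_scheme
       \<Rightarrow> nat \<Rightarrow> ('r, ('m \<times> ('g set set \<Rightarrow> 'g set set \<Rightarrow> 'r) set \<Rightarrow> 'r) set, 'g) gmodule" where
  "T_omega R G K T j \<equiv>
     tensor_gmodule R T (omega_quot R (quot_topgroup G K) j) (omega_act R G K j)"

abbreviation T_graded ::
    "('r, 'x) topring_scheme \<Rightarrow> ('g, 'y) topgroup_scheme \<Rightarrow> 'g set \<Rightarrow> ('r, 'm, 'g, 'z) gmodule_scheme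
       \<Rightarrow> nat \<Rightarrow> ('r, ('m \<times> ('g set set \<Rightarrow> 'g set set \<Rightarrow> 'r) set \<Rightarrow> 'r) set, 'g) gmodule" where
  "T_graded R G K T n \<equiv>
     tensor_gmodule R T (aug_graded R (quot_topgroup G K) n) (omega_act R G K (Suc n))"

definition T_incl ::
    "('r, 'x) topring_scheme \<Rightarrow> ('g, 'y) topgroup_scheme \<Rightarrow> 'g set \<Rightarrow> ('r, 'm, 'g, 'z) gmodule_scheme
       \<Rightarrow> nat \<Rightarrow> ('m \<times> ('g set set \<Rightarrow> 'g set set \<Rightarrow> 'r) set \<Rightarrow> 'r) set
       \<Rightarrow> ('m \<times> ('g set set \<Rightarrow> 'g set set \<Rightarrow> 'r) set \<Rightarrow> 'r) set" where
  "T_incl R G K T n = (let H = quot_topgroup G K in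
     tensor_lift R T (aug_graded R H n) (T_omega R G K T (Suc n))
       (pure_tensor R T (omega_quot R H (Suc n))))"

text \<open>The projection \<open>\<Omega>/I^(n+1) \<rightarrow> \<Omega>/I^n\<close> sends a coset \<open>X\<close> of \<open>I^(n+1)\<close> to \<open>I^n + X\<close>.\<close>

definition T_proj ::
    "('r, 'x) topring_scheme \<Rightarrow> ('g, 'y) topgroup_scheme \<Rightarrow> 'g set \<Rightarrow> ('r, 'm, 'g, 'z) gmodule_scheme
       \<Rightarrow> nat \<Rightarrow> ('m \<times> ('g set set \<Rightarrow> 'g set set \<Rightarrow> 'r) set \<Rightarrow> 'r) set
       \<Rightarrow> ('m \<times> ('g set set \<Rightarrow> 'g set set \<Rightarrow> 'r) set \<Rightarrow> 'r) set" where
  "T_proj R G K T n = (let H = quot_topgroup G K in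
     tensor_lift R T (omega_quot R H (Suc n)) (T_omega R G K T n)
       (\<lambda>t X. pure_tensor R T (omega_quot R H n) t
                (aug_pow R H n <+>\<^bsub>completed_group_ring R H\<^esub> X)))"

text \<open>The canonical map \<open>H^2(G, T) \<otimes> I^n/I^(n+1) \<rightarrow> H^2(G, T \<otimes> I^n/I^(n+1))\<close>.\<close>

definition H2_tensor_map ::
    "('r, 'x) topring_scheme \<Rightarrow> ('g, 'y) topgroup_scheme \<Rightarrow> 'g set \<Rightarrow> ('r, 'm, 'g, 'z) gmodule_scheme
       \<Rightarrow> nat \<Rightarrow> (('g \<times> 'g \<Rightarrow> 'm) set \<times> ('g set set \<Rightarrow> 'g set set \<Rightarrow> 'r) set \<Rightarrow> 'r) set
       \<Rightarrow> ('g \<times> 'g \<Rightarrow> ('m \<times> ('g set set \<Rightarrow> 'g set set \<Rightarrow> 'r) set \<Rightarrow> 'r) set) set" where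
  "H2_tensor_map R G K T n = (let N = aug_graded R (quot_topgroup G K) n in
     tensor_lift R (H2 G T) N (H2 G (T_graded R G K T n))
       (\<lambda>X m. H2_map G (T_graded R G K T n) (\<lambda>t. pure_tensor R T N t m) X))"

definition Psi ::
    "('r, 'x) topring_scheme \<Rightarrow> ('g, 'y) topgroup_scheme \<Rightarrow> 'g set \<Rightarrow> ('r, 'm, 'g, 'z) gmodule_scheme
       \<Rightarrow> nat \<Rightarrow> ('g \<Rightarrow> ('m \<times> ('g set set \<Rightarrow> 'g set set \<Rightarrow> 'r) set \<Rightarrow> 'r) set) set
       \<Rightarrow> (('g \<times> 'g \<Rightarrow> 'm) set \<times> ('g set set \<Rightarrow> 'g set set \<Rightarrow> 'r) set \<Rightarrow> 'r) set" where
  "Psi R G K T n z =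
     inv_into (carrier (tensor R (H2 G T) (aug_graded R (quot_topgroup G K) n)))
       (H2_tensor_map R G K T n)
       (connecting G (T_graded R G K T n) (T_omega R G K T (Suc n))
          (T_incl R G K T n) (T_proj R G K T n) z)"


section \<open>Defining systems and Massey products\<close>

definition unitriangular :: "('r, 'x) ring_scheme \<Rightarrow> nat \<Rightarrow> (nat \<times> nat \<Rightarrow> 'r) set" where
  "unitriangular R m = {P \<in> {1..m} \<times> {1..m} \<rightarrow>\<^sub>E carrier R.
     (\<forall>i\<in>{1..m}. P (i, i) = \<one>\<^bsub>R\<^esub>) \<and> (\<forall>i\<in>{1..m}. \<forall>j\<in>{1..m}. j < i \<longrightarrow> P (i, j) = \<zero>\<^bsub>R\<^esub>)}"

text \<open>The pair \<open>(P, v)\<close> stands for the block matrix with rows \<open>(P v)\<close> and \<open>(0 1)\<close>, of size \<open>m + 1\<close>;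
  thus \<open>v i\<close> is its \<open>(i, m + 1)\<close>-entry.\<close>

definition block_group ::
    "('r, 'x) topring_scheme \<Rightarrow> ('r, 'm, 'y) topmodule_scheme \<Rightarrow> nat
       \<Rightarrow> ((nat \<times> nat \<Rightarrow> 'r) \<times> (nat \<Rightarrow> 'm)) topgroup" where
  "block_group R T m =
     \<lparr>carrier = unitriangular R m \<times> ({1..m} \<rightarrow>\<^sub>E carrier T),
      mult = (\<lambda>(P, v) (Q, w).
        (\<lambda>(i, j)\<in>{1..m} \<times> {1..m}. \<Oplus>\<^bsub>R\<^esub>k\<in>{1..m}. P (i, k) \<otimes>\<^bsub>R\<^esub> Q (k, j),
         \<lambda>i\<in>{1..m}. (\<Oplus>\<^bsub>T\<^esub>k\<in>{1..m}. P (i, k) \<odot>\<^bsub>T\<^esub> w k) \<oplus>\<^bsub>T\<^esub> v i)),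
      one = (\<lambda>(i, j)\<in>{1..m} \<times> {1..m}. if i = j then \<one>\<^bsub>R\<^esub> else \<zero>\<^bsub>R\<^esub>, \<lambda>i\<in>{1..m}. \<zero>\<^bsub>T\<^esub>),
      grp_top = subtopology
        (prod_topology (product_topology (\<lambda>_. ring_top R) ({1..m} \<times> {1..m}))
                       (product_topology (\<lambda>_. mod_top T) {1..m}))
        (unitriangular R m \<times> ({1..m} \<rightarrow>\<^sub>E carrier T))\<rparr>"

definition block_corner ::
    "('r, 'x) topring_scheme \<Rightarrow> ('r, 'm, 'y) topmodule_scheme \<Rightarrow> nat
       \<Rightarrow> ((nat \<times> nat \<Rightarrow> 'r) \<times> (nat \<Rightarrow> 'm)) set" where
  "block_corner R T m = {u \<in> carrier (block_group R T m).
     fst u = fst \<one>\<^bsub>block_group R T m\<^esub> \<and> (\<forall>i\<in>{2..m}. snd u i = \<zero>\<^bsub>T\<^esub>)}"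

definition block_quot ::
    "('r, 'x) topring_scheme \<Rightarrow> ('r, 'm, 'y) topmodule_scheme \<Rightarrow> nat
       \<Rightarrow> ((nat \<times> nat \<Rightarrow> 'r) \<times> (nat \<Rightarrow> 'm)) set topgroup" where
  "block_quot R T m = quot_topgroup (block_group R T m) (block_corner R T m)"

definition block_act ::
    "('r, 'm, 'g, 'y) gmodule_scheme \<Rightarrow> nat \<Rightarrow> 'g
       \<Rightarrow> (nat \<times> nat \<Rightarrow> 'r) \<times> (nat \<Rightarrow> 'm) \<Rightarrow> (nat \<times> nat \<Rightarrow> 'r) \<times> (nat \<Rightarrow> 'm)" where
  "block_act T m g u = (fst u, \<lambda>i\<in>{1..m}. act T g (snd u i))"

text \<open>Proper defining systems relative to \<open>\<theta>: G \<rightarrow> U_(n+1)(R)\<close>: continuous 1-cocycles with values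
  in the quotient by the corner subgroup and with upper-left block \<open>\<theta>\<close>.\<close>

definition proper_defining_system ::
    "('r, 'x) topring_scheme \<Rightarrow> ('g, 'y) topgroup_scheme \<Rightarrow> ('r, 'm, 'g, 'z) gmodule_scheme \<Rightarrow> nat
       \<Rightarrow> ('g \<Rightarrow> (nat \<times> nat \<Rightarrow> 'r)) \<Rightarrow> ('g \<Rightarrow> ((nat \<times> nat \<Rightarrow> 'r) \<times> (nat \<Rightarrow> 'm)) set) \<Rightarrow> bool" where
  "proper_defining_system R G T n \<theta> \<rho> \<longleftrightarrow>
     continuous_map (grp_top G) (grp_top (block_quot R T (n+1))) \<rho> \<and>
     (\<forall>g\<in>carrier G. \<rho> g \<in> carrier (block_quot R T (n+1))) \<and>
     (\<forall>g\<in>carrier G. \<forall>h\<in>carrier G.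
        \<rho> (g \<otimes>\<^bsub>G\<^esub> h) = \<rho> g \<otimes>\<^bsub>block_quot R T (n+1)\<^esub> (block_act T (n+1) g ` \<rho> h)) \<and>
     (\<forall>g\<in>carrier G. \<forall>u\<in>\<rho> g. fst u = \<theta> g)"

text \<open>The cocycle with upper-left block \<open>\<theta>\<close> and \<open>(n+1-k, n+2)\<close>-entry \<open>\<lambda>_k\<close> for \<open>k < n\<close>.\<close>

definition attached_system ::
    "('r, 'x) topring_scheme \<Rightarrow> ('r, 'm, 'g, 'z) gmodule_scheme \<Rightarrow> nat
       \<Rightarrow> ('g \<Rightarrow> (nat \<times> nat \<Rightarrow> 'r)) \<Rightarrow> (nat \<Rightarrow> 'g \<Rightarrow> 'm)
       \<Rightarrow> 'g \<Rightarrow> ((nat \<times> nat \<Rightarrow> 'r) \<times> (nat \<Rightarrow> 'm)) set" where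
  "attached_system R T n \<theta> lam g = block_corner R T (n+1) #>\<^bsub>block_group R T (n+1)\<^esub>
     (\<theta> g, \<lambda>i\<in>{1..n+1}. if i = 1 then \<zero>\<^bsub>T\<^esub> else lam (n + 1 - i) g)"

definition corner_zero_lift ::
    "('r, 'm, 'y) module_scheme \<Rightarrow> ((nat \<times> nat \<Rightarrow> 'r) \<times> (nat \<Rightarrow> 'm)) set
       \<Rightarrow> (nat \<times> nat \<Rightarrow> 'r) \<times> (nat \<Rightarrow> 'm)" where
  "corner_zero_lift T X = (THE u. u \<in> X \<and> snd u 1 = \<zero>\<^bsub>T\<^esub>)"

definition massey_product ::
    "('g, 'y) topgroup_scheme \<Rightarrow> ('r, 'm, 'g, 'z) gmodule_scheme \<Rightarrow> nat
       \<Rightarrow> ('g \<Rightarrow> ((nat \<times> nat \<Rightarrow> 'r) \<times> (nat \<Rightarrow> 'm)) set) \<Rightarrow> ('g \<times> 'g \<Rightarrow> 'm) set" where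
  "massey_product G T n \<rho> = class2 G T (\<lambda>(g, h)\<in>carrier G \<times> carrier G.
     \<Oplus>\<^bsub>T\<^esub>i\<in>{2..n+1}. fst (corner_zero_lift T (\<rho> g)) (1, i)
                      \<odot>\<^bsub>T\<^esub> act T g (snd (corner_zero_lift T (\<rho> h)) i))"

end

theory Submission
  imports Defs "HOL-Number_Theory.Cong" "HOL-Algebra.Multiplicative_Group"
begin

text \<open>
  A lift \<open>b(g) = \<Sum>k<n. lam k g \<otimes> x^k\<close> of \<open>f\<close> to \<open>T \<otimes> \<Omega>/I^(n+1)\<close> has a coboundary concentrated in the
  coordinate of \<open>x^n\<close>, so \<open>\<Psi>^(n)([f])\<close> is read off from that coordinate. Since \<open>g\<close> acts on \<open>\<Omega>/I^(n+1)\<close> as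
  multiplication by \<open>(1 + x)^\<chi>(g) = \<Sum>k. binom(\<chi>(g), k) x^k\<close>, the coordinate is
  \<open>\<Sum>l<n. binom(\<chi>(g), n - l) g lam l h\<close>, which is the Massey cochain of the attached system; the lower
  coordinates of the cocycle condition on \<open>f\<close> say that the attached system is a cocycle.

  The expansion of \<open>(1 + x)^z\<close> for \<open>p\<close>-adic \<open>z\<close> rests on \<open>1, x, \<dots>, x^n\<close> being a basis of \<open>\<Omega>/I^(n+1)\<close>. For
  finite \<open>A\<close> of order \<open>p^a\<close> this is where the bound on \<open>n\<close> enters: the annihilator of \<open>x\<close> is generated
  by the norm element, whose coefficients are the binomials \<open>p^a choose k + 1\<close>, and the bound makes those
  with \<open>k < n\<close> vanish in \<open>R\<close>.
\<close>

\<comment> \<open>Two steps need an idea beyond the formulas. Divisibility by x in the inverse limit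
  \<Omega> is a difference equation at every finite level. A solution at one level is unique only up
  to a constant, and matching the constants of consecutive levels leads to c_j = -E_j + p c_{j+1};
  this is solvable because R is a quotient of Z_p, where the series obtained by unrolling converges.
  The expansion of (1 + x)^z is obtained by approximation: z = N + p^K y with N a natural number,
  the factor with exponent p^K y is 1 modulo (p, x)^{K+1}, and since no nonzero element of R is
  divisible by all powers of p, the congruences for all K give equality. The same separatedness
  shows that x is not a zero divisor when A = Z_p, which is why that case carries no bound on n. On
  the side of cohomology all work is done in coordinates T \<otimes> \<Omega>/I^j = T^j. The
  coordinates are continuous and so is the tensor assembled from them, which supplies the continuous
  lifts; the connecting map is a description over all lifts, so an arbitrary lift is compared with
  the explicit one.\<close>
text \<open>Structure indices may be written \<open>x \<oplus>\<^sub>R y\<close>.\<close>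

syntax (input) "_index" :: "logic => index" ("\<^sub>_" [1000] 1000)

section \<open>Modules and tensor products\<close>

lemma (in abelian_monoid) finsum_swap:
  assumes "finite A" "finite B" "\<And>i j. i \<in> A ==> j \<in> B ==> f i j \<in> carrier G"
  shows "(\<Oplus>i\<in>A. \<Oplus>j\<in>B. f i j) = (\<Oplus>j\<in>B. \<Oplus>i\<in>A. f i j)"
  using assms(1,3)
proof (induction A rule: finite_induct)
  case empty
  then show ?case by simp
next
  case (insert a A)
  have "(\<Oplus>i\<in>insert a A. \<Oplus>j\<in>B. f i j) = (\<Oplus>j\<in>B. f a j) \<oplus> (\<Oplus>i\<in>A. \<Oplus>j\<in>B. f i j)"
    using insert by (subst finsum_insert) auto
  also have "\<dots> = (\<Oplus>j\<in>B. f a j) \<oplus> (\<Oplus>j\<in>B. \<Oplus>i\<in>A. f i j)"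
    using insert by simp
  also have "\<dots> = (\<Oplus>j\<in>B. f a j \<oplus> (\<Oplus>i\<in>A. f i j))"
    using insert by (subst finsum_addf) auto
  also have "\<dots> = (\<Oplus>j\<in>B. \<Oplus>i\<in>insert a A. f i j)"
  proof (rule finsum_cong')
    fix j assume "j \<in> B"
    then show "f a j \<oplus> (\<Oplus>i\<in>A. f i j) = (\<Oplus>i\<in>insert a A. f i j)"
      using insert by (subst finsum_insert) auto
  qed (use insert in auto)
  finally show ?case .
qed

lemma additive_finsum:
  assumes "abelian_monoid M" "abelian_monoid P" "finite A" "f \<in> A \<rightarrow> carrier M"
    and "\<And>a. a \<in> carrier M ==> \<phi> a \<in> carrier P" "\<phi> \<zero>\<^sub>M = \<zero>\<^sub>P"
    and "\<And>a b. a \<in> carrier M ==> b \<in> carrier M ==> \<phi> (a \<oplus>\<^sub>M b) = \<phi> a \<oplus>\<^sub>P \<phi> b"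
  shows "\<phi> (\<Oplus>\<^sub>M i\<in>A. f i) = (\<Oplus>\<^sub>P i\<in>A. \<phi> (f i))"
  using assms(3,4)
proof (induction A rule: finite_induct)
  case empty
  then show ?case
    using assms by (simp add: abelian_monoid.finsum_empty)
next
  case (insert a A)
  have "\<phi> (\<Oplus>\<^sub>M i\<in>insert a A. f i) = \<phi> (f a \<oplus>\<^sub>M (\<Oplus>\<^sub>M i\<in>A. f i))"
    using insert assms(1) by (subst abelian_monoid.finsum_insert) auto
  also have "\<dots> = \<phi> (f a) \<oplus>\<^sub>P (\<Oplus>\<^sub>P i\<in>A. \<phi> (f i))"
    using insert assms by (subst assms(7)) (auto intro!: abelian_monoid.finsum_closed)
  also have "\<dots> = (\<Oplus>\<^sub>P i\<in>insert a A. \<phi> (f i))"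
    using insert assms by (subst abelian_monoid.finsum_insert) (auto simp: Pi_iff)
  finally show ?case .
qed

text \<open>\<open>finsum\<close> looks only at carrier, zero and addition. Hence sums in
  \<open>tensor R T N\<close> and in \<open>tensor_gmodule R T N a\<close>, which repacks the same
  additive structure in another record, agree.\<close>

lemma finsum_eq_of_add_monoid_eq:
  assumes "carrier M = carrier P" "add M = add P" "zero M = zero P"
  shows "finsum M f A = finsum P f A"
  unfolding finsum_def finprod_def using assms by simp

definition module_hom :: "('r, 'x) ring_scheme => ('r, 'm, 'y) module_scheme =>
    ('r, 'k, 'z) module_scheme => ('m => 'k) set" where
  "module_hom R M P = {\<phi> \<in> carrier M \<rightarrow> carrier P.
     (\<forall>a\<in>carrier M. \<forall>b\<in>carrier M. \<phi> (a \<oplus>\<^sub>M b) = \<phi> a \<oplus>\<^sub>P \<phi> b) \<and>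
     (\<forall>r\<in>carrier R. \<forall>a\<in>carrier M. \<phi> (r \<odot>\<^sub>M a) = r \<odot>\<^sub>P \<phi> a)}"

lemma module_homI:
  assumes "\<And>a. a \<in> carrier M ==> \<phi> a \<in> carrier P"
    and "\<And>a b. a \<in> carrier M ==> b \<in> carrier M ==> \<phi> (a \<oplus>\<^sub>M b) = \<phi> a \<oplus>\<^sub>P \<phi> b"
    and "\<And>r a. r \<in> carrier R ==> a \<in> carrier M ==> \<phi> (r \<odot>\<^sub>M a) = r \<odot>\<^sub>P \<phi> a"
  shows "\<phi> \<in> module_hom R M P"
  using assms by (auto simp: module_hom_def)

lemma module_homD:
  assumes "\<phi> \<in> module_hom R M P"
  shows "a \<in> carrier M ==> \<phi> a \<in> carrier P"
    and "a \<in> carrier M ==> b \<in> carrier M ==> \<phi> (a \<oplus>\<^sub>M b) = \<phi> a \<oplus>\<^sub>P \<phi> b"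
    and "r \<in> carrier R ==> a \<in> carrier M ==> \<phi> (r \<odot>\<^sub>M a) = r \<odot>\<^sub>P \<phi> a"
  using assms by (auto simp: module_hom_def)

lemma module_is_abelian_group: "module R M ==> abelian_group M"
  by (simp add: module_def)

lemma module_is_abelian_monoid: "module R M ==> abelian_monoid M"
  by (simp add: module_def abelian_group_def)

lemma module_is_cring: "module R M ==> cring R"
  by (simp add: module_def)

lemma (in abelian_group) minus_eq_zero_iff:
  assumes "a \<in> carrier G" "b \<in> carrier G"
  shows "a \<ominus> b = \<zero> \<longleftrightarrow> a = b"
  using assms by (metis a_minus_def add.inv_closed add.inv_inv add.inv_equality add.r_inv)

lemma additive_zero:
  assumes "abelian_group M" "abelian_group P"
    and "\<And>a. a \<in> carrier M ==> \<phi> a \<in> carrier P"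
    and "\<And>a b. a \<in> carrier M ==> b \<in> carrier M ==> \<phi> (a \<oplus>\<^sub>M b) = \<phi> a \<oplus>\<^sub>P \<phi> b"
  shows "\<phi> \<zero>\<^sub>M = \<zero>\<^sub>P"
proof -
  interpret M: abelian_group M by fact
  interpret P: abelian_group P by fact
  have "\<phi> \<zero>\<^sub>M \<oplus>\<^sub>P \<phi> \<zero>\<^sub>M = \<phi> \<zero>\<^sub>M"
    using assms(4)[of "\<zero>\<^sub>M" "\<zero>\<^sub>M"] by simp
  then show ?thesis
    using assms(3)[of "\<zero>\<^sub>M"] by (metis M.zero_closed P.add.r_cancel_one)
qed

lemma additive_minus:
  assumes "abelian_group M" "abelian_group P"
    and "\<And>a. a \<in> carrier M ==> \<phi> a \<in> carrier P"
    and "\<And>a b. a \<in> carrier M ==> b \<in> carrier M ==> \<phi> (a \<oplus>\<^sub>M b) = \<phi> a \<oplus>\<^sub>P \<phi> b"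
    and "a \<in> carrier M"
  shows "\<phi> (\<ominus>\<^sub>M a) = \<ominus>\<^sub>P \<phi> a"
proof -
  interpret M: abelian_group M by fact
  interpret P: abelian_group P by fact
  have "\<phi> (\<ominus>\<^sub>M a) \<oplus>\<^sub>P \<phi> a = \<zero>\<^sub>P"
    using assms(4)[of "\<ominus>\<^sub>M a" a] assms(5) additive_zero[of M P \<phi>] assms
    by (simp add: M.l_neg)
  then show ?thesis
    using assms(3,5) by (metis M.a_inv_closed P.minus_equality)
qed

lemma module_hom_zero:
  assumes "module R M" "module R P" "\<phi> \<in> module_hom R M P"
  shows "\<phi> \<zero>\<^sub>M = \<zero>\<^sub>P"
  using assms by (intro additive_zero) (auto simp: module_is_abelian_group module_homD)

lemma module_hom_minus:
  assumes "module R M" "module R P" "\<phi> \<in> module_hom R M P" "a \<in> carrier M"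
  shows "\<phi> (\<ominus>\<^sub>M a) = \<ominus>\<^sub>P \<phi> a"
  using assms by (intro additive_minus) (auto simp: module_is_abelian_group module_homD)

lemma module_hom_diff:
  assumes "module R M" "module R P" "\<phi> \<in> module_hom R M P" "a \<in> carrier M" "b \<in> carrier M"
  shows "\<phi> (a \<ominus>\<^sub>M b) = \<phi> a \<ominus>\<^sub>P \<phi> b"
  using assms module_homD[OF assms(3)] module_hom_minus[OF assms(1,2,3,5)]
  by (simp add: a_minus_def abelian_group.a_inv_closed[OF module_is_abelian_group])

lemma module_hom_finsum:
  assumes "module R M" "module R P" "\<phi> \<in> module_hom R M P" "finite A" "f \<in> A \<rightarrow> carrier M"
  shows "\<phi> (\<Oplus>\<^sub>M i\<in>A. f i) = (\<Oplus>\<^sub>P i\<in>A. \<phi> (f i))"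
  using assms module_hom_zero[OF assms(1-3)] module_homD[OF assms(3)]
  by (intro additive_finsum) (auto simp: module_is_abelian_monoid)

subsection \<open>Quotient modules\<close>

lemma abelian_subgroup_of_subgroup:
  assumes "abelian_group M" "subgroup N (add_monoid M)"
  shows "abelian_subgroup N M"
  using assms by (intro abelian_subgroupI3) (auto simp: additive_subgroup_def)

lemma coset_eq_iff:
  assumes "abelian_group M" "subgroup N (add_monoid M)" "a \<in> carrier M" "b \<in> carrier M"
  shows "N +>\<^sub>M a = N +>\<^sub>M b \<longleftrightarrow> a \<ominus>\<^sub>M b \<in> N"
proof -
  have N: "abelian_subgroup N M"
    by (rule abelian_subgroup_of_subgroup) fact+
  have "a \<in> N +>\<^sub>M b \<longleftrightarrow> a \<ominus>\<^sub>M b \<in> N"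
    using abelian_subgroup.a_rcos_module[OF N assms(4,3)] by (simp add: a_minus_def)
  then show ?thesis
    using abelian_subgroup.a_repr_independence'[OF N _ assms(4)]
      abelian_subgroup.a_rcos_self[OF N assms(3)] by metis
qed

lemma coset_add:
  assumes "abelian_group M" "subgroup N (add_monoid M)" "a \<in> carrier M" "b \<in> carrier M"
  shows "(N +>\<^sub>M a) <+>\<^sub>M (N +>\<^sub>M b) = N +>\<^sub>M (a \<oplus>\<^sub>M b)"
  by (rule abelian_subgroup.a_rcos_sum[OF abelian_subgroup_of_subgroup[OF assms(1,2)] assms(3,4)])

lemma coset_carrier_eq: "a_rcosets\<^bsub>M\<^esub> N = (\<lambda>a. N +>\<^sub>M a) ` carrier M"
  unfolding A_RCOSETS_def' a_r_coset_def' by (auto simp: a_r_coset_def')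

text \<open>The scalar action of \<open>quot_module\<close> is a union over all representatives. For
  two of them the multiples by \<open>r\<close> differ by an element of \<open>N\<close>, so the
  union is over copies of a single coset.\<close>

lemma coset_smult:
  assumes "module R M" "submodule N R M" "r \<in> carrier R" "a \<in> carrier M"
  shows "(\<Union>x\<in>N +>\<^sub>M a. N +>\<^sub>M (r \<odot>\<^sub>M x)) = N +>\<^sub>M (r \<odot>\<^sub>M a)"
proof -
  interpret M: module R M by fact
  have sub: "subgroup N (add_monoid M)"
    using assms(2) by (rule submodule.axioms)
  have ag: "abelian_group M" by unfold_locales
  have Nc: "N \<subseteq> carrier M" and Ns: "\<And>y. y \<in> N ==> r \<odot>\<^sub>M y \<in> N"
    using M.submoduleE[OF assms(2)] assms(3) by auto
  have "N +>\<^sub>M (r \<odot>\<^sub>M x) = N +>\<^sub>M (r \<odot>\<^sub>M a)" if x: "x \<in> N +>\<^sub>M a" for x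
  proof -
    obtain y where y: "y \<in> N" "x = y \<oplus>\<^sub>M a"
      using x unfolding a_r_coset_def' by blast
    have yc: "y \<in> carrier M" using y Nc by auto
    have "r \<odot>\<^sub>M x \<ominus>\<^sub>M r \<odot>\<^sub>M a = r \<odot>\<^sub>M y"
      using y yc assms(3,4)
      by (simp add: M.smult_r_distr a_minus_def M.a_assoc M.M.r_neg)
    then show ?thesis
      using y yc assms(3,4) Ns by (subst coset_eq_iff[OF ag sub]) auto
  qed
  moreover have "a \<in> N +>\<^sub>M a"
    by (rule abelian_subgroup.a_rcos_self[OF abelian_subgroup_of_subgroup[OF ag sub] assms(4)])
  ultimately show ?thesis by blast
qed

lemma quot_module_simps:
  "carrier (quot_module M N) = (\<lambda>a. N +>\<^sub>M a) ` carrier M"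
  "zero (quot_module M N) = N"
  "add (quot_module M N) = set_add M"
  "smult (quot_module M N) = (\<lambda>r X. \<Union>x\<in>X. N +>\<^sub>M (r \<odot>\<^sub>M x))"
  by (simp_all add: quot_module_def coset_carrier_eq)

lemma quot_module_is_module:
  assumes M: "module R M" and N: "submodule N R M"
  shows "module R (quot_module M N)"
proof -
  interpret M: module R M by fact
  have sub: "subgroup N (add_monoid M)"
    using N by (rule submodule.axioms)
  have ag: "abelian_group M" by unfold_locales
  note add = coset_add[OF ag sub] and sm = coset_smult[OF M N]
  have N0: "N = N +>\<^sub>M \<zero>\<^sub>M"
    using M.a_coset_add_zero[of N] M.submoduleE(1)[OF N] by simp
  have 1: "abelian_group (quot_module M N)"
  proof (rule abelian_groupI)
    show "\<zero>\<^sub>(quot_module M N) \<in> carrier (quot_module M N)"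
      using N0 by (auto simp: quot_module_simps)
    fix X assume X: "X \<in> carrier (quot_module M N)"
    then obtain a where a: "a \<in> carrier M" "X = N +>\<^sub>M a"
      by (auto simp: quot_module_simps)
    show "\<zero>\<^sub>(quot_module M N) \<oplus>\<^sub>(quot_module M N) X = X"
      using add[of "\<zero>\<^sub>M" a] a N0 by (simp add: quot_module_simps)
    have "(N +>\<^sub>M (\<ominus>\<^sub>M a)) <+>\<^sub>M X = N"
      using add[of "\<ominus>\<^sub>M a" a] a N0 by (simp add: M.M.l_neg)
    then show "\<exists>Y\<in>carrier (quot_module M N). Y \<oplus>\<^sub>(quot_module M N) X = \<zero>\<^sub>(quot_module M N)"
      using a by (auto simp: quot_module_simps)
  qed (use add in \<open>auto simp: quot_module_simps M.a_ac\<close>)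
  have qc: "N +>\<^sub>M a \<in> (\<lambda>a. N +>\<^sub>M a) ` carrier M" if "a \<in> carrier M" for a
    using that by (rule imageI)
  have qa: "(N +>\<^sub>M a) \<oplus>\<^sub>(quot_module M N) (N +>\<^sub>M b) = N +>\<^sub>M (a \<oplus>\<^sub>M b)"
    if "a \<in> carrier M" "b \<in> carrier M" for a b
    using that add by (simp add: quot_module_simps)
  have qs: "r \<odot>\<^sub>(quot_module M N) (N +>\<^sub>M a) = N +>\<^sub>M (r \<odot>\<^sub>M a)"
    if "r \<in> carrier R" "a \<in> carrier M" for r a
    unfolding quot_module_simps using that by (rule sm)
  show ?thesis
    by (rule moduleI[OF module_is_cring[OF M] 1]; unfold quot_module_simps(1); elim imageE)
      (simp_all add: qc qa qs M.smult_l_distr M.smult_r_distr M.smult_assoc1)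
qed

subsection \<open>Tensor products\<close>

lemma free_module_simps:
  "carrier (free_module R S) = {a \<in> S \<rightarrow>\<^sub>E carrier R. finite {s \<in> S. a s \<noteq> \<zero>\<^sub>R}}"
  "zero (free_module R S) = (\<lambda>s\<in>S. \<zero>\<^sub>R)"
  "add (free_module R S) = (\<lambda>a b. \<lambda>s\<in>S. a s \<oplus>\<^sub>R b s)"
  "smult (free_module R S) = (\<lambda>r a. \<lambda>s\<in>S. r \<otimes>\<^sub>R a s)"
  by (simp_all add: free_module_def)

lemma free_module_closedI:
  assumes "\<And>s. s \<in> S ==> c s \<in> carrier R" "finite A" "\<And>s. s \<in> S ==> s \<notin> A ==> c s = \<zero>\<^sub>R"
  shows "(\<lambda>s\<in>S. c s) \<in> carrier (free_module R S)"
proof -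
  have "{s \<in> S. (\<lambda>s\<in>S. c s) s \<noteq> \<zero>\<^sub>R} \<subseteq> A"
    using assms(3) by auto
  then have "finite {s \<in> S. (\<lambda>s\<in>S. c s) s \<noteq> \<zero>\<^sub>R}"
    using assms(2) finite_subset by blast
  moreover have "(\<lambda>s\<in>S. c s) \<in> S \<rightarrow>\<^sub>E carrier R"
    using assms(1) by (simp add: PiE_def Pi_def)
  ultimately show ?thesis
    unfolding free_module_simps by blast
qed

lemma free_moduleD:
  assumes "a \<in> carrier (free_module R S)"
  shows "s \<in> S ==> a s \<in> carrier R" "finite {s \<in> S. a s \<noteq> \<zero>\<^sub>R}" "(\<lambda>s\<in>S. a s) = a"
  using assms unfolding free_module_simps by (auto simp: PiE_mem)

lemma free_module_is_module:
  assumes "cring R"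
  shows "module R (free_module R S)"
proof -
  interpret R: cring R by fact
  let ?F = "free_module R S"
  note D = free_moduleD
  have ext: "(\<lambda>s\<in>S. c s) = (\<lambda>s\<in>S. d s)" if "\<And>s. s \<in> S ==> c s = d s" for c d :: "'c => 'a"
    using that by (rule restrict_ext)
  have add: "a \<oplus>\<^sub>?F b = (\<lambda>s\<in>S. a s \<oplus>\<^sub>R b s)"
    and sm: "r \<odot>\<^sub>?F a = (\<lambda>s\<in>S. r \<otimes>\<^sub>R a s)"
    and zero: "\<zero>\<^sub>?F = (\<lambda>s\<in>S. \<zero>\<^sub>R)" for a b r
    by (simp_all add: free_module_simps)
  have c1: "a \<oplus>\<^sub>?F b \<in> carrier ?F" if "a \<in> carrier ?F" "b \<in> carrier ?F" for a b
    unfolding add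
    by (rule free_module_closedI[OF _ finite_UnI[OF D(2)[OF that(1)] D(2)[OF that(2)]]])
      (use D(1)[OF that(1)] D(1)[OF that(2)] in auto)
  have c2: "r \<odot>\<^sub>?F a \<in> carrier ?F" if "a \<in> carrier ?F" "r \<in> carrier R" for a r
    unfolding sm
    by (rule free_module_closedI[OF _ D(2)[OF that(1)]]) (use D(1)[OF that(1)] that(2) in auto)
  have 1: "abelian_group ?F"
  proof (rule abelian_groupI)
    show "\<zero>\<^sub>?F \<in> carrier ?F"
      unfolding zero by (rule free_module_closedI[of _ _ _ "{}"]) auto
  next
    fix a b c assume abc: "a \<in> carrier ?F" "b \<in> carrier ?F" "c \<in> carrier ?F"
    show "a \<oplus>\<^sub>?F b \<oplus>\<^sub>?F c = a \<oplus>\<^sub>?F (b \<oplus>\<^sub>?F c)"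
      unfolding add by (rule ext) (simp add: D(1)[OF abc(1)] D(1)[OF abc(2)] D(1)[OF abc(3)] R.a_assoc)
  next
    fix a b assume ab: "a \<in> carrier ?F" "b \<in> carrier ?F"
    show "a \<oplus>\<^sub>?F b = b \<oplus>\<^sub>?F a"
      unfolding add by (rule ext) (simp add: D(1)[OF ab(1)] D(1)[OF ab(2)] R.a_comm)
  next
    fix a assume a: "a \<in> carrier ?F"
    have "\<zero>\<^sub>?F \<oplus>\<^sub>?F a = (\<lambda>s\<in>S. a s)"
      unfolding add zero by (rule ext) (simp add: D(1)[OF a])
    then show "\<zero>\<^sub>?F \<oplus>\<^sub>?F a = a" using D(3)[OF a] by simp
    let ?b = "\<lambda>s\<in>S. \<ominus>\<^sub>R a s"
    have "?b \<in> carrier ?F"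
      by (rule free_module_closedI[OF _ D(2)[OF a]]) (use D(1)[OF a] in auto)
    moreover have "?b \<oplus>\<^sub>?F a = \<zero>\<^sub>?F"
      unfolding add zero by (rule ext) (simp add: D(1)[OF a] R.l_neg)
    ultimately show "\<exists>b\<in>carrier ?F. b \<oplus>\<^sub>?F a = \<zero>\<^sub>?F"
      by blast
  qed (rule c1)
  show ?thesis
  proof (rule moduleI[OF assms 1])
    fix r a assume r: "r \<in> carrier R" and a: "a \<in> carrier ?F"
    show "r \<odot>\<^sub>?F a \<in> carrier ?F" by (rule c2[OF a r])
    {
      fix b assume b: "b \<in> carrier ?F"
      show "r \<odot>\<^sub>?F (a \<oplus>\<^sub>?F b) = r \<odot>\<^sub>?F a \<oplus>\<^sub>?F r \<odot>\<^sub>?F b"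
        unfolding add sm by (rule ext) (simp add: D(1)[OF a] D(1)[OF b] r R.r_distr)
    }
    {
      fix t assume t: "t \<in> carrier R"
      show "(r \<oplus>\<^sub>R t) \<odot>\<^sub>?F a = r \<odot>\<^sub>?F a \<oplus>\<^sub>?F t \<odot>\<^sub>?F a"
        unfolding add sm by (rule ext) (simp add: D(1)[OF a] t r R.l_distr)
      show "(r \<otimes>\<^sub>R t) \<odot>\<^sub>?F a = r \<odot>\<^sub>?F (t \<odot>\<^sub>?F a)"
        unfolding sm by (rule ext) (simp add: D(1)[OF a] t r R.m_assoc)
    }
  next
    fix a assume a: "a \<in> carrier ?F"
    have "\<one>\<^sub>R \<odot>\<^sub>?F a = (\<lambda>s\<in>S. a s)"
      unfolding sm by (rule ext) (simp add: D(1)[OF a])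
    then show "\<one>\<^sub>R \<odot>\<^sub>?F a = a" using D(3)[OF a] by simp
  qed
qed

lemma free_gen_closed:
  assumes "cring R" "s \<in> S"
  shows "free_gen R S s \<in> carrier (free_module R S)"
proof -
  interpret cring R by fact
  show ?thesis
    unfolding free_gen_def by (rule free_module_closedI[of _ _ _ "{s}"]) auto
qed

definition free_ext :: "('r, 'x) ring_scheme => 's set => ('r, 'k, 'z) module_scheme =>
    ('s => 'k) => ('s => 'r) => 'k" where
  "free_ext R S P u a = (\<Oplus>\<^sub>P s\<in>{s \<in> S. a s \<noteq> \<zero>\<^sub>R}. a s \<odot>\<^sub>P u s)"

context
  fixes R :: "('r, 'x) ring_scheme" and P :: "('r, 'k, 'z) module_scheme"
    and S :: "'s set" and u :: "'s => 'k"
  assumes P: "module R P" and u: "u \<in> S \<rightarrow> carrier P"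
begin

interpretation P: module R P by (rule P)

text \<open>The support of a sum can be smaller than the union of the supports. Summing over any
  larger finite set makes the values at different vectors comparable, which additivity
  requires.\<close>

lemma free_ext_eq:
  assumes "a \<in> carrier (free_module R S)" "finite A" "A \<subseteq> S" "{s \<in> S. a s \<noteq> \<zero>\<^sub>R} \<subseteq> A"
  shows "free_ext R S P u a = (\<Oplus>\<^sub>P s\<in>A. a s \<odot>\<^sub>P u s)"
  unfolding free_ext_def using assms u
  by (intro P.M.add.finprod_mono_neutral_cong_left) (auto simp: free_module_simps PiE_def Pi_def)

lemma free_ext_hom: "free_ext R S P u \<in> module_hom R (free_module R S) P"
proof (rule module_homI)
  let ?F = "free_module R S" and ?s = "\<lambda>a. {s \<in> S. a s \<noteq> \<zero>\<^sub>R}"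
  have F: "module R ?F" by (rule free_module_is_module[OF P.R.is_cring])
  have c: "a s \<in> carrier R" if "a \<in> carrier ?F" "s \<in> S" for a s
    using that by (auto simp: free_module_simps PiE_mem)
  have f: "finite (?s a)" if "a \<in> carrier ?F" for a
    using that by (auto simp: free_module_simps)
  fix a assume a: "a \<in> carrier ?F"
  show "free_ext R S P u a \<in> carrier P"
    unfolding free_ext_def using c[OF a] u by (intro P.M.finsum_closed) auto
  {
    fix b assume b: "b \<in> carrier ?F"
    let ?A = "?s a \<union> ?s b"
    have ab: "a \<oplus>\<^sub>?F b \<in> carrier ?F"
      using a b abelian_monoid.a_closed[OF module_is_abelian_monoid[OF F]] by simp
    have "free_ext R S P u (a \<oplus>\<^sub>?F b) = (\<Oplus>\<^sub>P s\<in>?A. (a \<oplus>\<^sub>?F b) s \<odot>\<^sub>P u s)"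
      using f[OF a] f[OF b] by (intro free_ext_eq ab) (auto simp: free_module_simps)
    also have "\<dots> = (\<Oplus>\<^sub>P s\<in>?A. a s \<odot>\<^sub>P u s \<oplus>\<^sub>P b s \<odot>\<^sub>P u s)"
      using c[OF a] c[OF b] u
      by (intro P.M.finsum_cong') (auto simp: free_module_simps P.smult_l_distr Pi_def)
    also have "\<dots> = (\<Oplus>\<^sub>P s\<in>?A. a s \<odot>\<^sub>P u s) \<oplus>\<^sub>P (\<Oplus>\<^sub>P s\<in>?A. b s \<odot>\<^sub>P u s)"
      using c[OF a] c[OF b] u by (intro P.M.finsum_addf) auto
    also have "\<dots> = free_ext R S P u a \<oplus>\<^sub>P free_ext R S P u b"
      using f[OF a] f[OF b] by (subst (1 2) free_ext_eq[of _ ?A]) (use a b in auto)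
    finally show "free_ext R S P u (a \<oplus>\<^sub>?F b) = free_ext R S P u a \<oplus>\<^sub>P free_ext R S P u b" .
  }
  {
    fix r assume r: "r \<in> carrier R"
    have ra: "r \<odot>\<^sub>?F a \<in> carrier ?F"
      using module.smult_closed[OF F r a] .
    have "free_ext R S P u (r \<odot>\<^sub>?F a) = (\<Oplus>\<^sub>P s\<in>?s a. (r \<odot>\<^sub>?F a) s \<odot>\<^sub>P u s)"
      using f[OF a] r by (intro free_ext_eq ra) (auto simp: free_module_simps)
    also have "\<dots> = (\<Oplus>\<^sub>P s\<in>?s a. r \<odot>\<^sub>P (a s \<odot>\<^sub>P u s))"
      using c[OF a] u r
      by (intro P.M.finsum_cong') (auto simp: free_module_simps P.smult_assoc1 Pi_def)
    also have "\<dots> = r \<odot>\<^sub>P free_ext R S P u a"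
      unfolding free_ext_def using f[OF a] c[OF a] u r
      by (intro P.finsum_smult_ldistr[symmetric]) auto
    finally show "free_ext R S P u (r \<odot>\<^sub>?F a) = r \<odot>\<^sub>P free_ext R S P u a" .
  }
qed

lemma free_ext_gen:
  assumes "s \<in> S"
  shows "free_ext R S P u (free_gen R S s) = u s"
proof -
  have "free_ext R S P u (free_gen R S s) = (\<Oplus>\<^sub>P t\<in>{s}. free_gen R S s t \<odot>\<^sub>P u t)"
    using assms by (intro free_ext_eq free_gen_closed P.R.is_cring) (auto simp: free_gen_def)
  then show ?thesis
    using assms u by (auto simp: free_gen_def Pi_def)
qed

end

locale tensor_modules =
  fixes R :: "('r, 'x) ring_scheme" and M :: "('r, 'm, 'y) module_scheme"
    and N :: "('r, 'n, 'z) module_scheme"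
  assumes M: "module R M" and N: "module R N"
begin

abbreviation "SS \<equiv> carrier M \<times> carrier N"
abbreviation "FF \<equiv> free_module R SS"
abbreviation "gen \<equiv> free_gen R SS"
abbreviation "ker \<equiv> tensor_kernel R M N"
abbreviation "pt \<equiv> pure_tensor R M N"

lemma cR: "cring R" using M by (rule module_is_cring)

lemma FF: "module R FF" by (rule free_module_is_module[OF cR])

lemma agF: "abelian_group FF" using FF by (rule module_is_abelian_group)

lemma gen_closed: "m \<in> carrier M ==> n \<in> carrier N ==> gen (m, n) \<in> carrier FF"
  by (rule free_gen_closed[OF cR]) simp

lemma relatorI:
  "m \<in> carrier M ==> m' \<in> carrier M ==> n \<in> carrier N ==>
    gen (m \<oplus>\<^sub>M m', n) \<ominus>\<^sub>FF (gen (m, n) \<oplus>\<^sub>FF gen (m', n)) \<in> tensor_relators R M N"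
  "m \<in> carrier M ==> n \<in> carrier N ==> n' \<in> carrier N ==>
    gen (m, n \<oplus>\<^sub>N n') \<ominus>\<^sub>FF (gen (m, n) \<oplus>\<^sub>FF gen (m, n')) \<in> tensor_relators R M N"
  "r \<in> carrier R ==> m \<in> carrier M ==> n \<in> carrier N ==>
    gen (r \<odot>\<^sub>M m, n) \<ominus>\<^sub>FF (r \<odot>\<^sub>FF gen (m, n)) \<in> tensor_relators R M N"
  "r \<in> carrier R ==> m \<in> carrier M ==> n \<in> carrier N ==>
    gen (m, r \<odot>\<^sub>N n) \<ominus>\<^sub>FF (r \<odot>\<^sub>FF gen (m, n)) \<in> tensor_relators R M N"
  unfolding tensor_relators_def Let_def by blast+

lemma relatorE:
  assumes "a \<in> tensor_relators R M N"
  obtains (add_left) m m' n where "m \<in> carrier M" "m' \<in> carrier M" "n \<in> carrier N"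
      "a = gen (m \<oplus>\<^sub>M m', n) \<ominus>\<^sub>FF (gen (m, n) \<oplus>\<^sub>FF gen (m', n))"
    | (add_right) m n n' where "m \<in> carrier M" "n \<in> carrier N" "n' \<in> carrier N"
      "a = gen (m, n \<oplus>\<^sub>N n') \<ominus>\<^sub>FF (gen (m, n) \<oplus>\<^sub>FF gen (m, n'))"
    | (smult_left) r m n where "r \<in> carrier R" "m \<in> carrier M" "n \<in> carrier N"
      "a = gen (r \<odot>\<^sub>M m, n) \<ominus>\<^sub>FF (r \<odot>\<^sub>FF gen (m, n))"
    | (smult_right) r m n where "r \<in> carrier R" "m \<in> carrier M" "n \<in> carrier N"
      "a = gen (m, r \<odot>\<^sub>N n) \<ominus>\<^sub>FF (r \<odot>\<^sub>FF gen (m, n))"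
  using assms unfolding tensor_relators_def Let_def by blast

lemma M_closed:
  "m \<in> carrier M ==> m' \<in> carrier M ==> m \<oplus>\<^sub>M m' \<in> carrier M"
  "r \<in> carrier R ==> m \<in> carrier M ==> r \<odot>\<^sub>M m \<in> carrier M"
  "n \<in> carrier N ==> n' \<in> carrier N ==> n \<oplus>\<^sub>N n' \<in> carrier N"
  "r \<in> carrier R ==> n \<in> carrier N ==> r \<odot>\<^sub>N n \<in> carrier N"
  using abelian_monoid.a_closed[OF module_is_abelian_monoid[OF M]] module.smult_closed[OF M]
    abelian_monoid.a_closed[OF module_is_abelian_monoid[OF N]] module.smult_closed[OF N] by auto

lemma F_closed:
  "a \<in> carrier FF ==> b \<in> carrier FF ==> a \<oplus>\<^sub>FF b \<in> carrier FF"
  "a \<in> carrier FF ==> b \<in> carrier FF ==> a \<ominus>\<^sub>FF b \<in> carrier FF"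
  "r \<in> carrier R ==> a \<in> carrier FF ==> r \<odot>\<^sub>FF a \<in> carrier FF"
  using abelian_monoid.a_closed[OF module_is_abelian_monoid[OF FF]]
    abelian_group.minus_closed[OF agF] module.smult_closed[OF FF] by auto

lemma relators_closed: "tensor_relators R M N \<subseteq> carrier FF"
proof
  fix a assume "a \<in> tensor_relators R M N"
  then show "a \<in> carrier FF"
    by (cases rule: relatorE) (simp_all add: F_closed M_closed gen_closed)
qed

text \<open>The free module itself contains the relators, so the intersection defining the kernel is
  over a nonempty family and stays inside the free module.\<close>

lemma ker_submodule: "submodule ker R FF"
proof -
  interpret F: module R FF by (rule FF)
  have c: "submodule (carrier FF) R FF" by (rule F.carrier_is_submodule)
  have sub: "ker \<subseteq> carrier FF"
    unfolding tensor_kernel_def using c relators_closed by blast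
  show ?thesis
  proof (rule F.submoduleI[OF sub])
    have "\<zero>\<^sub>FF \<in> S" if "submodule S R FF" for S
      using subgroup.one_closed[OF submodule.axioms(1)[OF that]] by simp
    then show "\<zero>\<^sub>FF \<in> ker"
      unfolding tensor_kernel_def by blast
  qed (use F.submoduleE in \<open>auto simp: tensor_kernel_def\<close>)
qed

lemma ker_subgroup: "subgroup ker (add_monoid FF)"
  using ker_submodule by (rule submodule.axioms)

lemma tensor_eq: "tensor R M N = quot_module FF ker"
  by (simp add: tensor_def)

lemma tensor_module: "module R (tensor R M N)"
  unfolding tensor_eq by (rule quot_module_is_module[OF FF ker_submodule])

lemma tensor_agroup: "abelian_group (tensor R M N)"
  using tensor_module by (rule module_is_abelian_group)

lemma relator_in_ker: "a \<in> tensor_relators R M N ==> a \<in> ker"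
  unfolding tensor_kernel_def by blast

lemma tensor_carrier: "carrier (tensor R M N) = (\<lambda>a. ker +>\<^sub>FF a) ` carrier FF"
  by (simp add: tensor_eq quot_module_simps)

lemma cos_eq:
  assumes "a \<in> carrier FF" "b \<in> carrier FF" "a \<ominus>\<^sub>FF b \<in> tensor_relators R M N"
  shows "ker +>\<^sub>FF a = ker +>\<^sub>FF b"
  using assms relator_in_ker by (subst coset_eq_iff[OF agF ker_subgroup]) auto

lemma cos_add:
  "a \<in> carrier FF ==> b \<in> carrier FF ==>
    (ker +>\<^sub>FF a) \<oplus>\<^sub>(tensor R M N) (ker +>\<^sub>FF b) = ker +>\<^sub>FF (a \<oplus>\<^sub>FF b)"
  using coset_add[OF agF ker_subgroup] by (simp add: tensor_eq quot_module_simps)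

lemma cos_smult:
  assumes "r \<in> carrier R" "a \<in> carrier FF"
  shows "r \<odot>\<^sub>(tensor R M N) (ker +>\<^sub>FF a) = ker +>\<^sub>FF (r \<odot>\<^sub>FF a)"
  unfolding tensor_eq quot_module_simps by (rule coset_smult[OF FF ker_submodule assms])

lemma pt_closed: "m \<in> carrier M ==> n \<in> carrier N ==> pt m n \<in> carrier (tensor R M N)"
  using gen_closed by (simp add: pure_tensor_def tensor_carrier)

lemma pt_add_left:
  assumes "m \<in> carrier M" "m' \<in> carrier M" "n \<in> carrier N"
  shows "pt (m \<oplus>\<^sub>M m') n = pt m n \<oplus>\<^sub>(tensor R M N) pt m' n"
  unfolding pure_tensor_def using assms relatorI(1)[OF assms]
  by (simp add: cos_add gen_closed) (intro cos_eq, simp_all add: F_closed M_closed gen_closed)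

lemma pt_add_right:
  assumes "m \<in> carrier M" "n \<in> carrier N" "n' \<in> carrier N"
  shows "pt m (n \<oplus>\<^sub>N n') = pt m n \<oplus>\<^sub>(tensor R M N) pt m n'"
  unfolding pure_tensor_def using assms relatorI(2)[OF assms]
  by (simp add: cos_add gen_closed) (intro cos_eq, simp_all add: F_closed M_closed gen_closed)

lemma pt_smult_left:
  assumes "r \<in> carrier R" "m \<in> carrier M" "n \<in> carrier N"
  shows "pt (r \<odot>\<^sub>M m) n = r \<odot>\<^sub>(tensor R M N) pt m n"
  unfolding pure_tensor_def using assms relatorI(3)[OF assms]
  by (simp add: cos_smult gen_closed) (intro cos_eq, simp_all add: F_closed M_closed gen_closed)

lemma pt_smult_right:
  assumes "r \<in> carrier R" "m \<in> carrier M" "n \<in> carrier N"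
  shows "pt m (r \<odot>\<^sub>N n) = r \<odot>\<^sub>(tensor R M N) pt m n"
  unfolding pure_tensor_def using assms relatorI(4)[OF assms]
  by (simp add: cos_smult gen_closed) (intro cos_eq, simp_all add: F_closed M_closed gen_closed)

lemma pt_zero_left:
  assumes "n \<in> carrier N" shows "pt \<zero>\<^sub>M n = \<zero>\<^sub>(tensor R M N)"
  by (rule additive_zero[OF module_is_abelian_group[OF M] tensor_agroup, of "\<lambda>m. pt m n"])
    (use assms pt_closed pt_add_left in auto)

text \<open>A sum in the free module is a function, so the identity is checked point by point:
  induction over a finite index set evaluates the partial sums, and outside the support both sides
  are zero.\<close>

lemma free_decomp:
  assumes "a \<in> carrier FF"
  shows "a = free_ext R SS FF gen a"
proof -
  interpret F: module R FF by (rule FF)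
  interpret R: cring R by (rule cR)
  note D = free_moduleD[OF assms]
  let ?A = "{s \<in> SS. a s \<noteq> \<zero>\<^sub>R}"
  have gen': "gen \<in> SS \<rightarrow> carrier FF" using gen_closed by auto
  have addE: "(b \<oplus>\<^sub>FF c) t = b t \<oplus>\<^sub>R c t" and smE: "(r \<odot>\<^sub>FF b) t = r \<otimes>\<^sub>R b t"
    if "t \<in> SS" for b c r t
    using that by (simp_all add: free_module_simps(3,4))
  have ev: "(\<Oplus>\<^sub>FF s\<in>A. a s \<odot>\<^sub>FF gen s) t = (if t \<in> A then a t else \<zero>\<^sub>R)"
    if "finite A" "A \<subseteq> SS" "t \<in> SS" for A t
    using that
  proof (induction A rule: finite_induct)
    case empty
    then show ?case by (simp add: free_module_simps(2))
  next
    case (insert s A)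
    have IH: "(\<Oplus>\<^sub>FF s\<in>A. a s \<odot>\<^sub>FF gen s) t = (if t \<in> A then a t else \<zero>\<^sub>R)"
      by (rule insert.IH) (use insert.prems in auto)
    have "(\<Oplus>\<^sub>FF s\<in>insert s A. a s \<odot>\<^sub>FF gen s) =
        a s \<odot>\<^sub>FF gen s \<oplus>\<^sub>FF (\<Oplus>\<^sub>FF s\<in>A. a s \<odot>\<^sub>FF gen s)"
      using insert D(1) gen' by (intro F.finsum_insert) (auto simp: Pi_iff subset_eq)
    then have "(\<Oplus>\<^sub>FF s\<in>insert s A. a s \<odot>\<^sub>FF gen s) t =
        a s \<otimes>\<^sub>R gen s t \<oplus>\<^sub>R (if t \<in> A then a t else \<zero>\<^sub>R)"
      by (simp only: addE[OF insert.prems(2)] smE[OF insert.prems(2)] IH)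
    also have "gen s t = (if t = s then \<one>\<^sub>R else \<zero>\<^sub>R)"
      using insert.prems by (simp add: free_gen_def)
    also have "a s \<otimes>\<^sub>R \<dots> \<oplus>\<^sub>R (if t \<in> A then a t else \<zero>\<^sub>R) = (if t \<in> insert s A then a t else \<zero>\<^sub>R)"
      using insert.hyps insert.prems D(1)[of s] D(1)[of t] by auto
    finally show ?case .
  qed
  have "free_ext R SS FF gen a \<in> carrier FF"
    using module_homD(1)[OF free_ext_hom[OF FF gen']] assms by auto
  then have 1: "(\<lambda>s\<in>SS. free_ext R SS FF gen a s) = free_ext R SS FF gen a"
    by (rule free_moduleD(3))
  have "(\<lambda>s\<in>SS. a s) = (\<lambda>s\<in>SS. free_ext R SS FF gen a s)"
    by (rule restrict_ext) (use ev[OF D(2)] in \<open>auto simp: free_ext_def\<close>)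
  then show ?thesis using 1 D(3) by simp
qed

text \<open>Scalars can be absorbed into the left factor, so sums of pure tensors exhaust the tensor
  product. Zero needs no case of its own, being the pure tensor of two zeros.\<close>

lemma tensor_induct [consumes 1, case_names pure add]:
  assumes "z \<in> carrier (tensor R M N)"
    and "\<And>m n. m \<in> carrier M ==> n \<in> carrier N ==> Q (pt m n)"
    and "\<And>y z. y \<in> carrier (tensor R M N) ==> z \<in> carrier (tensor R M N) ==> Q y ==> Q z ==>
      Q (y \<oplus>\<^sub>(tensor R M N) z)"
  shows "Q z"
proof -
  interpret F: module R FF by (rule FF)
  interpret N: module R N by (rule N)
  interpret M: module R M by (rule M)
  obtain a where a: "a \<in> carrier FF" "z = ker +>\<^sub>FF a"
    using assms(1) by (auto simp: tensor_carrier)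
  note D = free_moduleD[OF a(1)]
  have "Q (ker +>\<^sub>FF (\<Oplus>\<^sub>FF s\<in>A. a s \<odot>\<^sub>FF gen s))" if "finite A" "A \<subseteq> SS" for A
    using that
  proof (induction A rule: finite_induct)
    case empty
    have "ker +>\<^sub>FF \<zero>\<^sub>FF = ker"
      using F.a_coset_add_zero subgroup.subset[OF ker_subgroup] by simp
    also have "\<dots> = \<zero>\<^sub>(tensor R M N)"
      by (simp add: tensor_eq quot_module_simps)
    also have "\<dots> = pt \<zero>\<^sub>M \<zero>\<^sub>N"
      by (rule pt_zero_left[symmetric]) simp
    finally show ?case
      using assms(2)[of "\<zero>\<^sub>M" "\<zero>\<^sub>N"] by simp
  next
    case (insert s A)
    obtain m n where s: "s = (m, n)" "m \<in> carrier M" "n \<in> carrier N"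
      using insert by (cases s) auto
    have as: "a s \<in> carrier R" using D(1) insert by simp
    let ?t = "\<Oplus>\<^sub>FF s\<in>A. a s \<odot>\<^sub>FF gen s"
    have cl: "a s \<odot>\<^sub>FF gen s \<in> carrier FF" "?t \<in> carrier FF"
      using insert D(1) gen_closed by (auto intro!: F.finsum_closed F.smult_closed)
    have "(\<Oplus>\<^sub>FF s\<in>insert s A. a s \<odot>\<^sub>FF gen s) = a s \<odot>\<^sub>FF gen s \<oplus>\<^sub>FF ?t"
      using insert D(1) gen_closed by (intro F.finsum_insert) (auto intro!: F.smult_closed)
    then have "ker +>\<^sub>FF (\<Oplus>\<^sub>FF s\<in>insert s A. a s \<odot>\<^sub>FF gen s) =
        pt (a s \<odot>\<^sub>M m) n \<oplus>\<^sub>(tensor R M N) (ker +>\<^sub>FF ?t)"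
      using cl as s by (simp add: cos_add[symmetric] cos_smult[symmetric] gen_closed pt_smult_left)
        (simp add: pure_tensor_def)
    moreover have "Q (pt (a s \<odot>\<^sub>M m) n \<oplus>\<^sub>(tensor R M N) (ker +>\<^sub>FF ?t))"
    proof (rule assms(3))
      show "ker +>\<^sub>FF ?t \<in> carrier (tensor R M N)"
        unfolding tensor_carrier using cl(2) by (rule imageI)
      show "Q (ker +>\<^sub>FF ?t)" using insert by simp
      show "pt (a s \<odot>\<^sub>M m) n \<in> carrier (tensor R M N)" "Q (pt (a s \<odot>\<^sub>M m) n)"
        using s as M_closed(2) by (auto intro: assms(2) pt_closed)
    qed
    ultimately show ?case
      by (simp only:)
  qed
  from this[OF D(2)] show ?thesis
    using a free_decomp[OF a(1)] by (simp add: free_ext_def)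
qed

lemma tensor_maps_eq:
  assumes "\<And>y z. y \<in> carrier (tensor R M N) ==> z \<in> carrier (tensor R M N) ==>
      \<phi> (y \<oplus>\<^sub>(tensor R M N) z) = \<phi> y \<oplus>\<^sub>P \<phi> z"
    and "\<And>y z. y \<in> carrier (tensor R M N) ==> z \<in> carrier (tensor R M N) ==>
      \<psi> (y \<oplus>\<^sub>(tensor R M N) z) = \<psi> y \<oplus>\<^sub>P \<psi> z"
    and "\<And>m n. m \<in> carrier M ==> n \<in> carrier N ==> \<phi> (pt m n) = \<psi> (pt m n)"
    and "z \<in> carrier (tensor R M N)"
  shows "\<phi> z = \<psi> z"
  using assms(4) by (induction z rule: tensor_induct) (use assms in auto)

text \<open>\<open>tensor_lift\<close> is a description over extensional maps, and additive maps are
  determined on pure tensors. \<open>P\<close> enters only through carrier and addition; this lets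
  \<open>HT_eq\<close> take \<open>P = H2 G TN\<close> with no module axioms at hand.\<close>

lemma tensor_lift_eqI:
  assumes "\<phi> \<in> extensional (carrier (tensor R M N))"
    and "\<And>z. z \<in> carrier (tensor R M N) ==> \<phi> z \<in> carrier P"
    and "\<And>y z. y \<in> carrier (tensor R M N) ==> z \<in> carrier (tensor R M N) ==>
      \<phi> (y \<oplus>\<^sub>(tensor R M N) z) = \<phi> y \<oplus>\<^sub>P \<phi> z"
    and "\<And>m n. m \<in> carrier M ==> n \<in> carrier N ==> \<phi> (pt m n) = \<beta> m n"
  shows "tensor_lift R M N P \<beta> = \<phi>"
  unfolding tensor_lift_def
proof (rule the_equality)
  show "\<phi> \<in> extensional (carrier (tensor R M N)) \<and>
    \<phi> \<in> hom (add_monoid (tensor R M N)) (add_monoid P) \<and>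
    (\<forall>m\<in>carrier M. \<forall>n\<in>carrier N. \<phi> (pt m n) = \<beta> m n)"
    using assms by (auto simp: hom_def)
next
  fix \<psi> assume "\<psi> \<in> extensional (carrier (tensor R M N)) \<and>
    \<psi> \<in> hom (add_monoid (tensor R M N)) (add_monoid P) \<and>
    (\<forall>m\<in>carrier M. \<forall>n\<in>carrier N. \<psi> (pt m n) = \<beta> m n)"
  then have \<psi>: "\<psi> \<in> extensional (carrier (tensor R M N))"
    "\<And>y z. y \<in> carrier (tensor R M N) ==> z \<in> carrier (tensor R M N) ==>
      \<psi> (y \<oplus>\<^sub>(tensor R M N) z) = \<psi> y \<oplus>\<^sub>P \<psi> z"
    "\<And>m n. m \<in> carrier M ==> n \<in> carrier N ==> \<psi> (pt m n) = \<beta> m n"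
    by (auto simp: hom_def)
  show "\<psi> = \<phi>"
    by (rule extensionalityI[OF \<psi>(1) assms(1)], rule tensor_maps_eq[OF \<psi>(2) assms(3)])
      (use \<psi>(3) assms(4) in auto)
qed

text \<open>The linear extension \<open>E\<close> to the free module kills the relators, so its zero
  set is a submodule containing the kernel. \<open>E\<close> therefore takes the same value on all
  representatives of a coset and descends.\<close>

lemma tensor_lift:
  assumes P: "module R P"
    and cl: "\<And>m n. m \<in> carrier M ==> n \<in> carrier N ==> \<beta> m n \<in> carrier P"
    and al: "\<And>m m' n. m \<in> carrier M ==> m' \<in> carrier M ==> n \<in> carrier N ==>
      \<beta> (m \<oplus>\<^sub>M m') n = \<beta> m n \<oplus>\<^sub>P \<beta> m' n"
    and ar: "\<And>m n n'. m \<in> carrier M ==> n \<in> carrier N ==> n' \<in> carrier N ==>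
      \<beta> m (n \<oplus>\<^sub>N n') = \<beta> m n \<oplus>\<^sub>P \<beta> m n'"
    and sl: "\<And>r m n. r \<in> carrier R ==> m \<in> carrier M ==> n \<in> carrier N ==>
      \<beta> (r \<odot>\<^sub>M m) n = r \<odot>\<^sub>P \<beta> m n"
    and sr: "\<And>r m n. r \<in> carrier R ==> m \<in> carrier M ==> n \<in> carrier N ==>
      \<beta> m (r \<odot>\<^sub>N n) = r \<odot>\<^sub>P \<beta> m n"
  shows tensor_lift_hom: "tensor_lift R M N P \<beta> \<in> module_hom R (tensor R M N) P"
    and tensor_lift_pure: "\<And>m n. m \<in> carrier M ==> n \<in> carrier N ==>
      tensor_lift R M N P \<beta> (pt m n) = \<beta> m n"
proof -
  interpret P: module R P by (rule P)
  define E where "E = free_ext R SS P (\<lambda>(m, n). \<beta> m n)"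
  have u: "(\<lambda>(m, n). \<beta> m n) \<in> SS \<rightarrow> carrier P" using cl by auto
  have E: "E \<in> module_hom R FF P"
    unfolding E_def by (rule free_ext_hom[OF P u])
  note EE = module_homD[OF E] module_hom_diff[OF FF P E] module_hom_zero[OF FF P E]
    module_hom_minus[OF FF P E]
  have Eg: "E (gen (m, n)) = \<beta> m n" if "m \<in> carrier M" "n \<in> carrier N" for m n
    unfolding E_def using free_ext_gen[OF P u, of "(m, n)"] that by simp
  have "submodule {a \<in> carrier FF. E a = \<zero>\<^sub>P} R FF"
  proof -
    interpret F: module R FF by (rule FF)
    show ?thesis
      by (rule F.submoduleI) (use EE in auto)
  qed
  moreover have "tensor_relators R M N \<subseteq> {a \<in> carrier FF. E a = \<zero>\<^sub>P}"
  proof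
    fix a assume a: "a \<in> tensor_relators R M N"
    then have "E a = \<zero>\<^sub>P"
      by (cases rule: relatorE)
        (simp_all add: EE Eg F_closed M_closed gen_closed al ar sl sr cl P.M.minus_eq_zero_iff)
    with a relators_closed show "a \<in> {a \<in> carrier FF. E a = \<zero>\<^sub>P}" by auto
  qed
  ultimately have kerE: "E a = \<zero>\<^sub>P" if "a \<in> ker" for a
    using that unfolding tensor_kernel_def by blast
  have Econg: "E a = E b" if "a \<in> carrier FF" "b \<in> carrier FF" "ker +>\<^sub>FF a = ker +>\<^sub>FF b" for a b
  proof -
    have "E a \<ominus>\<^sub>P E b = \<zero>\<^sub>P"
      using that kerE[of "a \<ominus>\<^sub>FF b"] EE by (simp add: coset_eq_iff[OF agF ker_subgroup])
    then show ?thesis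
      using that EE(1) by (simp add: P.M.minus_eq_zero_iff)
  qed
  define \<phi> where "\<phi> = (\<lambda>z\<in>carrier (tensor R M N). E (SOME a. a \<in> carrier FF \<and> z = ker +>\<^sub>FF a))"
  have \<phi>: "\<phi> (ker +>\<^sub>FF a) = E a" if "a \<in> carrier FF" for a
  proof -
    have "\<exists>b. b \<in> carrier FF \<and> ker +>\<^sub>FF a = ker +>\<^sub>FF b" using that by blast
    note b = someI_ex[OF this]
    have "E (SOME b. b \<in> carrier FF \<and> ker +>\<^sub>FF a = ker +>\<^sub>FF b) = E a"
      by (rule Econg[OF conjunct1[OF b] that conjunct2[OF b, symmetric]])
    then show ?thesis
      using that by (simp add: \<phi>_def tensor_carrier)
  qed
  have hom: "\<phi> \<in> module_hom R (tensor R M N) P"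
    by (rule module_homI; unfold tensor_carrier; elim imageE)
      (simp_all add: \<phi> EE F_closed cos_add cos_smult)
  have pure: "\<phi> (pt m n) = \<beta> m n" if "m \<in> carrier M" "n \<in> carrier N" for m n
    unfolding pure_tensor_def using \<phi>[OF gen_closed[OF that]] Eg[OF that] by simp
  have "tensor_lift R M N P \<beta> = \<phi>"
    by (rule tensor_lift_eqI) (use module_homD[OF hom] pure in \<open>auto simp: \<phi>_def\<close>)
  with hom pure show "tensor_lift R M N P \<beta> \<in> module_hom R (tensor R M N) P"
    "\<And>m n. m \<in> carrier M ==> n \<in> carrier N ==> tensor_lift R M N P \<beta> (pt m n) = \<beta> m n"
    by auto
qed

end

text \<open>A free module of rank \<open>d\<close> with a basis and its dual basis. The dual basis
  is part of the data because on \<Omega>/I^m it is a concrete function whose values are computed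
  later.\<close>

locale based_module = module R N for R :: "('r, 'x) ring_scheme" and N :: "('r, 'n, 'z) module_scheme" +
  fixes d :: nat and e :: "nat => 'n" and eps :: "nat => 'n => 'r"
  assumes e_closed: "k < d ==> e k \<in> carrier N"
    and eps_closed: "k < d ==> \<nu> \<in> carrier N ==> eps k \<nu> \<in> carrier R"
    and eps_add: "k < d ==> \<nu> \<in> carrier N ==> \<mu> \<in> carrier N ==>
      eps k (\<nu> \<oplus>\<^sub>N \<mu>) = eps k \<nu> \<oplus>\<^sub>R eps k \<mu>"
    and eps_smult: "k < d ==> r \<in> carrier R ==> \<nu> \<in> carrier N ==>
      eps k (r \<odot>\<^sub>N \<nu>) = r \<otimes>\<^sub>R eps k \<nu>"
    and eps_e: "k < d ==> l < d ==> eps k (e l) = (if k = l then \<one>\<^sub>R else \<zero>\<^sub>R)"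
    and expand: "\<nu> \<in> carrier N ==> \<nu> = (\<Oplus>\<^sub>N k\<in>{..<d}. eps k \<nu> \<odot>\<^sub>N e k)"

text \<open>This is the identity of M tensored with the functional \<open>ep\<close>, followed by M
  \<otimes> R = M.\<close>

definition tensor_coord :: "('r, 'x) ring_scheme => ('r, 'm, 'y) module_scheme =>
    ('r, 'n, 'z) module_scheme => ('n => 'r) => ('m \<times> 'n => 'r) set => 'm" where
  "tensor_coord R M N ep = tensor_lift R M N M (\<lambda>m \<nu>. ep \<nu> \<odot>\<^sub>M m)"

locale tensor_based = based_module R N d e eps
  for R :: "('r, 'x) ring_scheme" and M :: "('r, 'm, 'y) module_scheme"
    and N :: "('r, 'n, 'z) module_scheme" and d e eps +
  assumes M': "module R M"
begin

sublocale tm: tensor_modules R M N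
  by (rule tensor_modules.intro[OF M' module_axioms])

abbreviation "kap k \<equiv> tensor_coord R M N (eps k)"

lemma kap:
  assumes "k < d"
  shows kap_hom: "kap k \<in> module_hom R (tensor R M N) M"
    and kap_pure: "\<And>m \<nu>. m \<in> carrier M ==> \<nu> \<in> carrier N ==> kap k (pure_tensor R M N m \<nu>) = eps k \<nu> \<odot>\<^sub>M m"
proof -
  interpret M: module R M by (rule M')
  have *: "eps k \<nu> \<odot>\<^sub>M (r \<odot>\<^sub>M m) = r \<odot>\<^sub>M (eps k \<nu> \<odot>\<^sub>M m)"
    if "r \<in> carrier R" "m \<in> carrier M" "\<nu> \<in> carrier N" for r m \<nu>
    using that assms eps_closed by (simp add: M.smult_assoc1[symmetric] m_comm)
  show "kap k \<in> module_hom R (tensor R M N) M"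
    "\<And>m \<nu>. m \<in> carrier M ==> \<nu> \<in> carrier N ==> kap k (pure_tensor R M N m \<nu>) = eps k \<nu> \<odot>\<^sub>M m"
    unfolding tensor_coord_def
    using assms eps_closed eps_add eps_smult *
    by (intro tm.tensor_lift_hom tm.tensor_lift_pure M';
        simp add: M.smult_r_distr M.smult_l_distr M.smult_assoc1)+
qed

lemma expand_pure:
  assumes "m \<in> carrier M" "\<nu> \<in> carrier N"
  shows "pure_tensor R M N m \<nu> = (\<Oplus>\<^sub>(tensor R M N)k\<in>{..<d}. pure_tensor R M N (eps k \<nu> \<odot>\<^sub>M m) (e k))"
proof -
  interpret T: module R "tensor R M N" by (rule tm.tensor_module)
  interpret M: module R M by (rule M')
  have "pure_tensor R M N m \<nu> = pure_tensor R M N m (\<Oplus>\<^sub>N k\<in>{..<d}. eps k \<nu> \<odot>\<^sub>N e k)"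
    using expand[OF assms(2)] by simp
  also have "\<dots> = (\<Oplus>\<^sub>(tensor R M N)k\<in>{..<d}. pure_tensor R M N m (eps k \<nu> \<odot>\<^sub>N e k))"
    using assms e_closed eps_closed
    by (intro module_hom_finsum[OF module_axioms tm.tensor_module, of "pure_tensor R M N m"] module_homI)
      (auto simp: tm.pt_closed tm.pt_add_right tm.pt_smult_right)
  also have "\<dots> = (\<Oplus>\<^sub>(tensor R M N)k\<in>{..<d}. pure_tensor R M N (eps k \<nu> \<odot>\<^sub>M m) (e k))"
    using assms e_closed eps_closed
    by (intro T.finsum_cong') (auto simp: tm.pt_closed tm.pt_smult_left tm.pt_smult_right)
  finally show ?thesis .
qed

text \<open>Together with \<open>kap_sum\<close> this identifies the tensor product with the d-fold
  power of M, so that identities in it can be checked coordinate by coordinate.\<close>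

lemma expand_tensor:
  assumes "z \<in> carrier (tensor R M N)"
  shows "z = (\<Oplus>\<^sub>(tensor R M N)k\<in>{..<d}. pure_tensor R M N (kap k z) (e k))"
  using assms
proof (induction z rule: tm.tensor_induct)
  case (pure m \<nu>)
  interpret T: module R "tensor R M N" by (rule tm.tensor_module)
  interpret M: module R M by (rule M')
  show ?case
    by (subst expand_pure[OF pure], rule T.finsum_cong')
      (use pure e_closed eps_closed in \<open>auto simp: kap_pure tm.pt_closed\<close>)
next
  case (add y z)
  interpret T: module R "tensor R M N" by (rule tm.tensor_module)
  have c: "kap k y \<in> carrier M" "kap k z \<in> carrier M" if "k < d" for k
    using add module_homD(1)[OF kap_hom[OF that]] by auto
  have "(\<Oplus>\<^sub>(tensor R M N)k\<in>{..<d}. pure_tensor R M N (kap k (y \<oplus>\<^sub>(tensor R M N) z)) (e k)) =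
    (\<Oplus>\<^sub>(tensor R M N)k\<in>{..<d}. pure_tensor R M N (kap k y) (e k) \<oplus>\<^sub>(tensor R M N) pure_tensor R M N (kap k z) (e k))"
    by (rule T.finsum_cong')
      (use c add e_closed in \<open>auto simp: module_homD(2)[OF kap_hom] tm.pt_add_left tm.pt_closed\<close>)
  also have "\<dots> = y \<oplus>\<^sub>(tensor R M N) z"
    using c e_closed by (subst T.finsum_addf) (auto simp: tm.pt_closed add(3)[symmetric] add(4)[symmetric])
  finally show ?case by simp
qed

lemma kap_sum:
  assumes "\<And>k. k < d ==> t k \<in> carrier M" "l < d"
  shows "kap l (\<Oplus>\<^sub>(tensor R M N)k\<in>{..<d}. pure_tensor R M N (t k) (e k)) = t l"
proof -
  interpret M: module R M by (rule M')
  have "kap l (\<Oplus>\<^sub>(tensor R M N)k\<in>{..<d}. pure_tensor R M N (t k) (e k)) =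
      (\<Oplus>\<^sub>M k\<in>{..<d}. kap l (pure_tensor R M N (t k) (e k)))"
    using assms e_closed
    by (intro module_hom_finsum[OF tm.tensor_module M' kap_hom]) (auto simp: tm.pt_closed)
  also have "\<dots> = (\<Oplus>\<^sub>M k\<in>{..<d}. if l = k then t k else \<zero>\<^sub>M)"
    using assms e_closed by (intro M.M.finsum_cong') (auto simp: kap_pure eps_e)
  also have "\<dots> = t l"
    using assms by (intro M.M.finsum_singleton) auto
  finally show ?thesis .
qed

lemma tensor_eqI:
  assumes "y \<in> carrier (tensor R M N)" "z \<in> carrier (tensor R M N)" "\<And>k. k < d ==> kap k y = kap k z"
  shows "y = z"
proof -
  interpret T: module R "tensor R M N" by (rule tm.tensor_module)
  have "(\<Oplus>\<^sub>(tensor R M N)k\<in>{..<d}. pure_tensor R M N (kap k y) (e k)) =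
      (\<Oplus>\<^sub>(tensor R M N)k\<in>{..<d}. pure_tensor R M N (kap k z) (e k))"
    using assms e_closed module_homD(1)[OF kap_hom]
    by (intro T.finsum_cong') (auto simp: tm.pt_closed)
  from trans[OF expand_tensor[OF assms(1)] trans[OF this expand_tensor[OF assms(2), symmetric]]]
  show ?thesis .
qed

end

section \<open>Group rings\<close>

lemma (in abelian_monoid) finsum_fibres:
  assumes "finite A" "finite B" "f ` A \<subseteq> B" "g \<in> A \<rightarrow> carrier G"
  shows "(\<Oplus>v\<in>B. \<Oplus>d\<in>{d \<in> A. f d = v}. g d) = (\<Oplus>d\<in>A. g d)"
proof -
  have "(\<Oplus>d\<in>(\<Union>v\<in>B. {d \<in> A. f d = v}). g d) = (\<Oplus>v\<in>B. \<Oplus>d\<in>{d \<in> A. f d = v}. g d)"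
    by (rule add.finprod_UN_disjoint) (use assms in \<open>auto simp: pairwise_def disjnt_def\<close>)
  moreover have "(\<Union>v\<in>B. {d \<in> A. f d = v}) = A"
    using assms(3) by auto
  ultimately show ?thesis by simp
qed

lemma (in abelian_monoid) finsum_reindex_bij:
  assumes "bij_betw k A B" "g \<in> B \<rightarrow> carrier G"
  shows "(\<Oplus>v\<in>B. g v) = (\<Oplus>v\<in>A. g (k v))"
  using finsum_reindex[of g k A] assms by (auto simp: bij_betw_def)

lemma (in abelian_monoid) finsum_delta:
  assumes "finite A" "i \<in> A ==> f i \<in> carrier G" "\<And>j. j \<in> A ==> j \<noteq> i ==> f j = \<zero>"
  shows "(\<Oplus>j\<in>A. f j) = (if i \<in> A then f i else \<zero>)"
proof (cases "i \<in> A")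
  case True
  have "(\<Oplus>j\<in>A. f j) = (\<Oplus>j\<in>A. if i = j then f j else \<zero>)"
    using True assms by (intro finsum_cong') auto
  also have "\<dots> = f i"
    using True assms by (intro finsum_singleton) (auto simp: Pi_iff, metis zero_closed)
  finally show ?thesis using True by simp
next
  case False
  have "(\<Oplus>j\<in>A. f j) = (\<Oplus>j\<in>A. \<zero>)"
    using False assms by (intro finsum_cong') auto
  then show ?thesis using False by simp
qed

text \<open>The element r[v] of the group ring.\<close>

definition gr_single :: "('r, 'x) ring_scheme => ('q, 'y) monoid_scheme => 'r => 'q => 'q => 'r" where
  "gr_single R Q r v = (\<lambda>u\<in>carrier Q. if u = v then r else \<zero>\<^sub>R)"

locale finite_group_ring = R: cring R + Q: group Q
  for R :: "('r, 'x) ring_scheme" and Q :: "('q, 'y) monoid_scheme" +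
  assumes fin: "finite (carrier Q)"
begin

abbreviation "RQ \<equiv> group_ring R Q"

lemma RQ_carrier: "carrier RQ = carrier Q \<rightarrow>\<^sub>E carrier R"
  by (simp add: group_ring_def)

lemma RQ_eval: "a \<in> carrier RQ ==> u \<in> carrier Q ==> a u \<in> carrier R"
  unfolding RQ_carrier by (rule PiE_mem)

lemma RQ_ext:
  assumes "a \<in> carrier RQ" "b \<in> carrier RQ" "\<And>u. u \<in> carrier Q ==> a u = b u"
  shows "a = b"
  using assms unfolding RQ_carrier by (rule PiE_ext)

lemma RQ_closedI:
  assumes "\<And>u. u \<in> carrier Q ==> c u \<in> carrier R"
  shows "(\<lambda>u\<in>carrier Q. c u) \<in> carrier RQ"
  unfolding RQ_carrier using assms by (simp add: PiE_def Pi_def)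

lemma RQ_add: "u \<in> carrier Q ==> (a \<oplus>\<^sub>RQ b) u = a u \<oplus>\<^sub>R b u"
  by (simp add: group_ring_def)

lemma RQ_mult: "u \<in> carrier Q ==>
    (a \<otimes>\<^sub>RQ b) u = (\<Oplus>\<^sub>R v\<in>carrier Q. a v \<otimes>\<^sub>R b (inv\<^bsub>Q\<^esub> v \<otimes>\<^sub>Q u))"
  by (simp add: group_ring_def)

lemma RQ_zero: "u \<in> carrier Q ==> \<zero>\<^sub>RQ u = \<zero>\<^sub>R"
  by (simp add: group_ring_def)

lemma RQ_one: "\<one>\<^sub>RQ = gr_single R Q \<one>\<^sub>R \<one>\<^sub>Q"
  by (simp add: group_ring_def gr_single_def)

lemma single_closed: "r \<in> carrier R ==> gr_single R Q r v \<in> carrier RQ"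
  unfolding gr_single_def by (rule RQ_closedI) auto

lemma RQ_add_closed: "a \<in> carrier RQ ==> b \<in> carrier RQ ==> a \<oplus>\<^sub>RQ b \<in> carrier RQ"
  using RQ_closedI[of "\<lambda>u. a u \<oplus>\<^sub>R b u"] RQ_eval[of a] RQ_eval[of b] by (simp add: group_ring_def)

lemma RQ_zero_closed: "\<zero>\<^sub>RQ \<in> carrier RQ"
  using RQ_closedI[of "\<lambda>u. \<zero>\<^sub>R"] by (simp add: group_ring_def)

lemma RQ_mult_closed:
  assumes "a \<in> carrier RQ" "b \<in> carrier RQ"
  shows "a \<otimes>\<^sub>RQ b \<in> carrier RQ"
proof -
  have "(\<lambda>u\<in>carrier Q. \<Oplus>\<^sub>R v\<in>carrier Q. a v \<otimes>\<^sub>R b (inv\<^bsub>Q\<^esub> v \<otimes>\<^sub>Q u)) \<in> carrier RQ"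
    using RQ_eval[OF assms(1)] RQ_eval[OF assms(2)]
    by (intro RQ_closedI R.finsum_closed) auto
  then show ?thesis by (simp add: group_ring_def)
qed

lemma single_mult:
  assumes "r \<in> carrier R" "v \<in> carrier Q" "b \<in> carrier RQ" "u \<in> carrier Q"
  shows "(gr_single R Q r v \<otimes>\<^sub>RQ b) u = r \<otimes>\<^sub>R b (inv\<^bsub>Q\<^esub> v \<otimes>\<^sub>Q u)"
proof -
  have "(\<Oplus>\<^sub>R w\<in>carrier Q. gr_single R Q r v w \<otimes>\<^sub>R b (inv\<^bsub>Q\<^esub> w \<otimes>\<^sub>Q u)) =
      (if v \<in> carrier Q then gr_single R Q r v v \<otimes>\<^sub>R b (inv\<^bsub>Q\<^esub> v \<otimes>\<^sub>Q u) else \<zero>\<^sub>R)"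
    using assms fin by (intro R.finsum_delta) (auto simp: gr_single_def RQ_eval)
  then show ?thesis
    using assms by (simp add: RQ_mult gr_single_def)
qed

lemma single_mult_single:
  assumes "r \<in> carrier R" "s \<in> carrier R" "v \<in> carrier Q" "w \<in> carrier Q"
  shows "gr_single R Q r v \<otimes>\<^sub>RQ gr_single R Q s w = gr_single R Q (r \<otimes>\<^sub>R s) (v \<otimes>\<^sub>Q w)"
proof (rule RQ_ext)
  fix u assume u: "u \<in> carrier Q"
  have "inv\<^bsub>Q\<^esub> v \<otimes>\<^sub>Q u = w \<longleftrightarrow> u = v \<otimes>\<^sub>Q w"
    using assms u by (metis Q.inv_solve_left)
  then show "(gr_single R Q r v \<otimes>\<^sub>RQ gr_single R Q s w) u = gr_single R Q (r \<otimes>\<^sub>R s) (v \<otimes>\<^sub>Q w) u"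
    using assms u by (subst single_mult) (auto simp: single_closed, auto simp: gr_single_def)
qed (use assms in \<open>auto intro: RQ_mult_closed single_closed\<close>)

lemma single_add:
  assumes "r \<in> carrier R" "s \<in> carrier R"
  shows "gr_single R Q (r \<oplus>\<^sub>R s) v = gr_single R Q r v \<oplus>\<^sub>RQ gr_single R Q s v"
  by (rule RQ_ext) (use assms in \<open>auto simp: single_closed RQ_add_closed RQ_add\<close>, auto simp: gr_single_def)

lemma bij_shift: "v \<in> carrier Q ==> bij_betw (\<lambda>w. v \<otimes>\<^sub>Q w) (carrier Q) (carrier Q)"
  by (rule bij_betw_byWitness[of _ "\<lambda>w. inv\<^bsub>Q\<^esub> v \<otimes>\<^sub>Q w"]) (auto simp: Q.m_assoc[symmetric])

lemma RQ_assoc: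
  assumes a: "a \<in> carrier RQ" and b: "b \<in> carrier RQ" and c: "c \<in> carrier RQ"
  shows "a \<otimes>\<^sub>RQ b \<otimes>\<^sub>RQ c = a \<otimes>\<^sub>RQ (b \<otimes>\<^sub>RQ c)"
proof (rule RQ_ext)
  note ev = RQ_eval[OF a] RQ_eval[OF b] RQ_eval[OF c]
  fix u assume u: "u \<in> carrier Q"
  let ?t = "\<lambda>v w. a v \<otimes>\<^sub>R b (inv\<^bsub>Q\<^esub> v \<otimes>\<^sub>Q w) \<otimes>\<^sub>R c (inv\<^bsub>Q\<^esub> w \<otimes>\<^sub>Q u)"
  have "(a \<otimes>\<^sub>RQ b \<otimes>\<^sub>RQ c) u = (\<Oplus>\<^sub>R w\<in>carrier Q. (\<Oplus>\<^sub>R v\<in>carrier Q. ?t v w))"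
    unfolding RQ_mult[OF u]
    using fin ev u by (intro R.finsum_cong') (auto simp: RQ_mult R.finsum_ldistr)
  also have "\<dots> = (\<Oplus>\<^sub>R v\<in>carrier Q. (\<Oplus>\<^sub>R w\<in>carrier Q. ?t v w))"
    using fin ev u by (intro R.finsum_swap) auto
  also have "\<dots> = (\<Oplus>\<^sub>R v\<in>carrier Q. a v \<otimes>\<^sub>R (b \<otimes>\<^sub>RQ c) (inv\<^bsub>Q\<^esub> v \<otimes>\<^sub>Q u))"
  proof (rule R.finsum_cong')
    \<comment> \<open>The substitution of vw for w turns the inner sum into the convolution of b and
      c at v^{-1} u.\<close>
    fix v assume v: "v \<in> carrier Q"
    have "(\<Oplus>\<^sub>R w\<in>carrier Q. ?t v w) = (\<Oplus>\<^sub>R w\<in>carrier Q. ?t v (v \<otimes>\<^sub>Q w))"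
      using fin ev u v by (intro R.finsum_reindex_bij[OF bij_shift[OF v]]) auto
    also have "\<dots> = (\<Oplus>\<^sub>R w\<in>carrier Q. a v \<otimes>\<^sub>R (b w \<otimes>\<^sub>R c (inv\<^bsub>Q\<^esub> w \<otimes>\<^sub>Q (inv\<^bsub>Q\<^esub> v \<otimes>\<^sub>Q u))))"
    proof (rule R.finsum_cong')
      fix w assume w: "w \<in> carrier Q"
      have "inv\<^bsub>Q\<^esub> v \<otimes>\<^sub>Q (v \<otimes>\<^sub>Q w) = w"
        using v w by (simp add: Q.m_assoc[symmetric])
      moreover have "inv\<^bsub>Q\<^esub> (v \<otimes>\<^sub>Q w) \<otimes>\<^sub>Q u = inv\<^bsub>Q\<^esub> w \<otimes>\<^sub>Q (inv\<^bsub>Q\<^esub> v \<otimes>\<^sub>Q u)"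
        using v w u by (simp add: Q.m_assoc Q.inv_mult_group)
      ultimately show "?t v (v \<otimes>\<^sub>Q w) = a v \<otimes>\<^sub>R (b w \<otimes>\<^sub>R c (inv\<^bsub>Q\<^esub> w \<otimes>\<^sub>Q (inv\<^bsub>Q\<^esub> v \<otimes>\<^sub>Q u)))"
        using ev u v w by (simp add: R.m_assoc)
    qed (use ev u v in auto)
    also have "\<dots> = a v \<otimes>\<^sub>R (b \<otimes>\<^sub>RQ c) (inv\<^bsub>Q\<^esub> v \<otimes>\<^sub>Q u)"
      using fin ev u v by (subst RQ_mult) (auto intro!: R.finsum_rdistr[symmetric])
    finally show "(\<Oplus>\<^sub>R w\<in>carrier Q. ?t v w) = a v \<otimes>\<^sub>R (b \<otimes>\<^sub>RQ c) (inv\<^bsub>Q\<^esub> v \<otimes>\<^sub>Q u)" .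
  qed (use ev u RQ_eval[OF RQ_mult_closed[OF b c]] in auto)
  also have "\<dots> = (a \<otimes>\<^sub>RQ (b \<otimes>\<^sub>RQ c)) u"
    using RQ_mult[OF u] by simp
  finally show "(a \<otimes>\<^sub>RQ b \<otimes>\<^sub>RQ c) u = (a \<otimes>\<^sub>RQ (b \<otimes>\<^sub>RQ c)) u" .
qed (use assms in \<open>auto intro: RQ_mult_closed\<close>)

lemma RQ_comm:
  assumes "comm_group Q" and a: "a \<in> carrier RQ" and b: "b \<in> carrier RQ"
  shows "a \<otimes>\<^sub>RQ b = b \<otimes>\<^sub>RQ a"
proof (rule RQ_ext)
  interpret C: comm_group Q by fact
  note ev = RQ_eval[OF a] RQ_eval[OF b]
  fix u assume u: "u \<in> carrier Q"
  have 1: "u \<otimes>\<^sub>Q inv\<^bsub>Q\<^esub> (inv\<^bsub>Q\<^esub> w \<otimes>\<^sub>Q u) = w" if "w \<in> carrier Q" for w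
    using that u by (simp add: Q.inv_mult_group Q.m_assoc[symmetric])
  have 2: "inv\<^bsub>Q\<^esub> (u \<otimes>\<^sub>Q inv\<^bsub>Q\<^esub> w) \<otimes>\<^sub>Q u = w" if "w \<in> carrier Q" for w
    using that u by (simp add: Q.inv_mult_group Q.m_assoc)
  \<comment> \<open>Replacing v by w^{-1} u exchanges the two factors of the convolution;
    commutativity of Q gives (w^{-1} u)^{-1} u = w.\<close>
  have bij: "bij_betw (\<lambda>w. inv\<^bsub>Q\<^esub> w \<otimes>\<^sub>Q u) (carrier Q) (carrier Q)"
    using u by (intro bij_betw_byWitness[of _ "\<lambda>w. u \<otimes>\<^sub>Q inv\<^bsub>Q\<^esub> w"]) (auto simp: 1 2)
  have *: "inv\<^bsub>Q\<^esub> (inv\<^bsub>Q\<^esub> w \<otimes>\<^sub>Q u) \<otimes>\<^sub>Q u = w" if "w \<in> carrier Q" for w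
    using that u 1[OF that] C.m_comm[of u "inv\<^bsub>Q\<^esub> (inv\<^bsub>Q\<^esub> w \<otimes>\<^sub>Q u)"] by simp
  have "(a \<otimes>\<^sub>RQ b) u = (\<Oplus>\<^sub>R v\<in>carrier Q. a v \<otimes>\<^sub>R b (inv\<^bsub>Q\<^esub> v \<otimes>\<^sub>Q u))"
    by (rule RQ_mult[OF u])
  also have "\<dots> = (\<Oplus>\<^sub>R w\<in>carrier Q. a (inv\<^bsub>Q\<^esub> w \<otimes>\<^sub>Q u) \<otimes>\<^sub>R b (inv\<^bsub>Q\<^esub> (inv\<^bsub>Q\<^esub> w \<otimes>\<^sub>Q u) \<otimes>\<^sub>Q u))"
    using ev u by (intro R.finsum_reindex_bij[OF bij]) auto
  also have "\<dots> = (\<Oplus>\<^sub>R w\<in>carrier Q. b w \<otimes>\<^sub>R a (inv\<^bsub>Q\<^esub> w \<otimes>\<^sub>Q u))"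
    using ev u by (intro R.finsum_cong') (auto simp: * R.m_comm)
  also have "\<dots> = (b \<otimes>\<^sub>RQ a) u"
    using RQ_mult[OF u] by simp
  finally show "(a \<otimes>\<^sub>RQ b) u = (b \<otimes>\<^sub>RQ a) u" .
qed (use assms in \<open>auto intro: RQ_mult_closed\<close>)

lemma RQ_abelian_group: "abelian_group RQ"
proof (rule abelian_groupI)
  fix a assume a: "a \<in> carrier RQ"
  let ?b = "\<lambda>u\<in>carrier Q. \<ominus>\<^sub>R a u"
  have b: "?b \<in> carrier RQ" by (rule RQ_closedI) (simp add: RQ_eval[OF a])
  have "?b \<oplus>\<^sub>RQ a = \<zero>\<^sub>RQ"
    by (rule RQ_ext) (use a b in \<open>auto simp: RQ_add_closed RQ_zero_closed RQ_add RQ_zero RQ_eval R.l_neg\<close>)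
  with b show "\<exists>b\<in>carrier RQ. b \<oplus>\<^sub>RQ a = \<zero>\<^sub>RQ" by blast
  show "\<zero>\<^sub>RQ \<oplus>\<^sub>RQ a = a"
    by (rule RQ_ext) (use a in \<open>auto simp: RQ_add_closed RQ_zero_closed RQ_add RQ_zero RQ_eval\<close>)
next
  fix a b c assume "a \<in> carrier RQ" "b \<in> carrier RQ" "c \<in> carrier RQ"
  then show "a \<oplus>\<^sub>RQ b \<oplus>\<^sub>RQ c = a \<oplus>\<^sub>RQ (b \<oplus>\<^sub>RQ c)"
    by (intro RQ_ext) (auto simp: RQ_add_closed RQ_add RQ_eval R.a_assoc)
next
  fix a b assume "a \<in> carrier RQ" "b \<in> carrier RQ"
  then show "a \<oplus>\<^sub>RQ b = b \<oplus>\<^sub>RQ a"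
    by (intro RQ_ext) (auto simp: RQ_add_closed RQ_add RQ_eval R.a_comm)
qed (auto simp: RQ_add_closed RQ_zero_closed)

lemma RQ_cring:
  assumes "comm_group Q"
  shows "cring RQ"
proof (rule cringI[OF RQ_abelian_group])
  have one: "\<one>\<^sub>RQ \<in> carrier RQ" unfolding RQ_one by (rule single_closed) simp
  have l_one: "\<one>\<^sub>RQ \<otimes>\<^sub>RQ a = a" if a: "a \<in> carrier RQ" for a
    by (rule RQ_ext) (use a one RQ_eval[OF a] in \<open>auto simp: RQ_mult_closed RQ_one single_mult\<close>)
  show "comm_monoid RQ"
    by (rule comm_monoidI) (use one l_one RQ_mult_closed RQ_assoc RQ_comm[OF assms] in auto)
  fix a b c assume a: "a \<in> carrier RQ" and b: "b \<in> carrier RQ" and c: "c \<in> carrier RQ"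
  note ev = RQ_eval[OF a] RQ_eval[OF b] RQ_eval[OF c]
  show "(a \<oplus>\<^sub>RQ b) \<otimes>\<^sub>RQ c = a \<otimes>\<^sub>RQ c \<oplus>\<^sub>RQ b \<otimes>\<^sub>RQ c"
  proof (rule RQ_ext)
    fix u assume u: "u \<in> carrier Q"
    have "((a \<oplus>\<^sub>RQ b) \<otimes>\<^sub>RQ c) u = (\<Oplus>\<^sub>R v\<in>carrier Q.
        a v \<otimes>\<^sub>R c (inv\<^bsub>Q\<^esub> v \<otimes>\<^sub>Q u) \<oplus>\<^sub>R b v \<otimes>\<^sub>R c (inv\<^bsub>Q\<^esub> v \<otimes>\<^sub>Q u))"
      unfolding RQ_mult[OF u] using ev u
      by (intro R.finsum_cong') (auto simp: RQ_add R.l_distr)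
    also have "\<dots> = (a \<otimes>\<^sub>RQ c \<oplus>\<^sub>RQ b \<otimes>\<^sub>RQ c) u"
      using ev u by (simp add: RQ_add RQ_mult R.finsum_addf Pi_def)
    finally show "((a \<oplus>\<^sub>RQ b) \<otimes>\<^sub>RQ c) u = (a \<otimes>\<^sub>RQ c \<oplus>\<^sub>RQ b \<otimes>\<^sub>RQ c) u" .
  qed (use a b c in \<open>auto intro: RQ_mult_closed RQ_add_closed\<close>)
qed

end

text \<open>Translation by d^{-1} carries the fibre over c to the fibre over f(d)^{-1} c, so summing
  over the fibres of a homomorphism commutes with convolution. Applied to the transition maps, it
  makes products of compatible families compatible.\<close>

lemma group_ring_push_mult:
  assumes Q: "finite_group_ring R Q" and Q': "finite_group_ring R Q'"
    and f: "f \<in> hom Q Q'"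
    and a: "a \<in> carrier (group_ring R Q)" and b: "b \<in> carrier (group_ring R Q)"
    and a': "a' \<in> carrier (group_ring R Q')" and b': "b' \<in> carrier (group_ring R Q')"
    and pa: "\<And>c. c \<in> carrier Q' ==> a' c = (\<Oplus>\<^sub>R d\<in>{d \<in> carrier Q. f d = c}. a d)"
    and pb: "\<And>c. c \<in> carrier Q' ==> b' c = (\<Oplus>\<^sub>R d\<in>{d \<in> carrier Q. f d = c}. b d)"
    and c: "c \<in> carrier Q'"
  shows "(a' \<otimes>\<^sub>(group_ring R Q') b') c = (\<Oplus>\<^sub>R u\<in>{u \<in> carrier Q. f u = c}. (a \<otimes>\<^sub>(group_ring R Q) b) u)"
proof -
  interpret Q: finite_group_ring R Q by fact
  interpret Q': finite_group_ring R Q' by fact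
  interpret f: group_hom Q Q' f
    by (intro group_hom.intro group_hom_axioms.intro f) unfold_locales
  note ev = Q.RQ_eval[OF a] Q.RQ_eval[OF b] Q'.RQ_eval[OF a'] Q'.RQ_eval[OF b']
  let ?F = "\<lambda>c. {d \<in> carrier Q. f d = c}"
  have "(a' \<otimes>\<^sub>(group_ring R Q') b') c = (\<Oplus>\<^sub>R v\<in>carrier Q'. a' v \<otimes>\<^sub>R b' (inv\<^bsub>Q'\<^esub> v \<otimes>\<^sub>Q' c))"
    by (rule Q'.RQ_mult[OF c])
  also have "\<dots> = (\<Oplus>\<^sub>R v\<in>carrier Q'. \<Oplus>\<^sub>R d\<in>?F v. a d \<otimes>\<^sub>R b' (inv\<^bsub>Q'\<^esub> (f d) \<otimes>\<^sub>Q' c))"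
  proof (rule Q.R.finsum_cong')
    fix v assume v: "v \<in> carrier Q'"
    have "a' v \<otimes>\<^sub>R b' (inv\<^bsub>Q'\<^esub> v \<otimes>\<^sub>Q' c) = (\<Oplus>\<^sub>R d\<in>?F v. a d \<otimes>\<^sub>R b' (inv\<^bsub>Q'\<^esub> v \<otimes>\<^sub>Q' c))"
      unfolding pa[OF v] using Q.fin ev v c by (intro Q.R.finsum_ldistr) auto
    also have "\<dots> = (\<Oplus>\<^sub>R d\<in>?F v. a d \<otimes>\<^sub>R b' (inv\<^bsub>Q'\<^esub> (f d) \<otimes>\<^sub>Q' c))"
      using ev v c by (intro Q.R.finsum_cong') auto
    finally show "a' v \<otimes>\<^sub>R b' (inv\<^bsub>Q'\<^esub> v \<otimes>\<^sub>Q' c) = (\<Oplus>\<^sub>R d\<in>?F v. a d \<otimes>\<^sub>R b' (inv\<^bsub>Q'\<^esub> (f d) \<otimes>\<^sub>Q' c))" .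
  qed (use ev c in auto)
  also have "\<dots> = (\<Oplus>\<^sub>R d\<in>carrier Q. a d \<otimes>\<^sub>R b' (inv\<^bsub>Q'\<^esub> (f d) \<otimes>\<^sub>Q' c))"
    using Q.fin Q'.fin ev c by (intro Q.R.finsum_fibres) auto
  also have "\<dots> = (\<Oplus>\<^sub>R d\<in>carrier Q. \<Oplus>\<^sub>R u\<in>?F c. a d \<otimes>\<^sub>R b (inv\<^bsub>Q\<^esub> d \<otimes>\<^sub>Q u))"
  proof (rule Q.R.finsum_cong')
    fix d assume d: "d \<in> carrier Q"
    have bij: "bij_betw (\<lambda>u. inv\<^bsub>Q\<^esub> d \<otimes>\<^sub>Q u) (?F c) (?F (inv\<^bsub>Q'\<^esub> (f d) \<otimes>\<^sub>Q' c))"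
      using d c by (intro bij_betw_byWitness[of _ "\<lambda>u. d \<otimes>\<^sub>Q u"])
        (auto simp: Q.Q.m_assoc[symmetric] Q'.Q.m_assoc[symmetric])
    have "b' (inv\<^bsub>Q'\<^esub> (f d) \<otimes>\<^sub>Q' c) = (\<Oplus>\<^sub>R u\<in>?F (inv\<^bsub>Q'\<^esub> (f d) \<otimes>\<^sub>Q' c). b u)"
      using d c by (intro pb) auto
    also have "\<dots> = (\<Oplus>\<^sub>R u\<in>?F c. b (inv\<^bsub>Q\<^esub> d \<otimes>\<^sub>Q u))"
      using ev by (intro Q.R.finsum_reindex_bij[OF bij]) auto
    finally show "a d \<otimes>\<^sub>R b' (inv\<^bsub>Q'\<^esub> (f d) \<otimes>\<^sub>Q' c) = (\<Oplus>\<^sub>R u\<in>?F c. a d \<otimes>\<^sub>R b (inv\<^bsub>Q\<^esub> d \<otimes>\<^sub>Q u))"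
      using Q.fin ev d by (simp add: Q.R.finsum_rdistr Pi_def)
  qed (use ev in auto)
  also have "\<dots> = (\<Oplus>\<^sub>R u\<in>?F c. \<Oplus>\<^sub>R d\<in>carrier Q. a d \<otimes>\<^sub>R b (inv\<^bsub>Q\<^esub> d \<otimes>\<^sub>Q u))"
    using Q.fin ev by (intro Q.R.finsum_swap) auto
  also have "\<dots> = (\<Oplus>\<^sub>R u\<in>?F c. (a \<otimes>\<^sub>(group_ring R Q) b) u)"
    using ev by (intro Q.R.finsum_cong') (auto simp: Q.RQ_mult)
  finally show ?thesis .
qed

section \<open>Completed group rings\<close>

text \<open>The element r[g] of R[[G]]. Both \<open>cgr_elt\<close> (r = 1) and
  \<open>cgr_const\<close> (g = 1) are instances, so closure and product rules are proved
  once.\<close>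

definition cgr_single ::
    "('r, 'x) topring_scheme => ('g, 'y) topgroup_scheme => 'r => 'g => ('g set => 'g set => 'r)" where
  "cgr_single R G r g = (\<lambda>N\<in>open_normals G. gr_single R (G Mod N) r (N #>\<^sub>G g))"

text \<open>Finiteness of the quotients is what makes the sums in R[G/N] and in the transition maps
  meaningful. The locale is used both for G, by profiniteness, and for H = G/K, by compactness of
  G.\<close>

locale cgr_base = G: group G + R: cring R
  for G :: "('g, 'x) topgroup_scheme" and R :: "('r, 'y) topring_scheme" +
  assumes finQ: "N \<in> open_normals G ==> finite (carrier (G Mod N))"
    and carrier_open: "carrier G \<in> open_normals G"
begin

abbreviation "ON \<equiv> open_normals G"
abbreviation "CG \<equiv> completed_group_ring R G"
abbreviation "GR N \<equiv> group_ring R (G Mod N)"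

lemma ON_normal: "N \<in> ON ==> normal N G"
  by (simp add: open_normals_def)

lemma ON_subgroup: "N \<in> ON ==> subgroup N G"
  by (simp add: ON_normal normal_imp_subgroup)

lemma FR: "N \<in> ON ==> finite_group_ring R (G Mod N)"
  using finQ normal.factorgroup_is_group[OF ON_normal]
  by (simp add: finite_group_ring_def finite_group_ring_axioms_def R.is_cring)

lemma Mod_carrier: "carrier (G Mod N) = (\<lambda>g. N #>\<^sub>G g) ` carrier G"
  by (auto simp: FactGroup_def RCOSETS_def)

lemma Mod_mult:
  assumes "N \<in> ON" "g \<in> carrier G" "h \<in> carrier G"
  shows "(N #>\<^sub>G g) <#>\<^sub>G (N #>\<^sub>G h) = N #>\<^sub>G (g \<otimes>\<^sub>G h)"
  using normal.rcos_sum[OF ON_normal] assms by simp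

lemma Mod_one: "N \<in> ON ==> N #>\<^sub>G \<one>\<^sub>G = N"
  using G.coset_mult_one[of N] subgroup.subset[OF ON_subgroup] by simp

text \<open>All cosets in the union coincide. Written this way, the transition map from G/N to G/M
  needs no choice of representatives.\<close>

lemma coset_trans:
  assumes "N \<in> ON" "M \<in> ON" "N \<subseteq> M" "g \<in> carrier G"
  shows "(\<Union>d\<in>N #>\<^sub>G g. M #>\<^sub>G d) = M #>\<^sub>G g"
proof -
  have "N #>\<^sub>G g \<subseteq> M #>\<^sub>G g"
    using assms(3) by (auto simp: r_coset_def)
  then have "M #>\<^sub>G d = M #>\<^sub>G g" if "d \<in> N #>\<^sub>G g" for d
    using G.repr_independence[OF _ assms(4) ON_subgroup[OF assms(2)]] that by auto
  moreover have "g \<in> N #>\<^sub>G g"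
    by (rule G.rcos_self[OF assms(4) ON_subgroup[OF assms(1)]])
  ultimately show ?thesis by blast
qed

lemma coset_trans_hom:
  assumes "N \<in> ON" "M \<in> ON" "N \<subseteq> M"
  shows "(\<lambda>D. \<Union>d\<in>D. M #>\<^sub>G d) \<in> hom (G Mod N) (G Mod M)"
proof (rule homI)
  fix C D assume "C \<in> carrier (G Mod N)" "D \<in> carrier (G Mod N)"
  then obtain c d where "c \<in> carrier G" "d \<in> carrier G" "C = N #>\<^sub>G c" "D = N #>\<^sub>G d"
    by (auto simp: Mod_carrier)
  then show "(\<Union>d\<in>C \<otimes>\<^sub>(G Mod N) D. M #>\<^sub>G d) = (\<Union>d\<in>C. M #>\<^sub>G d) \<otimes>\<^sub>(G Mod M) (\<Union>d\<in>D. M #>\<^sub>G d)"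
    using assms by (simp add: coset_trans Mod_mult)
next
  fix D assume "D \<in> carrier (G Mod N)"
  then show "(\<Union>d\<in>D. M #>\<^sub>G d) \<in> carrier (G Mod M)"
    unfolding Mod_carrier by (elim imageE) (simp only: coset_trans[OF assms] imageI)
qed

text \<open>\<open>cgr_carrier\<close> sums over the cosets of \<open>N\<close> contained in
  \<open>C\<close>, whereas \<open>group_ring_push_mult\<close> speaks of fibres of a homomorphism;
  the two index sets are the same.\<close>

lemma coset_fibre:
  assumes "N \<in> ON" "M \<in> ON" "N \<subseteq> M" "C \<in> carrier (G Mod M)"
  shows "{D \<in> carrier (G Mod N). D \<subseteq> C} = {D \<in> carrier (G Mod N). (\<Union>d\<in>D. M #>\<^sub>G d) = C}"
proof -
  have "N #>\<^sub>G g \<subseteq> C \<longleftrightarrow> M #>\<^sub>G g = C" if g: "g \<in> carrier G" for g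
  proof
    assume "N #>\<^sub>G g \<subseteq> C"
    then have "g \<in> C"
      using G.rcos_self[OF g ON_subgroup[OF assms(1)]] by auto
    moreover obtain c where "c \<in> carrier G" "C = M #>\<^sub>G c"
      using assms(4) by (auto simp: Mod_carrier)
    ultimately show "M #>\<^sub>G g = C"
      using G.repr_independence[OF _ _ ON_subgroup[OF assms(2)]] by auto
  next
    assume "M #>\<^sub>G g = C"
    moreover have "N #>\<^sub>G g \<subseteq> M #>\<^sub>G g"
      using assms(3) by (auto simp: r_coset_def)
    ultimately show "N #>\<^sub>G g \<subseteq> C" by simp
  qed
  then have "D \<subseteq> C \<longleftrightarrow> (\<Union>d\<in>D. M #>\<^sub>G d) = C" if "D \<in> carrier (G Mod N)" for D
    using that unfolding Mod_carrier by (elim imageE) (simp only: coset_trans[OF assms(1-3)])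
  then show ?thesis by auto
qed

lemma CG_simps:
  "carrier CG = cgr_carrier R G"
  "N \<in> ON ==> (a \<oplus>\<^sub>CG b) N = a N \<oplus>\<^sub>(GR N) b N"
  "N \<in> ON ==> (a \<otimes>\<^sub>CG b) N = a N \<otimes>\<^sub>(GR N) b N"
  "N \<in> ON ==> \<zero>\<^sub>CG N = \<zero>\<^sub>(GR N)"
  "N \<in> ON ==> \<one>\<^sub>CG N = \<one>\<^sub>(GR N)"
  by (simp_all add: completed_group_ring_def)

lemma CGI:
  assumes "\<And>N. N \<in> ON ==> c N \<in> carrier (GR N)"
    and "\<And>N M C. N \<in> ON ==> M \<in> ON ==> N \<subseteq> M ==> C \<in> carrier (G Mod M) ==>
      c M C = (\<Oplus>\<^sub>R D\<in>{D \<in> carrier (G Mod N). D \<subseteq> C}. c N D)"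
  shows "(\<lambda>N\<in>ON. c N) \<in> carrier CG"
proof -
  have "(\<lambda>N\<in>ON. c N) \<in> (\<Pi>\<^sub>E N\<in>ON. carrier (GR N))"
    using assms(1) by (simp add: PiE_def Pi_def)
  then show ?thesis
    unfolding CG_simps(1) cgr_carrier_def
    by (intro CollectI conjI ballI impI) (simp_all only: restrict_apply if_True assms(2))
qed

lemma CGD:
  assumes "a \<in> carrier CG"
  shows "N \<in> ON ==> a N \<in> carrier (GR N)"
    and "N \<in> ON ==> M \<in> ON ==> N \<subseteq> M ==> C \<in> carrier (G Mod M) ==>
      a M C = (\<Oplus>\<^sub>R D\<in>{D \<in> carrier (G Mod N). D \<subseteq> C}. a N D)"
    and "(\<lambda>N\<in>ON. a N) = a"
  using assms unfolding CG_simps(1) cgr_carrier_def by (auto simp: PiE_mem)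

lemma CG_eval: "a \<in> carrier CG ==> N \<in> ON ==> C \<in> carrier (G Mod N) ==> a N C \<in> carrier R"
  by (rule finite_group_ring.RQ_eval[OF FR CGD(1)])

lemma CG_ext:
  assumes "a \<in> carrier CG" "b \<in> carrier CG" "\<And>N. N \<in> ON ==> a N = b N"
  shows "a = b"
proof -
  have "(\<lambda>N\<in>ON. a N) = (\<lambda>N\<in>ON. b N)"
    using assms(3) by (rule restrict_ext)
  then show ?thesis using CGD(3)[OF assms(1)] CGD(3)[OF assms(2)] by simp
qed

lemma CG_ext':
  assumes "a \<in> carrier CG" "b \<in> carrier CG"
    and "\<And>N C. N \<in> ON ==> C \<in> carrier (G Mod N) ==> a N C = b N C"
  shows "a = b"
  by (rule CG_ext[OF assms(1,2)])
    (rule finite_group_ring.RQ_ext[OF FR CGD(1)[OF assms(1)] CGD(1)[OF assms(2)] assms(3)])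

lemma fin_sub: "N \<in> ON ==> finite {D \<in> carrier (G Mod N). P D}"
  using finQ by simp

lemma CG_add_closed:
  assumes a: "a \<in> carrier CG" and b: "b \<in> carrier CG"
  shows "a \<oplus>\<^sub>CG b \<in> carrier CG"
proof -
  have "(\<lambda>N\<in>ON. a N \<oplus>\<^sub>(GR N) b N) \<in> carrier CG"
  proof (rule CGI)
    fix N assume N: "N \<in> ON"
    interpret F: finite_group_ring R "G Mod N" by (rule FR[OF N])
    show "a N \<oplus>\<^sub>(GR N) b N \<in> carrier (GR N)"
      using CGD(1)[OF a N] CGD(1)[OF b N] by (rule F.RQ_add_closed)
    fix M C assume M: "M \<in> ON" and NM: "N \<subseteq> M" and C: "C \<in> carrier (G Mod M)"
    interpret F': finite_group_ring R "G Mod M" by (rule FR[OF M])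
    have "(a M \<oplus>\<^sub>(GR M) b M) C = (\<Oplus>\<^sub>R D\<in>{D \<in> carrier (G Mod N). D \<subseteq> C}. a N D \<oplus>\<^sub>R b N D)"
      using CGD(2)[OF a N M NM C] CGD(2)[OF b N M NM C] CG_eval[OF a N] CG_eval[OF b N]
      by (simp add: F'.RQ_add[OF C] R.finsum_addf Pi_def)
    also have "\<dots> = (\<Oplus>\<^sub>R D\<in>{D \<in> carrier (G Mod N). D \<subseteq> C}. (a N \<oplus>\<^sub>(GR N) b N) D)"
      using CG_eval[OF a N] CG_eval[OF b N]
      by (intro R.finsum_cong') (auto simp: F.RQ_add)
    finally show "(a M \<oplus>\<^sub>(GR M) b M) C = (\<Oplus>\<^sub>R D\<in>{D \<in> carrier (G Mod N). D \<subseteq> C}. (a N \<oplus>\<^sub>(GR N) b N) D)" .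
  qed
  then show ?thesis by (simp add: completed_group_ring_def)
qed

lemma CG_mult_closed:
  assumes a: "a \<in> carrier CG" and b: "b \<in> carrier CG"
  shows "a \<otimes>\<^sub>CG b \<in> carrier CG"
proof -
  have "(\<lambda>N\<in>ON. a N \<otimes>\<^sub>(GR N) b N) \<in> carrier CG"
  proof (rule CGI)
    fix N assume N: "N \<in> ON"
    interpret F: finite_group_ring R "G Mod N" by (rule FR[OF N])
    show "a N \<otimes>\<^sub>(GR N) b N \<in> carrier (GR N)"
      using CGD(1)[OF a N] CGD(1)[OF b N] by (rule F.RQ_mult_closed)
    fix M C assume M: "M \<in> ON" and NM: "N \<subseteq> M" and C: "C \<in> carrier (G Mod M)"
    show "(a M \<otimes>\<^sub>(GR M) b M) C = (\<Oplus>\<^sub>R D\<in>{D \<in> carrier (G Mod N). D \<subseteq> C}. (a N \<otimes>\<^sub>(GR N) b N) D)"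
      unfolding coset_fibre[OF N M NM C]
      by (rule group_ring_push_mult[OF FR[OF N] FR[OF M] coset_trans_hom[OF N M NM]
            CGD(1)[OF a N] CGD(1)[OF b N] CGD(1)[OF a M] CGD(1)[OF b M] _ _ C])
        (use CGD(2)[OF a N M NM] CGD(2)[OF b N M NM] coset_fibre[OF N M NM] in \<open>simp_all only:\<close>)
  qed
  then show ?thesis by (simp add: completed_group_ring_def)
qed

lemma single_eval: "N \<in> ON ==> cgr_single R G r g N = gr_single R (G Mod N) r (N #>\<^sub>G g)"
  by (simp add: cgr_single_def)

text \<open>Exactly one coset of \<open>N\<close> carries the coefficient \<open>r\<close>, and it
  lies in \<open>C\<close> precisely if \<open>C\<close> is the coset of \<open>g\<close> modulo
  \<open>M\<close>.\<close>

lemma single_closed: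
  assumes r: "r \<in> carrier R" and g: "g \<in> carrier G"
  shows "cgr_single R G r g \<in> carrier CG"
  unfolding cgr_single_def
proof (rule CGI)
  fix N assume N: "N \<in> ON"
  interpret F: finite_group_ring R "G Mod N" by (rule FR[OF N])
  show "gr_single R (G Mod N) r (N #>\<^sub>G g) \<in> carrier (GR N)"
    using r by (rule F.single_closed)
  fix M C assume M: "M \<in> ON" and NM: "N \<subseteq> M" and C: "C \<in> carrier (G Mod M)"
  have "(\<Oplus>\<^sub>R D\<in>{D \<in> carrier (G Mod N). D \<subseteq> C}. gr_single R (G Mod N) r (N #>\<^sub>G g) D) =
      (if N #>\<^sub>G g \<in> {D \<in> carrier (G Mod N). D \<subseteq> C} then gr_single R (G Mod N) r (N #>\<^sub>G g) (N #>\<^sub>G g) else \<zero>\<^sub>R)"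
    using fin_sub[OF N] r by (intro R.finsum_delta) (auto simp: gr_single_def)
  also have "\<dots> = gr_single R (G Mod M) r (M #>\<^sub>G g) C"
    unfolding coset_fibre[OF N M NM C]
    using g C by (simp add: coset_trans[OF N M NM g] gr_single_def Mod_carrier)
  finally show "gr_single R (G Mod M) r (M #>\<^sub>G g) C =
      (\<Oplus>\<^sub>R D\<in>{D \<in> carrier (G Mod N). D \<subseteq> C}. gr_single R (G Mod N) r (N #>\<^sub>G g) D)" by simp
qed

lemma single_mult:
  assumes "r \<in> carrier R" "s \<in> carrier R" "g \<in> carrier G" "h \<in> carrier G"
  shows "cgr_single R G r g \<otimes>\<^sub>CG cgr_single R G s h = cgr_single R G (r \<otimes>\<^sub>R s) (g \<otimes>\<^sub>G h)"
proof (rule CG_ext)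
  fix N assume N: "N \<in> ON"
  interpret F: finite_group_ring R "G Mod N" by (rule FR[OF N])
  show "(cgr_single R G r g \<otimes>\<^sub>CG cgr_single R G s h) N = cgr_single R G (r \<otimes>\<^sub>R s) (g \<otimes>\<^sub>G h) N"
    using assms N by (simp add: CG_simps single_eval F.single_mult_single Mod_carrier Mod_mult)
qed (use assms in \<open>auto intro: CG_mult_closed single_closed\<close>)

lemma single_add:
  assumes "r \<in> carrier R" "s \<in> carrier R" "g \<in> carrier G"
  shows "cgr_single R G (r \<oplus>\<^sub>R s) g = cgr_single R G r g \<oplus>\<^sub>CG cgr_single R G s g"
proof (rule CG_ext)
  fix N assume N: "N \<in> ON"
  interpret F: finite_group_ring R "G Mod N" by (rule FR[OF N])
  show "cgr_single R G (r \<oplus>\<^sub>R s) g N = (cgr_single R G r g \<oplus>\<^sub>CG cgr_single R G s g) N"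
    using assms N by (simp add: CG_simps single_eval F.single_add)
qed (use assms in \<open>auto intro: CG_add_closed single_closed\<close>)

lemma const_eq: "cgr_const R G r = cgr_single R G r \<one>\<^sub>G"
  unfolding cgr_const_def cgr_single_def
  by (rule restrict_ext) (simp add: gr_single_def G.coset_mult_one subgroup.subset[OF ON_subgroup])

lemma elt_eq: "cgr_elt R G g = cgr_single R G \<one>\<^sub>R g"
  unfolding cgr_elt_def cgr_single_def gr_single_def by simp

lemma CG_one: "\<one>\<^sub>CG = cgr_single R G \<one>\<^sub>R \<one>\<^sub>G"
proof -
  have "\<one>\<^sub>CG = (\<lambda>N\<in>ON. \<one>\<^sub>(GR N))" by (simp add: completed_group_ring_def)
  also have "\<dots> = cgr_single R G \<one>\<^sub>R \<one>\<^sub>G"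
    unfolding cgr_single_def
    by (rule restrict_ext) (simp add: finite_group_ring.RQ_one[OF FR] Mod_one)
  finally show ?thesis .
qed

lemma CG_zero_eq: "\<zero>\<^sub>CG = cgr_single R G \<zero>\<^sub>R \<one>\<^sub>G"
  unfolding cgr_single_def by (simp add: completed_group_ring_def group_ring_def gr_single_def)

lemma CG_cring:
  assumes "comm_group G"
  shows "cring CG"
proof -
  interpret comm_group G by fact
  have cm: "comm_group (G Mod N)" if N: "N \<in> ON" for N
  proof (rule group.group_comm_groupI)
    show "group (G Mod N)" by (rule normal.factorgroup_is_group[OF ON_normal[OF N]])
    fix C D assume "C \<in> carrier (G Mod N)" "D \<in> carrier (G Mod N)"
    then obtain c d where "c \<in> carrier G" "d \<in> carrier G" "C = N #>\<^sub>G c" "D = N #>\<^sub>G d"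
      by (auto simp: Mod_carrier)
    then show "C \<otimes>\<^sub>(G Mod N) D = D \<otimes>\<^sub>(G Mod N) C"
      by (simp add: Mod_mult[OF N] m_comm)
  qed
  have cr: "cring (GR N)" if "N \<in> ON" for N
    by (rule finite_group_ring.RQ_cring[OF FR[OF that] cm[OF that]])
  have ab: "abelian_monoid (GR N)" and cmo: "comm_monoid (GR N)" if "N \<in> ON" for N
    using cr[OF that] by (simp_all add: cring_def ring_def abelian_group_def)
  have mo: "monoid (GR N)" if "N \<in> ON" for N
    using cmo[OF that] by (simp add: comm_monoid_def)
  have zc: "\<zero>\<^sub>CG \<in> carrier CG" unfolding CG_zero_eq by (rule single_closed) auto
  have oc: "\<one>\<^sub>CG \<in> carrier CG" unfolding CG_one by (rule single_closed) auto
  note cl = CG_add_closed CG_mult_closed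
  show ?thesis
  proof (rule cringI)
    show "abelian_group CG"
    proof (rule abelian_groupI)
      fix a b c assume abc: "a \<in> carrier CG" "b \<in> carrier CG" "c \<in> carrier CG"
      show "a \<oplus>\<^sub>CG b \<oplus>\<^sub>CG c = a \<oplus>\<^sub>CG (b \<oplus>\<^sub>CG c)"
      proof (rule CG_ext)
        fix N assume N: "N \<in> ON"
        show "(a \<oplus>\<^sub>CG b \<oplus>\<^sub>CG c) N = (a \<oplus>\<^sub>CG (b \<oplus>\<^sub>CG c)) N"
          unfolding CG_simps(2)[OF N]
          by (rule abelian_monoid.a_assoc[OF ab[OF N]]) (use abc N CGD(1) in auto)
      qed (use abc cl in auto)
    next
      fix a b assume abc: "a \<in> carrier CG" "b \<in> carrier CG"
      show "a \<oplus>\<^sub>CG b = b \<oplus>\<^sub>CG a"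
      proof (rule CG_ext)
        fix N assume N: "N \<in> ON"
        show "(a \<oplus>\<^sub>CG b) N = (b \<oplus>\<^sub>CG a) N"
          unfolding CG_simps(2)[OF N]
          by (rule abelian_monoid.a_comm[OF ab[OF N]]) (use abc N CGD(1) in auto)
      qed (use abc cl in auto)
    next
      fix a assume a: "a \<in> carrier CG"
      show "\<zero>\<^sub>CG \<oplus>\<^sub>CG a = a"
      proof (rule CG_ext)
        fix N assume N: "N \<in> ON"
        show "(\<zero>\<^sub>CG \<oplus>\<^sub>CG a) N = a N"
          unfolding CG_simps(2)[OF N] CG_simps(4)[OF N]
          by (rule abelian_monoid.l_zero[OF ab[OF N] CGD(1)[OF a N]])
      qed (use a zc cl in auto)
      \<comment> \<open>The negative is formed as a product with the constant -1, so that its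
        compatibility along the inverse system follows from closure under products.\<close>
      define b where "b = cgr_single R G (\<ominus>\<^sub>R \<one>\<^sub>R) \<one>\<^sub>G \<otimes>\<^sub>CG a"
      have bc: "b \<in> carrier CG" unfolding b_def by (intro cl single_closed a) auto
      have "b \<oplus>\<^sub>CG a = \<zero>\<^sub>CG"
      proof (rule CG_ext')
        fix N C assume N: "N \<in> ON" and C: "C \<in> carrier (G Mod N)"
        interpret F: finite_group_ring R "G Mod N" by (rule FR[OF N])
        have "b N C = \<ominus>\<^sub>R \<one>\<^sub>R \<otimes>\<^sub>R a N C"
          unfolding b_def CG_simps(3)[OF N] single_eval[OF N] Mod_one[OF N]
          using CGD(1)[OF a N] C F.Q.one_closed F.single_mult[of "\<ominus>\<^sub>R \<one>\<^sub>R" "\<one>\<^sub>(G Mod N)" "a N" C]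
          F.Q.l_one[OF C] F.Q.inv_one by simp
        then show "(b \<oplus>\<^sub>CG a) N C = \<zero>\<^sub>CG N C"
          unfolding CG_simps(2)[OF N] CG_simps(4)[OF N] F.RQ_add[OF C] F.RQ_zero[OF C]
          using CG_eval[OF a N C] by (simp add: R.l_minus R.l_neg)
      qed (use a bc zc cl in auto)
      with bc show "\<exists>b\<in>carrier CG. b \<oplus>\<^sub>CG a = \<zero>\<^sub>CG" by blast
    qed (use cl zc in auto)
    show "comm_monoid CG"
    proof (rule comm_monoidI)
      fix a b c assume abc: "a \<in> carrier CG" "b \<in> carrier CG" "c \<in> carrier CG"
      show "a \<otimes>\<^sub>CG b \<otimes>\<^sub>CG c = a \<otimes>\<^sub>CG (b \<otimes>\<^sub>CG c)"
      proof (rule CG_ext)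
        fix N assume N: "N \<in> ON"
        show "(a \<otimes>\<^sub>CG b \<otimes>\<^sub>CG c) N = (a \<otimes>\<^sub>CG (b \<otimes>\<^sub>CG c)) N"
          unfolding CG_simps(3)[OF N]
          by (rule monoid.m_assoc[OF mo[OF N]]) (use abc N CGD(1) in auto)
      qed (use abc cl in auto)
    next
      fix a b assume abc: "a \<in> carrier CG" "b \<in> carrier CG"
      show "a \<otimes>\<^sub>CG b = b \<otimes>\<^sub>CG a"
      proof (rule CG_ext)
        fix N assume N: "N \<in> ON"
        show "(a \<otimes>\<^sub>CG b) N = (b \<otimes>\<^sub>CG a) N"
          unfolding CG_simps(3)[OF N]
          by (rule comm_monoid.m_comm[OF cmo[OF N]]) (use abc N CGD(1) in auto)
      qed (use abc cl in auto)
    next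
      fix a assume a: "a \<in> carrier CG"
      show "\<one>\<^sub>CG \<otimes>\<^sub>CG a = a"
      proof (rule CG_ext)
        fix N assume N: "N \<in> ON"
        show "(\<one>\<^sub>CG \<otimes>\<^sub>CG a) N = a N"
          unfolding CG_simps(3)[OF N] CG_simps(5)[OF N]
          by (rule monoid.l_one[OF mo[OF N] CGD(1)[OF a N]])
      qed (use a oc cl in auto)
    qed (use cl oc in auto)
    fix a b c assume abc: "a \<in> carrier CG" "b \<in> carrier CG" "c \<in> carrier CG"
    show "(a \<oplus>\<^sub>CG b) \<otimes>\<^sub>CG c = a \<otimes>\<^sub>CG c \<oplus>\<^sub>CG b \<otimes>\<^sub>CG c"
    proof (rule CG_ext)
      fix N assume N: "N \<in> ON"
      interpret C: cring "GR N" by (rule cr[OF N])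
      show "((a \<oplus>\<^sub>CG b) \<otimes>\<^sub>CG c) N = (a \<otimes>\<^sub>CG c \<oplus>\<^sub>CG b \<otimes>\<^sub>CG c) N"
        unfolding CG_simps(2,3)[OF N]
        by (rule C.l_distr) (use abc N CGD(1) in auto)
    qed (use abc cl in auto)
  qed
qed

end

section \<open>Topological modules\<close>

text \<open>The constructor \<open>topology\<close> returns the given predicate only if that is a
  topology; here this holds because preimages commute with intersections and unions.\<close>

lemma openin_quot_topology:
  "openin (quot_topology X f) U \<longleftrightarrow> U \<subseteq> f ` topspace X \<and> openin X {x \<in> topspace X. f x \<in> U}"
proof -
  have "istopology (\<lambda>U. U \<subseteq> f ` topspace X \<and> openin X {x \<in> topspace X. f x \<in> U})"
    unfolding istopology_def
  proof (intro conjI allI impI)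
    fix S T assume S: "S \<subseteq> f ` topspace X \<and> openin X {x \<in> topspace X. f x \<in> S}"
      and T: "T \<subseteq> f ` topspace X \<and> openin X {x \<in> topspace X. f x \<in> T}"
    have "{x \<in> topspace X. f x \<in> S \<inter> T} = {x \<in> topspace X. f x \<in> S} \<inter> {x \<in> topspace X. f x \<in> T}"
      by auto
    then show "openin X {x \<in> topspace X. f x \<in> S \<inter> T}" using S T by (simp add: openin_Int)
    show "S \<inter> T \<subseteq> f ` topspace X" using S by auto
  next
    fix \<K> assume K: "\<forall>S\<in>\<K>. S \<subseteq> f ` topspace X \<and> openin X {x \<in> topspace X. f x \<in> S}"
    have "{x \<in> topspace X. f x \<in> \<Union>\<K>} = (\<Union>S\<in>\<K>. {x \<in> topspace X. f x \<in> S})" by auto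
    then show "openin X {x \<in> topspace X. f x \<in> \<Union>\<K>}" using K by auto
    show "\<Union>\<K> \<subseteq> f ` topspace X" using K by auto
  qed
  then show ?thesis
    by (simp add: quot_topology_def topology_inverse')
qed

lemma topspace_quot_topology: "topspace (quot_topology X f) = f ` topspace X"
proof
  show "topspace (quot_topology X f) \<subseteq> f ` topspace X"
    using openin_quot_topology[of X f "topspace (quot_topology X f)"] by simp
  have "{x \<in> topspace X. f x \<in> f ` topspace X} = topspace X" by auto
  then have "openin (quot_topology X f) (f ` topspace X)"
    by (simp add: openin_quot_topology)
  then show "f ` topspace X \<subseteq> topspace (quot_topology X f)" by (rule openin_subset)
qed

text \<open>The fibres form an open cover; a finite subcover leaves only finitely many values of
  \<open>c\<close>.\<close>

lemma compact_open_fibres_finite: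
  assumes "compact_space X" "\<And>x. x \<in> topspace X ==> openin X {y \<in> topspace X. c y = c x}"
  shows "finite (c ` topspace X)"
proof -
  let ?U = "(\<lambda>x. {y \<in> topspace X. c y = c x}) ` topspace X"
  have "topspace X \<subseteq> \<Union>?U" by auto
  moreover have "\<forall>U\<in>?U. openin X U" using assms(2) by auto
  ultimately obtain F where F: "finite F" "F \<subseteq> ?U" "topspace X \<subseteq> \<Union>F"
    using spec[OF assms(1)[unfolded compact_space_alt], of ?U] by (elim impE) auto
  then obtain A where A: "finite A" "A \<subseteq> topspace X" "F = (\<lambda>x. {y \<in> topspace X. c y = c x}) ` A"
    by (meson finite_subset_image)
  have "c ` topspace X \<subseteq> c ` A"
    using F(3) A by auto
  then show ?thesis using A(1) finite_subset by blast
qed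

lemma profinite_groupD:
  assumes "profinite_group G"
  shows "group G" "topspace (grp_top G) = carrier G" "compact_space (grp_top G)"
    "continuous_map (prod_topology (grp_top G) (grp_top G)) (grp_top G) (\<lambda>(g, h). g \<otimes>\<^sub>G h)"
    "continuous_map (grp_top G) (grp_top G) (\<lambda>g. inv\<^bsub>G\<^esub> g)"
  using assms by (auto simp: profinite_group_def)

lemma profinite_translation:
  assumes "profinite_group G" "a \<in> carrier G"
  shows "continuous_map (grp_top G) (grp_top G) (\<lambda>g. g \<otimes>\<^sub>G a)"
proof -
  note D = profinite_groupD[OF assms(1)]
  have "continuous_map (grp_top G) (prod_topology (grp_top G) (grp_top G)) (\<lambda>g. (g, a))"
    using assms(2) D(2) by (simp add: continuous_map_pairwise o_def)
  from continuous_map_compose[OF this D(4)] show ?thesis by (simp add: o_def)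
qed

text \<open>The set is the preimage of \<open>N\<close> under right translation by the inverse of
  \<open>a\<close>, which is continuous.\<close>

lemma profinite_coset_open:
  assumes G: "profinite_group G" and N: "openin (grp_top G) N" "subgroup N G" and a: "a \<in> carrier G"
  shows "openin (grp_top G) {g \<in> carrier G. N #>\<^sub>G g = N #>\<^sub>G a}"
proof -
  note D = profinite_groupD[OF G]
  interpret group G by (rule D(1))
  have eq: "N #>\<^sub>G g = N #>\<^sub>G a \<longleftrightarrow> g \<otimes>\<^sub>G inv\<^bsub>G\<^esub> a \<in> N" if "g \<in> carrier G" for g
  proof
    assume "N #>\<^sub>G g = N #>\<^sub>G a"
    then have "g \<in> N #>\<^sub>G a" using rcos_self[OF that N(2)] by auto
    then show "g \<otimes>\<^sub>G inv\<^bsub>G\<^esub> a \<in> N"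
      using subgroup.rcos_module_imp[OF N(2) is_group a] by simp
  next
    assume "g \<otimes>\<^sub>G inv\<^bsub>G\<^esub> a \<in> N"
    then have "g \<in> N #>\<^sub>G a"
      using subgroup.rcos_module_rev[OF N(2) is_group a that] by simp
    then show "N #>\<^sub>G g = N #>\<^sub>G a"
      using repr_independence[OF _ a N(2)] by simp
  qed
  have "openin (grp_top G) {g \<in> topspace (grp_top G). g \<otimes>\<^sub>G inv\<^bsub>G\<^esub> a \<in> N}"
    using profinite_translation[OF G inv_closed[OF a]] N(1)
    by (rule openin_continuous_map_preimage)
  moreover have "{g \<in> topspace (grp_top G). g \<otimes>\<^sub>G inv\<^bsub>G\<^esub> a \<in> N} = {g \<in> carrier G. N #>\<^sub>G g = N #>\<^sub>G a}"
    using eq by (auto simp: D(2))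
  ultimately show ?thesis by simp
qed

lemma profinite_cgr_base:
  assumes G: "profinite_group G" and R: "cring R"
  shows "cgr_base G R"
proof -
  note D = profinite_groupD[OF G]
  interpret group G by (rule D(1))
  interpret R: cring R by (rule R)
  show ?thesis
  proof (unfold_locales)
    fix N assume "N \<in> open_normals G"
    then have N: "openin (grp_top G) N" "subgroup N G"
      by (auto simp: open_normals_def normal_imp_subgroup)
    have "finite ((\<lambda>g. N #>\<^sub>G g) ` topspace (grp_top G))"
      using profinite_coset_open[OF G N]
      by (intro compact_open_fibres_finite[OF D(3)]) (simp add: D(2))
    moreover have "carrier (G Mod N) = (\<lambda>g. N #>\<^sub>G g) ` topspace (grp_top G)"
      by (auto simp: FactGroup_def RCOSETS_def D(2))
    ultimately show "finite (carrier (G Mod N))" by simp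
  next
    have "normal (carrier G) G"
      by (simp add: normal_inv_iff subgroup_self)
    moreover have "openin (grp_top G) (carrier G)"
      using openin_topspace[of "grp_top G"] D(2) by simp
    ultimately show "carrier G \<in> open_normals G"
      by (simp add: open_normals_def)
  qed
qed

text \<open>A topological R-module with a continuous R-linear action of G: the form in which a
  compact R[[G]]-module enters the cochain computations.\<close>

locale top_gmodule = module R T + G: group G
  for R :: "('r, 'x) topring_scheme" and G :: "('g, 'y) topgroup_scheme"
    and T :: "('r, 'm, 'g, 'z) gmodule_scheme" +
  assumes act_closed: "g \<in> carrier G ==> t \<in> carrier T ==> act T g t \<in> carrier T"
    and act_add: "g \<in> carrier G ==> t \<in> carrier T ==> u \<in> carrier T ==>
      act T g (t \<oplus>\<^sub>T u) = act T g t \<oplus>\<^sub>T act T g u"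
    and act_smult: "g \<in> carrier G ==> r \<in> carrier R ==> t \<in> carrier T ==>
      act T g (r \<odot>\<^sub>T t) = r \<odot>\<^sub>T act T g t"
    and act_one: "t \<in> carrier T ==> act T \<one>\<^sub>G t = t"
    and act_mult: "g \<in> carrier G ==> h \<in> carrier G ==> t \<in> carrier T ==>
      act T (g \<otimes>\<^sub>G h) t = act T g (act T h t)"
    and top_T: "topspace (mod_top T) = carrier T"
    and top_G: "topspace (grp_top G) = carrier G"
    and top_R: "topspace (ring_top R) = carrier R"
    and cont_mult: "continuous_map (prod_topology (grp_top G) (grp_top G)) (grp_top G) (\<lambda>(g, h). g \<otimes>\<^sub>G h)"
    and cont_add: "continuous_map (prod_topology (mod_top T) (mod_top T)) (mod_top T) (\<lambda>(t, u). t \<oplus>\<^sub>T u)"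
    and cont_neg: "continuous_map (mod_top T) (mod_top T) (\<lambda>t. \<ominus>\<^sub>T t)"
    and cont_smult: "continuous_map (prod_topology (ring_top R) (mod_top T)) (mod_top T) (\<lambda>(r, t). r \<odot>\<^sub>T t)"
    and cont_act: "continuous_map (prod_topology (grp_top G) (mod_top T)) (mod_top T) (\<lambda>(g, t). act T g t)"
begin

lemma continuous_add:
  assumes "continuous_map X (mod_top T) a" "continuous_map X (mod_top T) b"
  shows "continuous_map X (mod_top T) (\<lambda>x. a x \<oplus>\<^sub>T b x)"
  using continuous_map_compose[OF continuous_map_pairedI[OF assms] cont_add] by (simp add: o_def)

lemma continuous_neg:
  assumes "continuous_map X (mod_top T) a"
  shows "continuous_map X (mod_top T) (\<lambda>x. \<ominus>\<^sub>T a x)"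
  using continuous_map_compose[OF assms cont_neg] by (simp add: o_def)

lemma continuous_minus:
  assumes "continuous_map X (mod_top T) a" "continuous_map X (mod_top T) b"
  shows "continuous_map X (mod_top T) (\<lambda>x. a x \<ominus>\<^sub>T b x)"
  unfolding a_minus_def by (intro continuous_add continuous_neg assms)

lemma continuous_smult:
  assumes "continuous_map X (ring_top R) a" "continuous_map X (mod_top T) b"
  shows "continuous_map X (mod_top T) (\<lambda>x. a x \<odot>\<^sub>T b x)"
  using continuous_map_compose[OF continuous_map_pairedI[OF assms] cont_smult] by (simp add: o_def)

lemma continuous_act:
  assumes "continuous_map X (grp_top G) a" "continuous_map X (mod_top T) b"
  shows "continuous_map X (mod_top T) (\<lambda>x. act T (a x) (b x))"
  using continuous_map_compose[OF continuous_map_pairedI[OF assms] cont_act] by (simp add: o_def)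

lemma continuous_mult:
  assumes "continuous_map X (grp_top G) a" "continuous_map X (grp_top G) b"
  shows "continuous_map X (grp_top G) (\<lambda>x. a x \<otimes>\<^sub>G b x)"
  using continuous_map_compose[OF continuous_map_pairedI[OF assms] cont_mult] by (simp add: o_def)

lemma continuous_const: "t \<in> carrier T ==> continuous_map X (mod_top T) (\<lambda>x. t)"
  by (simp add: top_T)

lemma continuous_finsum:
  assumes "finite A" "\<And>i. i \<in> A ==> continuous_map X (mod_top T) (\<lambda>x. f i x)"
  shows "continuous_map X (mod_top T) (\<lambda>x. \<Oplus>\<^sub>T i\<in>A. f i x)"
  using assms
proof (induction A rule: finite_induct)
  case empty
  then show ?case by (simp add: top_T)
next
  case (insert i A)
  have c: "f j x \<in> carrier T" if "x \<in> topspace X" "j \<in> insert i A" for x j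
    using continuous_map_image_subset_topspace[OF insert.prems[OF that(2)]] that(1) top_T by auto
  have "continuous_map X (mod_top T) (\<lambda>x. f i x \<oplus>\<^sub>T (\<Oplus>\<^sub>T i\<in>A. f i x))"
    using insert by (intro continuous_add) auto
  then show ?case
    by (rule continuous_map_eq) (use insert.hyps c in \<open>auto intro!: finsum_insert[symmetric]\<close>)
qed

end

lemma coeff_module_simps:
  "carrier (coeff_module R G M) = carrier M" "zero (coeff_module R G M) = zero M"
  "add (coeff_module R G M) = add M"
  "smult (coeff_module R G M) = (\<lambda>r m. cgr_const R G r \<odot>\<^sub>M m)"
  "mod_top (coeff_module R G M) = mod_top M"
  "act (coeff_module R G M) = (\<lambda>g m. cgr_elt R G g \<odot>\<^sub>M m)"
  by (simp_all add: coeff_module_def)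

context cgr_base
begin

text \<open>R[[G]] is a subspace of an iterated product, so continuity of a map into it is tested on
  single coefficients.\<close>

lemma continuous_into_CG:
  assumes "\<And>x. x \<in> topspace X ==> F x \<in> carrier CG"
    and "\<And>N C. N \<in> ON ==> C \<in> carrier (G Mod N) ==> continuous_map X (ring_top R) (\<lambda>x. F x N C)"
  shows "continuous_map X (ring_top CG) F"
proof -
  have top: "ring_top CG = subtopology (product_topology (\<lambda>N. product_topology (\<lambda>_. ring_top R)
      (carrier (G Mod N))) ON) (carrier CG)"
    by (simp add: completed_group_ring_def)
  have ext: "F x N \<in> extensional (carrier (G Mod N))" if "x \<in> topspace X" "N \<in> ON" for x N
    using CGD(1)[OF assms(1)[OF that(1)] that(2)]
    by (simp add: finite_group_ring.RQ_carrier[OF FR[OF that(2)]] PiE_def)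
  have ext': "F x \<in> extensional ON" if "x \<in> topspace X" for x
    using CGD(3)[OF assms(1)[OF that]] restrict_extensional by metis
  show ?thesis
    unfolding top continuous_map_in_subtopology
  proof
    show "F \<in> topspace X \<rightarrow> carrier CG" using assms(1) by auto
    show "continuous_map X (product_topology (\<lambda>N. product_topology (\<lambda>_. ring_top R)
        (carrier (G Mod N))) ON) F"
      unfolding continuous_map_componentwise using assms(2) ext ext' by auto
  qed
qed

end

text \<open>The actions of G and of R are the action of R[[G]] composed with g \<mapsto> [g] and r
  \<mapsto> r[1]. Both maps into R[[G]] are continuous, so joint continuity is inherited from
  M.\<close>

lemma coeff_module_top_gmodule:
  assumes G: "profinite_group G" and R: "cring R" "topspace (ring_top R) = carrier R"
    and M: "compact_module (completed_group_ring R G) M"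
  shows "top_gmodule R G (coeff_module R G M)"
proof -
  interpret C: cgr_base G R by (rule profinite_cgr_base[OF G R(1)])
  note D = profinite_groupD[OF G]
  let ?T = "coeff_module R G M" and ?S = "completed_group_ring R G"
  have ag: "abelian_group M" and topM: "topspace (mod_top M) = carrier M"
    and cadd: "continuous_map (prod_topology (mod_top M) (mod_top M)) (mod_top M) (\<lambda>(m, m'). m \<oplus>\<^sub>M m')"
    and cneg: "continuous_map (mod_top M) (mod_top M) (\<lambda>m. \<ominus>\<^sub>M m)"
    and csm: "continuous_map (prod_topology (ring_top ?S) (mod_top M)) (mod_top M) (\<lambda>(a, m). a \<odot>\<^sub>M m)"
    using M by (auto simp: compact_module_def)
  interpret M: abelian_group M by (rule ag)
  have one: "\<one>\<^sub>?S \<odot>\<^sub>M m = m" if "m \<in> carrier M" for m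
    using M that by (auto simp: compact_module_def)
  have cl: "a \<odot>\<^sub>M m \<in> carrier M"
    if "a \<in> carrier ?S" "m \<in> carrier M" for a m
    using M that by (auto simp: compact_module_def)
  have ld: "(a \<oplus>\<^sub>?S b) \<odot>\<^sub>M m = a \<odot>\<^sub>M m \<oplus>\<^sub>M b \<odot>\<^sub>M m"
    and mu: "(a \<otimes>\<^sub>?S b) \<odot>\<^sub>M m = a \<odot>\<^sub>M (b \<odot>\<^sub>M m)"
    if "a \<in> carrier ?S" "b \<in> carrier ?S" "m \<in> carrier M" for a b m
    using M that by (auto simp: compact_module_def)
  have rd: "a \<odot>\<^sub>M (m \<oplus>\<^sub>M m') = a \<odot>\<^sub>M m \<oplus>\<^sub>M a \<odot>\<^sub>M m'"
    if "a \<in> carrier ?S" "m \<in> carrier M" "m' \<in> carrier M" for a m m'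
    using M that by (auto simp: compact_module_def)
  note T = coeff_module_simps[of R G M] C.const_eq C.elt_eq
  note sc = C.single_closed
  have agT: "abelian_group ?T"
    by (rule abelian_groupI)
      (use M.a_assoc M.a_comm M.a_closed M.l_zero M.zero_closed in \<open>auto simp: T intro: M.add.l_inv_ex\<close>)
  have modT: "module R ?T"
    by (rule moduleI[OF R(1) agT])
      (simp_all add: T cl sc rd ld mu[symmetric] C.single_add C.single_mult one C.CG_one[symmetric])
  have neg: "\<ominus>\<^sub>?T t = \<ominus>\<^sub>M t" if "t \<in> carrier M" for t
    using abelian_group.minus_equality[OF agT, of "\<ominus>\<^sub>M t" t] that by (simp add: T M.l_neg)
  have ce: "continuous_map (grp_top G) (ring_top ?S) (cgr_elt R G)"
  proof (rule C.continuous_into_CG)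
    fix N C assume N: "N \<in> open_normals G" and C: "C \<in> carrier (G Mod N)"
    have N': "openin (grp_top G) N" "subgroup N G"
      using N by (auto simp: open_normals_def normal_imp_subgroup)
    obtain c where c: "c \<in> carrier G" "C = N #>\<^sub>G c"
      using C by (auto simp: C.Mod_carrier)
    \<comment> \<open>The coefficient of [g] at \<open>C\<close> depends only on the coset of g
      modulo the open subgroup \<open>N\<close>, so the preimage of any set whatsoever is
      open.\<close>
    have "openin (grp_top G) {g \<in> topspace (grp_top G). cgr_elt R G g N C \<in> U}" for U
    proof (subst openin_subopen, intro ballI)
      fix g assume "g \<in> {g \<in> topspace (grp_top G). cgr_elt R G g N C \<in> U}"
      then have g: "g \<in> carrier G" "cgr_elt R G g N C \<in> U" by (auto simp: D(2))
      let ?V = "{h \<in> carrier G. N #>\<^sub>G h = N #>\<^sub>G g}"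
      have "cgr_elt R G h N C = cgr_elt R G g N C" if "h \<in> ?V" for h
        using that N by (simp add: cgr_elt_def)
      then have "?V \<subseteq> {g \<in> topspace (grp_top G). cgr_elt R G g N C \<in> U}"
        using g(2) D(2) by auto
      moreover have "g \<in> ?V" using g(1) by simp
      ultimately show "\<exists>T. openin (grp_top G) T \<and> g \<in> T \<and> T \<subseteq> {g \<in> topspace (grp_top G). cgr_elt R G g N C \<in> U}"
        using profinite_coset_open[OF G N' g(1)] by blast
    qed
    then show "continuous_map (grp_top G) (ring_top R) (\<lambda>g. cgr_elt R G g N C)"
      using N C by (auto simp: continuous_map_def R(2) cgr_elt_def)
  qed (simp add: D(2) C.elt_eq sc)
  have cc: "continuous_map (ring_top R) (ring_top ?S) (cgr_const R G)"
  proof (rule C.continuous_into_CG)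
    fix N C assume N: "N \<in> open_normals G" and C: "C \<in> carrier (G Mod N)"
    show "continuous_map (ring_top R) (ring_top R) (\<lambda>r. cgr_const R G r N C)"
      using N C by (cases "C = N") (simp_all add: cgr_const_def R(2))
  qed (simp add: R(2) C.const_eq sc)
  have c1: "continuous_map (prod_topology (grp_top G) (mod_top M)) (mod_top M) (\<lambda>(g, t). cgr_elt R G g \<odot>\<^sub>M t)"
    using continuous_map_compose[OF continuous_map_pairedI[OF continuous_map_compose[OF continuous_map_fst ce]
        continuous_map_snd] csm]
    by (simp add: o_def case_prod_beta')
  have c2: "continuous_map (prod_topology (ring_top R) (mod_top M)) (mod_top M) (\<lambda>(r, t). cgr_const R G r \<odot>\<^sub>M t)"
    using continuous_map_compose[OF continuous_map_pairedI[OF continuous_map_compose[OF continuous_map_fst cc]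
        continuous_map_snd] csm]
    by (simp add: o_def case_prod_beta')
  show ?thesis
  proof (intro top_gmodule.intro top_gmodule_axioms.intro modT D(1))
    show "continuous_map (mod_top ?T) (mod_top ?T) (\<lambda>t. \<ominus>\<^sub>?T t)"
      using cneg by (simp add: T(5)) (rule continuous_map_eq, auto simp: neg topM)
  qed (use c1 c2 D R(2) cadd in \<open>simp_all add: T(1-3,5) topM\<close>,
      simp_all add: T cl sc rd mu[symmetric] C.single_mult one C.CG_one[symmetric])
qed

section \<open>The \<open>p\<close>-adic integers\<close>

lemma Zp_simps:
  "carrier (Zp p) = Zp_carrier p"
  "(a \<oplus>\<^sub>(Zp p) b) k = (a k + b k) mod int p ^ k"
  "(a \<otimes>\<^sub>(Zp p) b) k = (a k * b k) mod int p ^ k"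
  "\<zero>\<^sub>(Zp p) k = 0" "\<one>\<^sub>(Zp p) k = 1 mod int p ^ k"
  by (simp_all add: Zp_def)

definition Zp_int :: "nat => int => nat => int" where
  "Zp_int p z = (\<lambda>k. z mod int p ^ k)"

text \<open>The ideal generated by \<open>p^j\<close>.\<close>

definition Zp_ker :: "nat => nat => (nat => int) set" where
  "Zp_ker p j = {z \<in> carrier (Zp p). z j = 0}"

locale p_adic =
  fixes p :: nat
  assumes prime_p: "prime p"
begin

lemma p_pos: "int p ^ k > 0"
  using prime_p by (simp add: prime_gt_0_nat)

lemma p_gt_1: "p > 1"
  using prime_p by (rule prime_gt_1_nat)

lemma prime_int_p: "prime (int p)"
  using prime_p by simp

lemma ZpI:
  assumes "\<And>k. a k mod int p ^ k = a k" "\<And>k. a (Suc k) mod int p ^ k = a k"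
  shows "a \<in> carrier (Zp p)"
proof -
  have "0 \<le> a k \<and> a k < int p ^ k" for k
    using pos_mod_bound[OF p_pos, of "a k" k] pos_mod_sign[OF p_pos, of "a k" k] assms(1)[of k] by simp
  then show ?thesis using assms(2) by (simp add: Zp_simps Zp_carrier_def)
qed

lemma ZpD:
  assumes "a \<in> carrier (Zp p)"
  shows "a k mod int p ^ k = a k" "a (Suc k) mod int p ^ k = a k" "0 \<le> a k" "a k < int p ^ k"
  using assms by (auto simp: Zp_simps Zp_carrier_def)

lemma Zp_mod:
  assumes "a \<in> carrier (Zp p)" "m \<le> k"
  shows "a k mod int p ^ m = a m"
  using assms(2)
proof (induction k rule: dec_induct)
  case base
  then show ?case using ZpD(1)[OF assms(1)] .
next
  case (step k)
  have "a (Suc k) mod int p ^ m = a (Suc k) mod int p ^ k mod int p ^ m"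
    using step by (simp add: mod_mod_cancel le_imp_power_dvd)
  then show ?case using step ZpD(2)[OF assms(1)] by simp
qed

lemma mod_dvd_cancel: "x mod int p ^ Suc k mod int p ^ k = x mod int p ^ k"
  by (simp add: mod_mod_cancel)

lemma Zp_closedI:
  assumes "\<And>k. F (Suc k) mod int p ^ k = F k mod int p ^ k"
  shows "(\<lambda>k. F k mod int p ^ k) \<in> carrier (Zp p)"
  by (rule ZpI) (use assms in \<open>simp_all add: mod_mod_cancel\<close>)

lemma Zp_int_closed: "Zp_int p z \<in> carrier (Zp p)"
  unfolding Zp_int_def by (rule Zp_closedI) simp

lemma Zp_add_closed:
  assumes "a \<in> carrier (Zp p)" "b \<in> carrier (Zp p)"
  shows "a \<oplus>\<^sub>(Zp p) b \<in> carrier (Zp p)"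
proof -
  have "(\<lambda>k. (a k + b k) mod int p ^ k) \<in> carrier (Zp p)"
    by (rule Zp_closedI) (metis ZpD(2)[OF assms(1)] ZpD(2)[OF assms(2)] mod_add_eq)
  moreover have "a \<oplus>\<^sub>(Zp p) b = (\<lambda>k. (a k + b k) mod int p ^ k)" by (rule ext) (simp add: Zp_simps)
  ultimately show ?thesis by simp
qed

lemma Zp_mult_closed:
  assumes "a \<in> carrier (Zp p)" "b \<in> carrier (Zp p)"
  shows "a \<otimes>\<^sub>(Zp p) b \<in> carrier (Zp p)"
proof -
  have "(\<lambda>k. (a k * b k) mod int p ^ k) \<in> carrier (Zp p)"
    by (rule Zp_closedI) (metis ZpD(2)[OF assms(1)] ZpD(2)[OF assms(2)] mod_mult_eq)
  moreover have "a \<otimes>\<^sub>(Zp p) b = (\<lambda>k. (a k * b k) mod int p ^ k)" by (rule ext) (simp add: Zp_simps)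
  ultimately show ?thesis by simp
qed

lemma Zp_zero_eq: "\<zero>\<^sub>(Zp p) = Zp_int p 0" and Zp_one_eq: "\<one>\<^sub>(Zp p) = Zp_int p 1"
  by (simp_all add: Zp_int_def fun_eq_iff Zp_simps)

lemma Zp_cring: "cring (Zp p)"
proof (rule cringI)
  show "abelian_group (Zp p)"
  proof (rule abelian_groupI)
    fix a assume a: "a \<in> carrier (Zp p)"
    show "\<zero>\<^sub>(Zp p) \<oplus>\<^sub>(Zp p) a = a"
      by (rule ext) (simp add: Zp_simps ZpD(1)[OF a])
    let ?b = "\<lambda>k. (- a k) mod int p ^ k"
    have "?b \<in> carrier (Zp p)"
      by (rule Zp_closedI) (metis ZpD(2)[OF a] mod_minus_eq)
    moreover have "?b \<oplus>\<^sub>(Zp p) a = \<zero>\<^sub>(Zp p)"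
      by (rule ext) (simp add: Zp_simps mod_simps)
    ultimately show "\<exists>b\<in>carrier (Zp p). b \<oplus>\<^sub>(Zp p) a = \<zero>\<^sub>(Zp p)" by blast
  qed (auto simp: Zp_add_closed Zp_zero_eq Zp_int_closed fun_eq_iff Zp_simps(2-5) mod_simps algebra_simps)
  show "comm_monoid (Zp p)"
  proof (rule comm_monoidI)
    fix a assume a: "a \<in> carrier (Zp p)"
    show "\<one>\<^sub>(Zp p) \<otimes>\<^sub>(Zp p) a = a"
      by (rule ext) (simp add: Zp_simps mod_simps ZpD(1)[OF a])
  qed (auto simp: Zp_mult_closed Zp_one_eq Zp_int_closed fun_eq_iff Zp_simps(2-5) mod_simps algebra_simps)
qed (auto simp: fun_eq_iff Zp_simps(2-5) mod_simps algebra_simps)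

sublocale Z: cring "Zp p" by (rule Zp_cring)

lemma Zp_int_add: "Zp_int p (x + y) = Zp_int p x \<oplus>\<^sub>(Zp p) Zp_int p y"
  and Zp_int_mult: "Zp_int p (x * y) = Zp_int p x \<otimes>\<^sub>(Zp p) Zp_int p y"
  by (simp_all add: Zp_int_def fun_eq_iff Zp_simps mod_simps)

lemma Zp_neg: "a \<in> carrier (Zp p) ==> (\<ominus>\<^sub>(Zp p) a) k = (- a k) mod int p ^ k"
proof -
  assume a: "a \<in> carrier (Zp p)"
  have "((\<ominus>\<^sub>(Zp p) a) k + a k) mod int p ^ k = 0"
    using Z.l_neg[OF a] by (metis Zp_simps(2) Zp_simps(4))
  then have "(\<ominus>\<^sub>(Zp p) a) k mod int p ^ k = (- a k) mod int p ^ k"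
    by (metis (no_types) add_diff_cancel_right' diff_0 mod_diff_left_eq)
  then show ?thesis using ZpD(1)[OF Z.a_inv_closed[OF a]] by simp
qed

lemma Zp_minus: "a \<in> carrier (Zp p) ==> b \<in> carrier (Zp p) ==>
    (a \<ominus>\<^sub>(Zp p) b) k = (a k - b k) mod int p ^ k"
  by (simp add: a_minus_def Zp_simps Zp_neg mod_simps)

lemma Zp_add_pow: "a \<in> carrier (Zp p) ==> ([(n::nat)] \<cdot>\<^sub>(Zp p) a) = Zp_int p (int n) \<otimes>\<^sub>(Zp p) a"
proof (induction n)
  case 0
  then show ?case by (simp add: Zp_zero_eq[symmetric])
next
  case (Suc n)
  have "Zp_int p (int (Suc n)) = Zp_int p (int n) \<oplus>\<^sub>(Zp p) \<one>\<^sub>(Zp p)"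
    by (simp add: Zp_one_eq Zp_int_add[symmetric] add.commute)
  then show ?case
    using Suc by (simp add: Z.add.nat_pow_Suc Z.l_distr Zp_int_closed)
qed

lemma Zp_int_mult_eval: "a \<in> carrier (Zp p) ==> (Zp_int p x \<otimes>\<^sub>(Zp p) a) k = (x * a k) mod int p ^ k"
  by (simp add: Zp_int_def Zp_simps mod_simps)

text \<open>Division by p^m costs m digits of precision: component k of the quotient is read off
  from component k + m.\<close>

lemma Zp_ker_dvd:
  assumes "z \<in> Zp_ker p m"
  obtains y where "y \<in> carrier (Zp p)" "z = Zp_int p (int p ^ m) \<otimes>\<^sub>(Zp p) y"
    "\<And>k. y k = z (k + m) div int p ^ m"
proof -
  have z: "z \<in> carrier (Zp p)" "z m = 0" using assms by (auto simp: Zp_ker_def)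
  have dv: "int p ^ m dvd z (k + m)" for k
    using Zp_mod[OF z(1), of m "k + m"] z(2) by (simp add: mod_eq_0_iff_dvd)
  define y where "y = (\<lambda>k. z (k + m) div int p ^ m)"
  have zy: "z (k + m) = int p ^ m * y k" for k
    using dv by (simp add: y_def)
  have y: "y \<in> carrier (Zp p)"
  proof (rule ZpI)
    fix k
    have "int p ^ m * y k mod (int p ^ m * int p ^ k) = int p ^ m * y k"
      using ZpD(1)[OF z(1), of "k + m"] zy[of k] by (simp add: power_add mult.commute)
    then show "y k mod int p ^ k = y k"
      using p_gt_1 by (simp add: mult_mod_right[symmetric])
    have "int p ^ m * y (Suc k) mod (int p ^ m * int p ^ k) = int p ^ m * y k"
      using ZpD(2)[OF z(1), of "k + m"] zy[of "Suc k"] zy[of k] by (simp add: power_add mult.commute)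
    then show "y (Suc k) mod int p ^ k = y k"
      using p_gt_1 by (simp add: mult_mod_right[symmetric])
  qed
  have "z = Zp_int p (int p ^ m) \<otimes>\<^sub>(Zp p) y"
  proof
    fix k
    have "(int p ^ m * y k) mod int p ^ k = z k"
      using Zp_mod[OF z(1), of k "k + m"] zy[of k] by simp
    then show "z k = (Zp_int p (int p ^ m) \<otimes>\<^sub>(Zp p) y) k"
      by (simp add: Zp_int_mult_eval[OF y])
  qed
  from that[OF y this] show ?thesis by (simp add: y_def)
qed

lemma Zp_ker_mult: "y \<in> carrier (Zp p) ==> Zp_int p (int p ^ m) \<otimes>\<^sub>(Zp p) y \<in> Zp_ker p m"
  by (simp add: Zp_ker_def Zp_int_closed Zp_int_mult_eval)

lemma Zp_approx:
  assumes "z \<in> carrier (Zp p)"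
  obtains y where "y \<in> carrier (Zp p)"
    "z = Zp_int p (z K) \<oplus>\<^sub>(Zp p) Zp_int p (int p ^ K) \<otimes>\<^sub>(Zp p) y"
proof -
  have "z \<ominus>\<^sub>(Zp p) Zp_int p (z K) \<in> Zp_ker p K"
    using assms by (simp add: Zp_ker_def Zp_int_closed Zp_minus) (simp add: Zp_int_def mod_simps)
  then obtain y where y: "y \<in> carrier (Zp p)" "z \<ominus>\<^sub>(Zp p) Zp_int p (z K) = Zp_int p (int p ^ K) \<otimes>\<^sub>(Zp p) y"
    by (rule Zp_ker_dvd)
  have "z = Zp_int p (z K) \<oplus>\<^sub>(Zp p) (z \<ominus>\<^sub>(Zp p) Zp_int p (z K))"
    using assms Zp_int_closed[of "z K"] by (simp add: a_minus_def Z.a_lcomm Z.r_neg)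
  with y that show ?thesis by metis
qed

text \<open>A p-adic integer prime to p is invertible modulo each p^k, and uniqueness of inverses
  there makes the chosen inverses compatible.\<close>

lemma Zp_unit:
  assumes z: "z \<in> carrier (Zp p)" "z 1 \<noteq> 0"
  obtains w where "w \<in> carrier (Zp p)" "z \<otimes>\<^sub>(Zp p) w = \<one>\<^sub>(Zp p)"
proof -
  have cop: "coprime (z k) (int p ^ k)" for k
  proof (cases "k = 0")
    case False
    have "z k mod int p = z 1" using Zp_mod[OF z(1), of 1 k] False by simp
    then have "\<not> int p dvd z k" using z(2) by auto
    then have "coprime (int p) (z k)" by (rule prime_imp_coprime[OF prime_int_p])
    then show ?thesis by (simp add: coprime_commute)
  qed simp
  have "\<exists>w. z k * w mod int p ^ k = 1 mod int p ^ k" for k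
    using cong_solve_coprime_int[OF cop[of k]] by (auto simp: cong_def)
  then obtain w where w: "\<And>k. z k * w k mod int p ^ k = 1 mod int p ^ k" by metis
  have wc: "(\<lambda>k. w k mod int p ^ k) \<in> carrier (Zp p)"
  proof (rule Zp_closedI)
    fix k
    have "z (Suc k) * w (Suc k) mod int p ^ k = 1 mod int p ^ k"
      using w[of "Suc k"] by (metis mod_dvd_cancel)
    then have "z k * w (Suc k) mod int p ^ k = 1 mod int p ^ k"
      using ZpD(2)[OF z(1), of k] by (metis mod_mult_left_eq)
    then have "[z k * w (Suc k) = z k * w k] (mod int p ^ k)"
      using w[of k] by (simp add: cong_def)
    then have "[w (Suc k) = w k] (mod int p ^ k)"
      using cop[of k] by (simp add: cong_mult_lcancel)
    then show "w (Suc k) mod int p ^ k = w k mod int p ^ k" by (simp add: cong_def)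
  qed
  moreover have "z \<otimes>\<^sub>(Zp p) (\<lambda>k. w k mod int p ^ k) = \<one>\<^sub>(Zp p)"
    using w by (simp add: fun_eq_iff Zp_simps mod_simps)
  ultimately show ?thesis using that by blast
qed

text \<open>Component 0 is always zero, so the first nonzero component has an index
  \<open>Suc v\<close>; then \<open>v\<close> is the valuation, and dividing by p^v leaves a
  unit.\<close>

lemma Zp_factor:
  assumes "z \<in> carrier (Zp p)" "z i \<noteq> 0"
  obtains v u where "v < i" "u \<in> carrier (Zp p)" "u 1 \<noteq> 0" "z = Zp_int p (int p ^ v) \<otimes>\<^sub>(Zp p) u"
proof -
  define w where "w = (LEAST i. z i \<noteq> 0)"
  have w: "z w \<noteq> 0" "w \<le> i" and ltw: "\<And>j. j < w ==> z j = 0"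
    unfolding w_def using LeastI[of "\<lambda>i. z i \<noteq> 0", OF assms(2)] assms(2)
    by (auto intro: Least_le dest: not_less_Least)
  have "z 0 = 0" using ZpD(3,4)[OF assms(1), of 0] by simp
  then obtain v where v: "w = Suc v" using w(1) by (cases w) auto
  have "z \<in> Zp_ker p v" using assms(1) ltw[of v] v by (simp add: Zp_ker_def)
  then obtain u where u: "u \<in> carrier (Zp p)" "z = Zp_int p (int p ^ v) \<otimes>\<^sub>(Zp p) u"
    "\<And>k. u k = z (k + v) div int p ^ v"
    by (rule Zp_ker_dvd) blast
  have "u 1 \<noteq> 0"
  proof
    assume "u 1 = 0"
    moreover have "int p ^ v dvd z (Suc v)"
      using Zp_mod[OF assms(1), of v "Suc v"] ltw[of v] v by (simp add: mod_eq_0_iff_dvd)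
    ultimately have "z (Suc v) = 0" using u(3)[of 1] by (metis dvd_div_eq_0_iff plus_1_eq_Suc)
    with w(1) v show False by simp
  qed
  with u w(2) v that[of v u] show ?thesis by simp
qed

lemma Zp_int_smult_mem:
  assumes "\<And>a b. a \<in> B ==> b \<in> B ==> a \<oplus>\<^sub>(Zp p) b \<in> B" "\<zero>\<^sub>(Zp p) \<in> B" "B \<subseteq> carrier (Zp p)" "b \<in> B" "0 \<le> x"
  shows "Zp_int p x \<otimes>\<^sub>(Zp p) b \<in> B"
proof -
  have "Zp_int p (int n) \<otimes>\<^sub>(Zp p) b \<in> B" for n
  proof (induction n)
    case 0
    then show ?case using assms by (auto simp: Zp_zero_eq[symmetric])
  next
    case (Suc n)
    have "Zp_int p (int (Suc n)) \<otimes>\<^sub>(Zp p) b = Zp_int p (int n) \<otimes>\<^sub>(Zp p) b \<oplus>\<^sub>(Zp p) b"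
      using assms(3,4) by (simp add: Zp_int_add Zp_one_eq[symmetric] Z.l_distr Zp_int_closed Z.a_comm subset_eq)
    then show ?case using Suc assms(1,4) by simp
  qed
  from this[of "nat x"] show ?thesis using assms(5) by simp
qed

text \<open>Take the least \<open>i\<close> with p^i Z_p inside \<open>B\<close>. An element of
  smaller valuation v would bring p^v Z_p into \<open>B\<close>: its multiples by p-adic integers
  are needed for this, although \<open>B\<close> is only additively closed.\<close>

lemma Zp_subgroup_eq_ker:
  assumes add: "\<And>a b. a \<in> B ==> b \<in> B ==> a \<oplus>\<^sub>(Zp p) b \<in> B" and B: "B \<subseteq> carrier (Zp p)"
    and j: "Zp_ker p j \<subseteq> B"
  shows "\<exists>i\<le>j. B = Zp_ker p i"
proof -
  have zero: "\<zero>\<^sub>(Zp p) \<in> B" using j by (auto simp: Zp_ker_def Zp_simps(4))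
  define i where "i = (LEAST i. Zp_ker p i \<subseteq> B)"
  have i: "Zp_ker p i \<subseteq> B" "i \<le> j" and least: "\<And>v. v < i ==> \<not> Zp_ker p v \<subseteq> B"
    unfolding i_def using LeastI[of "\<lambda>i. Zp_ker p i \<subseteq> B", OF j] j
    by (fast, auto intro: Least_le dest: not_less_Least)
  have "b i = 0" if b: "b \<in> B" for b
  proof (rule ccontr)
    assume bi: "b i \<noteq> 0"
    have bc: "b \<in> carrier (Zp p)" using b B by auto
    obtain v u where v: "v < i" and u: "u \<in> carrier (Zp p)" "u 1 \<noteq> 0"
      and bu: "b = Zp_int p (int p ^ v) \<otimes>\<^sub>(Zp p) u"
      using Zp_factor[OF bc bi] by blast
    obtain w where w: "w \<in> carrier (Zp p)" "u \<otimes>\<^sub>(Zp p) w = \<one>\<^sub>(Zp p)"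
      using Zp_unit[OF u] .
    have "Zp_ker p v \<subseteq> B"
    proof
      fix z assume "z \<in> Zp_ker p v"
      then obtain y where y: "y \<in> carrier (Zp p)" "z = Zp_int p (int p ^ v) \<otimes>\<^sub>(Zp p) y"
        by (rule Zp_ker_dvd)
      define s where "s = w \<otimes>\<^sub>(Zp p) y"
      have s: "s \<in> carrier (Zp p)" using w y by (simp add: s_def)
      have "b \<otimes>\<^sub>(Zp p) s = Zp_int p (int p ^ v) \<otimes>\<^sub>(Zp p) ((u \<otimes>\<^sub>(Zp p) w) \<otimes>\<^sub>(Zp p) y)"
        unfolding bu s_def using u(1) w(1) y(1) by (simp add: Z.m_assoc Zp_int_closed)
      then have zs: "z = b \<otimes>\<^sub>(Zp p) s" using w y by simp
      \<comment> \<open>Modulo p^j Z_p, which lies in \<open>B\<close>, the p-adic multiplier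
        \<open>s\<close> may be replaced by its residue \<open>s j\<close>, a nonnegative integer,
        and such multiples are repeated sums.\<close>
      obtain t where t: "t \<in> carrier (Zp p)" "s = Zp_int p (s j) \<oplus>\<^sub>(Zp p) Zp_int p (int p ^ j) \<otimes>\<^sub>(Zp p) t"
        using Zp_approx[OF s] .
      have "z = b \<otimes>\<^sub>(Zp p) (Zp_int p (s j) \<oplus>\<^sub>(Zp p) Zp_int p (int p ^ j) \<otimes>\<^sub>(Zp p) t)"
        using zs t(2) by simp
      also have "\<dots> = Zp_int p (s j) \<otimes>\<^sub>(Zp p) b \<oplus>\<^sub>(Zp p) Zp_int p (int p ^ j) \<otimes>\<^sub>(Zp p) (b \<otimes>\<^sub>(Zp p) t)"
        using bc t(1) by (simp add: Z.r_distr Zp_int_closed Z.m_ac)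
      finally have z: "z = Zp_int p (s j) \<otimes>\<^sub>(Zp p) b \<oplus>\<^sub>(Zp p) Zp_int p (int p ^ j) \<otimes>\<^sub>(Zp p) (b \<otimes>\<^sub>(Zp p) t)" .
      have "Zp_int p (s j) \<otimes>\<^sub>(Zp p) b \<in> B"
        by (rule Zp_int_smult_mem[OF add zero B b ZpD(3)[OF s]])
      moreover have "Zp_int p (int p ^ j) \<otimes>\<^sub>(Zp p) (b \<otimes>\<^sub>(Zp p) t) \<in> B"
        using Zp_ker_mult[of "b \<otimes>\<^sub>(Zp p) t" j] bc t(1) j by auto
      ultimately show "z \<in> B" unfolding z by (rule add)
    qed
    with least[OF v] show False by simp
  qed
  then have "B = Zp_ker p i" using i(1) B by (auto simp: Zp_ker_def)
  with i(2) show ?thesis by blast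
qed

text \<open>Z_p is a discrete valuation ring: a nonzero element p^v u with u a unit puts p^v Z_p
  into the ideal, and \<open>Zp_subgroup_eq_ker\<close> takes over.\<close>

lemma Zp_ideal_cases:
  assumes add: "\<And>a b. a \<in> B ==> b \<in> B ==> a \<oplus>\<^sub>(Zp p) b \<in> B" and B: "B \<subseteq> carrier (Zp p)"
    and mult: "\<And>a b. a \<in> carrier (Zp p) ==> b \<in> B ==> a \<otimes>\<^sub>(Zp p) b \<in> B"
  shows "B \<subseteq> {\<zero>\<^sub>(Zp p)} \<or> (\<exists>i. B = Zp_ker p i)"
proof (cases "B \<subseteq> {\<zero>\<^sub>(Zp p)}")
  case False
  then obtain z where z: "z \<in> B" "z \<noteq> \<zero>\<^sub>(Zp p)" by auto
  then obtain i where i: "z i \<noteq> 0" by (auto simp: fun_eq_iff Zp_simps)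
  have zc: "z \<in> carrier (Zp p)" using z B by auto
  obtain v u where u: "u \<in> carrier (Zp p)" "u 1 \<noteq> 0" and zu: "z = Zp_int p (int p ^ v) \<otimes>\<^sub>(Zp p) u"
    using Zp_factor[OF zc i] by blast
  obtain w where w: "w \<in> carrier (Zp p)" "u \<otimes>\<^sub>(Zp p) w = \<one>\<^sub>(Zp p)"
    using Zp_unit[OF u] .
  have "Zp_ker p v \<subseteq> B"
  proof
    fix x assume "x \<in> Zp_ker p v"
    then obtain y where y: "y \<in> carrier (Zp p)" "x = Zp_int p (int p ^ v) \<otimes>\<^sub>(Zp p) y"
      by (rule Zp_ker_dvd)
    have "(w \<otimes>\<^sub>(Zp p) y) \<otimes>\<^sub>(Zp p) z = Zp_int p (int p ^ v) \<otimes>\<^sub>(Zp p) ((u \<otimes>\<^sub>(Zp p) w) \<otimes>\<^sub>(Zp p) y)"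
      unfolding zu using u w(1) y by (simp add: Z.m_ac Zp_int_closed)
    then have "x = (w \<otimes>\<^sub>(Zp p) y) \<otimes>\<^sub>(Zp p) z" using w y by simp
    then show "x \<in> B" using mult[OF _ z(1)] w(1) y(1) by simp
  qed
  then show ?thesis using Zp_subgroup_eq_ker[OF add B] by blast
qed simp

text \<open>The part of \<open>m\<close> prime to p is a unit, so m Z_p is p^v Z_p with v the
  valuation of \<open>m\<close>. It is applied with \<open>m\<close> the order of a finite quotient
  of H.\<close>

lemma Zp_finite_index:
  assumes m: "0 < m" and mB: "\<And>z. z \<in> carrier (Zp p) ==> Zp_int p (int m) \<otimes>\<^sub>(Zp p) z \<in> B"
  shows "\<exists>j. Zp_ker p j \<subseteq> B"
proof -
  obtain v u where u: "\<not> p dvd u" "m = p ^ v * u"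
    using multiplicity_decompose'[of m p] m p_gt_1 prime_p by (metis gr_implies_not0 not_prime_unit)
  have "Zp_int p (int u) 1 \<noteq> 0"
    using u(1) by (simp add: Zp_int_def) (metis int_dvd_int_iff mod_eq_0_iff_dvd of_nat_mod of_nat_0 of_nat_eq_0_iff)
  then obtain w where w: "w \<in> carrier (Zp p)" "Zp_int p (int u) \<otimes>\<^sub>(Zp p) w = \<one>\<^sub>(Zp p)"
    using Zp_unit[OF Zp_int_closed] by metis
  have "Zp_ker p v \<subseteq> B"
  proof
    fix x assume "x \<in> Zp_ker p v"
    then obtain y where y: "y \<in> carrier (Zp p)" "x = Zp_int p (int p ^ v) \<otimes>\<^sub>(Zp p) y"
      by (rule Zp_ker_dvd)
    have "Zp_int p (int m) = Zp_int p (int p ^ v) \<otimes>\<^sub>(Zp p) Zp_int p (int u)"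
      using u(2) by (simp add: Zp_int_mult)
    then have "Zp_int p (int m) \<otimes>\<^sub>(Zp p) (w \<otimes>\<^sub>(Zp p) y) =
        Zp_int p (int p ^ v) \<otimes>\<^sub>(Zp p) ((Zp_int p (int u) \<otimes>\<^sub>(Zp p) w) \<otimes>\<^sub>(Zp p) y)"
      using w(1) y(1) by (simp add: Z.m_assoc Zp_int_closed)
    then have "x = Zp_int p (int m) \<otimes>\<^sub>(Zp p) (w \<otimes>\<^sub>(Zp p) y)" using w y by simp
    then show "x \<in> B" using mB w(1) y(1) by simp
  qed
  then show ?thesis by blast
qed

text \<open>The solution is the convergent series c_k = d_k + p d_{k+1} + p^2 d_{k+2} + ..., of
  which only the first m terms are visible modulo p^m.\<close>

lemma Zp_recursion:
  assumes d: "\<And>k. d k \<in> carrier (Zp p)"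
  obtains c where "\<And>k. c k \<in> carrier (Zp p)"
    "\<And>k. c k = d k \<oplus>\<^sub>(Zp p) Zp_int p (int p) \<otimes>\<^sub>(Zp p) c (Suc k)"
proof -
  define c where "c k = (\<lambda>m. (\<Sum>l<m. int p ^ l * d (k + l) m) mod int p ^ m)" for k
  have cc: "c k \<in> carrier (Zp p)" for k
    unfolding c_def
  proof (rule Zp_closedI)
    fix m
    have "(\<Sum>l<Suc m. int p ^ l * d (k + l) (Suc m)) mod int p ^ m =
        (\<Sum>l<m. int p ^ l * d (k + l) (Suc m)) mod int p ^ m"
      by (simp add: mod_add_right_eq[symmetric] mod_mult_self1_is_0)
    also have "\<dots> = (\<Sum>l<m. (int p ^ l * d (k + l) (Suc m)) mod int p ^ m) mod int p ^ m"
      by (simp add: mod_sum_eq)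
    also have "(\<Sum>l<m. (int p ^ l * d (k + l) (Suc m)) mod int p ^ m) =
        (\<Sum>l<m. (int p ^ l * d (k + l) m) mod int p ^ m)"
      by (intro sum.cong refl) (metis ZpD(2)[OF d] mod_mult_right_eq)
    also have "\<dots> mod int p ^ m = (\<Sum>l<m. int p ^ l * d (k + l) m) mod int p ^ m"
      by (simp add: mod_sum_eq)
    finally show "(\<Sum>l<Suc m. int p ^ l * d (k + l) (Suc m)) mod int p ^ m =
        (\<Sum>l<m. int p ^ l * d (k + l) m) mod int p ^ m" .
  qed
  have "c k = d k \<oplus>\<^sub>(Zp p) Zp_int p (int p) \<otimes>\<^sub>(Zp p) c (Suc k)" for k
  proof
    fix m
    have "(d k \<oplus>\<^sub>(Zp p) Zp_int p (int p) \<otimes>\<^sub>(Zp p) c (Suc k)) m =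
        (d k m + int p * (\<Sum>l<m. int p ^ l * d (Suc k + l) m)) mod int p ^ m"
      by (simp add: Zp_simps(2) Zp_int_mult_eval[OF cc]) (simp add: c_def mod_simps)
    also have "d k m + int p * (\<Sum>l<m. int p ^ l * d (Suc k + l) m) = (\<Sum>l<Suc m. int p ^ l * d (k + l) m)"
      by (subst sum.lessThan_Suc_shift) (simp add: sum_distrib_left mult.assoc)
    also have "\<dots> mod int p ^ m = (\<Sum>l<m. int p ^ l * d (k + l) m) mod int p ^ m"
      by (simp add: mod_add_right_eq[symmetric] mod_mult_self1_is_0)
    finally show "c k m = (d k \<oplus>\<^sub>(Zp p) Zp_int p (int p) \<otimes>\<^sub>(Zp p) c (Suc k)) m"
      by (simp add: c_def)
  qed
  with cc that show ?thesis by blast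
qed

subsection \<open>Binomial coefficients\<close>

text \<open>The number of p-adic digits lost on division by k!.\<close>

definition vfact :: "nat => nat" where "vfact k = multiplicity p (fact k :: nat)"

lemma fact_cancel:
  assumes "int p ^ (m + vfact k) dvd fact k * x"
  shows "int p ^ m dvd x"
proof -
  obtain u where u: "\<not> p dvd u" "(fact k :: nat) = p ^ vfact k * u"
    using multiplicity_decompose'[of "fact k :: nat" p] p_gt_1 prime_p unfolding vfact_def
    by (metis fact_nonzero not_prime_unit)
  have "(fact k :: int) = int p ^ vfact k * int u"
    using arg_cong[OF u(2), of int] by simp
  then have "int p ^ vfact k * int p ^ m dvd int p ^ vfact k * (int u * x)"
    using assms by (simp add: power_add mult_ac)
  then have "int p ^ m dvd int u * x"
    using p_pos[of "vfact k"] by (metis dvd_mult_cancel_left less_irrefl)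
  moreover have "coprime (int p ^ m) (int u)"
    using prime_imp_coprime[OF prime_int_p, of "int u"] u(1) by simp
  ultimately show ?thesis
    by (simp add: coprime_dvd_mult_right_iff)
qed

text \<open>Over the reals the binomial is the falling product divided by k!; the identity is then
  pulled back along the injection of the integers.\<close>

lemma fact_binomial_prod: "(fact k :: int) * int (x choose k) = (\<Prod>i<k. int x - int i)"
proof -
  have "real_of_int (fact k * int (x choose k)) = fact k * (real x gchoose k)"
    by (simp add: binomial_gbinomial)
  also have "\<dots> = (\<Prod>i<k. real x - real i)"
    by (simp add: gbinomial_mult_fact atLeast0LessThan)
  also have "\<dots> = real_of_int (\<Prod>i<k. int x - int i)" by simp
  finally show ?thesis by (simp only: of_int_eq_iff)
qed

lemma prod_mod_cong:
  fixes f g :: "nat => int"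
  assumes "\<And>i. i < k ==> f i mod q = g i mod q"
  shows "(\<Prod>i<k. f i) mod q = (\<Prod>i<k. g i) mod q"
  using assms by (induction k) (auto, metis lessI less_Suc_eq mod_mult_cong)

text \<open>The falling products are congruent modulo p^(m + v), v the valuation of k!, and
  cancelling k! leaves a congruence modulo p^m. This is uniform p-adic continuity of x \<mapsto>
  binom(x, k).\<close>

lemma binomial_mod_cong:
  assumes "int x mod int p ^ (m + vfact k) = int y mod int p ^ (m + vfact k)"
  shows "int (x choose k) mod int p ^ m = int (y choose k) mod int p ^ m"
proof -
  have "(\<Prod>i<k. int x - int i) mod int p ^ (m + vfact k) = (\<Prod>i<k. int y - int i) mod int p ^ (m + vfact k)"
    by (rule prod_mod_cong) (metis assms mod_diff_left_eq)
  then have "int p ^ (m + vfact k) dvd fact k * (int (x choose k) - int (y choose k))"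
    unfolding fact_binomial_prod[symmetric] by (simp add: mod_eq_dvd_iff right_diff_distrib)
  from fact_cancel[OF this] show ?thesis
    by (simp add: mod_eq_dvd_iff)
qed

lemma Zp_finprod:
  fixes k :: nat
  assumes "\<And>i. i < k ==> f i \<in> carrier (Zp p)"
  shows "(\<Otimes>\<^sub>(Zp p)i\<in>{..<k}. f i) m = (\<Prod>i<k. f i m) mod int p ^ m"
  using assms
proof (induction k)
  case 0
  then show ?case by (simp add: Zp_simps)
next
  case (Suc k)
  have "(\<Otimes>\<^sub>(Zp p)i\<in>{..<Suc k}. f i) = f k \<otimes>\<^sub>(Zp p) (\<Otimes>\<^sub>(Zp p)i\<in>{..<k}. f i)"
    unfolding lessThan_Suc using Suc.prems by (intro Z.finprod_insert) auto
  then show ?case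
    using Suc by (simp add: Zp_simps mod_simps mult.commute)
qed

lemma Zp_binom_prod_eval:
  assumes z: "z \<in> carrier (Zp p)"
  shows "(\<Otimes>\<^sub>(Zp p)i\<in>{..<k}. z \<ominus>\<^sub>(Zp p) ([i] \<cdot>\<^sub>(Zp p) \<one>\<^sub>(Zp p))) m = (\<Prod>i<k. z m - int i) mod int p ^ m"
proof -
  have "(z \<ominus>\<^sub>(Zp p) ([i] \<cdot>\<^sub>(Zp p) \<one>\<^sub>(Zp p))) m mod int p ^ m = (z m - int i) mod int p ^ m" for i
    using z by (simp add: Zp_add_pow Zp_minus Zp_int_closed) (simp add: Zp_int_def mod_simps)
  then have "(\<Prod>i<k. (z \<ominus>\<^sub>(Zp p) ([i] \<cdot>\<^sub>(Zp p) \<one>\<^sub>(Zp p))) m) mod int p ^ m = (\<Prod>i<k. z m - int i) mod int p ^ m"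
    by (rule prod_mod_cong)
  then show ?thesis
    using z by (subst Zp_finprod) auto
qed

text \<open>Component m of the p-adic binomial is an ordinary binomial of a residue known to m +
  \<open>vfact k\<close> digits. The description in \<open>Zp_binom\<close> has at most one solution
  since multiplication by k! is injective on Z_p.\<close>

lemma Zp_binom_eval:
  assumes z: "z \<in> carrier (Zp p)"
  shows Zp_binom_closed: "Zp_binom p z k \<in> carrier (Zp p)"
    and Zp_binom_comp: "m + vfact k \<le> K ==> Zp_binom p z k m = int (nat (z K) choose k) mod int p ^ m"
proof -
  define b where "b = (\<lambda>m. int (nat (z (m + vfact k)) choose k) mod int p ^ m)"
  have cong: "int (nat (z K) choose k) mod int p ^ m = int (nat (z (m + vfact k)) choose k) mod int p ^ m"
    if "m + vfact k \<le> K" for m K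
    using Zp_mod[OF z that] ZpD(3)[OF z] ZpD(1)[OF z] by (intro binomial_mod_cong) simp
  have bc: "b \<in> carrier (Zp p)"
    unfolding b_def by (rule Zp_closedI) (rule cong, simp)
  let ?P = "\<lambda>b. b \<in> carrier (Zp p) \<and> [(fact k :: nat)] \<cdot>\<^sub>(Zp p) b =
       (\<Otimes>\<^sub>(Zp p)i\<in>{..<k}. z \<ominus>\<^sub>(Zp p) ([i] \<cdot>\<^sub>(Zp p) \<one>\<^sub>(Zp p)))"
  have fc: "([(fact k :: nat)] \<cdot>\<^sub>(Zp p) c) m = (fact k * c m) mod int p ^ m" if "c \<in> carrier (Zp p)" for c m
    using that by (simp add: Zp_add_pow Zp_int_mult_eval)
  have "Zp_binom p z k = b"
    unfolding Zp_binom_def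
  proof (rule the_equality)
    show "?P b"
    proof (intro conjI bc ext)
      fix m
      let ?x = "nat (z (m + vfact k))"
      have "([(fact k :: nat)] \<cdot>\<^sub>(Zp p) b) m = (fact k * int (?x choose k)) mod int p ^ m"
        by (simp add: fc[OF bc]) (simp add: b_def mod_simps)
      also have "\<dots> = (\<Prod>i<k. z (m + vfact k) - int i) mod int p ^ m"
        using ZpD(3)[OF z] by (simp add: fact_binomial_prod)
      also have "\<dots> = (\<Prod>i<k. z m - int i) mod int p ^ m"
        using Zp_mod[OF z, of m "m + vfact k"] by (intro prod_mod_cong) (metis le_add1 mod_diff_left_eq)
      finally show "([(fact k :: nat)] \<cdot>\<^sub>(Zp p) b) m =
          (\<Otimes>\<^sub>(Zp p)i\<in>{..<k}. z \<ominus>\<^sub>(Zp p) ([i] \<cdot>\<^sub>(Zp p) \<one>\<^sub>(Zp p))) m"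
        by (simp add: Zp_binom_prod_eval[OF z])
    qed
    fix c assume c: "?P c"
    then have cc: "c \<in> carrier (Zp p)" by simp
    have eq: "[(fact k :: nat)] \<cdot>\<^sub>(Zp p) c = [(fact k :: nat)] \<cdot>\<^sub>(Zp p) b"
      using c \<open>?P b\<close> by simp
    show "c = b"
    proof
      fix m
      have "(fact k * c (m + vfact k)) mod int p ^ (m + vfact k) = (fact k * b (m + vfact k)) mod int p ^ (m + vfact k)"
        using fun_cong[OF eq, of "m + vfact k"] by (simp add: fc cc bc)
      then have "int p ^ m dvd c (m + vfact k) - b (m + vfact k)"
        by (intro fact_cancel[of m k]) (simp add: mod_eq_dvd_iff right_diff_distrib)
      then have "c (m + vfact k) mod int p ^ m = b (m + vfact k) mod int p ^ m"
        by (simp add: mod_eq_dvd_iff)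
      then show "c m = b m"
        using Zp_mod[OF cc, of m "m + vfact k"] Zp_mod[OF bc, of m "m + vfact k"] by simp
    qed
  qed
  note eq = this
  show "Zp_binom p z k \<in> carrier (Zp p)" unfolding eq by (rule bc)
  show "Zp_binom p z k m = int (nat (z K) choose k) mod int p ^ m" if "m + vfact k \<le> K"
    unfolding eq using cong[OF that] by (simp only: b_def)
qed

end

section \<open>Truncated power series expansions\<close>

text \<open>An augmented R-algebra whose augmentation ideal is generated by \<open>x\<close>. It
  isolates the power series bookkeeping from the inverse limit, to which it is applied with S =
  R[[H]].\<close>

locale aug_ring = S: cring S + R: cring R
  for S :: "('s, 'x) ring_scheme" and R :: "('r, 'y) ring_scheme" +
  fixes \<iota> :: "'r => 's" and aug :: "'s => 'r" and x :: 's
  assumes io: "\<iota> \<in> ring_hom R S" and aug: "aug \<in> ring_hom S R"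
    and aug_io: "r \<in> carrier R ==> aug (\<iota> r) = r"
    and x_closed: "x \<in> carrier S" and aug_x: "aug x = \<zero>\<^sub>R"
    and aug_ker: "a \<in> carrier S ==> aug a = \<zero>\<^sub>R ==> \<exists>b\<in>carrier S. a = x \<otimes>\<^sub>S b"
begin

lemma io_simps:
  "r \<in> carrier R ==> \<iota> r \<in> carrier S"
  "r \<in> carrier R ==> t \<in> carrier R ==> \<iota> (r \<oplus>\<^sub>R t) = \<iota> r \<oplus>\<^sub>S \<iota> t"
  "r \<in> carrier R ==> t \<in> carrier R ==> \<iota> (r \<otimes>\<^sub>R t) = \<iota> r \<otimes>\<^sub>S \<iota> t"
  "\<iota> \<one>\<^sub>R = \<one>\<^sub>S" "\<iota> \<zero>\<^sub>R = \<zero>\<^sub>S"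
  using ring_hom_zero[OF io R.ring_axioms S.ring_axioms]
  by (auto simp: ring_hom_closed[OF io] ring_hom_add[OF io] ring_hom_mult[OF io] ring_hom_one[OF io])

lemma aug_simps:
  "a \<in> carrier S ==> aug a \<in> carrier R"
  "a \<in> carrier S ==> b \<in> carrier S ==> aug (a \<oplus>\<^sub>S b) = aug a \<oplus>\<^sub>R aug b"
  "a \<in> carrier S ==> b \<in> carrier S ==> aug (a \<otimes>\<^sub>S b) = aug a \<otimes>\<^sub>R aug b"
  "aug \<one>\<^sub>S = \<one>\<^sub>R" "aug \<zero>\<^sub>S = \<zero>\<^sub>R"
  using ring_hom_zero[OF aug S.ring_axioms R.ring_axioms]
  by (auto simp: ring_hom_closed[OF aug] ring_hom_add[OF aug] ring_hom_mult[OF aug] ring_hom_one[OF aug])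

text \<open>The polynomial with coefficients f 0, ..., f (m - 1), in Horner form so that an
  induction peels off the constant term, the one that the augmentation detects.\<close>

primrec horner :: "nat => (nat => 'r) => 's" where
  "horner 0 f = \<zero>\<^sub>S"
| "horner (Suc m) f = \<iota> (f 0) \<oplus>\<^sub>S x \<otimes>\<^sub>S horner m (\<lambda>k. f (Suc k))"

lemma horner_closed: "(\<And>k. f k \<in> carrier R) ==> horner m f \<in> carrier S"
  by (induction m arbitrary: f) (auto simp: io_simps x_closed)

lemma horner_add:
  assumes "\<And>k. f k \<in> carrier R" "\<And>k. g k \<in> carrier R"
  shows "horner m (\<lambda>k. f k \<oplus>\<^sub>R g k) = horner m f \<oplus>\<^sub>S horner m g"
  using assms
proof (induction m arbitrary: f g)
  case (Suc m)
  have c: "horner m (\<lambda>k. f (Suc k)) \<in> carrier S" "horner m (\<lambda>k. g (Suc k)) \<in> carrier S"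
    using Suc.prems by (auto intro: horner_closed)
  show ?case
    using Suc.prems c Suc.IH[of "\<lambda>k. f (Suc k)" "\<lambda>k. g (Suc k)"]
    by (simp add: io_simps x_closed S.r_distr S.a_ac)
qed simp

lemma horner_smult:
  assumes "\<And>k. f k \<in> carrier R" "r \<in> carrier R"
  shows "horner m (\<lambda>k. r \<otimes>\<^sub>R f k) = \<iota> r \<otimes>\<^sub>S horner m f"
  using assms
proof (induction m arbitrary: f)
  case (Suc m)
  have c: "horner m (\<lambda>k. f (Suc k)) \<in> carrier S"
    using Suc.prems by (auto intro: horner_closed)
  show ?case
    using Suc.prems c Suc.IH[of "\<lambda>k. f (Suc k)"]
    by (simp add: io_simps x_closed S.r_distr S.m_lcomm)
qed (simp add: io_simps)

lemma horner_cong: "(\<And>k. k < m ==> f k = g k) ==> horner m f = horner m g"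
proof (induction m arbitrary: f g)
  case (Suc m)
  have "horner m (\<lambda>k. f (Suc k)) = horner m (\<lambda>k. g (Suc k))"
    by (rule Suc.IH) (simp add: Suc.prems)
  then show ?case using Suc.prems[of 0] by simp
qed simp

lemma horner_zero: "horner m (\<lambda>k. \<zero>\<^sub>R) = \<zero>\<^sub>S"
  by (induction m) (auto simp: io_simps x_closed)

lemma horner_snoc:
  assumes "\<And>k. f k \<in> carrier R"
  shows "horner (Suc m) f = horner m f \<oplus>\<^sub>S \<iota> (f m) \<otimes>\<^sub>S x [^]\<^sub>S m"
  using assms
proof (induction m arbitrary: f)
  case 0
  then show ?case by (simp add: io_simps x_closed)
next
  case (Suc m)
  have c: "horner m (\<lambda>k. f (Suc k)) \<in> carrier S"
    using Suc.prems by (auto intro: horner_closed)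
  have "horner (Suc (Suc m)) f = \<iota> (f 0) \<oplus>\<^sub>S x \<otimes>\<^sub>S horner (Suc m) (\<lambda>k. f (Suc k))" by simp
  also have "horner (Suc m) (\<lambda>k. f (Suc k)) = horner m (\<lambda>k. f (Suc k)) \<oplus>\<^sub>S \<iota> (f (Suc m)) \<otimes>\<^sub>S x [^]\<^sub>S m"
    using Suc.IH[of "\<lambda>k. f (Suc k)"] Suc.prems by simp
  finally show ?case
    using Suc.prems c by (simp add: io_simps x_closed S.r_distr S.a_assoc S.m_ac)
qed

text \<open>Congruence of \<open>a\<close> to a polynomial modulo x^m. The sequence \<open>f\<close>
  is total, but its values from m on are irrelevant.\<close>

definition expands :: "nat => (nat => 'r) => 's => bool" where
  "expands m f a \<longleftrightarrow> (\<exists>y\<in>carrier S. a = horner m f \<oplus>\<^sub>S x [^]\<^sub>S m \<otimes>\<^sub>S y)"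

lemma expands_add:
  assumes "\<And>k. f k \<in> carrier R" "\<And>k. g k \<in> carrier R" "expands m f a" "expands m g b"
  shows "expands m (\<lambda>k. f k \<oplus>\<^sub>R g k) (a \<oplus>\<^sub>S b)"
proof -
  obtain y z where yz: "y \<in> carrier S" "a = horner m f \<oplus>\<^sub>S x [^]\<^sub>S m \<otimes>\<^sub>S y"
    "z \<in> carrier S" "b = horner m g \<oplus>\<^sub>S x [^]\<^sub>S m \<otimes>\<^sub>S z"
    using assms(3,4) by (auto simp: expands_def)
  have c: "horner m f \<in> carrier S" "horner m g \<in> carrier S"
    using assms(1,2) by (auto intro: horner_closed)
  show ?thesis
    unfolding expands_def
    by (rule bexI[of _ "y \<oplus>\<^sub>S z"])
      (use yz c x_closed assms(1,2) in \<open>simp_all add: horner_add S.r_distr S.a_ac\<close>)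
qed

lemma expands_smult:
  assumes "\<And>k. f k \<in> carrier R" "r \<in> carrier R" "expands m f a"
  shows "expands m (\<lambda>k. r \<otimes>\<^sub>R f k) (\<iota> r \<otimes>\<^sub>S a)"
proof -
  obtain y where y: "y \<in> carrier S" "a = horner m f \<oplus>\<^sub>S x [^]\<^sub>S m \<otimes>\<^sub>S y"
    using assms(3) by (auto simp: expands_def)
  show ?thesis
    unfolding expands_def
    by (rule bexI[of _ "\<iota> r \<otimes>\<^sub>S y"])
      (use y horner_closed[OF assms(1)] x_closed assms(1,2) in
        \<open>simp_all add: horner_smult S.r_distr io_simps S.m_ac\<close>)
qed

text \<open>Multiplication by x pushes the top coefficient f (m - 1) beyond the cut, where it is
  absorbed into the remainder.\<close>

lemma expands_shift:
  assumes "\<And>k. f k \<in> carrier R" "expands m f a"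
  shows "expands m (\<lambda>k. if k = 0 then \<zero>\<^sub>R else f (k - 1)) (x \<otimes>\<^sub>S a)"
proof (cases m)
  case 0
  then show ?thesis
    using assms x_closed by (auto simp: expands_def)
next
  case (Suc m')
  obtain y where y: "y \<in> carrier S" "a = horner m f \<oplus>\<^sub>S x [^]\<^sub>S m \<otimes>\<^sub>S y"
    using assms(2) by (auto simp: expands_def)
  have c: "horner m' f \<in> carrier S" "\<iota> (f m') \<in> carrier S" using assms(1) by (auto intro: horner_closed io_simps)
  have "x \<otimes>\<^sub>S a = x \<otimes>\<^sub>S horner m' f \<oplus>\<^sub>S x [^]\<^sub>S m \<otimes>\<^sub>S (\<iota> (f m') \<oplus>\<^sub>S x \<otimes>\<^sub>S y)"
    unfolding y(2) Suc horner_snoc[OF assms(1)]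
    using y(1) c x_closed by (simp add: S.r_distr S.m_ac S.a_assoc)
  moreover have "horner m (\<lambda>k. if k = 0 then \<zero>\<^sub>R else f (k - 1)) = x \<otimes>\<^sub>S horner m' f"
    using c x_closed by (simp add: Suc io_simps)
  ultimately show ?thesis
    unfolding expands_def using y c x_closed by (intro bexI[of _ "\<iota> (f m') \<oplus>\<^sub>S x \<otimes>\<^sub>S y"]) auto
qed

lemma expands_const:
  assumes "r \<in> carrier R"
  shows "expands m (\<lambda>k. if k = 0 then r else \<zero>\<^sub>R) (\<iota> r)"
proof (cases m)
  case 0
  then show ?thesis
    using assms by (auto simp: expands_def io_simps)
next
  case (Suc m')
  then show ?thesis
    unfolding expands_def
    using assms x_closed by (intro bexI[of _ "\<zero>\<^sub>S"]) (auto simp: io_simps horner_zero)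
qed

text \<open>Subtracting the constant \<open>aug a\<close> leaves an element of augmentation zero,
  hence x times some b, and b is expanded to one order less.\<close>

lemma expands_exists:
  assumes "a \<in> carrier S"
  shows "\<exists>f. (\<forall>k. f k \<in> carrier R) \<and> expands m f a"
  using assms
proof (induction m arbitrary: a)
  case 0
  then show ?case by (intro exI[of _ "\<lambda>k. \<zero>\<^sub>R"]) (auto simp: expands_def)
next
  case (Suc m)
  have "aug (a \<ominus>\<^sub>S \<iota> (aug a)) = \<zero>\<^sub>R"
  proof -
    have "aug (a \<ominus>\<^sub>S \<iota> (aug a)) \<oplus>\<^sub>R aug (\<iota> (aug a)) = aug ((a \<ominus>\<^sub>S \<iota> (aug a)) \<oplus>\<^sub>S \<iota> (aug a))"
      using Suc.prems by (subst aug_simps(2)) (auto simp: aug_simps io_simps)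
    also have "(a \<ominus>\<^sub>S \<iota> (aug a)) \<oplus>\<^sub>S \<iota> (aug a) = a"
      using Suc.prems by (simp add: a_minus_def S.a_assoc S.l_neg aug_simps io_simps)
    finally show ?thesis
      using Suc.prems by (simp add: aug_io aug_simps io_simps)
  qed
  then obtain b where b: "b \<in> carrier S" "a \<ominus>\<^sub>S \<iota> (aug a) = x \<otimes>\<^sub>S b"
    using aug_ker[of "a \<ominus>\<^sub>S \<iota> (aug a)"] Suc.prems by (auto simp: aug_simps io_simps)
  obtain f y where f: "\<And>k. f k \<in> carrier R" and y: "y \<in> carrier S" "b = horner m f \<oplus>\<^sub>S x [^]\<^sub>S m \<otimes>\<^sub>S y"
    using Suc.IH[OF b(1)] by (auto simp: expands_def)
  let ?g = "\<lambda>k. case k of 0 => aug a | Suc k => f k"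
  have "a = \<iota> (aug a) \<oplus>\<^sub>S (a \<ominus>\<^sub>S \<iota> (aug a))"
    using Suc.prems by (simp add: a_minus_def S.a_lcomm S.r_neg aug_simps io_simps)
  also have "\<dots> = horner (Suc m) ?g \<oplus>\<^sub>S x [^]\<^sub>S Suc m \<otimes>\<^sub>S y"
    unfolding b(2) y(2) using y(1) horner_closed[OF f] x_closed Suc.prems
    by (simp add: aug_simps io_simps S.r_distr S.a_assoc S.m_ac)
  finally have "a = horner (Suc m) ?g \<oplus>\<^sub>S x [^]\<^sub>S Suc m \<otimes>\<^sub>S y" .
  then show ?case
    using f y(1) Suc.prems by (intro exI[of _ ?g]) (auto simp: expands_def aug_simps split: nat.split)
qed

end

text \<open>If multiplication by \<open>x\<close> is injective up to \<open>x^n S\<close>, the coefficients of order at most \<open>n\<close>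
  are unique.\<close>

locale aug_ring_trunc = aug_ring S R \<iota> aug x
  for S :: "('s, 'x) ring_scheme" and R :: "('r, 'y) ring_scheme" and \<iota> aug x +
  fixes n :: nat
  assumes ann: "b \<in> carrier S ==> x \<otimes>\<^sub>S b = \<zero>\<^sub>S ==> \<exists>y\<in>carrier S. b = x [^]\<^sub>S n \<otimes>\<^sub>S y"
begin

text \<open>The augmentation isolates f 0, which is therefore zero. Now x times the remaining series
  vanishes, so by \<open>ann\<close> that series is a multiple of x^n, and it expands zero to order
  m. The constant term comes for free, hence the range up to \<open>Suc n\<close>.\<close>

lemma expands_zero_unique:
  assumes "m \<le> Suc n" "\<And>k. f k \<in> carrier R" "expands m f \<zero>\<^sub>S" "k < m"
  shows "f k = \<zero>\<^sub>R"
  using assms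
proof (induction m arbitrary: f k)
  case (Suc m)
  obtain y where y: "y \<in> carrier S" "\<zero>\<^sub>S = horner (Suc m) f \<oplus>\<^sub>S x [^]\<^sub>S Suc m \<otimes>\<^sub>S y"
    using Suc.prems(3) by (auto simp: expands_def)
  let ?g = "\<lambda>k. f (Suc k)"
  have c: "horner m ?g \<in> carrier S" using Suc.prems(2) by (auto intro: horner_closed)
  have "aug \<zero>\<^sub>S = f 0"
    unfolding y(2) using y(1) c Suc.prems(2) x_closed
    by (simp add: aug_simps aug_io io_simps aug_x)
  then have f0: "f 0 = \<zero>\<^sub>R" by (simp add: aug_simps)
  let ?b = "horner m ?g \<oplus>\<^sub>S x [^]\<^sub>S m \<otimes>\<^sub>S y"
  have bc: "?b \<in> carrier S" using c y(1) x_closed by simp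
  have "x \<otimes>\<^sub>S ?b = \<zero>\<^sub>S"
    using y f0 c x_closed by (simp add: io_simps S.r_distr S.m_ac)
  then obtain z where z: "z \<in> carrier S" "?b = x [^]\<^sub>S n \<otimes>\<^sub>S z"
    using ann[OF bc] by blast
  have xn: "x [^]\<^sub>S n = x [^]\<^sub>S m \<otimes>\<^sub>S x [^]\<^sub>S (n - m)"
    using Suc.prems(1) x_closed by (simp add: S.nat_pow_mult)
  have "horner m ?g \<oplus>\<^sub>S x [^]\<^sub>S m \<otimes>\<^sub>S (y \<ominus>\<^sub>S x [^]\<^sub>S (n - m) \<otimes>\<^sub>S z) = ?b \<ominus>\<^sub>S x [^]\<^sub>S n \<otimes>\<^sub>S z"
    unfolding xn using c y(1) z(1) x_closed
    by (simp add: a_minus_def S.r_distr S.r_minus S.m_assoc S.a_assoc)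
  also have "\<dots> = \<zero>\<^sub>S"
    unfolding z(2) using z(1) x_closed by (simp add: a_minus_def S.r_neg)
  finally have "expands m ?g \<zero>\<^sub>S"
    unfolding expands_def using y(1) z(1) x_closed
    by (intro bexI[of _ "y \<ominus>\<^sub>S x [^]\<^sub>S (n - m) \<otimes>\<^sub>S z"]) auto
  then have "?g k = \<zero>\<^sub>R" if "k < m" for k
    using Suc.IH[of ?g k] Suc.prems(1,2) that by simp
  then show ?case
    using f0 Suc.prems(4) by (cases k) auto
qed simp

lemma expands_unique:
  assumes "m \<le> Suc n" "\<And>k. f k \<in> carrier R" "\<And>k. g k \<in> carrier R" "a \<in> carrier S"
    "expands m f a" "expands m g a" "k < m"
  shows "f k = g k"
proof -
  have io1: "\<iota> (\<ominus>\<^sub>R \<one>\<^sub>R) \<otimes>\<^sub>S a = \<ominus>\<^sub>S a"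
  proof -
    have "\<iota> (\<ominus>\<^sub>R \<one>\<^sub>R) \<oplus>\<^sub>S \<one>\<^sub>S = \<zero>\<^sub>S"
      using io_simps(2)[of "\<ominus>\<^sub>R \<one>\<^sub>R" "\<one>\<^sub>R"] by (simp add: R.l_neg io_simps)
    then have "\<iota> (\<ominus>\<^sub>R \<one>\<^sub>R) = \<ominus>\<^sub>S \<one>\<^sub>S"
      by (metis R.add.inv_closed R.one_closed S.minus_equality S.one_closed io_simps(1) S.add.inv_inv S.add.inv_closed)
    then show ?thesis using assms(4) by (simp add: S.l_minus)
  qed
  have "expands m (\<lambda>k. f k \<oplus>\<^sub>R \<ominus>\<^sub>R \<one>\<^sub>R \<otimes>\<^sub>R g k) (a \<oplus>\<^sub>S \<iota> (\<ominus>\<^sub>R \<one>\<^sub>R) \<otimes>\<^sub>S a)"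
    using assms by (intro expands_add expands_smult) auto
  also have "a \<oplus>\<^sub>S \<iota> (\<ominus>\<^sub>R \<one>\<^sub>R) \<otimes>\<^sub>S a = \<zero>\<^sub>S"
    using assms(4) by (simp add: io1 S.r_neg)
  finally have "f k \<oplus>\<^sub>R \<ominus>\<^sub>R \<one>\<^sub>R \<otimes>\<^sub>R g k = \<zero>\<^sub>R"
    using assms by (intro expands_zero_unique[of m]) auto
  then have "f k \<ominus>\<^sub>R g k = \<zero>\<^sub>R"
    using assms(2,3) by (simp add: a_minus_def R.l_minus)
  then show ?thesis
    using assms(2,3) by (simp add: R.minus_eq_zero_iff)
qed

text \<open>The choice is harmless at indices up to n, where the coefficients are unique; beyond n
  the values are arbitrary elements of R.\<close>

definition cf :: "'s => nat => 'r" where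
  "cf a = (SOME f. (\<forall>k. f k \<in> carrier R) \<and> expands (Suc n) f a)"

lemma cf:
  assumes "a \<in> carrier S"
  shows cf_closed: "cf a k \<in> carrier R" and cf_expands: "expands (Suc n) (cf a) a"
  using someI_ex[OF expands_exists[OF assms, of "Suc n"]] by (auto simp: cf_def)

lemma cf_eqI:
  assumes "a \<in> carrier S" "\<And>k. f k \<in> carrier R" "expands (Suc n) f a" "k \<le> n"
  shows "cf a k = f k"
  using assms cf[OF assms(1)] by (intro expands_unique[of "Suc n" "cf a" f a k]) auto

lemma cf_add:
  assumes "a \<in> carrier S" "b \<in> carrier S" "k \<le> n"
  shows "cf (a \<oplus>\<^sub>S b) k = cf a k \<oplus>\<^sub>R cf b k"
  using assms cf by (intro cf_eqI[of "a \<oplus>\<^sub>S b" "\<lambda>k. cf a k \<oplus>\<^sub>R cf b k" k] expands_add) auto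

lemma cf_smult:
  assumes "a \<in> carrier S" "r \<in> carrier R" "k \<le> n"
  shows "cf (\<iota> r \<otimes>\<^sub>S a) k = r \<otimes>\<^sub>R cf a k"
  using assms cf by (intro cf_eqI[of "\<iota> r \<otimes>\<^sub>S a" "\<lambda>k. r \<otimes>\<^sub>R cf a k" k] expands_smult) (auto simp: io_simps)

lemma cf_x:
  assumes "a \<in> carrier S" "k \<le> n"
  shows "cf (x \<otimes>\<^sub>S a) k = (if k = 0 then \<zero>\<^sub>R else cf a (k - 1))"
  using assms cf x_closed
  by (intro cf_eqI[of "x \<otimes>\<^sub>S a" "\<lambda>k. if k = 0 then \<zero>\<^sub>R else cf a (k - 1)" k] expands_shift) auto

lemma cf_const:
  assumes "r \<in> carrier R" "k \<le> n"
  shows "cf (\<iota> r) k = (if k = 0 then r else \<zero>\<^sub>R)"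
  using assms
  by (intro cf_eqI[of "\<iota> r" "\<lambda>k. if k = 0 then r else \<zero>\<^sub>R" k] expands_const) (auto simp: io_simps)

lemma cf_one: "k \<le> n ==> cf \<one>\<^sub>S k = (if k = 0 then \<one>\<^sub>R else \<zero>\<^sub>R)"
  using cf_const[of "\<one>\<^sub>R" k] by (simp add: io_simps)

lemma cf_x_pow:
  assumes "a \<in> carrier S" "k \<le> n"
  shows "cf (x [^]\<^sub>S l \<otimes>\<^sub>S a) k = (if k < l then \<zero>\<^sub>R else cf a (k - l))"
  using assms
proof (induction l arbitrary: k)
  case (Suc l)
  have "x [^]\<^sub>S Suc l \<otimes>\<^sub>S a = x \<otimes>\<^sub>S (x [^]\<^sub>S l \<otimes>\<^sub>S a)"
    using Suc.prems x_closed by (simp add: S.m_ac)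
  then show ?case
    using Suc x_closed by (auto simp: cf_x)
qed (simp add: cf)

lemma cf_minus:
  assumes "a \<in> carrier S" "b \<in> carrier S" "k \<le> n"
  shows "cf (a \<ominus>\<^sub>S b) k = cf a k \<ominus>\<^sub>R cf b k"
proof -
  have "(a \<ominus>\<^sub>S b) \<oplus>\<^sub>S b = a"
    using assms by (simp add: a_minus_def S.a_assoc S.l_neg)
  then have "cf a k = cf (a \<ominus>\<^sub>S b) k \<oplus>\<^sub>R cf b k"
    using cf_add[of "a \<ominus>\<^sub>S b" b k] assms by simp
  then show ?thesis
    using cf_closed assms by (simp add: a_minus_def R.a_assoc R.r_neg)
qed

text \<open>This turns membership in powers of the augmentation ideal into vanishing of
  coefficients. A polynomial of length m is recovered from its coefficients, so if these vanish only
  the multiple of x^m remains.\<close>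

lemma cf_vanish:
  assumes "a \<in> carrier S" "m \<le> Suc n"
  shows "(\<exists>y\<in>carrier S. a = x [^]\<^sub>S m \<otimes>\<^sub>S y) \<longleftrightarrow> (\<forall>k<m. cf a k = \<zero>\<^sub>R)"
proof
  assume "\<exists>y\<in>carrier S. a = x [^]\<^sub>S m \<otimes>\<^sub>S y"
  then show "\<forall>k<m. cf a k = \<zero>\<^sub>R"
    using assms(2) by (auto simp: cf_x_pow)
next
  assume van: "\<forall>k<m. cf a k = \<zero>\<^sub>R"
  obtain f where f: "\<And>k. f k \<in> carrier R" "expands m f a"
    using expands_exists[OF assms(1)] by blast
  then obtain y where y: "y \<in> carrier S" "a = horner m f \<oplus>\<^sub>S x [^]\<^sub>S m \<otimes>\<^sub>S y"
    by (auto simp: expands_def)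
  have cfh: "cf (horner l g) k = (if k < l then g k else \<zero>\<^sub>R)" if "\<And>k. g k \<in> carrier R" "k \<le> n" for l g k
    using that
  proof (induction l arbitrary: g k)
    case 0
    then show ?case using cf_const[of "\<zero>\<^sub>R" k] by (simp add: io_simps)
  next
    case (Suc l)
    have c: "horner l (\<lambda>k. g (Suc k)) \<in> carrier S" using Suc.prems by (auto intro: horner_closed)
    show ?case
      using Suc.prems c Suc.IH[of "\<lambda>k. g (Suc k)" "k - 1"] x_closed
      by (cases k) (auto simp: cf_add io_simps cf_const cf_x)
  qed
  have "f k = \<zero>\<^sub>R" if "k < m" for k
  proof -
    have "cf a k = f k \<oplus>\<^sub>R \<zero>\<^sub>R"
      unfolding y(2) using that assms(2) y(1) x_closed horner_closed[OF f(1)]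
      by (subst cf_add) (auto simp: cfh f cf_x_pow)
    then show ?thesis using van that f by simp
  qed
  then have "horner m f = \<zero>\<^sub>S"
    using horner_cong[of m f "\<lambda>k. \<zero>\<^sub>R"] by (simp add: horner_zero)
  then show "\<exists>y\<in>carrier S. a = x [^]\<^sub>S m \<otimes>\<^sub>S y"
    using y x_closed by auto
qed

text \<open>By linearity in b it is enough to multiply a by the monomials of the expansion of b,
  each of which shifts the coefficients of a; the remainder of b starts at x^(n+1) and is
  invisible.\<close>

lemma cf_mult:
  assumes a: "a \<in> carrier S" and b: "b \<in> carrier S" and k: "k \<le> n"
  shows "cf (a \<otimes>\<^sub>S b) k = (\<Oplus>\<^sub>R l\<in>{..k}. cf a (k - l) \<otimes>\<^sub>R cf b l)"
proof -
  have hor: "cf (a \<otimes>\<^sub>S horner m g) k = (\<Oplus>\<^sub>R l\<in>{..<m}. if l \<le> k then cf a (k - l) \<otimes>\<^sub>R g l else \<zero>\<^sub>R)"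
    if g: "\<And>k. g k \<in> carrier R" for m g
  proof (induction m)
    case 0
    then show ?case
      using a k cf_const[of "\<zero>\<^sub>R" k] by (simp add: io_simps)
  next
    case (Suc m)
    have "a \<otimes>\<^sub>S horner (Suc m) g = a \<otimes>\<^sub>S horner m g \<oplus>\<^sub>S \<iota> (g m) \<otimes>\<^sub>S (x [^]\<^sub>S m \<otimes>\<^sub>S a)"
      unfolding horner_snoc[OF g] using a g x_closed horner_closed[OF g]
      by (simp add: S.r_distr io_simps S.m_ac)
    then have "cf (a \<otimes>\<^sub>S horner (Suc m) g) k =
        cf (a \<otimes>\<^sub>S horner m g) k \<oplus>\<^sub>R g m \<otimes>\<^sub>R (if k < m then \<zero>\<^sub>R else cf a (k - m))"
      using a g x_closed horner_closed[OF g] k by (simp add: cf_add cf_smult cf_x_pow io_simps)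
    also have "\<dots> = (\<Oplus>\<^sub>R l\<in>{..<Suc m}. if l \<le> k then cf a (k - l) \<otimes>\<^sub>R g l else \<zero>\<^sub>R)"
      unfolding Suc lessThan_Suc using a g cf_closed[OF a]
      by (subst R.finsum_insert) (auto simp: R.m_comm R.a_comm)
    finally show ?case .
  qed
  obtain y where y: "y \<in> carrier S" "b = horner (Suc n) (cf b) \<oplus>\<^sub>S x [^]\<^sub>S Suc n \<otimes>\<^sub>S y"
    using cf_expands[OF b] by (auto simp: expands_def)
  have hc: "horner (Suc n) (cf b) \<in> carrier S" using cf_closed[OF b] by (rule horner_closed)
  have "a \<otimes>\<^sub>S b = a \<otimes>\<^sub>S horner (Suc n) (cf b) \<oplus>\<^sub>S x [^]\<^sub>S Suc n \<otimes>\<^sub>S (a \<otimes>\<^sub>S y)"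
    by (subst y(2)) (use a y(1) x_closed hc in \<open>simp add: S.r_distr S.m_ac del: horner.simps\<close>)
  then have "cf (a \<otimes>\<^sub>S b) k = cf (a \<otimes>\<^sub>S horner (Suc n) (cf b)) k \<oplus>\<^sub>R \<zero>\<^sub>R"
    using a y(1) x_closed hc k cf_x_pow[of "a \<otimes>\<^sub>S y" k "Suc n"] by (simp add: cf_add del: horner.simps S.nat_pow_Suc)
  also have "\<dots> = (\<Oplus>\<^sub>R l\<in>{..<Suc n}. if l \<le> k then cf a (k - l) \<otimes>\<^sub>R cf b l else \<zero>\<^sub>R)"
    using hor[of "cf b" "Suc n", OF cf_closed[OF b]] cf_closed[OF a] cf_closed[OF b]
    by (simp add: R.finsum_closed Pi_def del: horner.simps)
  also have "\<dots> = (\<Oplus>\<^sub>R l\<in>{..k}. cf a (k - l) \<otimes>\<^sub>R cf b l)"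
    using k cf_closed[OF a] cf_closed[OF b]
    by (intro R.add.finprod_mono_neutral_cong_right) auto
  finally show ?thesis .
qed

end

section \<open>Quotients of the \<open>p\<close>-adic integers\<close>

locale Zp_quotient = p_adic p + R: cring R
  for p :: nat and R :: "('r, 'y) ring_scheme" +
  fixes q :: "(nat => int) => 'r"
  assumes q_hom: "q \<in> ring_hom (Zp p) R" and q_surj: "q ` carrier (Zp p) = carrier R"
begin

definition nu :: "int => 'r" where "nu z = q (Zp_int p z)"

lemma q_simps:
  "a \<in> carrier (Zp p) ==> q a \<in> carrier R"
  "a \<in> carrier (Zp p) ==> b \<in> carrier (Zp p) ==> q (a \<oplus>\<^sub>(Zp p) b) = q a \<oplus>\<^sub>R q b"
  "a \<in> carrier (Zp p) ==> b \<in> carrier (Zp p) ==> q (a \<otimes>\<^sub>(Zp p) b) = q a \<otimes>\<^sub>R q b"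
  "q \<one>\<^sub>(Zp p) = \<one>\<^sub>R" "q \<zero>\<^sub>(Zp p) = \<zero>\<^sub>R"
  using ring_hom_zero[OF q_hom Z.ring_axioms R.ring_axioms]
  by (auto simp: ring_hom_closed[OF q_hom] ring_hom_add[OF q_hom] ring_hom_mult[OF q_hom] ring_hom_one[OF q_hom])

lemma q_surjE:
  assumes "r \<in> carrier R"
  obtains z where "z \<in> carrier (Zp p)" "q z = r"
  using assms unfolding q_surj[symmetric] by blast

lemma nu_simps:
  "nu i \<in> carrier R" "nu (i + j) = nu i \<oplus>\<^sub>R nu j" "nu (i * j) = nu i \<otimes>\<^sub>R nu j"
  "nu 1 = \<one>\<^sub>R" "nu 0 = \<zero>\<^sub>R"
  by (simp_all add: nu_def q_simps Zp_int_closed Zp_int_add Zp_int_mult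
      Zp_one_eq[symmetric] Zp_zero_eq[symmetric])

text \<open>The two cases are R = Z_p and R = Z/p^a, by the classification of ideals of Z_p.\<close>

lemma q_ker_cases:
  "(\<forall>z\<in>carrier (Zp p). q z = \<zero>\<^sub>R \<longrightarrow> z = \<zero>\<^sub>(Zp p)) \<or>
   (\<exists>a. \<forall>z\<in>carrier (Zp p). q z = \<zero>\<^sub>R \<longleftrightarrow> z a = 0)"
proof -
  let ?B = "{z \<in> carrier (Zp p). q z = \<zero>\<^sub>R}"
  have "?B \<subseteq> {\<zero>\<^sub>(Zp p)} \<or> (\<exists>i. ?B = Zp_ker p i)"
    by (rule Zp_ideal_cases) (auto simp: q_simps)
  then show ?thesis
  proof
    assume "\<exists>i. ?B = Zp_ker p i"
    then obtain i where i: "?B = Zp_ker p i" by blast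
    then have "\<forall>z\<in>carrier (Zp p). q z = \<zero>\<^sub>R \<longleftrightarrow> z i = 0"
      by (auto simp: Zp_ker_def set_eq_iff)
    then show ?thesis by blast
  qed auto
qed

text \<open>For R = Z_p all components of a lift vanish. For R = Z/p^a the exponent i = a already
  gives zero.\<close>

lemma separated:
  assumes r: "r \<in> carrier R" and div: "\<And>i. \<exists>s\<in>carrier R. r = nu (int p ^ i) \<otimes>\<^sub>R s"
  shows "r = \<zero>\<^sub>R"
  using q_ker_cases
proof
  assume inj: "\<forall>z\<in>carrier (Zp p). q z = \<zero>\<^sub>R \<longrightarrow> z = \<zero>\<^sub>(Zp p)"
  obtain z where z: "z \<in> carrier (Zp p)" "r = q z" using r q_surj by auto
  have "z i = 0" for i
  proof -
    obtain s where s: "s \<in> carrier R" "r = nu (int p ^ i) \<otimes>\<^sub>R s" using div by blast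
    obtain y where y0: "y \<in> carrier (Zp p)" "q y = s" using q_surjE[OF s(1)] .
    then have y: "y \<in> carrier (Zp p)" "q z = q (Zp_int p (int p ^ i) \<otimes>\<^sub>(Zp p) y)"
      using s z(2) by (auto simp: nu_def q_simps Zp_int_closed)
    let ?w = "Zp_int p (int p ^ i) \<otimes>\<^sub>(Zp p) y"
    have wc: "?w \<in> carrier (Zp p)" using y by (simp add: Zp_int_closed)
    have "q (\<ominus>\<^sub>(Zp p) ?w) = \<ominus>\<^sub>R q ?w"
      by (rule additive_minus[OF Z.abelian_group_axioms R.abelian_group_axioms q_simps(1,2) wc])
    then have "q (z \<ominus>\<^sub>(Zp p) ?w) = q z \<ominus>\<^sub>R q ?w"
      by (simp only: a_minus_def q_simps(2)[OF z(1) Z.a_inv_closed[OF wc]])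
    also have "\<dots> = \<zero>\<^sub>R"
      using y(2) q_simps(1)[OF wc] by (simp add: R.minus_eq_zero_iff)
    finally have "q (z \<ominus>\<^sub>(Zp p) ?w) = \<zero>\<^sub>R" .
    then have "z \<ominus>\<^sub>(Zp p) ?w = \<zero>\<^sub>(Zp p)" using inj z(1) wc by auto
    then have "z = ?w" using z(1) wc by (simp add: Z.minus_eq_zero_iff)
    then show ?thesis using Zp_ker_mult[OF y(1), of i] by (simp add: Zp_ker_def)
  qed
  then have "z = \<zero>\<^sub>(Zp p)" by (simp add: fun_eq_iff Zp_simps)
  then show ?thesis using z by (simp add: q_simps)
next
  assume "\<exists>a. \<forall>z\<in>carrier (Zp p). q z = \<zero>\<^sub>R \<longleftrightarrow> z a = 0"
  then obtain a where a: "\<forall>z\<in>carrier (Zp p). q z = \<zero>\<^sub>R \<longleftrightarrow> z a = 0" by blast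
  obtain s where s: "s \<in> carrier R" "r = nu (int p ^ a) \<otimes>\<^sub>R s" using div by blast
  have "nu (int p ^ a) = \<zero>\<^sub>R"
    unfolding nu_def using a by (simp add: Zp_int_closed) (simp add: Zp_int_def)
  then show ?thesis using s by simp
qed

text \<open>The coefficients are lifted to Z_p, where the solving series converges, and the solution
  is mapped back to R.\<close>

lemma R_recursion:
  assumes "\<And>k. d k \<in> carrier R"
  obtains c where "\<And>k. c k \<in> carrier R" "\<And>k. c k = d k \<oplus>\<^sub>R nu (int p) \<otimes>\<^sub>R c (Suc k)"
proof -
  have "\<exists>z. z \<in> carrier (Zp p) \<and> q z = d k" for k
    using q_surjE[OF assms[of k]] by metis
  then obtain e where e: "\<And>k. e k \<in> carrier (Zp p)" "\<And>k. q (e k) = d k" by metis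
  obtain c where c: "\<And>k. c k \<in> carrier (Zp p)"
    "\<And>k. c k = e k \<oplus>\<^sub>(Zp p) Zp_int p (int p) \<otimes>\<^sub>(Zp p) c (Suc k)"
    using Zp_recursion[of e] e(1) by blast
  show ?thesis
  proof (rule that[of "\<lambda>k. q (c k)"])
    fix k
    show "q (c k) = d k \<oplus>\<^sub>R nu (int p) \<otimes>\<^sub>R q (c (Suc k))"
      by (subst c(2)) (simp add: q_simps c(1) e Zp_int_closed nu_def)
  qed (simp add: q_simps c(1))
qed

lemma finsum_const_nu:
  assumes "c \<in> carrier R"
  shows "(\<Oplus>\<^sub>R l\<in>{..<m}. c) = nu (int m) \<otimes>\<^sub>R c"
proof (induction m)
  case (Suc m)
  have "(\<Oplus>\<^sub>R l\<in>{..<Suc m}. c) = c \<oplus>\<^sub>R nu (int m) \<otimes>\<^sub>R c"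
    unfolding lessThan_Suc Suc[symmetric] using assms by (subst R.finsum_insert) auto
  then show ?case using assms by (simp add: nu_simps R.l_distr)
qed (simp add: nu_simps assms)

end

section \<open>The completed group ring of a procyclic pro-\<open>p\<close> group\<close>

lemma (in group) rcos_eq_iff:
  assumes "subgroup N G" "g \<in> carrier G" "a \<in> carrier G"
  shows "N #> g = N #> a \<longleftrightarrow> g \<otimes> inv a \<in> N"
proof
  assume "N #> g = N #> a"
  then have "g \<in> N #> a" using rcos_self[OF assms(2,1)] by auto
  then show "g \<otimes> inv a \<in> N"
    using subgroup.rcos_module_imp[OF assms(1) is_group assms(3)] by simp
next
  assume "g \<otimes> inv a \<in> N"
  then have "g \<in> N #> a"
    using subgroup.rcos_module_rev[OF assms(1) is_group assms(3,2)] by simp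
  then show "N #> g = N #> a"
    using repr_independence[OF _ assms(3,1)] by simp
qed

text \<open>H is presented as a quotient of the additive group of Z_p, infinite or of order p^a. Its
  topology enters only through \<open>ON_eq\<close>, the list of open normal subgroups as images of
  p^j Z_p.\<close>

locale Zp_tower = cgr_base H R + Zp_quotient p R q + HC: comm_group H
  for H :: "('h, 'x) topgroup_scheme" and R :: "('r, 'y) topring_scheme" and p q +
  fixes sig :: "(nat => int) => 'h"
  assumes sig_closed: "z \<in> carrier (Zp p) ==> sig z \<in> carrier H"
    and sig_add: "z \<in> carrier (Zp p) ==> w \<in> carrier (Zp p) ==>
      sig (z \<oplus>\<^sub>(Zp p) w) = sig z \<otimes>\<^sub>H sig w"
    and sig_surj: "C \<in> carrier H ==> \<exists>z\<in>carrier (Zp p). sig z = C"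
    and ON_eq: "open_normals H = range (\<lambda>j. sig ` Zp_ker p j)"
    and sig_ker: "(\<forall>z\<in>carrier (Zp p). sig z = \<one>\<^sub>H \<longrightarrow> z = \<zero>\<^sub>(Zp p)) \<or>
      (\<exists>a. \<forall>z\<in>carrier (Zp p). sig z = \<one>\<^sub>H \<longleftrightarrow> z a = 0)"
begin

definition Nn :: "nat => 'h set" where "Nn j = sig ` Zp_ker p j"

text \<open>The levels \<open>j\<close> at which \<open>H\<close> has a quotient of order \<open>p^j\<close>.\<close>

definition levels :: "nat set" where
  "levels = {j. \<forall>z\<in>carrier (Zp p). sig z = \<one>\<^sub>H \<longrightarrow> z j = 0}"

definition cs :: "nat => int => 'h set" where "cs j i = Nn j #>\<^sub>H sig (Zp_int p i)"

text \<open>Indexing cosets by integers rather than residues lets translation be written as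
  \<open>i - 1\<close>, with no wrap-around to treat.\<close>

definition co :: "('h set => 'h set => 'r) => nat => int => 'r" where "co a j i = a (Nn j) (cs j i)"

lemma sig_zero: "sig \<zero>\<^sub>(Zp p) = \<one>\<^sub>H"
  using sig_add[of "\<zero>\<^sub>(Zp p)" "\<zero>\<^sub>(Zp p)"] sig_closed[of "\<zero>\<^sub>(Zp p)"] G.l_cancel_one by simp

lemma sig_neg: "z \<in> carrier (Zp p) ==> sig (\<ominus>\<^sub>(Zp p) z) = inv\<^bsub>H\<^esub> sig z"
  using sig_add[of "\<ominus>\<^sub>(Zp p) z" z] sig_closed[of z] sig_closed[of "\<ominus>\<^sub>(Zp p) z"]
  by (intro G.inv_equality[symmetric]) (auto simp: Z.l_neg sig_zero)

lemma sig_minus: "z \<in> carrier (Zp p) ==> w \<in> carrier (Zp p) ==>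
    sig (z \<ominus>\<^sub>(Zp p) w) = sig z \<otimes>\<^sub>H inv\<^bsub>H\<^esub> sig w"
  by (simp add: a_minus_def sig_add sig_neg)

lemma Nn_open: "Nn j \<in> ON"
  unfolding Nn_def ON_eq by blast

lemma comp_le: "z \<in> carrier (Zp p) ==> z j = 0 ==> i \<le> j ==> z i = 0"
  using Zp_mod[of z i j] by simp

lemma comp_minus_zero:
  assumes "z \<in> carrier (Zp p)" "w \<in> carrier (Zp p)"
  shows "(z \<ominus>\<^sub>(Zp p) w) j = 0 \<longleftrightarrow> z j = w j"
proof -
  have "(z j - w j) mod int p ^ j = 0 \<longleftrightarrow> z j mod int p ^ j = w j mod int p ^ j"
    by (simp add: mod_eq_dvd_iff mod_eq_0_iff_dvd)
  then show ?thesis using assms ZpD(1) by (simp add: Zp_minus)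
qed

lemma levels_down: "j \<in> levels ==> i \<le> j ==> i \<in> levels"
  unfolding levels_def using comp_le by blast

lemma sig_mem_Nn:
  assumes "j \<in> levels" "z \<in> carrier (Zp p)"
  shows "sig z \<in> Nn j \<longleftrightarrow> z j = 0"
proof
  assume "sig z \<in> Nn j"
  then obtain w where w: "w \<in> carrier (Zp p)" "w j = 0" "sig z = sig w"
    by (auto simp: Nn_def Zp_ker_def)
  then have "sig (z \<ominus>\<^sub>(Zp p) w) = \<one>\<^sub>H"
    using assms(2) sig_closed[of w] by (simp add: sig_minus)
  then have "(z \<ominus>\<^sub>(Zp p) w) j = 0" using assms w(1) by (auto simp: levels_def)
  then show "z j = 0" using comp_minus_zero[OF assms(2) w(1)] w(2) by simp
next
  assume "z j = 0"
  then show "sig z \<in> Nn j" using assms(2) by (auto simp: Nn_def Zp_ker_def)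
qed

lemma Nn_mono: "i \<le> j ==> Nn j \<subseteq> Nn i"
  unfolding Nn_def Zp_ker_def using comp_le by blast

lemma Nn_mono_iff:
  assumes "i \<in> levels" "j \<in> levels"
  shows "Nn j \<subseteq> Nn i \<longleftrightarrow> i \<le> j"
proof
  assume sub: "Nn j \<subseteq> Nn i"
  have "sig (Zp_int p (int p ^ j)) \<in> Nn j"
    using assms by (subst sig_mem_Nn) (auto simp: Zp_int_closed, simp add: Zp_int_def)
  then have "Zp_int p (int p ^ j) i = 0"
    using sub sig_mem_Nn[OF assms(1) Zp_int_closed] by auto
  then have "int p ^ i dvd int p ^ j" by (simp add: Zp_int_def mod_eq_0_iff_dvd)
  then have "p ^ i dvd p ^ j" by (metis of_nat_dvd_iff of_nat_power)
  then show "i \<le> j" using p_gt_1 by (simp add: power_dvd_imp_le)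
qed (rule Nn_mono)

lemma Nn_inj: "i \<in> levels ==> j \<in> levels ==> Nn i = Nn j ==> i = j"
  using Nn_mono_iff[of i j] Nn_mono_iff[of j i] by auto

text \<open>If H has order p^a, the images of p^j Z_p are trivial for all j \<ge> a, so j may be cut
  down to a. On \<open>levels\<close> distinct indices give distinct subgroups.\<close>

lemma open_normal_level:
  assumes "N \<in> ON"
  shows "\<exists>j\<in>levels. N = Nn j"
proof -
  obtain j where j: "N = Nn j" using assms by (auto simp: ON_eq Nn_def)
  show ?thesis using sig_ker
  proof
    assume "\<forall>z\<in>carrier (Zp p). sig z = \<one>\<^sub>H \<longrightarrow> z = \<zero>\<^sub>(Zp p)"
    then have "j \<in> levels" by (auto simp: levels_def Zp_simps(4))
    with j show ?thesis by blast
  next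
    assume "\<exists>a. \<forall>z\<in>carrier (Zp p). sig z = \<one>\<^sub>H \<longleftrightarrow> z a = 0"
    then obtain a where a: "\<forall>z\<in>carrier (Zp p). sig z = \<one>\<^sub>H \<longleftrightarrow> z a = 0" by blast
    then have al: "a \<in> levels" by (auto simp: levels_def)
    show ?thesis
    proof (cases "j \<le> a")
      case True
      then show ?thesis using j levels_down[OF al] by blast
    next
      case False
      have one: "Nn i = {\<one>\<^sub>H}" if "a \<le> i" for i
      proof
        show "Nn i \<subseteq> {\<one>\<^sub>H}"
          unfolding Nn_def Zp_ker_def using a comp_le that by blast
        show "{\<one>\<^sub>H} \<subseteq> Nn i"
          using sig_zero unfolding Nn_def Zp_ker_def by (auto simp: Zp_simps(4) intro!: image_eqI[of _ _ "\<zero>\<^sub>(Zp p)"])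
      qed
      have "N = Nn a" using one[of j] one[of a] False j by simp
      with al show ?thesis by blast
    qed
  qed
qed

lemma sig_coset_eq_iff:
  assumes "j \<in> levels" "z \<in> carrier (Zp p)" "w \<in> carrier (Zp p)"
  shows "Nn j #>\<^sub>H sig z = Nn j #>\<^sub>H sig w \<longleftrightarrow> z j = w j"
  using assms sig_mem_Nn[OF assms(1), of "z \<ominus>\<^sub>(Zp p) w"] comp_minus_zero[OF assms(2,3)]
  by (subst G.rcos_eq_iff[OF ON_subgroup[OF Nn_open]]) (auto simp: sig_closed sig_minus)

lemma sig_coset:
  assumes "j \<in> levels" "z \<in> carrier (Zp p)"
  shows "Nn j #>\<^sub>H sig z = cs j (z j)"
  unfolding cs_def using assms by (subst sig_coset_eq_iff) (auto simp: Zp_int_closed, simp add: Zp_int_def ZpD(1))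

lemma cs_closed: "cs j i \<in> carrier (H Mod Nn j)"
  unfolding cs_def Mod_carrier using sig_closed[OF Zp_int_closed] by blast

lemma cs_eq_iff: "j \<in> levels ==> cs j i = cs j i' \<longleftrightarrow> i mod int p ^ j = i' mod int p ^ j"
  unfolding cs_def by (subst sig_coset_eq_iff) (auto simp: Zp_int_closed, simp_all add: Zp_int_def)

lemma cs_E:
  assumes "j \<in> levels" "C \<in> carrier (H Mod Nn j)"
  obtains i where "0 \<le> i" "i < int p ^ j" "C = cs j i"
proof -
  obtain c where c: "c \<in> carrier H" "C = Nn j #>\<^sub>H c" using assms(2) by (auto simp: Mod_carrier)
  then obtain z where z: "z \<in> carrier (Zp p)" "c = sig z" using sig_surj by blast
  then show ?thesis
    using that[of "z j"] sig_coset[OF assms(1) z(1)] ZpD(3,4)[OF z(1), of j] c by simp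
qed

lemma cs_trans:
  assumes "j \<le> k"
  shows "(\<Union>d\<in>cs k i. Nn j #>\<^sub>H d) = cs j i"
  unfolding cs_def
  by (rule coset_trans[OF Nn_open Nn_open Nn_mono[OF assms] sig_closed[OF Zp_int_closed]])

lemma cs_fibre:
  assumes "Suc j \<in> levels"
  shows "{D \<in> carrier (H Mod Nn (Suc j)). D \<subseteq> cs j i} = (\<lambda>l. cs (Suc j) (i + int l * int p ^ j)) ` {..<p}"
    and "inj_on (\<lambda>l. cs (Suc j) (i + int l * int p ^ j)) {..<p}"
proof -
  have j: "j \<in> levels" using levels_down[OF assms, of j] by simp
  note fib = coset_fibre[OF Nn_open Nn_open Nn_mono[of j "Suc j"] cs_closed[of j i], simplified]
  show "{D \<in> carrier (H Mod Nn (Suc j)). D \<subseteq> cs j i} = (\<lambda>l. cs (Suc j) (i + int l * int p ^ j)) ` {..<p}"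
    unfolding fib
  proof (intro equalityI subsetI)
    fix D assume "D \<in> {D \<in> carrier (H Mod Nn (Suc j)). (\<Union>d\<in>D. Nn j #>\<^sub>H d) = cs j i}"
    then have D: "D \<in> carrier (H Mod Nn (Suc j))" "(\<Union>d\<in>D. Nn j #>\<^sub>H d) = cs j i" by auto
    obtain i' where i': "D = cs (Suc j) i'" using cs_E[OF assms D(1)] by blast
    then have "cs j i' = cs j i" using D(2) cs_trans[of j "Suc j" i'] by simp
    then have "int p ^ j dvd i' - i" using cs_eq_iff[OF j] by (simp add: mod_eq_dvd_iff)
    then obtain k where k: "i' = i + k * int p ^ j" by (metis add.commute diff_add_cancel dvd_def mult.commute)
    \<comment> \<open>Adding a multiple of p^(j+1) does not change the coset at level j + 1, so only
      k modulo p matters.\<close>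
    define l where "l = nat (k mod int p)"
    have l: "l < p" "int l = k mod int p" using p_gt_1 by (simp_all add: l_def nat_less_iff)
    have "int p ^ Suc j dvd i' - (i + int l * int p ^ j)"
    proof -
      have "int p dvd k - int l" unfolding l(2) by (simp add: mod_eq_dvd_iff[symmetric])
      then obtain t where "k - int l = int p * t" by (rule dvdE)
      then have "i' - (i + int l * int p ^ j) = int p ^ Suc j * t"
        using k by (simp add: algebra_simps)
      then show ?thesis by simp
    qed
    then have "D = cs (Suc j) (i + int l * int p ^ j)"
      unfolding i' using cs_eq_iff[OF assms] by (simp add: mod_eq_dvd_iff)
    then show "D \<in> (\<lambda>l. cs (Suc j) (i + int l * int p ^ j)) ` {..<p}" using l by blast
  next
    fix D assume "D \<in> (\<lambda>l. cs (Suc j) (i + int l * int p ^ j)) ` {..<p}"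
    then obtain l where l: "D = cs (Suc j) (i + int l * int p ^ j)" by blast
    have "cs j (i + int l * int p ^ j) = cs j i" using cs_eq_iff[OF j] by simp
    then show "D \<in> {D \<in> carrier (H Mod Nn (Suc j)). (\<Union>d\<in>D. Nn j #>\<^sub>H d) = cs j i}"
      unfolding l using cs_closed cs_trans[of j "Suc j" "i + int l * int p ^ j"] by simp
  qed
  show "inj_on (\<lambda>l. cs (Suc j) (i + int l * int p ^ j)) {..<p}"
  proof (rule inj_onI)
    fix l m assume lm: "l \<in> {..<p}" "m \<in> {..<p}"
      "cs (Suc j) (i + int l * int p ^ j) = cs (Suc j) (i + int m * int p ^ j)"
    then have "int p * int p ^ j dvd (int l - int m) * int p ^ j"
      using cs_eq_iff[OF assms] by (simp add: mod_eq_dvd_iff algebra_simps)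
    then have "int p dvd int l - int m" using p_gt_1 by simp
    then have "int l mod int p = int m mod int p" by (simp add: mod_eq_dvd_iff)
    then show "l = m" using lm(1,2) by simp
  qed
qed

lemma co_closed: "a \<in> carrier CG ==> co a j i \<in> carrier R"
  unfolding co_def by (rule CG_eval[OF _ Nn_open cs_closed])

lemma co_compat:
  assumes "a \<in> carrier CG" "Suc j \<in> levels"
  shows "co a j i = (\<Oplus>\<^sub>R l\<in>{..<p}. co a (Suc j) (i + int l * int p ^ j))"
proof -
  have "co a j i = (\<Oplus>\<^sub>R D\<in>(\<lambda>l. cs (Suc j) (i + int l * int p ^ j)) ` {..<p}. a (Nn (Suc j)) D)"
    unfolding co_def cs_fibre(1)[OF assms(2), symmetric]
    by (rule CGD(2)[OF assms(1) Nn_open Nn_open Nn_mono cs_closed]) simp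
  also have "\<dots> = (\<Oplus>\<^sub>R l\<in>{..<p}. a (Nn (Suc j)) (cs (Suc j) (i + int l * int p ^ j)))"
    using co_closed[OF assms(1)] unfolding co_def
    by (intro R.finsum_reindex cs_fibre(2)[OF assms(2)]) auto
  finally show ?thesis by (simp add: co_def)
qed

lemma co_ext:
  assumes "a \<in> carrier CG" "b \<in> carrier CG" "\<And>j i. j \<in> levels ==> co a j i = co b j i"
  shows "a = b"
proof (rule CG_ext'[OF assms(1,2)])
  fix N C assume N: "N \<in> ON" and C: "C \<in> carrier (H Mod N)"
  obtain j where j: "j \<in> levels" "N = Nn j" using open_normal_level[OF N] by blast
  obtain i where "C = cs j i" using cs_E[OF j(1)] C j(2) by blast
  then show "a N C = b N C" using assms(3)[OF j(1), of i] j(2) by (simp add: co_def)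
qed

lemma co_mod: "j \<in> levels ==> i mod int p ^ j = i' mod int p ^ j ==> co a j i = co a j i'"
  unfolding co_def using cs_eq_iff by metis

text \<open>The converse of \<open>co_compat\<close>, used to construct elements of the inverse
  limit. Compatibility is demanded between consecutive levels only, because the transition maps
  between distant levels are composites.\<close>

lemma family_exists:
  assumes sc: "\<And>j i. s j i \<in> carrier R"
    and per: "\<And>j i i'. j \<in> levels ==> i mod int p ^ j = i' mod int p ^ j ==> s j i = s j i'"
    and comp: "\<And>j i. Suc j \<in> levels ==> 0 \<le> i ==> i < int p ^ j ==>
      s j i = (\<Oplus>\<^sub>R l\<in>{..<p}. s (Suc j) (i + int l * int p ^ j))"
  obtains a where "a \<in> carrier CG" "\<And>j i. j \<in> levels ==> co a j i = s j i"
proof -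
  \<comment> \<open>\<open>jj\<close> and \<open>ii\<close> recover a level and an integer from a
    coset. The level is unique by \<open>Nn_inj\<close>; the integer is unique modulo p^j only, and
    \<open>per\<close> absorbs this ambiguity.\<close>
  define jj where "jj N = (SOME j. j \<in> levels \<and> N = Nn j)" for N
  define ii where "ii N C = (SOME i. C = cs (jj N) i)" for N C
  define a where "a N = (\<lambda>C\<in>carrier (H Mod N). s (jj N) (ii N C))" for N
  have jj: "jj (Nn j) = j" if "j \<in> levels" for j
  proof -
    have "jj (Nn j) \<in> levels \<and> Nn j = Nn (jj (Nn j))"
      unfolding jj_def by (rule someI[of _ j]) (use that in simp)
    then show ?thesis using Nn_inj that by metis
  qed
  have a_cs: "a (Nn j) (cs j i) = s j i" if j: "j \<in> levels" for j i
  proof -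
    have "cs j i = cs j (ii (Nn j) (cs j i))"
      unfolding ii_def jj[OF j] by (rule someI[of _ i]) simp
    from per[OF j iffD1[OF cs_eq_iff[OF j] this]] show ?thesis
      by (simp add: a_def jj[OF j] cs_closed)
  qed
  have ac: "a N \<in> carrier (GR N)" if "N \<in> ON" for N
    unfolding a_def by (rule finite_group_ring.RQ_closedI[OF FR[OF that]]) (rule sc)
  have adj: "a (Nn j) C = (\<Oplus>\<^sub>R D\<in>{D \<in> carrier (H Mod Nn (Suc j)). D \<subseteq> C}. a (Nn (Suc j)) D)"
    if j: "Suc j \<in> levels" and C: "C \<in> carrier (H Mod Nn j)" for j C
  proof -
    have j': "j \<in> levels" using levels_down[OF j, of j] by simp
    obtain i where i: "0 \<le> i" "i < int p ^ j" "C = cs j i" using cs_E[OF j' C] .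
    have "(\<Oplus>\<^sub>R D\<in>{D \<in> carrier (H Mod Nn (Suc j)). D \<subseteq> C}. a (Nn (Suc j)) D) =
        (\<Oplus>\<^sub>R l\<in>{..<p}. a (Nn (Suc j)) (cs (Suc j) (i + int l * int p ^ j)))"
      unfolding i(3) cs_fibre(1)[OF j]
      by (rule R.finsum_reindex[OF _ cs_fibre(2)[OF j]]) (auto simp: a_cs[OF j] sc)
    also have "\<dots> = a (Nn j) C"
      using comp[OF j i(1,2)] by (simp add: a_cs[OF j] a_cs[OF j'] i(3))
    finally show ?thesis by simp
  qed
  have gen: "a (Nn j) C = (\<Oplus>\<^sub>R D\<in>{D \<in> carrier (H Mod Nn k). D \<subseteq> C}. a (Nn k) D)"
    if jk: "j \<le> k" and k: "k \<in> levels" and C: "C \<in> carrier (H Mod Nn j)" for j k C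
    using jk k
  proof (induction k rule: dec_induct)
    case base
    have "{D \<in> carrier (H Mod Nn j). D \<subseteq> C} = {C}"
    proof -
      have "{D \<in> carrier (H Mod Nn j). D \<subseteq> C} = {D \<in> carrier (H Mod Nn j). (\<Union>d\<in>D. Nn j #>\<^sub>H d) = C}"
        by (rule coset_fibre[OF Nn_open Nn_open order_refl C])
      also have "\<dots> = {D \<in> carrier (H Mod Nn j). D = C}"
        unfolding Mod_carrier using coset_trans[OF Nn_open Nn_open order_refl] by blast
      also have "\<dots> = {C}" using C by auto
      finally show ?thesis .
    qed
    moreover have "a (Nn j) C \<in> carrier R"
      using C by (simp add: a_def sc)
    ultimately show ?case by simp
  next
    case (step k)
    have k': "k \<in> levels" using levels_down[OF step.prems, of k] by simp
    let ?A = "{D \<in> carrier (H Mod Nn (Suc k)). D \<subseteq> C}" and ?B = "{E \<in> carrier (H Mod Nn k). E \<subseteq> C}"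
    \<comment> \<open>The transition map from level k + 1 to level k. It partitions the cosets of
      \<open>?A\<close> according to the cosets of \<open>?B\<close>, which reduces the sum over
      \<open>?A\<close> to one-step sums and the induction hypothesis.\<close>
    let ?f = "\<lambda>D. \<Union>d\<in>D. Nn k #>\<^sub>H d"
    have fh: "?f D \<in> carrier (H Mod Nn k)" if "D \<in> carrier (H Mod Nn (Suc k))" for D
      using hom_in_carrier[OF coset_trans_hom[OF Nn_open Nn_open Nn_mono, of k "Suc k"] that] by simp
    have ft: "(\<Union>d\<in>?f D. Nn j #>\<^sub>H d) = (\<Union>d\<in>D. Nn j #>\<^sub>H d)" if D: "D \<in> carrier (H Mod Nn (Suc k))" for D
    proof -
      obtain i where i: "D = cs (Suc k) i" using cs_E[OF step.prems D] by blast
      show ?thesis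
        unfolding i cs_trans[OF le_SucI[OF order_refl], of k] cs_trans[OF step.hyps(1)]
          cs_trans[OF le_SucI[OF step.hyps(1)]] ..
    qed
    have fA': "?A = {D \<in> carrier (H Mod Nn (Suc k)). (\<Union>d\<in>D. Nn j #>\<^sub>H d) = C}"
      by (rule coset_fibre[OF Nn_open Nn_open Nn_mono[OF le_SucI[OF step.hyps(1)]] C])
    have fB': "?B = {D \<in> carrier (H Mod Nn k). (\<Union>d\<in>D. Nn j #>\<^sub>H d) = C}"
      by (rule coset_fibre[OF Nn_open Nn_open Nn_mono[OF step.hyps(1)] C])
    have fA: "?f ` ?A \<subseteq> ?B"
    proof
      fix E assume "E \<in> ?f ` ?A"
      then obtain D where D: "D \<in> carrier (H Mod Nn (Suc k))" "(\<Union>d\<in>D. Nn j #>\<^sub>H d) = C" "E = ?f D"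
        unfolding fA' by blast
      then show "E \<in> ?B"
        unfolding fB' D(3) using fh[OF D(1)] ft[OF D(1)] by (intro CollectI conjI) simp_all
    qed
    have sub: "{D \<in> ?A. ?f D = E} = {D \<in> carrier (H Mod Nn (Suc k)). D \<subseteq> E}" if "E \<in> ?B" for E
    proof -
      have E: "E \<in> carrier (H Mod Nn k)" "E \<subseteq> C" using that by auto
      have "{D \<in> carrier (H Mod Nn (Suc k)). D \<subseteq> E} = {D \<in> carrier (H Mod Nn (Suc k)). ?f D = E}"
        by (rule coset_fibre[OF Nn_open Nn_open Nn_mono[OF le_SucI[OF order_refl]] E(1)])
      then show ?thesis
        using E(2) by blast
    qed
    have aR: "a (Nn (Suc k)) D \<in> carrier R" if "D \<in> ?A" for D
      using that by (simp add: a_def sc)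
    have "(\<Oplus>\<^sub>R D\<in>?A. a (Nn (Suc k)) D) = (\<Oplus>\<^sub>R E\<in>?B. \<Oplus>\<^sub>R D\<in>{D \<in> ?A. ?f D = E}. a (Nn (Suc k)) D)"
      by (rule R.finsum_fibres[OF _ _ fA, symmetric]) (use aR fin_sub[OF Nn_open] in auto)
    also have "\<dots> = (\<Oplus>\<^sub>R E\<in>?B. a (Nn k) E)"
    proof (rule R.finsum_cong')
      fix E assume E: "E \<in> ?B"
      show "(\<Oplus>\<^sub>R D\<in>{D \<in> ?A. ?f D = E}. a (Nn (Suc k)) D) = a (Nn k) E"
        unfolding sub[OF E] using adj[OF step.prems, of E] E by simp
    qed (auto simp: a_def sc)
    also have "\<dots> = a (Nn j) C" using step.IH[OF k'] by simp
    finally show ?case by simp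
  qed
  have "(\<lambda>N\<in>ON. a N) \<in> carrier CG"
  proof (rule CGI[OF ac])
    fix N M C assume NM: "N \<in> ON" "M \<in> ON" "N \<subseteq> M" "C \<in> carrier (H Mod M)"
    obtain k j where "k \<in> levels" "N = Nn k" "j \<in> levels" "M = Nn j"
      using open_normal_level NM(1,2) by metis
    then show "a M C = (\<Oplus>\<^sub>R D\<in>{D \<in> carrier (H Mod N). D \<subseteq> C}. a N D)"
      using gen[of j k C] NM(3,4) Nn_mono_iff by simp
  qed
  moreover have "co (\<lambda>N\<in>ON. a N) j i = s j i" if "j \<in> levels" for j i
    using a_cs[OF that] by (simp add: co_def Nn_open)
  ultimately show ?thesis using that by blast
qed

end

section \<open>Multiplication by \<open>xx\<close> and the augmentation ideal of R[[H]]\<close>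

context Zp_tower
begin

definition xx :: "'h set => 'h set => 'r" where
  "xx = cgr_elt R H (sig \<one>\<^sub>(Zp p)) \<ominus>\<^sub>CG \<one>\<^sub>CG"

sublocale OC: cring CG
  by (rule CG_cring[OF HC.comm_group_axioms])

lemma elt_closed: "z \<in> carrier (Zp p) ==> cgr_elt R H (sig z) \<in> carrier CG"
  unfolding elt_eq by (rule single_closed) (auto simp: sig_closed)

lemma const_closed: "r \<in> carrier R ==> cgr_const R H r \<in> carrier CG"
  unfolding const_eq by (rule single_closed) auto

lemma xx_closed: "xx \<in> carrier CG"
  unfolding xx_def using elt_closed by simp

lemma elt_xx: "cgr_elt R H (sig \<one>\<^sub>(Zp p)) = \<one>\<^sub>CG \<oplus>\<^sub>CG xx"
proof -
  have "xx \<oplus>\<^sub>CG \<one>\<^sub>CG = cgr_elt R H (sig \<one>\<^sub>(Zp p))"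
    unfolding xx_def using elt_closed[OF Z.one_closed] by (simp add: a_minus_def OC.a_assoc OC.l_neg)
  then show ?thesis using xx_closed by (simp add: OC.a_comm)
qed

lemma elt_add: "z \<in> carrier (Zp p) ==> w \<in> carrier (Zp p) ==>
    cgr_elt R H (sig (z \<oplus>\<^sub>(Zp p) w)) = cgr_elt R H (sig z) \<otimes>\<^sub>CG cgr_elt R H (sig w)"
  unfolding elt_eq by (simp add: sig_add single_mult sig_closed)

lemma elt_zero: "cgr_elt R H (sig \<zero>\<^sub>(Zp p)) = \<one>\<^sub>CG"
  by (simp add: elt_eq CG_one sig_zero)

lemma elt_nat_smult:
  assumes "z \<in> carrier (Zp p)"
  shows "cgr_elt R H (sig (Zp_int p (int m) \<otimes>\<^sub>(Zp p) z)) = cgr_elt R H (sig z) [^]\<^sub>CG m"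
proof (induction m)
  case 0
  then show ?case using assms by (simp add: Zp_zero_eq[symmetric] elt_zero)
next
  case (Suc m)
  have "Zp_int p (int (Suc m)) \<otimes>\<^sub>(Zp p) z = Zp_int p (int m) \<otimes>\<^sub>(Zp p) z \<oplus>\<^sub>(Zp p) z"
    using assms by (simp add: Zp_int_add Zp_one_eq[symmetric] Z.l_distr Zp_int_closed Z.a_comm)
  then show ?case
    using assms Suc by (simp add: elt_add Zp_int_closed)
qed

lemma co_single_mult:
  assumes r: "r \<in> carrier R" and b: "b \<in> carrier CG"
  shows "co (cgr_single R H r (sig (Zp_int p k)) \<otimes>\<^sub>CG b) j i = r \<otimes>\<^sub>R co b j (i - k)"
proof -
  interpret F: finite_group_ring R "H Mod Nn j" by (rule FR[OF Nn_open])
  have m: "(Nn j #>\<^sub>H sig (Zp_int p k)) \<otimes>\<^sub>(H Mod Nn j) cs j (i - k) = cs j i"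
  proof -
    have "sig (Zp_int p k) \<otimes>\<^sub>H sig (Zp_int p (i - k)) = sig (Zp_int p i)"
      using sig_add[OF Zp_int_closed Zp_int_closed, of k "i - k"] Zp_int_add[of k "i - k"] by simp
    then show ?thesis
      unfolding cs_def using Mod_mult[OF Nn_open sig_closed[OF Zp_int_closed] sig_closed[OF Zp_int_closed]] by simp
  qed
  have v: "Nn j #>\<^sub>H sig (Zp_int p k) \<in> carrier (H Mod Nn j)"
    using cs_closed[of j k] by (simp add: cs_def)
  have "inv\<^bsub>H Mod Nn j\<^esub> (Nn j #>\<^sub>H sig (Zp_int p k)) \<otimes>\<^sub>(H Mod Nn j) cs j i = cs j (i - k)"
    by (subst m[symmetric]) (rule F.Q.inv_solve_left'[OF _ v, THEN iffD2], use v cs_closed in \<open>auto intro: F.Q.m_closed simp del: mult_FactGroup\<close>)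
  then show ?thesis
    unfolding co_def CG_simps(3)[OF Nn_open] single_eval[OF Nn_open]
    by (subst F.single_mult[OF r v CGD(1)[OF b Nn_open] cs_closed]) (simp only:)
qed

lemma co_add: "a \<in> carrier CG ==> b \<in> carrier CG ==> co (a \<oplus>\<^sub>CG b) j i = co a j i \<oplus>\<^sub>R co b j i"
  unfolding co_def CG_simps(2)[OF Nn_open] by (rule finite_group_ring.RQ_add[OF FR[OF Nn_open] cs_closed])

lemma co_zero: "co \<zero>\<^sub>CG j i = \<zero>\<^sub>R"
  unfolding co_def CG_simps(4)[OF Nn_open] by (rule finite_group_ring.RQ_zero[OF FR[OF Nn_open] cs_closed])

lemma co_minus:
  assumes "a \<in> carrier CG" "b \<in> carrier CG"
  shows "co (a \<ominus>\<^sub>CG b) j i = co a j i \<ominus>\<^sub>R co b j i"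
proof -
  have "(a \<ominus>\<^sub>CG b) \<oplus>\<^sub>CG b = a"
    using assms by (simp add: a_minus_def OC.a_assoc OC.l_neg)
  then have "co a j i = co (a \<ominus>\<^sub>CG b) j i \<oplus>\<^sub>R co b j i"
    using co_add[of "a \<ominus>\<^sub>CG b" b j i] assms by simp
  then show ?thesis
    using co_closed assms by (simp add: a_minus_def R.a_assoc R.r_neg)
qed

text \<open>As x = [h] - 1, multiplication by x is a difference operator on coefficients. Dividing
  by x thus means summing coefficients, and the annihilator of x consists of families constant at
  each level.\<close>

lemma co_xx:
  assumes b: "b \<in> carrier CG"
  shows "co (xx \<otimes>\<^sub>CG b) j i = co b j (i - 1) \<ominus>\<^sub>R co b j i"
proof -
  have "xx \<otimes>\<^sub>CG b = cgr_elt R H (sig \<one>\<^sub>(Zp p)) \<otimes>\<^sub>CG b \<ominus>\<^sub>CG b"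
    unfolding xx_def using b elt_closed[OF Z.one_closed] by (simp add: a_minus_def OC.l_distr OC.l_minus)
  then show ?thesis
    using co_single_mult[OF R.one_closed b, of 1 j i] b elt_closed[OF Z.one_closed] co_closed[OF b]
    by (simp add: co_minus elt_eq Zp_one_eq)
qed

lemma Nn_0: "Nn 0 = carrier H"
proof
  show "Nn 0 \<subseteq> carrier H" using subgroup.subset[OF ON_subgroup[OF Nn_open]] .
  show "carrier H \<subseteq> Nn 0"
  proof
    fix C assume "C \<in> carrier H"
    then obtain z where z: "z \<in> carrier (Zp p)" "sig z = C" using sig_surj by blast
    then show "C \<in> Nn 0" using ZpD(3,4)[OF z(1), of 0] unfolding Nn_def Zp_ker_def by force
  qed
qed

lemma Mod_top: "carrier (H Mod carrier H) = {carrier H}"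
proof -
  have "carrier H #>\<^sub>H g = carrier H" if "g \<in> carrier H" for g
    using that G.coset_join2[OF that G.subgroup_self] by simp
  then show ?thesis unfolding Mod_carrier using G.one_closed by blast
qed

lemma cs_0: "cs 0 i = carrier H"
  using cs_closed[of 0 i] Mod_top by (simp add: Nn_0)

definition augm :: "('h set => 'h set => 'r) => 'r" where "augm a = a (carrier H) (carrier H)"

lemma augm_co: "augm a = co a 0 i"
  by (simp add: augm_def co_def cs_0 Nn_0)

lemma augm_hom: "augm \<in> ring_hom CG R"
proof (rule ring_hom_memI)
  interpret F: finite_group_ring R "H Mod carrier H" by (rule FR[OF carrier_open])
  have mem: "carrier H \<in> carrier (H Mod carrier H)" by (simp add: Mod_top)
  fix a b assume a: "a \<in> carrier CG" and b: "b \<in> carrier CG"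
  show "augm a \<in> carrier R" using co_closed[OF a] augm_co by metis
  show "augm (a \<oplus>\<^sub>CG b) = augm a \<oplus>\<^sub>R augm b"
    unfolding augm_co[of _ 0] using a b by (rule co_add)
  have "inv\<^bsub>H Mod carrier H\<^esub> carrier H \<otimes>\<^sub>(H Mod carrier H) carrier H \<in> carrier (H Mod carrier H)"
    using mem by (intro F.Q.m_closed F.Q.inv_closed)
  then have e: "inv\<^bsub>H Mod carrier H\<^esub> carrier H \<otimes>\<^sub>(H Mod carrier H) carrier H = carrier H"
    unfolding Mod_top by blast
  have "(a (carrier H) \<otimes>\<^sub>(GR (carrier H)) b (carrier H)) (carrier H) =
      (\<Oplus>\<^sub>R v\<in>{carrier H}. a (carrier H) v \<otimes>\<^sub>R b (carrier H) (inv\<^bsub>H Mod carrier H\<^esub> v \<otimes>\<^sub>(H Mod carrier H) carrier H))"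
    using F.RQ_mult[OF mem] unfolding Mod_top .
  also have "\<dots> = a (carrier H) (carrier H) \<otimes>\<^sub>R b (carrier H) (carrier H)"
    using CG_eval[OF a carrier_open mem] CG_eval[OF b carrier_open mem] e
    by (subst R.finsum_insert) (simp_all del: mult_FactGroup)
  finally show "augm (a \<otimes>\<^sub>CG b) = augm a \<otimes>\<^sub>R augm b"
    unfolding augm_def CG_simps(3)[OF carrier_open] .
next
  show "augm \<one>\<^sub>CG = \<one>\<^sub>R"
    unfolding augm_def CG_one single_eval[OF carrier_open]
    by (simp add: gr_single_def Mod_top G.coset_mult_one)
qed

lemma const_hom: "cgr_const R H \<in> ring_hom R CG"
  by (rule ring_hom_memI) (auto simp: const_eq single_closed single_mult single_add CG_one)

lemma augm_const: "r \<in> carrier R ==> augm (cgr_const R H r) = r"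
  unfolding augm_def by (simp add: cgr_const_def carrier_open Mod_top)

lemma augm_xx: "augm xx = \<zero>\<^sub>R"
proof -
  have "augm (xx \<otimes>\<^sub>CG \<one>\<^sub>CG) = co \<one>\<^sub>CG 0 (0 - 1) \<ominus>\<^sub>R co \<one>\<^sub>CG 0 0"
    unfolding augm_co[of _ 0] by (rule co_xx) simp
  also have "\<dots> = \<zero>\<^sub>R"
    using co_closed[OF OC.one_closed, of 0] unfolding augm_co[symmetric] by (simp add: a_minus_def R.r_neg augm_co[of _ 0])
  finally show ?thesis using xx_closed by simp
qed

text \<open>The sum f(1) + ... + f(m). It starts at 1 so that b(i) = c - f(1) - ... - f(i) solves
  b(i - 1) - b(i) = f(i), the shape of \<open>co_xx\<close>.\<close>

definition psum :: "(int => 'r) => nat => 'r" where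
  "psum f m = (\<Oplus>\<^sub>R t\<in>{..<m}. f (int t + 1))"

lemma psum_closed: "(\<And>i. f i \<in> carrier R) ==> psum f m \<in> carrier R"
  unfolding psum_def by (intro R.finsum_closed) auto

lemma psum_Suc: "(\<And>i. f i \<in> carrier R) ==> psum f (Suc m) = psum f m \<oplus>\<^sub>R f (int m + 1)"
  unfolding psum_def lessThan_Suc by (subst R.finsum_insert) (auto simp: R.a_comm Pi_def intro: R.finsum_closed)

lemma psum_add:
  assumes "\<And>i. f i \<in> carrier R"
  shows "psum f (m + k) = psum f m \<oplus>\<^sub>R psum (\<lambda>i. f (i + int m)) k"
proof (induction k)
  case 0
  then show ?case using psum_closed[of f m] assms by (simp add: psum_def)
next
  case (Suc k)
  then show ?case
    using assms by (simp add: psum_Suc psum_closed R.a_assoc add_ac)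
qed

text \<open>Any p^j consecutive integers meet each coset at level j exactly once, and the transition
  to level 0 adds up all coefficients.\<close>

lemma psum_total:
  assumes a: "a \<in> carrier CG" and j: "j \<in> levels"
  shows "psum (co a j) (p ^ j) = augm a"
proof -
  have bij: "bij_betw (\<lambda>t. cs j (int t + 1)) {..<p ^ j} (carrier (H Mod Nn j))"
  proof (rule bij_betw_imageI)
    show "inj_on (\<lambda>t. cs j (int t + 1)) {..<p ^ j}"
    proof (rule inj_onI)
      fix s t assume st: "s \<in> {..<p ^ j}" "t \<in> {..<p ^ j}" "cs j (int s + 1) = cs j (int t + 1)"
      then have "(int s + 1) mod int p ^ j = (int t + 1) mod int p ^ j" using cs_eq_iff[OF j] by simp
      then have "int s mod int p ^ j = int t mod int p ^ j"
        by (simp add: mod_eq_dvd_iff)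
      then show "s = t" using st(1,2) by (simp flip: of_nat_power)
    qed
    show "(\<lambda>t. cs j (int t + 1)) ` {..<p ^ j} = carrier (H Mod Nn j)"
    proof (intro equalityI subsetI)
      fix C assume "C \<in> carrier (H Mod Nn j)"
      then obtain i where i: "C = cs j i" using cs_E[OF j] by blast
      let ?t = "nat ((i - 1) mod int p ^ j)"
      have t: "?t < p ^ j" "int ?t = (i - 1) mod int p ^ j"
        using p_pos[of j] by (simp_all add: nat_less_iff)
      have "C = cs j (int ?t + 1)" unfolding i t(2) cs_eq_iff[OF j] by (simp add: mod_simps)
      then show "C \<in> (\<lambda>t. cs j (int t + 1)) ` {..<p ^ j}" using t(1) by blast
    qed (use cs_closed in auto)
  qed
  have "augm a = (\<Oplus>\<^sub>R D\<in>{D \<in> carrier (H Mod Nn j). D \<subseteq> carrier H}. a (Nn j) D)"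
    unfolding augm_def
    by (rule CGD(2)[OF a Nn_open carrier_open]) (auto simp: subgroup.subset[OF ON_subgroup[OF Nn_open]] Mod_top)
  also have "{D \<in> carrier (H Mod Nn j). D \<subseteq> carrier H} = carrier (H Mod Nn j)"
    using G.rcosets_subset_PowG[OF ON_subgroup[OF Nn_open]] by (auto simp: FactGroup_def)
  also have "(\<Oplus>\<^sub>R D\<in>carrier (H Mod Nn j). a (Nn j) D) = psum (co a j) (p ^ j)"
    unfolding psum_def co_def by (rule R.finsum_reindex_bij[OF bij]) (use CG_eval[OF a Nn_open] in auto)
  finally show ?thesis by simp
qed

text \<open>At level j the difference equation is solved by a constant \<open>c j\<close> minus the
  partial sums of the coefficients of \<open>a\<close>. That it also holds at the wrap-around of
  residues is the vanishing of the augmentation; compatibility of levels j and j + 1 fixes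
  \<open>c j\<close> in terms of \<open>c (Suc j)\<close>.\<close>

lemma aug_divisible:
  assumes a: "a \<in> carrier CG" and aug: "augm a = \<zero>\<^sub>R"
  shows "\<exists>b\<in>carrier CG. a = xx \<otimes>\<^sub>CG b"
proof -
  note cl = co_closed[OF a] psum_closed[of "co a _", OF co_closed[OF a]]
  \<comment> \<open>Summed over the p lifts l p^j + r of a residue r, the partial sums at level j +
    1 give the partial sum at level j up to r, plus this amount, which does not depend on r.\<close>
  define E where "E j = (\<Oplus>\<^sub>R l\<in>{..<p}. psum (co a (Suc j)) (l * p ^ j))" for j
  have Ec: "E j \<in> carrier R" for j unfolding E_def using cl by (intro R.finsum_closed) auto
  obtain c where c: "\<And>k. c k \<in> carrier R" "\<And>k. c k = \<ominus>\<^sub>R E k \<oplus>\<^sub>R nu (int p) \<otimes>\<^sub>R c (Suc k)"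
    using R_recursion[of "\<lambda>k. \<ominus>\<^sub>R E k"] Ec by blast
  define s where "s j i = c j \<ominus>\<^sub>R psum (co a j) (nat (i mod int p ^ j))" for j i
  have sc: "s j i \<in> carrier R" for j i unfolding s_def using c(1) cl by simp
  have per: "s j i = s j i'" if "i mod int p ^ j = i' mod int p ^ j" for j i i'
    using that by (simp add: s_def)
  have comp: "s j i = (\<Oplus>\<^sub>R l\<in>{..<p}. s (Suc j) (i + int l * int p ^ j))"
    if j: "Suc j \<in> levels" and i: "0 \<le> i" "i < int p ^ j" for j i
  proof -
    obtain r where r: "i = int r" "r < p ^ j" using i by (metis nat_less_iff nat_0_le of_nat_power)
    let ?f = "co a (Suc j)"
    have idx: "nat ((i + int l * int p ^ j) mod int p ^ Suc j) = l * p ^ j + r" if "l < p" for l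
    proof -
      have "l * p ^ j + r < Suc l * p ^ j" using r by simp
      also have "\<dots> \<le> p * p ^ j" using that by (intro mult_le_mono1) simp
      finally have "int (l * p ^ j + r) < int p ^ Suc j" by (metis of_nat_less_iff of_nat_power power_Suc)
      moreover have "i + int l * int p ^ j = int (l * p ^ j + r)" using r by simp
      ultimately show ?thesis by (metis mod_pos_pos_trivial nat_int of_nat_0_le_iff)
    qed
    have sp: "psum ?f (l * p ^ j + r) = psum ?f (l * p ^ j) \<oplus>\<^sub>R (\<Oplus>\<^sub>R t\<in>{..<r}. ?f (int t + 1 + int l * int p ^ j))" for l
      by (subst psum_add) (simp_all add: cl, simp add: psum_def)
    have "(\<Oplus>\<^sub>R l\<in>{..<p}. psum ?f (l * p ^ j + r)) =
        E j \<oplus>\<^sub>R (\<Oplus>\<^sub>R l\<in>{..<p}. \<Oplus>\<^sub>R t\<in>{..<r}. ?f (int t + 1 + int l * int p ^ j))"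
      unfolding sp E_def using cl by (intro R.finsum_addf) (auto intro: R.finsum_closed)
    also have "(\<Oplus>\<^sub>R l\<in>{..<p}. \<Oplus>\<^sub>R t\<in>{..<r}. ?f (int t + 1 + int l * int p ^ j)) =
        (\<Oplus>\<^sub>R t\<in>{..<r}. \<Oplus>\<^sub>R l\<in>{..<p}. ?f (int t + 1 + int l * int p ^ j))"
      using cl by (intro R.finsum_swap) auto
    also have "\<dots> = psum (co a j) r"
      unfolding psum_def co_compat[OF a j] ..
    finally have P: "(\<Oplus>\<^sub>R l\<in>{..<p}. psum ?f (l * p ^ j + r)) = E j \<oplus>\<^sub>R psum (co a j) r" .
    have "(\<Oplus>\<^sub>R l\<in>{..<p}. s (Suc j) (i + int l * int p ^ j)) =
        (\<Oplus>\<^sub>R l\<in>{..<p}. c (Suc j) \<oplus>\<^sub>R \<ominus>\<^sub>R psum ?f (l * p ^ j + r))"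
      using c(1) cl by (intro R.finsum_cong') (auto simp: s_def idx a_minus_def simp del: power_Suc)
    also have "\<dots> = nu (int p) \<otimes>\<^sub>R c (Suc j) \<oplus>\<^sub>R (\<Oplus>\<^sub>R l\<in>{..<p}. \<ominus>\<^sub>R psum ?f (l * p ^ j + r))"
      using c(1) cl by (subst R.finsum_addf) (auto simp: finsum_const_nu)
    also have "(\<Oplus>\<^sub>R l\<in>{..<p}. \<ominus>\<^sub>R psum ?f (l * p ^ j + r)) = \<ominus>\<^sub>R (\<Oplus>\<^sub>R l\<in>{..<p}. psum ?f (l * p ^ j + r))"
      using cl by (intro additive_finsum[symmetric, of R R]) (auto simp: R.minus_add R.abelian_monoid_axioms R.a_comm)
    also have "nu (int p) \<otimes>\<^sub>R c (Suc j) \<oplus>\<^sub>R \<ominus>\<^sub>R (\<Oplus>\<^sub>R l\<in>{..<p}. psum ?f (l * p ^ j + r)) =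
        (\<ominus>\<^sub>R E j \<oplus>\<^sub>R nu (int p) \<otimes>\<^sub>R c (Suc j)) \<oplus>\<^sub>R \<ominus>\<^sub>R psum (co a j) r"
      unfolding P using c(1) cl Ec by (simp add: R.minus_add nu_simps R.a_ac)
    also have "\<dots> = c j \<ominus>\<^sub>R psum (co a j) r"
      using c(2)[of j] by (simp add: a_minus_def)
    also have "\<dots> = s j i"
      using i r by (simp add: s_def)
    finally show ?thesis by simp
  qed
  obtain b where b: "b \<in> carrier CG" "\<And>j i. j \<in> levels ==> co b j i = s j i"
    using family_exists[OF sc per comp] by blast
  have "a = xx \<otimes>\<^sub>CG b"
  proof (rule co_ext[OF a OC.m_closed[OF xx_closed b(1)]])
    fix j i assume j: "j \<in> levels"
    define r where "r = i mod int p ^ j"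
    have r: "0 \<le> r" "r < int p ^ j" unfolding r_def using p_pos by simp_all
    have cr: "co a j i = co a j r" by (rule co_mod[OF j]) (simp add: r_def)
    let ?f = "co a j"
    have main: "s j (i - 1) \<ominus>\<^sub>R s j i = ?f r"
    proof (cases "r = 0")
      case False
      then obtain m where m: "r = int m + 1" using r by (metis add.commute int_one_le_iff_zero_less less_le zle_iff_zadd nonneg_int_cases diff_add_cancel zero_le_imp_eq_int le_add_diff_inverse2)
      have "(i - 1) mod int p ^ j = r - 1"
      proof -
        have "(i - 1) mod int p ^ j = (r - 1) mod int p ^ j" unfolding r_def by (simp add: mod_simps)
        also have "\<dots> = r - 1" by (rule mod_pos_pos_trivial) (use m r in linarith)+
        finally show ?thesis .
      qed
      then have "nat ((i - 1) mod int p ^ j) = m" "nat (i mod int p ^ j) = Suc m" using m r_def by auto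
      then have "s j (i - 1) \<ominus>\<^sub>R s j i = (c j \<ominus>\<^sub>R psum ?f m) \<ominus>\<^sub>R (c j \<ominus>\<^sub>R (psum ?f m \<oplus>\<^sub>R ?f r))"
        using cl m by (simp add: s_def psum_Suc)
      also have "\<dots> = ?f r"
        using c(1)[of j] cl(2)[of j m] cl(1)[of j r]
        by (simp add: a_minus_def R.minus_add R.a_ac R.r_neg R.r_neg1 R.r_neg2)
      finally show ?thesis .
    next
      \<comment> \<open>At r = 0 the predecessor is the residue p^j - 1. The sum over a whole period
        vanishes, so the partial sum up to that residue is minus the coefficient at 0.\<close>
      case True
      have pj: "p ^ j \<ge> 1" using p_gt_1 by simp
      have "(i - 1) mod int p ^ j = int p ^ j - 1"
      proof -
        have "(i - 1) mod int p ^ j = (r - 1) mod int p ^ j" unfolding r_def by (simp add: mod_simps)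
        also have "\<dots> = (int p ^ j - 1) mod int p ^ j" using True by (simp add: mod_eq_dvd_iff)
        also have "\<dots> = int p ^ j - 1" by (rule mod_pos_pos_trivial) (use p_pos[of j] in linarith)+
        finally show ?thesis .
      qed
      then have 1: "nat ((i - 1) mod int p ^ j) = p ^ j - 1"
        using pj by (simp add: nat_diff_distrib' flip: of_nat_power)
      have 2: "nat (i mod int p ^ j) = 0" using True r_def by simp
      have sj: "Suc (p ^ j - 1) = p ^ j" using pj by linarith
      have "psum ?f (Suc (p ^ j - 1)) = \<zero>\<^sub>R" unfolding sj using psum_total[OF a j] aug by simp
      then have "psum ?f (p ^ j - 1) \<oplus>\<^sub>R ?f (int (p ^ j - 1) + 1) = \<zero>\<^sub>R"
        using cl by (simp only: psum_Suc)
      moreover have "?f (int (p ^ j - 1) + 1) = ?f r"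
      proof (rule co_mod[OF j])
        have "int (p ^ j - 1) + 1 = int p ^ j" using sj by (metis of_nat_Suc of_nat_power add.commute)
        then show "(int (p ^ j - 1) + 1) mod int p ^ j = r mod int p ^ j" using True by simp
      qed
      ultimately have "psum ?f (p ^ j - 1) = \<ominus>\<^sub>R ?f r"
        using cl R.minus_equality by metis
      then have "s j (i - 1) \<ominus>\<^sub>R s j i = (c j \<oplus>\<^sub>R ?f r) \<ominus>\<^sub>R c j"
        using cl c(1) by (simp add: s_def 1 2 a_minus_def) (simp add: psum_def)
      also have "\<dots> = ?f r"
        using c(1)[of j] cl(1)[of j r] by (simp add: a_minus_def R.a_ac R.r_neg R.r_neg1 R.r_neg2)
      finally show ?thesis .
    qed
    show "co a j i = co (xx \<otimes>\<^sub>CG b) j i"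
      unfolding co_xx[OF b(1)] b(2)[OF j] main cr ..
  qed
  with b(1) show ?thesis by blast
qed

sublocale AR: aug_ring CG R "cgr_const R H" augm xx
  by unfold_locales (auto simp: const_hom augm_hom augm_const xx_closed augm_xx aug_divisible)

end

section \<open>The annihilator of \<open>xx\<close>\<close>

context Zp_tower
begin

lemma co_const_of_ann:
  assumes b: "b \<in> carrier CG" "xx \<otimes>\<^sub>CG b = \<zero>\<^sub>CG"
  shows "co b j i = co b j 0"
proof -
  have eq: "co b j (i - 1) = co b j i" for i
  proof -
    have "co b j (i - 1) \<ominus>\<^sub>R co b j i = \<zero>\<^sub>R"
      by (simp only: co_xx[OF b(1), symmetric] b(2) co_zero)
    then show ?thesis using co_closed[OF b(1)] by (simp add: R.minus_eq_zero_iff)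
  qed
  show ?thesis
  proof (induction i rule: int_induct[of _ 0])
    case (step1 i)
    then show ?case using eq[of "i + 1"] by simp
  next
    case (step2 i)
    then show ?case using eq[of i] by simp
  qed simp
qed

text \<open>With u = 1 + x, the identity u^(N+1) = u^N + x u^N is Pascal's rule for the
  coefficients.\<close>

lemma expands_elt_pow:
  "AR.expands m (\<lambda>k. nu (int (N choose k))) (cgr_elt R H (sig \<one>\<^sub>(Zp p)) [^]\<^sub>CG N)"
proof (induction N)
  case 0
  have "(\<lambda>k. nu (int (0 choose k))) = (\<lambda>k. if k = 0 then \<one>\<^sub>R else \<zero>\<^sub>R)"
  proof
    fix k show "nu (int (0 choose k)) = (if k = 0 then \<one>\<^sub>R else \<zero>\<^sub>R)"
      by (cases k) (auto simp: nu_simps)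
  qed
  then show ?case
    using AR.expands_const[OF R.one_closed, of m] by (simp add: AR.io_simps)
next
  case (Suc N)
  let ?u = "cgr_elt R H (sig \<one>\<^sub>(Zp p))"
  have u: "?u \<in> carrier CG" using elt_closed by simp
  have "?u [^]\<^sub>CG Suc N = ?u [^]\<^sub>CG N \<oplus>\<^sub>CG xx \<otimes>\<^sub>CG ?u [^]\<^sub>CG N"
  proof -
    have "?u [^]\<^sub>CG Suc N = ?u [^]\<^sub>CG N \<otimes>\<^sub>CG (\<one>\<^sub>CG \<oplus>\<^sub>CG xx)"
      using elt_xx by simp
    then show ?thesis
      using u xx_closed by (simp add: OC.r_distr OC.m_comm)
  qed
  moreover have "(\<lambda>k. nu (int (Suc N choose k))) = (\<lambda>k. nu (int (N choose k)) \<oplus>\<^sub>R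
      (if k = 0 then \<zero>\<^sub>R else nu (int (N choose (k - 1)))))"
  proof
    fix k
    show "nu (int (Suc N choose k)) = nu (int (N choose k)) \<oplus>\<^sub>R
        (if k = 0 then \<zero>\<^sub>R else nu (int (N choose (k - 1))))"
      by (cases k) (auto simp: nu_simps R.a_comm)
  qed
  ultimately show ?case
    using AR.expands_add[OF _ _ Suc AR.expands_shift[OF _ Suc]] by (simp add: nu_simps)
qed

definition norm_elt :: "nat => 'h set => 'h set => 'r" where
  "norm_elt N = (\<Oplus>\<^sub>CG i\<in>{..<N}. cgr_elt R H (sig \<one>\<^sub>(Zp p)) [^]\<^sub>CG i)"

lemma norm_elt_closed: "norm_elt N \<in> carrier CG"
  unfolding norm_elt_def using elt_closed[OF Z.one_closed] by (intro OC.finsum_closed) auto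

lemma norm_elt_Suc: "norm_elt (Suc N) = norm_elt N \<oplus>\<^sub>CG cgr_elt R H (sig \<one>\<^sub>(Zp p)) [^]\<^sub>CG N"
  unfolding norm_elt_def lessThan_Suc using elt_closed[OF Z.one_closed]
  by (subst OC.finsum_insert) (auto simp: OC.a_comm)

text \<open>Formally the norm element is ((1 + x)^N - 1)/x, which explains the shift to
  \<open>Suc k\<close>. Adding u^N to it is Pascal's rule one index higher.\<close>

lemma expands_norm: "AR.expands m (\<lambda>k. nu (int (N choose Suc k))) (norm_elt N)"
proof (induction N)
  case 0
  show ?case
    using AR.expands_const[OF R.zero_closed, of m]
    by (simp add: norm_elt_def AR.io_simps nu_simps if_distrib cong: if_cong)
next
  case (Suc N)
  have "(\<lambda>k. nu (int (Suc N choose Suc k))) = (\<lambda>k. nu (int (N choose Suc k)) \<oplus>\<^sub>R nu (int (N choose k)))"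
    by (auto simp: nu_simps R.a_comm)
  then show ?case
    using AR.expands_add[OF _ _ Suc expands_elt_pow] by (simp add: norm_elt_Suc nu_simps)
qed

text \<open>An element killed by x has constant coefficients at each level, and the constant at
  level j is p times that at level j + 1. If H is infinite the constants are divisible by all powers
  of p, so they vanish. If H has order p^a the element is a constant times the norm element, and
  \<open>bin\<close> removes the first n coefficients of the latter.\<close>

lemma ann_in_power:
  assumes bin: "\<And>a k. \<forall>z\<in>carrier (Zp p). sig z = \<one>\<^sub>H \<longleftrightarrow> z a = 0 ==> 1 \<le> k ==> k \<le> n ==>
      nu (int (p ^ a choose k)) = \<zero>\<^sub>R"
    and b: "b \<in> carrier CG" "xx \<otimes>\<^sub>CG b = \<zero>\<^sub>CG"
  shows "\<exists>y\<in>carrier CG. b = xx [^]\<^sub>CG n \<otimes>\<^sub>CG y"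
proof -
  note con = co_const_of_ann[OF b]
  note cl = co_closed[OF b(1)]
  have rec: "co b j 0 = nu (int p) \<otimes>\<^sub>R co b (Suc j) 0" if "Suc j \<in> levels" for j
  proof -
    have "co b j 0 = (\<Oplus>\<^sub>R l\<in>{..<p}. co b (Suc j) (0 + int l * int p ^ j))"
      by (rule co_compat[OF b(1) that])
    also have "\<dots> = (\<Oplus>\<^sub>R l\<in>{..<p}. co b (Suc j) 0)"
      by (intro R.finsum_cong' refl con) (use cl in auto)
    also have "\<dots> = nu (int p) \<otimes>\<^sub>R co b (Suc j) 0" using cl by (rule finsum_const_nu)
    finally show ?thesis .
  qed
  show ?thesis using sig_ker
  proof
    assume "\<forall>z\<in>carrier (Zp p). sig z = \<one>\<^sub>H \<longrightarrow> z = \<zero>\<^sub>(Zp p)"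
    then have lev: "j \<in> levels" for j by (auto simp: levels_def Zp_simps(4))
    have pw: "co b j 0 = nu (int p ^ i) \<otimes>\<^sub>R co b (j + i) 0" for i j
    proof (induction i)
      case 0
      then show ?case using cl by (simp add: nu_simps)
    next
      case (Suc i)
      then show ?case
        using rec[OF lev, of "j + i"] cl by (simp add: nu_simps R.m_ac)
    qed
    have z: "co b j 0 = \<zero>\<^sub>R" for j
      using cl pw by (intro separated) blast+
    have "b = \<zero>\<^sub>CG"
      by (rule co_ext[OF b(1) OC.zero_closed]) (simp only: trans[OF con z] co_zero)
    then show ?thesis
      using xx_closed by (intro bexI[of _ "\<zero>\<^sub>CG"]) auto
  next
    assume "\<exists>a. \<forall>z\<in>carrier (Zp p). sig z = \<one>\<^sub>H \<longleftrightarrow> z a = 0"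
    then obtain a where a: "\<forall>z\<in>carrier (Zp p). sig z = \<one>\<^sub>H \<longleftrightarrow> z a = 0" by blast
    have al: "a \<in> levels" using a by (auto simp: levels_def)
    have la: "j \<le> a" if "j \<in> levels" for j
    proof -
      have "sig (Zp_int p (int p ^ a)) = \<one>\<^sub>H"
        using a by (simp add: Zp_int_closed) (simp add: Zp_int_def)
      then have "Zp_int p (int p ^ a) j = 0" using that Zp_int_closed by (auto simp: levels_def)
      then have "int p ^ j dvd int p ^ a" by (simp add: Zp_int_def mod_eq_0_iff_dvd)
      then have "p ^ j dvd p ^ a" by (metis of_nat_dvd_iff of_nat_power)
      then show ?thesis using p_gt_1 by (simp add: power_dvd_imp_le)
    qed
    let ?c = "co b a 0" and ?u = "cgr_elt R H (sig \<one>\<^sub>(Zp p))"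
    let ?d = "cgr_const R H ?c \<otimes>\<^sub>CG norm_elt (p ^ a)"
    have dc: "?d \<in> carrier CG" using const_closed[OF cl] norm_elt_closed by simp
    have pow: "?u [^]\<^sub>CG i = cgr_single R H \<one>\<^sub>R (sig (Zp_int p (int i)))" for i
      using elt_nat_smult[OF Z.one_closed, of i] by (simp add: Zp_int_closed elt_eq)
    have co1: "co \<one>\<^sub>CG a i = (if int p ^ a dvd i then \<one>\<^sub>R else \<zero>\<^sub>R)" for i
    proof -
      have "cs a i = Nn a #>\<^sub>H \<one>\<^sub>H \<longleftrightarrow> int p ^ a dvd i"
        using cs_eq_iff[OF al, of i 0] by (simp add: cs_def Zp_zero_eq[symmetric] sig_zero mod_eq_0_iff_dvd)
      then show ?thesis
        unfolding co_def CG_one single_eval[OF Nn_open] gr_single_def using cs_closed[of a i] by simp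
    qed
    have cop: "co (?u [^]\<^sub>CG l) a i = (if int p ^ a dvd i - int l then \<one>\<^sub>R else \<zero>\<^sub>R)" for l i
      using co_single_mult[OF R.one_closed OC.one_closed, of "int l" a i] co_closed[OF OC.one_closed]
      unfolding pow co1 using single_closed[OF R.one_closed sig_closed[OF Zp_int_closed]] by (simp add: OC.r_one)
    have con1: "co (norm_elt (p ^ a)) a i = \<one>\<^sub>R" for i
    proof -
      have "co (norm_elt (p ^ a)) a i = (\<Oplus>\<^sub>R l\<in>{..<p ^ a}. co (?u [^]\<^sub>CG l) a i)"
        unfolding norm_elt_def using elt_closed[OF Z.one_closed]
        by (intro additive_finsum[OF OC.abelian_monoid_axioms R.abelian_monoid_axioms, of _ _ "\<lambda>b. co b a i"])
          (auto simp: co_closed co_zero co_add)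
      also have "\<dots> = (\<Oplus>\<^sub>R l\<in>{..<p ^ a}. if l = nat (i mod int p ^ a) then \<one>\<^sub>R else \<zero>\<^sub>R)"
      proof (rule R.finsum_cong')
        fix l assume l: "l \<in> {..<p ^ a}"
        have "int p ^ a dvd i - int l \<longleftrightarrow> i mod int p ^ a = int l mod int p ^ a"
          by (simp add: mod_eq_dvd_iff)
        also have "int l mod int p ^ a = int l"
          using l by (simp flip: of_nat_power)
        also have "i mod int p ^ a = int l \<longleftrightarrow> l = nat (i mod int p ^ a)"
          using p_pos[of a] by auto
        finally show "co (?u [^]\<^sub>CG l) a i = (if l = nat (i mod int p ^ a) then \<one>\<^sub>R else \<zero>\<^sub>R)"
          unfolding cop by simp
      qed auto
      also have "\<dots> = \<one>\<^sub>R"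
      proof -
        have "nat (i mod int p ^ a) < p ^ a" using p_pos[of a] by (simp add: nat_less_iff)
        then show ?thesis
          using R.finsum_delta[of "{..<p ^ a}" "nat (i mod int p ^ a)" "\<lambda>l. if l = nat (i mod int p ^ a) then \<one>\<^sub>R else \<zero>\<^sub>R"]
          by simp
      qed
      finally show ?thesis .
    qed
    have top: "co b a i = co ?d a i" for i
      using co_single_mult[OF cl norm_elt_closed, of a 0 0 "p ^ a" a i] con[of a i] cl
      by (simp add: const_eq Zp_zero_eq[symmetric] sig_zero con1)
    \<comment> \<open>Level \<open>a\<close> is the top one, and coefficients at lower levels are
      sums of those above them, so equality descends from there.\<close>
    have "co b j i = co ?d j i" if "j \<le> a" for j i
      using that
    proof (induction j arbitrary: i rule: inc_induct)
      case base
      show ?case by (rule top)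
    next
      case (step j)
      have "Suc j \<in> levels" using levels_down[OF al] step.hyps by simp
      then show ?case
        using co_compat[OF b(1)] co_compat[OF dc] step.IH by simp
    qed
    then have bd: "b = ?d" using la by (intro co_ext[OF b(1) dc]) blast
    obtain y where y: "y \<in> carrier CG"
      "norm_elt (p ^ a) = AR.horner n (\<lambda>k. nu (int (p ^ a choose Suc k))) \<oplus>\<^sub>CG xx [^]\<^sub>CG n \<otimes>\<^sub>CG y"
      using expands_norm[of n "p ^ a"] unfolding AR.expands_def by blast
    \<comment> \<open>The indices k < n of the expansion involve the binomials p^a choose k + 1,
      exactly the range 1 to n covered by \<open>bin\<close>.\<close>
    have "AR.horner n (\<lambda>k. nu (int (p ^ a choose Suc k))) = AR.horner n (\<lambda>k. \<zero>\<^sub>R)"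
      by (rule AR.horner_cong) (use bin[OF a] in simp)
    then have ny: "norm_elt (p ^ a) = xx [^]\<^sub>CG n \<otimes>\<^sub>CG y"
      using y xx_closed by (simp add: AR.horner_zero)
    show ?thesis
      by (rule bexI[of _ "cgr_const R H ?c \<otimes>\<^sub>CG y"], subst bd)
        (use ny y(1) const_closed[OF cl] xx_closed in \<open>simp_all add: OC.m_lcomm\<close>)
  qed
qed

end

text \<open>The premise of \<open>bin\<close> can hold only if H is finite of order p^a: for
  injective \<open>sig\<close> it fails at the nonzero element p^a. The conclusion is what makes the
  coefficients up to x^n unique.\<close>

locale Zp_tower_trunc = Zp_tower H R p q sig
  for H :: "('h, 'x) topgroup_scheme" and R :: "('r, 'y) topring_scheme" and p q sig +
  fixes n :: nat
  assumes bin: "\<And>a k. \<forall>z\<in>carrier (Zp p). sig z = \<one>\<^sub>H \<longleftrightarrow> z a = 0 ==> 1 \<le> k ==> k \<le> n ==>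
      nu (int (p ^ a choose k)) = \<zero>\<^sub>R"
begin

sublocale AT: aug_ring_trunc CG R "cgr_const R H" augm xx n
  by unfold_locales (rule ann_in_power[OF bin])

text \<open>Membership in the \<open>K\<close>-th power of the ideal \<open>(p, x)\<close>, modulo \<open>x^(n+1)\<close>.\<close>

definition fil :: "nat => ('h set => 'h set => 'r) => bool" where
  "fil K a \<longleftrightarrow> (\<forall>k\<le>n. \<exists>s\<in>carrier R. AT.cf a k = nu (int p ^ (K - k)) \<otimes>\<^sub>R s)"

lemma nu_dvd_mono:
  assumes "s \<in> carrier R" "r = nu (int p ^ K) \<otimes>\<^sub>R s" "L \<le> K"
  shows "\<exists>t\<in>carrier R. r = nu (int p ^ L) \<otimes>\<^sub>R t"
proof -
  have "int p ^ K = int p ^ L * int p ^ (K - L)" using assms(3) by (simp add: power_add[symmetric])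
  then have "r = nu (int p ^ L) \<otimes>\<^sub>R (nu (int p ^ (K - L)) \<otimes>\<^sub>R s)"
    using assms(1,2) by (simp add: nu_simps R.m_assoc)
  then show ?thesis using assms(1) by (intro bexI[of _ "nu (int p ^ (K - L)) \<otimes>\<^sub>R s"]) (auto simp: nu_simps)
qed

lemma nu_dvd_add:
  assumes "\<exists>s\<in>carrier R. r = nu i \<otimes>\<^sub>R s" "\<exists>s\<in>carrier R. r' = nu i \<otimes>\<^sub>R s"
  shows "\<exists>s\<in>carrier R. r \<oplus>\<^sub>R r' = nu i \<otimes>\<^sub>R s"
proof -
  obtain s s' where "s \<in> carrier R" "r = nu i \<otimes>\<^sub>R s" "s' \<in> carrier R" "r' = nu i \<otimes>\<^sub>R s'"
    using assms by blast
  then show ?thesis by (intro bexI[of _ "s \<oplus>\<^sub>R s'"]) (auto simp: nu_simps R.r_distr)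
qed

lemma nu_dvd_finsum:
  assumes "finite A" "\<And>l. l \<in> A ==> \<exists>s\<in>carrier R. f l = nu i \<otimes>\<^sub>R s"
  shows "\<exists>s\<in>carrier R. (\<Oplus>\<^sub>R l\<in>A. f l) = nu i \<otimes>\<^sub>R s"
  using assms
proof (induction A rule: finite_induct)
  case empty
  then show ?case by (intro bexI[of _ "\<zero>\<^sub>R"]) (auto simp: nu_simps)
next
  case (insert l A)
  have "f m \<in> carrier R" if "m \<in> insert l A" for m
    using insert.prems[OF that] by (auto simp: nu_simps)
  then have "(\<Oplus>\<^sub>R l\<in>insert l A. f l) = f l \<oplus>\<^sub>R (\<Oplus>\<^sub>R l\<in>A. f l)"
    using insert by (intro R.finsum_insert) auto
  then show ?case using nu_dvd_add insert by simp
qed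

text \<open>In each term of the Cauchy product the exponents of p add up to at least
  \<open>K + L - k\<close>; truncated subtraction can only increase them.\<close>

lemma fil_mult:
  assumes a: "a \<in> carrier CG" "fil K a" and b: "b \<in> carrier CG" "fil L b"
  shows "fil (K + L) (a \<otimes>\<^sub>CG b)"
  unfolding fil_def
proof (intro allI impI)
  fix k assume k: "k \<le> n"
  show "\<exists>s\<in>carrier R. AT.cf (a \<otimes>\<^sub>CG b) k = nu (int p ^ (K + L - k)) \<otimes>\<^sub>R s"
    unfolding AT.cf_mult[OF a(1) b(1) k]
  proof (rule nu_dvd_finsum)
    fix l assume l: "l \<in> {..k}"
    obtain s where s: "s \<in> carrier R" "AT.cf a (k - l) = nu (int p ^ (K - (k - l))) \<otimes>\<^sub>R s"
      using a(2)[unfolded fil_def, rule_format, of "k - l"] k by (meson diff_le_self le_trans)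
    obtain t where t: "t \<in> carrier R" "AT.cf b l = nu (int p ^ (L - l)) \<otimes>\<^sub>R t"
      using b(2)[unfolded fil_def, rule_format, of l] k l by (meson atMost_iff le_trans)
    have "AT.cf a (k - l) \<otimes>\<^sub>R AT.cf b l = nu (int p ^ ((K - (k - l)) + (L - l))) \<otimes>\<^sub>R (s \<otimes>\<^sub>R t)"
      unfolding s(2) t(2) power_add using s(1) t(1) by (simp add: nu_simps R.m_ac)
    then show "\<exists>s\<in>carrier R. AT.cf a (k - l) \<otimes>\<^sub>R AT.cf b l = nu (int p ^ (K + L - k)) \<otimes>\<^sub>R s"
      using s(1) t(1) l by (intro nu_dvd_mono[of "s \<otimes>\<^sub>R t"]) auto
  qed simp
qed

lemma fil_add:
  assumes "a \<in> carrier CG" "fil K a" "b \<in> carrier CG" "fil K b"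
  shows "fil K (a \<oplus>\<^sub>CG b)"
  using assms unfolding fil_def by (auto simp: AT.cf_add intro!: nu_dvd_add)

lemma fil_mono: "fil K a ==> L \<le> K ==> fil L a"
  unfolding fil_def using nu_dvd_mono diff_le_mono by meson

lemma fil_0: "a \<in> carrier CG ==> fil 0 a"
  unfolding fil_def using AT.cf_closed by (auto simp: nu_simps intro!: bexI)

lemma fil_p:
  assumes "a \<in> carrier CG" "fil K a"
  shows "fil (Suc K) (cgr_const R H (nu (int p)) \<otimes>\<^sub>CG a)"
  unfolding fil_def
proof (intro allI impI)
  fix k assume k: "k \<le> n"
  obtain s where s: "s \<in> carrier R" "AT.cf a k = nu (int p ^ (K - k)) \<otimes>\<^sub>R s"
    using assms(2) k by (auto simp: fil_def)
  have "AT.cf (cgr_const R H (nu (int p)) \<otimes>\<^sub>CG a) k = nu (int p) \<otimes>\<^sub>R (nu (int p ^ (K - k)) \<otimes>\<^sub>R s)"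
    using AT.cf_smult[OF assms(1) nu_simps(1) k] s by simp
  also have "\<dots> = nu (int p ^ Suc (K - k)) \<otimes>\<^sub>R s" using s(1) by (simp add: nu_simps R.m_assoc)
  finally have "AT.cf (cgr_const R H (nu (int p)) \<otimes>\<^sub>CG a) k = nu (int p ^ Suc (K - k)) \<otimes>\<^sub>R s" .
  from nu_dvd_mono[OF s(1) this, of "Suc K - k"]
  show "\<exists>s\<in>carrier R. AT.cf (cgr_const R H (nu (int p)) \<otimes>\<^sub>CG a) k = nu (int p ^ (Suc K - k)) \<otimes>\<^sub>R s"
    by simp
qed

text \<open>The binomial theorem cut off after the linear term: everything else is a multiple of
  j^2.\<close>

lemma one_plus_pow:
  assumes j: "j \<in> carrier CG"
  shows "\<exists>s\<in>carrier CG. (\<one>\<^sub>CG \<oplus>\<^sub>CG j) [^]\<^sub>CG (N::nat) =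
    \<one>\<^sub>CG \<oplus>\<^sub>CG (cgr_const R H (nu (int N)) \<otimes>\<^sub>CG j \<oplus>\<^sub>CG j \<otimes>\<^sub>CG j \<otimes>\<^sub>CG s)"
proof (induction N)
  case 0
  then show ?case
    using j by (intro bexI[of _ "\<zero>\<^sub>CG"]) (auto simp: nu_simps AR.io_simps)
next
  case (Suc N)
  then obtain s where s: "s \<in> carrier CG" "(\<one>\<^sub>CG \<oplus>\<^sub>CG j) [^]\<^sub>CG N =
    \<one>\<^sub>CG \<oplus>\<^sub>CG (cgr_const R H (nu (int N)) \<otimes>\<^sub>CG j \<oplus>\<^sub>CG j \<otimes>\<^sub>CG j \<otimes>\<^sub>CG s)" by blast
  let ?c = "cgr_const R H (nu (int N))"
  have c: "?c \<in> carrier CG" by (simp add: nu_simps const_closed)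
  have c1: "cgr_const R H (nu (int (Suc N))) = \<one>\<^sub>CG \<oplus>\<^sub>CG ?c"
    by (simp add: nu_simps AR.io_simps)
  let ?t = "?c \<oplus>\<^sub>CG s \<oplus>\<^sub>CG j \<otimes>\<^sub>CG s"
  have "(\<one>\<^sub>CG \<oplus>\<^sub>CG j) [^]\<^sub>CG Suc N =
      \<one>\<^sub>CG \<oplus>\<^sub>CG (cgr_const R H (nu (int (Suc N))) \<otimes>\<^sub>CG j \<oplus>\<^sub>CG j \<otimes>\<^sub>CG j \<otimes>\<^sub>CG ?t)"
    unfolding OC.nat_pow_Suc s(2) c1 using j c s(1)
    by (simp add: OC.r_distr OC.l_distr OC.m_ac OC.a_ac)
  then show ?case using j c s(1) by (intro bexI[of _ ?t]) auto
qed

text \<open>Each p-th power gains one order. For i of order K + 1 the linear term p i has order K +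
  2 because of the factor p, and i^2 has order 2K + 2.\<close>

lemma one_plus_p_power:
  assumes j: "j \<in> carrier CG" "fil 1 j"
  shows "\<exists>i\<in>carrier CG. fil (Suc K) i \<and> (\<one>\<^sub>CG \<oplus>\<^sub>CG j) [^]\<^sub>CG (p ^ K) = \<one>\<^sub>CG \<oplus>\<^sub>CG i"
proof (induction K)
  case 0
  then show ?case using j by auto
next
  case (Suc K)
  then obtain i where i: "i \<in> carrier CG" "fil (Suc K) i"
    "(\<one>\<^sub>CG \<oplus>\<^sub>CG j) [^]\<^sub>CG (p ^ K) = \<one>\<^sub>CG \<oplus>\<^sub>CG i" by blast
  obtain s where s: "s \<in> carrier CG" "(\<one>\<^sub>CG \<oplus>\<^sub>CG i) [^]\<^sub>CG p =
    \<one>\<^sub>CG \<oplus>\<^sub>CG (cgr_const R H (nu (int p)) \<otimes>\<^sub>CG i \<oplus>\<^sub>CG i \<otimes>\<^sub>CG i \<otimes>\<^sub>CG s)"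
    using one_plus_pow[OF i(1), of p] by blast
  let ?k = "cgr_const R H (nu (int p)) \<otimes>\<^sub>CG i \<oplus>\<^sub>CG i \<otimes>\<^sub>CG i \<otimes>\<^sub>CG s"
  have c: "cgr_const R H (nu (int p)) \<in> carrier CG" by (simp add: nu_simps const_closed)
  have "fil (Suc K + Suc K + 0) (i \<otimes>\<^sub>CG i \<otimes>\<^sub>CG s)"
    using i s(1) by (intro fil_mult fil_0) auto
  then have "fil (Suc (Suc K)) (i \<otimes>\<^sub>CG i \<otimes>\<^sub>CG s)" by (rule fil_mono) simp
  then have "fil (Suc (Suc K)) ?k"
    using fil_p[OF i(1,2)] i(1) s(1) c by (intro fil_add) auto
  moreover have "(\<one>\<^sub>CG \<oplus>\<^sub>CG j) [^]\<^sub>CG (p ^ Suc K) = \<one>\<^sub>CG \<oplus>\<^sub>CG ?k"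
    using OC.nat_pow_pow[of "\<one>\<^sub>CG \<oplus>\<^sub>CG j" "p ^ K" p] j(1) i(3) s(2) by (simp add: mult.commute)
  ultimately show ?case using i(1) s(1) c by (intro bexI[of _ ?k]) auto
qed

text \<open>With z = N + p^K y the group element factors as (1 + x)^N times (1 + j)^(p^K), j of
  augmentation zero. The second factor is 1 up to order K + 1, and N choose k approximates the
  p-adic binomial, so both sides agree modulo p^i for every i; \<open>separated\<close>
  concludes.\<close>

lemma cf_elt:
  assumes z: "z \<in> carrier (Zp p)" and k: "k \<le> n"
  shows "AT.cf (cgr_elt R H (sig z)) k = q (Zp_binom p z k)"
proof -
  let ?g = "cgr_elt R H (sig z)" and ?u = "cgr_elt R H (sig \<one>\<^sub>(Zp p))"
  have gc: "?g \<in> carrier CG" and uc: "?u \<in> carrier CG" using elt_closed z by auto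
  have bc: "Zp_binom p z k \<in> carrier (Zp p)" by (rule Zp_binom_closed[OF z])
  have "AT.cf ?g k \<ominus>\<^sub>R q (Zp_binom p z k) = \<zero>\<^sub>R"
  proof (rule separated)
    show "AT.cf ?g k \<ominus>\<^sub>R q (Zp_binom p z k) \<in> carrier R"
      using AT.cf_closed[OF gc] q_simps(1)[OF bc] by simp
    fix i
    \<comment> \<open>Of the precision K, \<open>vfact k\<close> digits are lost in the binomial
      coefficient and up to n in passing from the filtration to coefficient k; i digits
      remain.\<close>
    define K where "K = i + vfact k + n"
    define N where "N = nat (z K)"
    have N: "int N = z K" using ZpD(3)[OF z] by (simp add: N_def)
    obtain y where y: "y \<in> carrier (Zp p)" "z = Zp_int p (z K) \<oplus>\<^sub>(Zp p) Zp_int p (int p ^ K) \<otimes>\<^sub>(Zp p) y"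
      using Zp_approx[OF z] .
    have g: "?g = ?u [^]\<^sub>CG N \<otimes>\<^sub>CG cgr_elt R H (sig y) [^]\<^sub>CG (p ^ K)"
    proof -
      have "?g = cgr_elt R H (sig (Zp_int p (int N))) \<otimes>\<^sub>CG cgr_elt R H (sig (Zp_int p (int (p ^ K)) \<otimes>\<^sub>(Zp p) y))"
        using y(1) arg_cong[OF y(2), of "\<lambda>z. cgr_elt R H (sig z)"] N by (simp add: elt_add Zp_int_closed)
      also have "\<dots> = ?u [^]\<^sub>CG N \<otimes>\<^sub>CG cgr_elt R H (sig y) [^]\<^sub>CG (p ^ K)"
        unfolding elt_nat_smult[OF y(1)] using elt_nat_smult[OF Z.one_closed, of N] by (simp add: Zp_int_closed)
      finally show ?thesis .
    qed
    have yc: "cgr_elt R H (sig y) \<in> carrier CG" using elt_closed y by simp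
    define j where "j = cgr_elt R H (sig y) \<ominus>\<^sub>CG \<one>\<^sub>CG"
    have jc: "j \<in> carrier CG" using yc by (simp add: j_def)
    have yj: "cgr_elt R H (sig y) = \<one>\<^sub>CG \<oplus>\<^sub>CG j"
    proof -
      have "j \<oplus>\<^sub>CG \<one>\<^sub>CG = cgr_elt R H (sig y)"
        unfolding j_def using yc by (simp add: a_minus_def OC.a_assoc OC.l_neg)
      then show ?thesis using jc by (simp add: OC.a_comm)
    qed
    have aj: "augm j = \<zero>\<^sub>R"
    proof -
      have "augm (cgr_elt R H (sig y)) = \<one>\<^sub>R"
        unfolding augm_def elt_eq single_eval[OF carrier_open]
        using G.coset_join2[OF sig_closed[OF y(1)] G.subgroup_self sig_closed[OF y(1)]]
        by (simp add: gr_single_def Mod_top)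
      then have "\<one>\<^sub>R \<oplus>\<^sub>R augm j = \<one>\<^sub>R" using yj jc AR.aug_simps by simp
      then show ?thesis using AR.aug_simps(1)[OF jc] by (metis R.add.l_cancel_one R.one_closed)
    qed
    obtain j' where j': "j' \<in> carrier CG" "j = xx \<otimes>\<^sub>CG j'" using aug_divisible[OF jc aj] by blast
    \<comment> \<open>Only the constant coefficient is constrained, since \<open>1 - k\<close> is 0
      for k \<ge> 1, and it vanishes because j is a multiple of x.\<close>
    have "fil 1 j"
      unfolding fil_def
    proof (intro allI impI)
      fix k assume k: "k \<le> n"
      show "\<exists>s\<in>carrier R. AT.cf j k = nu (int p ^ (1 - k)) \<otimes>\<^sub>R s"
      proof (cases k)
        case 0
        then show ?thesis using AT.cf_x[OF j'(1), of 0] j'(2)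
          by (intro bexI[of _ "\<zero>\<^sub>R"]) (auto simp: nu_simps)
      next
        case (Suc k')
        then show ?thesis using AT.cf_closed[OF jc, of k]
          by (intro bexI[of _ "AT.cf j k"]) (auto simp: nu_simps)
      qed
    qed
    then obtain e where e: "e \<in> carrier CG" "fil (Suc K) e"
      "(\<one>\<^sub>CG \<oplus>\<^sub>CG j) [^]\<^sub>CG (p ^ K) = \<one>\<^sub>CG \<oplus>\<^sub>CG e"
      using one_plus_p_power[OF jc] by blast
    have uN: "?u [^]\<^sub>CG N \<in> carrier CG" using uc by simp
    have g2: "?g = ?u [^]\<^sub>CG N \<oplus>\<^sub>CG ?u [^]\<^sub>CG N \<otimes>\<^sub>CG e"
      unfolding g yj e(3) using uN e(1) by (simp add: OC.r_distr)
    have cu: "AT.cf (?u [^]\<^sub>CG N) k = nu (int (N choose k))"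
      using AT.cf_eqI[OF uN _ expands_elt_pow k] by (simp add: nu_simps)
    have "fil (0 + Suc K) (?u [^]\<^sub>CG N \<otimes>\<^sub>CG e)"
      using uN e by (intro fil_mult fil_0) auto
    then obtain s where s: "s \<in> carrier R" "AT.cf (?u [^]\<^sub>CG N \<otimes>\<^sub>CG e) k = nu (int p ^ (Suc K - k)) \<otimes>\<^sub>R s"
      using k unfolding fil_def by auto
    obtain t where t: "t \<in> carrier R" "AT.cf (?u [^]\<^sub>CG N \<otimes>\<^sub>CG e) k = nu (int p ^ i) \<otimes>\<^sub>R t"
    proof -
      have "i \<le> Suc K - k" using k by (simp add: K_def)
      from nu_dvd_mono[OF s this] that show ?thesis by blast
    qed
    have "Zp_int p (int (N choose k)) \<ominus>\<^sub>(Zp p) Zp_binom p z k \<in> Zp_ker p i"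
      using bc Zp_binom_comp[OF z, of i k K] unfolding Zp_ker_def N_def
      by (simp add: Zp_int_closed Zp_minus) (simp add: Zp_int_def mod_simps K_def)
    then obtain w where w: "w \<in> carrier (Zp p)"
      "Zp_int p (int (N choose k)) \<ominus>\<^sub>(Zp p) Zp_binom p z k = Zp_int p (int p ^ i) \<otimes>\<^sub>(Zp p) w"
      by (rule Zp_ker_dvd)
    have "nu (int (N choose k)) \<ominus>\<^sub>R q (Zp_binom p z k) = nu (int p ^ i) \<otimes>\<^sub>R q w"
    proof -
      have "q (\<ominus>\<^sub>(Zp p) Zp_binom p z k) = \<ominus>\<^sub>R q (Zp_binom p z k)"
        by (rule additive_minus[OF Z.abelian_group_axioms R.abelian_group_axioms q_simps(1,2) bc])
      then have "q (Zp_int p (int (N choose k)) \<ominus>\<^sub>(Zp p) Zp_binom p z k) = nu (int (N choose k)) \<ominus>\<^sub>R q (Zp_binom p z k)"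
        by (simp only: a_minus_def q_simps(2)[OF Zp_int_closed Z.a_inv_closed[OF bc]] nu_def)
      then show ?thesis
        unfolding w(2) using q_simps(3)[OF Zp_int_closed w(1)] by (simp add: nu_def)
    qed
    moreover have "AT.cf ?g k \<ominus>\<^sub>R q (Zp_binom p z k) =
        AT.cf (?u [^]\<^sub>CG N \<otimes>\<^sub>CG e) k \<oplus>\<^sub>R (nu (int (N choose k)) \<ominus>\<^sub>R q (Zp_binom p z k))"
      unfolding g2 using uN e(1) k q_simps(1)[OF bc] t
      by (subst AT.cf_add) (auto simp: cu nu_simps a_minus_def R.a_ac)
    ultimately show "\<exists>s\<in>carrier R. AT.cf ?g k \<ominus>\<^sub>R q (Zp_binom p z k) = nu (int p ^ i) \<otimes>\<^sub>R s"
      using nu_dvd_add[of "AT.cf (?u [^]\<^sub>CG N \<otimes>\<^sub>CG e) k" "int p ^ i"] t w(1) q_simps(1) by auto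
  qed
  then show ?thesis
    using AT.cf_closed[OF gc] q_simps(1)[OF bc] by (simp add: R.minus_eq_zero_iff)
qed

end

section \<open>Continuous cohomology\<close>

text \<open>The cancellation behind d d = 0: X occurs with both signs on the left and W with both
  signs on the right.\<close>

lemma (in abelian_group) coboundary_identity:
  assumes "A \<in> carrier G" "X \<in> carrier G" "Y \<in> carrier G" "Z \<in> carrier G" "W \<in> carrier G" "V \<in> carrier G"
  shows "((A \<ominus> X) \<oplus> Y) \<oplus> ((X \<ominus> Z) \<oplus> V) = ((A \<ominus> Z) \<oplus> W) \<oplus> ((Y \<ominus> W) \<oplus> V)"
proof -
  have "((A \<ominus> X) \<oplus> Y) \<oplus> ((X \<ominus> Z) \<oplus> V) = (A \<oplus> Y) \<oplus> ((\<ominus> X \<oplus> X) \<oplus> (\<ominus> Z \<oplus> V))"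
    using assms by (simp add: a_minus_def a_ac)
  also have "\<dots> = (A \<oplus> Y) \<oplus> ((\<ominus> W \<oplus> W) \<oplus> (\<ominus> Z \<oplus> V))"
    using assms by (simp add: l_neg)
  also have "\<dots> = ((A \<ominus> Z) \<oplus> W) \<oplus> ((Y \<ominus> W) \<oplus> V)"
    using assms by (simp add: a_minus_def a_ac)
  finally show ?thesis .
qed

text \<open>Only the algebraic laws of the action are assumed, because the lemma serves T as well as
  its tensor products, whose topology is treated separately.\<close>

lemma coboundary1_cocycle:
  assumes "group G" "abelian_group M"
    and cl: "\<And>g t. g \<in> carrier G ==> t \<in> carrier M ==> act M g t \<in> carrier M"
    and ad: "\<And>g t u. g \<in> carrier G ==> t \<in> carrier M ==> u \<in> carrier M ==>
      act M g (t \<oplus>\<^sub>M u) = act M g t \<oplus>\<^sub>M act M g u"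
    and mu: "\<And>g h t. g \<in> carrier G ==> h \<in> carrier G ==> t \<in> carrier M ==>
      act M (g \<otimes>\<^sub>G h) t = act M g (act M h t)"
    and b: "\<And>g. g \<in> carrier G ==> b g \<in> carrier M"
    and ghk: "g \<in> carrier G" "h \<in> carrier G" "k \<in> carrier G"
  shows "act M g (coboundary1 G M b (h, k)) \<oplus>\<^sub>M coboundary1 G M b (g, h \<otimes>\<^sub>G k) =
    coboundary1 G M b (g \<otimes>\<^sub>G h, k) \<oplus>\<^sub>M coboundary1 G M b (g, h)"
proof -
  interpret group G by fact
  interpret M: abelian_group M by fact
  have mi: "act M g (\<ominus>\<^sub>M t) = \<ominus>\<^sub>M act M g t" if "t \<in> carrier M" for t
    using additive_minus[OF assms(2,2), of "act M g" t] cl ad ghk that by blast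
  have "act M g (coboundary1 G M b (h, k)) =
      (act M (g \<otimes>\<^sub>G h) (b k) \<ominus>\<^sub>M act M g (b (h \<otimes>\<^sub>G k))) \<oplus>\<^sub>M act M g (b h)"
    using ghk b by (simp add: coboundary1_def a_minus_def ad cl mi mu)
  then show ?thesis
    using ghk b cl M.coboundary_identity[of "act M (g \<otimes>\<^sub>G h) (b k)" "act M g (b (h \<otimes>\<^sub>G k))" "act M g (b h)"
        "b (g \<otimes>\<^sub>G h \<otimes>\<^sub>G k)" "b (g \<otimes>\<^sub>G h)" "b g"]
    by (simp add: coboundary1_def m_assoc)
qed

section \<open>Cocycles, coboundaries and H^2 of a topological G-module\<close>

context top_gmodule
begin

abbreviation "GG \<equiv> carrier G \<times> carrier G"
abbreviation "GT2 \<equiv> prod_topology (grp_top G) (grp_top G)"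
abbreviation "Z2m \<equiv> fun_module T GG (Z2 G T)"

lemma top_GG: "topspace GT2 = GG"
  by (simp add: top_G)

lemma C1_eval: "f \<in> C1 G T ==> g \<in> carrier G ==> f g \<in> carrier T"
  unfolding C1_def using continuous_map_image_subset_topspace[of "grp_top G" "mod_top T" f] top_G top_T by auto

lemma C2_eval: "c \<in> C2 G T ==> s \<in> GG ==> c s \<in> carrier T"
  unfolding C2_def using continuous_map_image_subset_topspace[of GT2 "mod_top T" c] top_GG top_T by blast

lemma Z2_eval: "c \<in> Z2 G T ==> s \<in> GG ==> c s \<in> carrier T"
  unfolding Z2_def using C2_eval by blast

lemma Z2_ext:
  assumes "c \<in> Z2 G T" shows "(\<lambda>s\<in>GG. c s) = c"
  using assms unfolding Z2_def C2_def by (auto intro: extensional_restrict)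

lemma Z2_I:
  assumes "continuous_map GT2 (mod_top T) c"
    and "\<And>g h k. g \<in> carrier G ==> h \<in> carrier G ==> k \<in> carrier G ==>
      act T g (c (h, k)) \<oplus>\<^sub>T c (g, h \<otimes>\<^sub>G k) = c (g \<otimes>\<^sub>G h, k) \<oplus>\<^sub>T c (g, h)"
  shows "(\<lambda>s\<in>GG. c s) \<in> Z2 G T"
proof -
  have "continuous_map GT2 (mod_top T) (\<lambda>s\<in>GG. c s)"
    by (rule continuous_map_eq[OF assms(1)]) (simp add: top_G)
  then show ?thesis
    unfolding Z2_def C2_def using assms(2) by simp
qed

lemma Z2_D:
  assumes "c \<in> Z2 G T"
  shows "continuous_map GT2 (mod_top T) c"
    and "g \<in> carrier G ==> h \<in> carrier G ==> k \<in> carrier G ==>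
      act T g (c (h, k)) \<oplus>\<^sub>T c (g, h \<otimes>\<^sub>G k) = c (g \<otimes>\<^sub>G h, k) \<oplus>\<^sub>T c (g, h)"
  using assms by (auto simp: Z2_def C2_def)

lemma fun_module_simps:
  "carrier Z2m = Z2 G T" "zero Z2m = (\<lambda>s\<in>GG. \<zero>\<^sub>T)"
  "add Z2m = (\<lambda>f f'. \<lambda>s\<in>GG. f s \<oplus>\<^sub>T f' s)" "smult Z2m = (\<lambda>r f. \<lambda>s\<in>GG. r \<odot>\<^sub>T f s)"
  by (simp_all add: fun_module_def)

lemma act_zero: "g \<in> carrier G ==> act T g \<zero>\<^sub>T = \<zero>\<^sub>T"
  by (rule additive_zero[OF M.abelian_group_axioms M.abelian_group_axioms]) (auto simp: act_closed act_add)

lemma Z2_add: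
  assumes c: "c \<in> Z2 G T" and d: "d \<in> Z2 G T"
  shows "(\<lambda>s\<in>GG. c s \<oplus>\<^sub>T d s) \<in> Z2 G T"
proof (rule Z2_I)
  show "continuous_map GT2 (mod_top T) (\<lambda>s. c s \<oplus>\<^sub>T d s)"
    by (intro continuous_add Z2_D(1) c d)
  fix g h k assume ghk: "g \<in> carrier G" "h \<in> carrier G" "k \<in> carrier G"
  note ev = Z2_eval[OF c] Z2_eval[OF d] act_closed
  have "act T g (c (h, k) \<oplus>\<^sub>T d (h, k)) \<oplus>\<^sub>T (c (g, h \<otimes>\<^sub>G k) \<oplus>\<^sub>T d (g, h \<otimes>\<^sub>G k)) =
      (act T g (c (h, k)) \<oplus>\<^sub>T c (g, h \<otimes>\<^sub>G k)) \<oplus>\<^sub>T (act T g (d (h, k)) \<oplus>\<^sub>T d (g, h \<otimes>\<^sub>G k))"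
    using ghk ev by (simp add: act_add M.a_ac)
  also have "\<dots> = (c (g \<otimes>\<^sub>G h, k) \<oplus>\<^sub>T c (g, h)) \<oplus>\<^sub>T (d (g \<otimes>\<^sub>G h, k) \<oplus>\<^sub>T d (g, h))"
    using Z2_D(2)[OF c ghk] Z2_D(2)[OF d ghk] by simp
  also have "\<dots> = (c (g \<otimes>\<^sub>G h, k) \<oplus>\<^sub>T d (g \<otimes>\<^sub>G h, k)) \<oplus>\<^sub>T (c (g, h) \<oplus>\<^sub>T d (g, h))"
    using ghk ev by (simp add: M.a_ac)
  finally show "act T g (c (h, k) \<oplus>\<^sub>T d (h, k)) \<oplus>\<^sub>T (c (g, h \<otimes>\<^sub>G k) \<oplus>\<^sub>T d (g, h \<otimes>\<^sub>G k)) =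
      (c (g \<otimes>\<^sub>G h, k) \<oplus>\<^sub>T d (g \<otimes>\<^sub>G h, k)) \<oplus>\<^sub>T (c (g, h) \<oplus>\<^sub>T d (g, h))" .
qed

lemma Z2_smult:
  assumes c: "c \<in> Z2 G T" and r: "r \<in> carrier R"
  shows "(\<lambda>s\<in>GG. r \<odot>\<^sub>T c s) \<in> Z2 G T"
proof (rule Z2_I)
  show "continuous_map GT2 (mod_top T) (\<lambda>s. r \<odot>\<^sub>T c s)"
    using r by (intro continuous_smult Z2_D(1) c) (simp add: top_R)
  fix g h k assume ghk: "g \<in> carrier G" "h \<in> carrier G" "k \<in> carrier G"
  note ev = Z2_eval[OF c] act_closed
  have "act T g (r \<odot>\<^sub>T c (h, k)) \<oplus>\<^sub>T r \<odot>\<^sub>T c (g, h \<otimes>\<^sub>G k) = r \<odot>\<^sub>T (act T g (c (h, k)) \<oplus>\<^sub>T c (g, h \<otimes>\<^sub>G k))"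
    using ghk ev r by (simp add: act_smult smult_r_distr)
  also have "\<dots> = r \<odot>\<^sub>T c (g \<otimes>\<^sub>G h, k) \<oplus>\<^sub>T r \<odot>\<^sub>T c (g, h)"
    using Z2_D(2)[OF c ghk] ghk ev r by (simp add: smult_r_distr)
  finally show "act T g (r \<odot>\<^sub>T c (h, k)) \<oplus>\<^sub>T r \<odot>\<^sub>T c (g, h \<otimes>\<^sub>G k) =
      r \<odot>\<^sub>T c (g \<otimes>\<^sub>G h, k) \<oplus>\<^sub>T r \<odot>\<^sub>T c (g, h)" .
qed

lemma Z2_zero: "(\<lambda>s\<in>GG. \<zero>\<^sub>T) \<in> Z2 G T"
  by (rule Z2_I) (auto simp: act_zero top_T)

lemma Z2m_module: "module R Z2m"
proof (rule moduleI)
  show "cring R" by (rule R.is_cring)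
  show "abelian_group Z2m"
  proof (rule abelian_groupI; unfold fun_module_simps)
    fix c d e assume c: "c \<in> Z2 G T" and d: "d \<in> Z2 G T" and e: "e \<in> Z2 G T"
    note ev = Z2_eval[OF c] Z2_eval[OF d] Z2_eval[OF e]
    show "(\<lambda>s\<in>GG. (\<lambda>s\<in>GG. c s \<oplus>\<^sub>T d s) s \<oplus>\<^sub>T e s) = (\<lambda>s\<in>GG. c s \<oplus>\<^sub>T (\<lambda>s\<in>GG. d s \<oplus>\<^sub>T e s) s)"
      by (rule restrict_ext) (simp add: ev M.a_assoc)
  next
    fix c d assume c: "c \<in> Z2 G T" and d: "d \<in> Z2 G T"
    note ev = Z2_eval[OF c] Z2_eval[OF d]
    show "(\<lambda>s\<in>GG. c s \<oplus>\<^sub>T d s) = (\<lambda>s\<in>GG. d s \<oplus>\<^sub>T c s)"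
      by (rule restrict_ext) (simp add: ev M.a_comm)
  next
    fix c assume c: "c \<in> Z2 G T"
    note ev = Z2_eval[OF c]
    have "(\<lambda>s\<in>GG. (\<lambda>s\<in>GG. \<zero>\<^sub>T) s \<oplus>\<^sub>T c s) = (\<lambda>s\<in>GG. c s)"
      by (rule restrict_ext) (simp add: ev)
    then show "(\<lambda>s\<in>GG. (\<lambda>s\<in>GG. \<zero>\<^sub>T) s \<oplus>\<^sub>T c s) = c" using Z2_ext[OF c] by simp
    have "(\<lambda>s\<in>GG. (\<lambda>s\<in>GG. \<ominus>\<^sub>R \<one>\<^sub>R \<odot>\<^sub>T c s) s \<oplus>\<^sub>T c s) = (\<lambda>s\<in>GG. \<zero>\<^sub>T)"
      by (rule restrict_ext) (simp add: ev smult_l_minus M.l_neg)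
    then show "\<exists>d\<in>Z2 G T. (\<lambda>s\<in>GG. d s \<oplus>\<^sub>T c s) = (\<lambda>s\<in>GG. \<zero>\<^sub>T)"
      using Z2_smult[OF c, of "\<ominus>\<^sub>R \<one>\<^sub>R"] by blast
  qed (auto intro: Z2_add Z2_zero)
next
  fix r c assume r: "r \<in> carrier R" and c': "c \<in> carrier Z2m"
  then have c: "c \<in> Z2 G T" by (simp add: fun_module_simps)
  note ev = Z2_eval[OF c]
  show "r \<odot>\<^sub>Z2m c \<in> carrier Z2m" unfolding fun_module_simps by (rule Z2_smult[OF c r])
  {
    fix d assume "d \<in> carrier Z2m"
    then have d: "d \<in> Z2 G T" by (simp add: fun_module_simps)
    show "r \<odot>\<^sub>Z2m (c \<oplus>\<^sub>Z2m d) = r \<odot>\<^sub>Z2m c \<oplus>\<^sub>Z2m r \<odot>\<^sub>Z2m d"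
      unfolding fun_module_simps by (rule restrict_ext) (simp add: ev Z2_eval[OF d] r smult_r_distr)
  }
  {
    fix t assume t: "t \<in> carrier R"
    show "(r \<oplus>\<^sub>R t) \<odot>\<^sub>Z2m c = r \<odot>\<^sub>Z2m c \<oplus>\<^sub>Z2m t \<odot>\<^sub>Z2m c"
      unfolding fun_module_simps by (rule restrict_ext) (simp add: ev r t smult_l_distr)
    show "(r \<otimes>\<^sub>R t) \<odot>\<^sub>Z2m c = r \<odot>\<^sub>Z2m (t \<odot>\<^sub>Z2m c)"
      unfolding fun_module_simps by (rule restrict_ext) (simp add: ev r t smult_assoc1)
  }
next
  fix c assume "c \<in> carrier Z2m"
  then have c: "c \<in> Z2 G T" by (simp add: fun_module_simps)
  have "\<one>\<^sub>R \<odot>\<^sub>Z2m c = (\<lambda>s\<in>GG. c s)"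
    unfolding fun_module_simps by (rule restrict_ext) (simp add: Z2_eval[OF c])
  then show "\<one>\<^sub>R \<odot>\<^sub>Z2m c = c" using Z2_ext[OF c] by simp
qed

lemma coboundary1_eval: "g \<in> carrier G ==> h \<in> carrier G ==>
    coboundary1 G T f (g, h) = (act T g (f h) \<ominus>\<^sub>T f (g \<otimes>\<^sub>G h)) \<oplus>\<^sub>T f g"
  by (simp add: coboundary1_def)

lemma coboundary1_Z2:
  assumes "continuous_map (grp_top G) (mod_top T) f"
  shows "coboundary1 G T f \<in> Z2 G T"
proof -
  have fc: "f g \<in> carrier T" if "g \<in> carrier G" for g
    using continuous_map_image_subset_topspace[OF assms] that top_G top_T by auto
  have fst: "continuous_map GT2 (grp_top G) fst" and snd: "continuous_map GT2 (grp_top G) snd"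
    by (rule continuous_map_fst continuous_map_snd)+
  let ?D = "\<lambda>s. (act T (fst s) (f (snd s)) \<ominus>\<^sub>T f (fst s \<otimes>\<^sub>G snd s)) \<oplus>\<^sub>T f (fst s)"
  have eq: "coboundary1 G T f = (\<lambda>s\<in>GG. ?D s)"
    unfolding coboundary1_def by (rule restrict_ext) (simp add: case_prod_beta)
  note cf = continuous_map_compose[OF _ assms, unfolded o_def]
  have "continuous_map GT2 (mod_top T) ?D"
    by (intro continuous_add continuous_minus continuous_act cf continuous_mult fst snd)
  moreover have "act T g (?D (h, k)) \<oplus>\<^sub>T ?D (g, h \<otimes>\<^sub>G k) = ?D (g \<otimes>\<^sub>G h, k) \<oplus>\<^sub>T ?D (g, h)"
    if "g \<in> carrier G" "h \<in> carrier G" "k \<in> carrier G" for g h k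
    using coboundary1_cocycle[OF G.group_axioms M.abelian_group_axioms act_closed act_add act_mult fc that] that
    by (simp add: coboundary1_eval)
  ultimately show ?thesis unfolding eq by (rule Z2_I)
qed

lemma C1_I: "continuous_map (grp_top G) (mod_top T) f ==> (\<lambda>g\<in>carrier G. f g) \<in> C1 G T"
  unfolding C1_def by (auto intro: continuous_map_eq simp: top_G)

lemma coboundary1_cong:
  "(\<And>g. g \<in> carrier G ==> f g = f' g) ==> coboundary1 G T f = coboundary1 G T f'"
  unfolding coboundary1_def by (rule restrict_ext) auto

lemma B2_I: "continuous_map (grp_top G) (mod_top T) f ==> coboundary1 G T f \<in> B2 G T"
  unfolding B2_def
  by (rule image_eqI[OF coboundary1_cong C1_I]) simp_all

lemma B2_E:
  assumes "c \<in> B2 G T"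
  obtains f where "f \<in> C1 G T" "continuous_map (grp_top G) (mod_top T) f" "c = coboundary1 G T f"
  using assms unfolding B2_def C1_def by blast

lemma B2_submodule: "submodule (B2 G T) R Z2m"
proof -
  interpret Z: module R Z2m by (rule Z2m_module)
  have add: "coboundary1 G T f \<oplus>\<^sub>Z2m coboundary1 G T f' = coboundary1 G T (\<lambda>g. f g \<oplus>\<^sub>T f' g)"
    if f: "f \<in> C1 G T" and f': "f' \<in> C1 G T" for f f'
    unfolding fun_module_simps coboundary1_def
  proof (rule restrict_ext)
    fix s assume "s \<in> GG"
    then obtain g h where s: "s = (g, h)" "g \<in> carrier G" "h \<in> carrier G" by auto
    note ev = C1_eval[OF f] C1_eval[OF f'] act_closed
    show "(\<lambda>(g, h)\<in>GG. act T g (f h) \<ominus>\<^sub>T f (g \<otimes>\<^sub>G h) \<oplus>\<^sub>T f g) s \<oplus>\<^sub>T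
      (\<lambda>(g, h)\<in>GG. act T g (f' h) \<ominus>\<^sub>T f' (g \<otimes>\<^sub>G h) \<oplus>\<^sub>T f' g) s =
      (case s of (g, h) => act T g (f h \<oplus>\<^sub>T f' h) \<ominus>\<^sub>T (f (g \<otimes>\<^sub>G h) \<oplus>\<^sub>T f' (g \<otimes>\<^sub>G h)) \<oplus>\<^sub>T (f g \<oplus>\<^sub>T f' g))"
      using s ev by (simp add: a_minus_def act_add M.minus_add M.a_ac)
  qed
  have sm: "r \<odot>\<^sub>Z2m coboundary1 G T f = coboundary1 G T (\<lambda>g. r \<odot>\<^sub>T f g)"
    if f: "f \<in> C1 G T" and r: "r \<in> carrier R" for f r
    unfolding fun_module_simps coboundary1_def
  proof (rule restrict_ext)
    fix s assume "s \<in> GG"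
    then obtain g h where s: "s = (g, h)" "g \<in> carrier G" "h \<in> carrier G" by auto
    note ev = C1_eval[OF f] act_closed
    show "r \<odot>\<^sub>T (\<lambda>(g, h)\<in>GG. act T g (f h) \<ominus>\<^sub>T f (g \<otimes>\<^sub>G h) \<oplus>\<^sub>T f g) s =
      (case s of (g, h) => act T g (r \<odot>\<^sub>T f h) \<ominus>\<^sub>T r \<odot>\<^sub>T f (g \<otimes>\<^sub>G h) \<oplus>\<^sub>T r \<odot>\<^sub>T f g)"
      using s ev r by (simp add: a_minus_def act_smult smult_r_distr smult_r_minus)
  qed
  have addB: "a \<oplus>\<^sub>Z2m b \<in> B2 G T" if ab: "a \<in> B2 G T" "b \<in> B2 G T" for a b
  proof -
    obtain f where f: "f \<in> C1 G T" "continuous_map (grp_top G) (mod_top T) f" "a = coboundary1 G T f"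
      using B2_E[OF ab(1)] .
    obtain f' where f': "f' \<in> C1 G T" "continuous_map (grp_top G) (mod_top T) f'" "b = coboundary1 G T f'"
      using B2_E[OF ab(2)] .
    show ?thesis
      unfolding f(3) f'(3) add[OF f(1) f'(1)] by (intro B2_I continuous_add f(2) f'(2))
  qed
  have smB: "r \<odot>\<^sub>Z2m a \<in> B2 G T" if ra: "r \<in> carrier R" "a \<in> B2 G T" for r a
  proof -
    obtain f where f: "f \<in> C1 G T" "continuous_map (grp_top G) (mod_top T) f" "a = coboundary1 G T f"
      using B2_E[OF ra(2)] .
    show ?thesis
      unfolding f(3) sm[OF f(1) ra(1)] using ra(1)
      by (intro B2_I continuous_smult f(2)) (simp add: top_R)
  qed
  have sub: "B2 G T \<subseteq> carrier Z2m"
    unfolding fun_module_simps using coboundary1_Z2 by (auto elim!: B2_E)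
  have z: "\<zero>\<^sub>Z2m \<in> B2 G T"
  proof -
    have b: "coboundary1 G T (\<lambda>g. \<zero>\<^sub>T) \<in> B2 G T" by (intro B2_I continuous_const) simp
    then have "\<zero>\<^sub>R \<odot>\<^sub>Z2m coboundary1 G T (\<lambda>g. \<zero>\<^sub>T) = \<zero>\<^sub>Z2m"
      using sub by (intro Z.smult_l_null) blast
    then show ?thesis using smB[OF R.zero_closed b] by simp
  qed
  show ?thesis
  proof (rule Z.submoduleI[OF sub z])
    fix a assume a: "a \<in> B2 G T"
    then have "\<ominus>\<^sub>Z2m a = \<ominus>\<^sub>R \<one>\<^sub>R \<odot>\<^sub>Z2m a"
      using sub by (subst Z.smult_l_minus) auto
    then show "\<ominus>\<^sub>Z2m a \<in> B2 G T" using smB[OF _ a] by simp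
  qed (use addB smB in auto)
qed

lemma B2_subgroup: "subgroup (B2 G T) (add_monoid Z2m)"
  by (rule submodule.axioms(1)[OF B2_submodule])

lemma H2_module: "module R (H2 G T)"
  unfolding H2_def by (rule quot_module_is_module[OF Z2m_module B2_submodule])

lemma H2_carrier: "carrier (H2 G T) = class2 G T ` Z2 G T"
  unfolding H2_def quot_module_simps fun_module_simps(1) class2_def ..

lemma H2_smult: "r \<in> carrier R ==> c \<in> Z2 G T ==> r \<odot>\<^sub>(H2 G T) class2 G T c = class2 G T (\<lambda>s\<in>GG. r \<odot>\<^sub>T c s)"
  using coset_smult[OF Z2m_module B2_submodule, of r c]
  unfolding H2_def quot_module_simps(4) class2_def fun_module_simps(1,4) by blast

lemma class2_eqI:
  assumes "c \<in> Z2 G T" "d \<in> Z2 G T" "continuous_map (grp_top G) (mod_top T) e"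
    and "\<And>g h. g \<in> carrier G ==> h \<in> carrier G ==> c (g, h) = coboundary1 G T e (g, h) \<oplus>\<^sub>T d (g, h)"
  shows "class2 G T c = class2 G T d"
proof -
  interpret Z: module R Z2m by (rule Z2m_module)
  let ?b = "coboundary1 G T e"
  have bZ: "?b \<in> carrier Z2m" unfolding fun_module_simps by (rule coboundary1_Z2[OF assms(3)])
  have cd: "c \<in> carrier Z2m" "d \<in> carrier Z2m" using assms(1,2) by (simp_all add: fun_module_simps)
  have "(\<lambda>s\<in>GG. c s) = ?b \<oplus>\<^sub>Z2m d"
    unfolding fun_module_simps by (rule restrict_ext) (use assms(4) in auto)
  then have "c = ?b \<oplus>\<^sub>Z2m d" using Z2_ext[OF assms(1)] by simp
  then have "c \<ominus>\<^sub>Z2m d = ?b"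
    using bZ cd by (simp add: a_minus_def Z.M.a_assoc Z.M.r_neg)
  then show ?thesis
    unfolding class2_def using B2_I[OF assms(3)] cd
    by (subst coset_eq_iff[OF module_is_abelian_group[OF Z2m_module] B2_subgroup]) auto
qed

lemma class2_elem:
  assumes "c \<in> Z2 G T" "d \<in> class2 G T c"
  obtains e where "continuous_map (grp_top G) (mod_top T) e" "d = (\<lambda>s\<in>GG. coboundary1 G T e s \<oplus>\<^sub>T c s)"
proof -
  obtain b where b: "b \<in> B2 G T" "d = b \<oplus>\<^sub>Z2m c"
    using assms(2) unfolding class2_def a_r_coset_def' by blast
  obtain e where e: "continuous_map (grp_top G) (mod_top T) e" "b = coboundary1 G T e"
    using B2_E[OF b(1)] by blast
  show ?thesis by (rule that[OF e(1)]) (simp add: b(2) e(2) fun_module_simps)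
qed

end

text \<open>The algebraic part of a G-module. It carries the coboundary identities for T \<otimes>
  \<Omega>/I^(n+1), where continuity is handled through coordinates instead of the group
  operations.\<close>

locale gmod = G: group G + M: abelian_group M
  for G :: "('g, 'x) topgroup_scheme" and M :: "('r, 'm, 'g, 'z) gmodule_scheme" +
  assumes cl: "g \<in> carrier G ==> t \<in> carrier M ==> act M g t \<in> carrier M"
    and ad: "g \<in> carrier G ==> t \<in> carrier M ==> u \<in> carrier M ==>
      act M g (t \<oplus>\<^sub>M u) = act M g t \<oplus>\<^sub>M act M g u"
    and mu: "g \<in> carrier G ==> h \<in> carrier G ==> t \<in> carrier M ==>
      act M (g \<otimes>\<^sub>G h) t = act M g (act M h t)"
begin

lemma mi: "g \<in> carrier G ==> t \<in> carrier M ==> act M g (\<ominus>\<^sub>M t) = \<ominus>\<^sub>M act M g t"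
  using additive_minus[OF M.abelian_group_axioms M.abelian_group_axioms, of "act M g" t] cl ad by blast

lemma coboundary1_closed:
  assumes "\<And>g. g \<in> carrier G ==> b g \<in> carrier M" "g \<in> carrier G" "h \<in> carrier G"
  shows "coboundary1 G M b (g, h) \<in> carrier M"
  using assms by (simp add: coboundary1_def cl)

lemma coboundary1_add:
  assumes "\<And>g. g \<in> carrier G ==> b g \<in> carrier M" "\<And>g. g \<in> carrier G ==> b' g \<in> carrier M"
    "g \<in> carrier G" "h \<in> carrier G"
  shows "coboundary1 G M (\<lambda>g. b g \<oplus>\<^sub>M b' g) (g, h) =
    coboundary1 G M b (g, h) \<oplus>\<^sub>M coboundary1 G M b' (g, h)"
  using assms by (simp add: coboundary1_def ad cl a_minus_def M.minus_add M.a_ac)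

lemma coboundary1_coboundary0:
  assumes "m \<in> carrier M" "g \<in> carrier G" "h \<in> carrier G"
  shows "coboundary1 G M (\<lambda>g. act M g m \<ominus>\<^sub>M m) (g, h) = \<zero>\<^sub>M"
proof -
  let ?x = "act M g (act M h m)" and ?y = "act M g m"
  have c: "?x \<in> carrier M" "?y \<in> carrier M" using assms cl by auto
  have "coboundary1 G M (\<lambda>g. act M g m \<ominus>\<^sub>M m) (g, h) = (?x \<ominus>\<^sub>M ?y \<ominus>\<^sub>M (?x \<ominus>\<^sub>M m)) \<oplus>\<^sub>M (?y \<ominus>\<^sub>M m)"
    using assms by (simp add: coboundary1_def mu a_minus_def ad cl mi)
  also have "\<dots> = (?x \<oplus>\<^sub>M \<ominus>\<^sub>M ?x) \<oplus>\<^sub>M ((?y \<oplus>\<^sub>M \<ominus>\<^sub>M ?y) \<oplus>\<^sub>M (m \<oplus>\<^sub>M \<ominus>\<^sub>M m))"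
    using c assms(1) by (simp add: a_minus_def M.minus_add M.a_ac)
  also have "\<dots> = \<zero>\<^sub>M" using c assms(1) by (simp add: M.r_neg)
  finally show ?thesis .
qed

lemma coboundary1_cong':
  "(\<And>g. g \<in> carrier G ==> b g = b' g) ==> g \<in> carrier G ==> h \<in> carrier G ==>
    coboundary1 G M b (g, h) = coboundary1 G M b' (g, h)"
  by (simp add: coboundary1_def)

lemma cocycle:
  assumes "\<And>g. g \<in> carrier G ==> b g \<in> carrier M" "g \<in> carrier G" "h \<in> carrier G" "k \<in> carrier G"
  shows "act M g (coboundary1 G M b (h, k)) \<oplus>\<^sub>M coboundary1 G M b (g, h \<otimes>\<^sub>G k) =
    coboundary1 G M b (g \<otimes>\<^sub>G h, k) \<oplus>\<^sub>M coboundary1 G M b (g, h)"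
  by (rule coboundary1_cocycle[OF G.group_axioms M.abelian_group_axioms cl ad mu assms])

end

section \<open>Tensor products with a based module carrying a group action\<close>

text \<open>By \<open>eps_a\<close> the group acts on coordinates by a lower triangular Toeplitz
  matrix: it acts as multiplication by the truncated power series with coefficients
  \<open>B k g\<close>.\<close>

locale tensor_action = tb: tensor_based R T N d e eps + tg: top_gmodule R G T
  for R :: "('r, 'x) topring_scheme" and G :: "('g, 'y) topgroup_scheme"
    and T :: "('r, 'm, 'g, 'z) gmodule_scheme" and N :: "('r, 'n, 'w) module_scheme"
    and d :: nat and e :: "nat => 'n" and eps :: "nat => 'n => 'r" +
  fixes a :: "'g => 'n => 'n" and B :: "nat => 'g => 'r"
  assumes a_closed: "g \<in> carrier G ==> \<nu> \<in> carrier N ==> a g \<nu> \<in> carrier N"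
    and a_add: "g \<in> carrier G ==> \<nu> \<in> carrier N ==> \<mu> \<in> carrier N ==>
      a g (\<nu> \<oplus>\<^sub>N \<mu>) = a g \<nu> \<oplus>\<^sub>N a g \<mu>"
    and a_smult: "g \<in> carrier G ==> r \<in> carrier R ==> \<nu> \<in> carrier N ==>
      a g (r \<odot>\<^sub>N \<nu>) = r \<odot>\<^sub>N a g \<nu>"
    and B_closed: "k < d ==> g \<in> carrier G ==> B k g \<in> carrier R"
    and B_cont: "k < d ==> continuous_map (grp_top G) (ring_top R) (B k)"
    and eps_a: "k < d ==> g \<in> carrier G ==> \<nu> \<in> carrier N ==>
      eps k (a g \<nu>) = (\<Oplus>\<^sub>R l\<in>{..k}. B (k - l) g \<otimes>\<^sub>R eps l \<nu>)"
begin

abbreviation "TN \<equiv> tensor_gmodule R T N a"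
abbreviation "pt \<equiv> pure_tensor R T N"
abbreviation "kap k \<equiv> tensor_coord R T N (eps k)"

lemma TN_simps:
  "carrier TN = carrier (tensor R T N)" "zero TN = zero (tensor R T N)" "add TN = add (tensor R T N)"
  "smult TN = smult (tensor R T N)" "mod_top TN = tensor_topology R T N"
  "act TN g = tensor_lift R T N (tensor R T N) (\<lambda>t \<nu>. pt (act T g t) (a g \<nu>))"
  by (simp_all add: tensor_gmodule_def)

lemma TN_module: "module R TN"
proof -
  interpret X: module R "tensor R T N" by (rule tb.tm.tensor_module)
  have "abelian_group TN"
    by (rule abelian_groupI)
      (auto simp: TN_simps X.M.a_ac intro: X.M.add.l_inv_ex)
  then show ?thesis
    by (intro moduleI tb.tm.cR)
      (auto simp: TN_simps X.smult_l_distr X.smult_r_distr X.smult_assoc1)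
qed

lemma TN_finsum: "finsum TN f A = finsum (tensor R T N) f A"
  by (rule finsum_eq_of_add_monoid_eq) (simp_all add: TN_simps)

lemma TN_minus: "z \<in> carrier TN ==> w \<in> carrier TN ==> z \<ominus>\<^sub>TN w = z \<ominus>\<^sub>(tensor R T N) w"
proof -
  assume z: "z \<in> carrier TN" and w: "w \<in> carrier TN"
  have "id (\<ominus>\<^sub>TN w) = \<ominus>\<^sub>(tensor R T N) (id w)"
    by (rule additive_minus[OF module_is_abelian_group[OF TN_module] tb.tm.tensor_agroup])
      (use w in \<open>simp_all add: TN_simps\<close>)
  then show ?thesis by (simp add: a_minus_def TN_simps)
qed

lemma kap_hom: "k < d ==> kap k \<in> module_hom R TN T"
  using tb.kap_hom[of k] unfolding module_hom_def TN_simps .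

lemmas kap_closed = module_homD(1)[OF kap_hom]
lemmas kap_add = module_homD(2)[OF kap_hom]

lemma kap_minus: "k < d ==> z \<in> carrier TN ==> w \<in> carrier TN ==> kap k (z \<ominus>\<^sub>TN w) = kap k z \<ominus>\<^sub>T kap k w"
  by (rule module_hom_diff[OF TN_module tb.M' kap_hom])

lemma pt_closed: "t \<in> carrier T ==> \<nu> \<in> carrier N ==> pt t \<nu> \<in> carrier TN"
  unfolding TN_simps by (rule tb.tm.pt_closed)

lemma TN_eqI: "y \<in> carrier TN ==> z \<in> carrier TN ==> (\<And>k. k < d ==> kap k y = kap k z) ==> y = z"
  unfolding TN_simps by (rule tb.tensor_eqI)

definition vec :: "(nat => 'm) => ('m \<times> 'n => 'r) set" where
  "vec t = (\<Oplus>\<^sub>(tensor R T N)k\<in>{..<d}. pt (t k) (e k))"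

lemma vec_closed: "(\<And>k. k < d ==> t k \<in> carrier T) ==> vec t \<in> carrier TN"
  unfolding vec_def TN_simps
  by (rule abelian_monoid.finsum_closed[OF module_is_abelian_monoid[OF tb.tm.tensor_module]])
    (auto simp: tb.tm.pt_closed tb.e_closed)

lemma kap_vec: "(\<And>k. k < d ==> t k \<in> carrier T) ==> l < d ==> kap l (vec t) = t l"
  unfolding vec_def by (rule tb.kap_sum)

lemma act_lift:
  assumes g: "g \<in> carrier G"
  shows act_hom: "act TN g \<in> module_hom R TN TN"
    and act_pure: "\<And>t \<nu>. t \<in> carrier T ==> \<nu> \<in> carrier N ==> act TN g (pt t \<nu>) = pt (act T g t) (a g \<nu>)"
proof -
  note c = tg.act_closed[OF g] a_closed[OF g]
  have "tensor_lift R T N (tensor R T N) (\<lambda>t \<nu>. pt (act T g t) (a g \<nu>)) \<in> module_hom R (tensor R T N) (tensor R T N)"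
    by (rule tb.tm.tensor_lift_hom[OF tb.tm.tensor_module])
      (simp_all add: c g tb.tm.pt_closed tg.act_add a_add tg.act_smult a_smult tb.tm.pt_add_left
        tb.tm.pt_add_right tb.tm.pt_smult_left tb.tm.pt_smult_right)
  then show "act TN g \<in> module_hom R TN TN" unfolding module_hom_def TN_simps .
  show "act TN g (pt t \<nu>) = pt (act T g t) (a g \<nu>)" if "t \<in> carrier T" "\<nu> \<in> carrier N" for t \<nu>
    unfolding TN_simps
    by (rule tb.tm.tensor_lift_pure[OF tb.tm.tensor_module])
      (simp_all add: that c g tb.tm.pt_closed tg.act_add a_add tg.act_smult a_smult tb.tm.pt_add_left
        tb.tm.pt_add_right tb.tm.pt_smult_left tb.tm.pt_smult_right)
qed

lemmas act_closed = module_homD(1)[OF act_hom]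
lemmas act_add = module_homD(2)[OF act_hom]

text \<open>Both sides are additive in \<open>z\<close>, so pure tensors suffice; there the factor
  in T is acted on by g and the factor in N contributes the Toeplitz sum of
  \<open>eps_a\<close>.\<close>

lemma kap_act:
  assumes k: "k < d" and g: "g \<in> carrier G" and z: "z \<in> carrier TN"
  shows "kap k (act TN g z) = (\<Oplus>\<^sub>T l\<in>{..k}. B (k - l) g \<odot>\<^sub>T act T g (kap l z))"
proof -
  have z': "z \<in> carrier (tensor R T N)" using z by (simp add: TN_simps)
  have amR: "abelian_monoid R"
    using tb.tm.cR by (simp add: cring_def ring_def abelian_group_def)
  have Bc: "B (k - l) g \<in> carrier R" for l by (rule B_closed) (use k g in auto)
  have ec: "eps l \<nu> \<in> carrier R" if "l \<le> k" "\<nu> \<in> carrier N" for l \<nu>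
    using tb.eps_closed[of l \<nu>] that k by simp
  have kc: "kap l y \<in> carrier T" if "l \<le> k" "y \<in> carrier (tensor R T N)" for l y
    using kap_closed[of l y] that k by (simp add: TN_simps)
  show ?thesis
    using z'
  proof (induction z rule: tb.tm.tensor_induct)
    case (pure t \<nu>)
    have gt: "act T g t \<in> carrier T" by (rule tg.act_closed[OF g pure(1)])
    have ag: "a g \<nu> \<in> carrier N" by (rule a_closed[OF g pure(2)])
    have "kap k (act TN g (pt t \<nu>)) = (\<Oplus>\<^sub>R l\<in>{..k}. B (k - l) g \<otimes>\<^sub>R eps l \<nu>) \<odot>\<^sub>T act T g t"
      using pure g k gt ag by (simp add: act_pure tb.kap_pure eps_a)
    also have "\<dots> = (\<Oplus>\<^sub>T l\<in>{..k}. (B (k - l) g \<otimes>\<^sub>R eps l \<nu>) \<odot>\<^sub>T act T g t)"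
      by (rule additive_finsum[OF amR tg.M.abelian_monoid_axioms, of _ _ "\<lambda>r. r \<odot>\<^sub>T act T g t"])
        (use gt Bc ec pure(2) in \<open>auto simp: tg.smult_l_distr\<close>)
    also have "\<dots> = (\<Oplus>\<^sub>T l\<in>{..k}. B (k - l) g \<odot>\<^sub>T act T g (kap l (pt t \<nu>)))"
      by (rule tg.M.finsum_cong')
        (use pure g k gt Bc ec in \<open>auto simp: tb.kap_pure tg.act_smult tg.smult_assoc1\<close>)
    finally show ?case .
  next
    case (add y z)
    have yz: "y \<in> carrier TN" "z \<in> carrier TN" using add by (simp_all add: TN_simps)
    have "kap k (act TN g (y \<oplus>\<^sub>(tensor R T N) z)) = kap k (act TN g y) \<oplus>\<^sub>T kap k (act TN g z)"
      using act_add[OF g yz] kap_add[OF k act_closed[OF g yz(1)] act_closed[OF g yz(2)]]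
      by (simp only: TN_simps(3))
    also have "\<dots> = (\<Oplus>\<^sub>T l\<in>{..k}. B (k - l) g \<odot>\<^sub>T act T g (kap l y) \<oplus>\<^sub>T B (k - l) g \<odot>\<^sub>T act T g (kap l z))"
      unfolding add(3,4) by (rule tg.M.finsum_addf[symmetric]) (use add(1,2) kc Bc g tg.act_closed in auto)
    also have "\<dots> = (\<Oplus>\<^sub>T l\<in>{..k}. B (k - l) g \<odot>\<^sub>T act T g (kap l (y \<oplus>\<^sub>(tensor R T N) z)))"
    proof (rule tg.M.finsum_cong')
      fix l assume l: "l \<in> {..k}"
      have "kap l (y \<oplus>\<^sub>(tensor R T N) z) = kap l y \<oplus>\<^sub>T kap l z"
        using kap_add[OF _ yz, of l] l k by (simp add: TN_simps(3))
      then show "B (k - l) g \<odot>\<^sub>T act T g (kap l y) \<oplus>\<^sub>T B (k - l) g \<odot>\<^sub>T act T g (kap l z) =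
          B (k - l) g \<odot>\<^sub>T act T g (kap l (y \<oplus>\<^sub>(tensor R T N) z))"
        using l add(1,2) kc Bc g by (simp add: tg.act_add tg.act_closed tg.smult_r_distr)
    qed (use add(1,2) kc Bc g tg.act_closed abelian_monoid.a_closed[OF module_is_abelian_monoid[OF tb.tm.tensor_module]] in auto)
    finally show ?case .
  qed
qed

text \<open>The predicate in \<open>tensor_topology\<close> is a topology since it asks for open
  preimages, and preimages commute with intersections and unions.\<close>

lemma openin_tensor:
  "openin (tensor_topology R T N) U \<longleftrightarrow> U \<subseteq> carrier (tensor R T N) \<and>
     (\<forall>k::nat. \<forall>\<nu>\<in>{..<k} \<rightarrow> carrier N.
        openin (product_topology (\<lambda>_. mod_top T) {..<k})
          {t \<in> {..<k} \<rightarrow>\<^sub>E topspace (mod_top T).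
             (\<Oplus>\<^sub>(tensor R T N)i\<in>{..<k}. pt (t i) (\<nu> i)) \<in> U})"
proof -
  let ?P = "\<lambda>U. U \<subseteq> carrier (tensor R T N) \<and>
     (\<forall>k::nat. \<forall>\<nu>\<in>{..<k} \<rightarrow> carrier N.
        openin (product_topology (\<lambda>_. mod_top T) {..<k})
          {t \<in> {..<k} \<rightarrow>\<^sub>E topspace (mod_top T).
             (\<Oplus>\<^sub>(tensor R T N)i\<in>{..<k}. pt (t i) (\<nu> i)) \<in> U})"
  have "istopology ?P"
    unfolding istopology_def
  proof (rule conjI; intro allI impI)
    fix S S' assume S: "?P S" and S': "?P S'"
    show "?P (S \<inter> S')"
    proof (intro conjI allI ballI)
      show "S \<inter> S' \<subseteq> carrier (tensor R T N)" using S by blast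
      fix k :: nat and \<nu> assume \<nu>: "\<nu> \<in> {..<k} \<rightarrow> carrier N"
      let ?A = "\<lambda>U. {t \<in> {..<k} \<rightarrow>\<^sub>E topspace (mod_top T). (\<Oplus>\<^sub>(tensor R T N)i\<in>{..<k}. pt (t i) (\<nu> i)) \<in> U}"
      have "?A (S \<inter> S') = ?A S \<inter> ?A S'" by blast
      moreover have "openin (product_topology (\<lambda>_. mod_top T) {..<k}) (?A S)"
        "openin (product_topology (\<lambda>_. mod_top T) {..<k}) (?A S')"
        using S S' \<nu> by blast+
      ultimately show "openin (product_topology (\<lambda>_. mod_top T) {..<k}) (?A (S \<inter> S'))"
        by (simp only: openin_Int)
    qed
  next
    fix \<K> assume K: "\<forall>S\<in>\<K>. ?P S"
    show "?P (\<Union>\<K>)"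
    proof (intro conjI allI ballI)
      show "\<Union>\<K> \<subseteq> carrier (tensor R T N)" using K by blast
      fix k :: nat and \<nu> assume \<nu>: "\<nu> \<in> {..<k} \<rightarrow> carrier N"
      let ?A = "\<lambda>U. {t \<in> {..<k} \<rightarrow>\<^sub>E topspace (mod_top T). (\<Oplus>\<^sub>(tensor R T N)i\<in>{..<k}. pt (t i) (\<nu> i)) \<in> U}"
      have "?A (\<Union>\<K>) = \<Union>(?A ` \<K>)" by blast
      moreover have "openin (product_topology (\<lambda>_. mod_top T) {..<k}) (\<Union>(?A ` \<K>))"
        by (rule openin_Union) (use K \<nu> in blast)
      ultimately show "openin (product_topology (\<lambda>_. mod_top T) {..<k}) (?A (\<Union>\<K>))" by simp
    qed
  qed
  then show ?thesis
    unfolding tensor_topology_def by (simp add: topology_inverse')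
qed

lemma sum_pt_closed:
  assumes "\<nu> \<in> {..<k} \<rightarrow> carrier N" "t \<in> {..<k} \<rightarrow>\<^sub>E topspace (mod_top T)"
  shows "(\<Oplus>\<^sub>(tensor R T N)i\<in>{..<k}. pt (t i) (\<nu> i)) \<in> carrier (tensor R T N)"
  by (rule abelian_monoid.finsum_closed[OF module_is_abelian_monoid[OF tb.tm.tensor_module]])
    (use assms tg.top_T in \<open>auto intro!: tb.tm.pt_closed\<close>)

lemma topspace_TN: "topspace (mod_top TN) = carrier TN"
proof -
  have "openin (tensor_topology R T N) (carrier (tensor R T N))"
    unfolding openin_tensor
  proof (intro conjI allI ballI)
    fix k :: nat and \<nu> assume \<nu>: "\<nu> \<in> {..<k} \<rightarrow> carrier N"
    have "{t \<in> {..<k} \<rightarrow>\<^sub>E topspace (mod_top T). (\<Oplus>\<^sub>(tensor R T N)i\<in>{..<k}. pt (t i) (\<nu> i)) \<in> carrier (tensor R T N)} =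
        topspace (product_topology (\<lambda>_. mod_top T) {..<k})"
      using sum_pt_closed[OF \<nu>] by auto
    then show "openin (product_topology (\<lambda>_. mod_top T) {..<k})
        {t \<in> {..<k} \<rightarrow>\<^sub>E topspace (mod_top T). (\<Oplus>\<^sub>(tensor R T N)i\<in>{..<k}. pt (t i) (\<nu> i)) \<in> carrier (tensor R T N)}"
      by (simp only: openin_topspace)
  qed simp
  then have "carrier (tensor R T N) \<subseteq> topspace (tensor_topology R T N)" by (rule openin_subset)
  moreover have "topspace (tensor_topology R T N) \<subseteq> carrier (tensor R T N)"
    using openin_topspace[of "tensor_topology R T N"] unfolding openin_tensor by blast
  ultimately show ?thesis by (simp add: TN_simps)
qed

text \<open>In a final topology continuity is tested after composition with the defining maps from
  powers of T. There the coordinate becomes the linear form with coefficients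
  \<open>eps k (\<nu> i)\<close>, which is continuous.\<close>

lemma kap_continuous:
  assumes k: "k < d"
  shows "continuous_map (mod_top TN) (mod_top T) (kap k)"
  unfolding continuous_map_def
proof (intro conjI allI impI)
  show "kap k \<in> topspace (mod_top TN) \<rightarrow> topspace (mod_top T)"
    using kap_closed[OF k] by (simp add: topspace_TN tg.top_T Pi_def)
  fix U assume U: "openin (mod_top T) U"
  have "openin (tensor_topology R T N) {z \<in> carrier (tensor R T N). kap k z \<in> U}"
    unfolding openin_tensor
  proof (intro conjI allI ballI)
    fix m :: nat and \<nu> assume \<nu>: "\<nu> \<in> {..<m} \<rightarrow> carrier N"
    let ?S = "\<lambda>t. \<Oplus>\<^sub>(tensor R T N)i\<in>{..<m}. pt (t i) (\<nu> i)" and ?X = "product_topology (\<lambda>_. mod_top T) {..<m}"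
    let ?F = "\<lambda>t. \<Oplus>\<^sub>T i\<in>{..<m}. eps k (\<nu> i) \<odot>\<^sub>T t i"
    have "kap k (?S t) = ?F t" if t: "t \<in> {..<m} \<rightarrow>\<^sub>E topspace (mod_top T)" for t
    proof -
      have tc: "t i \<in> carrier T" "\<nu> i \<in> carrier N" if "i < m" for i using t \<nu> that tg.top_T by auto
      have "kap k (?S t) = (\<Oplus>\<^sub>T i\<in>{..<m}. kap k (pt (t i) (\<nu> i)))"
        by (rule module_hom_finsum[OF tb.tm.tensor_module tb.M' tb.kap_hom[OF k]]) (auto simp: tc tb.tm.pt_closed)
      also have "\<dots> = ?F t"
        by (rule tg.M.finsum_cong') (use tc k in \<open>auto simp: tb.kap_pure tb.eps_closed\<close>)
      finally show ?thesis .
    qed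
    then have "{t \<in> {..<m} \<rightarrow>\<^sub>E topspace (mod_top T). ?S t \<in> {z \<in> carrier (tensor R T N). kap k z \<in> U}} =
        {t \<in> topspace ?X. ?F t \<in> U}"
      using sum_pt_closed[OF \<nu>] by auto
    moreover have "openin ?X {t \<in> topspace ?X. ?F t \<in> U}"
    proof -
      have ec: "eps k (\<nu> i) \<in> carrier R" if "i < m" for i
        using tb.eps_closed[OF k] \<nu> that by auto
      have "continuous_map ?X (mod_top T) (\<lambda>t. eps k (\<nu> i) \<odot>\<^sub>T t i)" if "i < m" for i
        by (intro tg.continuous_smult continuous_map_product_projection) (use that ec in \<open>auto simp: tg.top_R\<close>)
      then have "continuous_map ?X (mod_top T) ?F"
        by (intro tg.continuous_finsum) auto
      from openin_continuous_map_preimage[OF this U] show ?thesis .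
    qed
    ultimately show "openin ?X {t \<in> {..<m} \<rightarrow>\<^sub>E topspace (mod_top T). ?S t \<in> {z \<in> carrier (tensor R T N). kap k z \<in> U}}"
      by simp
  qed blast
  then show "openin (mod_top TN) {z \<in> topspace (mod_top TN). kap k z \<in> U}"
    unfolding topspace_TN unfolding TN_simps .
qed

text \<open>A final topology gives no criterion for maps into it, but assembling a tensor from its
  coordinates is itself one of the defining maps, with the basis as the chosen elements. So it is
  continuous, and yields continuous lifts of cochains.\<close>

lemma vec_continuous:
  assumes b: "\<And>k. k < d ==> continuous_map X (mod_top T) (b k)"
  shows "continuous_map X (mod_top TN) (\<lambda>y. vec (\<lambda>k. b k y))"
  unfolding continuous_map_def
proof (intro conjI allI impI)
  have bc: "b k y \<in> carrier T" if "k < d" "y \<in> topspace X" for k y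
    using continuous_map_image_subset_topspace[OF b[OF that(1)]] that(2) tg.top_T by auto
  show "(\<lambda>y. vec (\<lambda>k. b k y)) \<in> topspace X \<rightarrow> topspace (mod_top TN)"
    unfolding topspace_TN using bc by (auto intro: vec_closed)
  fix U assume "openin (mod_top TN) U"
  then have U: "openin (product_topology (\<lambda>_. mod_top T) {..<d})
          {t \<in> {..<d} \<rightarrow>\<^sub>E topspace (mod_top T). vec t \<in> U}"
    unfolding TN_simps openin_tensor vec_def using tb.e_closed by blast
  let ?h = "\<lambda>y. \<lambda>k\<in>{..<d}. b k y"
  have "continuous_map X (product_topology (\<lambda>_. mod_top T) {..<d}) ?h"
    unfolding continuous_map_componentwise using b by (auto simp: continuous_map_def)
  from openin_continuous_map_preimage[OF this U]
  have "openin X {y \<in> topspace X. ?h y \<in> {..<d} \<rightarrow>\<^sub>E topspace (mod_top T) \<and> vec (?h y) \<in> U}" by simp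
  moreover have "{y \<in> topspace X. ?h y \<in> {..<d} \<rightarrow>\<^sub>E topspace (mod_top T) \<and> vec (?h y) \<in> U} =
      {y \<in> topspace X. vec (\<lambda>k. b k y) \<in> U}"
  proof -
    have "vec (?h y) = vec (\<lambda>k. b k y)" if "y \<in> topspace X" for y
      unfolding vec_def
      by (rule abelian_monoid.finsum_cong'[OF module_is_abelian_monoid[OF tb.tm.tensor_module]])
        (use bc that tb.e_closed in \<open>auto intro: tb.tm.pt_closed\<close>)
    moreover have "?h y \<in> {..<d} \<rightarrow>\<^sub>E topspace (mod_top T)" if "y \<in> topspace X" for y
      using bc that tg.top_T by auto
    ultimately show ?thesis by auto
  qed
  ultimately show "openin X {y \<in> topspace X. vec (\<lambda>k. b k y) \<in> U}" by simp
qed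

lemma TN_gmod:
  assumes "\<And>g h \<nu>. g \<in> carrier G ==> h \<in> carrier G ==> \<nu> \<in> carrier N ==> a (g \<otimes>\<^sub>G h) \<nu> = a g (a h \<nu>)"
  shows "gmod G TN"
proof (intro gmod.intro gmod_axioms.intro tg.G.group_axioms module_is_abelian_group[OF TN_module])
  fix g h z assume g: "g \<in> carrier G" and h: "h \<in> carrier G" and z: "z \<in> carrier TN"
  have gh: "g \<otimes>\<^sub>G h \<in> carrier G" using g h by simp
  show "act TN (g \<otimes>\<^sub>G h) z = act TN g (act TN h z)"
  proof (rule tb.tm.tensor_maps_eq[of "act TN (g \<otimes>\<^sub>G h)" TN "\<lambda>z. act TN g (act TN h z)" z])
    fix y w assume yw: "y \<in> carrier (tensor R T N)" "w \<in> carrier (tensor R T N)"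
    then have yw': "y \<in> carrier TN" "w \<in> carrier TN" by (simp_all add: TN_simps)
    show "act TN (g \<otimes>\<^sub>G h) (y \<oplus>\<^sub>(tensor R T N) w) = act TN (g \<otimes>\<^sub>G h) y \<oplus>\<^sub>TN act TN (g \<otimes>\<^sub>G h) w"
      using act_add[OF gh yw'] by (simp only: TN_simps(3))
    show "act TN g (act TN h (y \<oplus>\<^sub>(tensor R T N) w)) = act TN g (act TN h y) \<oplus>\<^sub>TN act TN g (act TN h w)"
      using act_add[OF h yw'] act_add[OF g act_closed[OF h yw'(1)] act_closed[OF h yw'(2)]] by (simp only: TN_simps(3))
  next
    fix t \<nu> assume "t \<in> carrier T" "\<nu> \<in> carrier N"
    then show "act TN (g \<otimes>\<^sub>G h) (pt t \<nu>) = act TN g (act TN h (pt t \<nu>))"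
      using g h gh by (simp add: act_pure tg.act_closed a_closed tg.act_mult assms)
  qed (use z in \<open>simp add: TN_simps\<close>)
qed (use act_closed act_add in auto)

end

text \<open>A free module of rank one with trivial action: tensoring with it does not change cohomology.\<close>

locale tensor_line = tensor_action R G T N 1 e eps a B
  for R :: "('r, 'x) topring_scheme" and G :: "('g, 'y) topgroup_scheme"
    and T :: "('r, 'm, 'g, 'z) gmodule_scheme" and N :: "('r, 'n, 'w) module_scheme"
    and e eps a B +
  assumes B_0: "g \<in> carrier G ==> B 0 g = \<one>\<^sub>R"
begin

abbreviation "GG \<equiv> carrier G \<times> carrier G"

definition ph :: "'m => ('m \<times> 'n => 'r) set" where "ph t = pt t (e 0)"

text \<open>A cohomology class is a set of cocycles, and this is its elementwise image. By
  \<open>class2_ph\<close> the image is a whole class again.\<close>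

definition lift_class :: "('g \<times> 'g => 'm) set => ('g \<times> 'g => ('m \<times> 'n => 'r) set) set" where
  "lift_class X = (\<lambda>c. \<lambda>s\<in>GG. ph (c s)) ` X"

lemma e0_closed: "e 0 \<in> carrier N" using tb.e_closed[of 0] by simp

lemma ph_closed: "t \<in> carrier T ==> ph t \<in> carrier TN"
  unfolding ph_def using e0_closed by (rule pt_closed[rotated])

lemma ph_add: "t \<in> carrier T ==> u \<in> carrier T ==> ph (t \<oplus>\<^sub>T u) = ph t \<oplus>\<^sub>TN ph u"
  unfolding ph_def TN_simps using tb.tm.pt_add_left e0_closed by simp

lemma ph_vec:
  assumes "t \<in> carrier T"
  shows "ph t = vec (\<lambda>_. t)"
proof -
  interpret X: abelian_monoid "tensor R T N"
    by (rule module_is_abelian_monoid[OF tb.tm.tensor_module])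
  have "vec (\<lambda>_. t) = (\<Oplus>\<^sub>(tensor R T N)k\<in>{0}. pt t (e k))"
    unfolding vec_def by (rule arg_cong[where f = "finsum (tensor R T N) (\<lambda>k. pt t (e k))"]) auto
  also have "\<dots> = pt t (e 0)"
    using tb.tm.pt_closed[OF assms e0_closed] by (subst X.finsum_insert) auto
  finally show ?thesis by (simp only: ph_def)
qed

lemma kap_ph: "t \<in> carrier T ==> kap 0 (ph t) = t"
  unfolding ph_def using tb.kap_pure[of 0 t "e 0"] tb.eps_e[of 0 0] e0_closed tg.smult_one by simp

lemma ph_kap: "z \<in> carrier TN ==> ph (kap 0 z) = z"
  using kap_closed[of 0 z] kap_ph by (intro TN_eqI ph_closed) auto

lemma kap0_act: "g \<in> carrier G ==> z \<in> carrier TN ==> kap 0 (act TN g z) = act T g (kap 0 z)"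
proof -
  assume g: "g \<in> carrier G" and z: "z \<in> carrier TN"
  have c: "act T g (kap 0 z) \<in> carrier T" using tg.act_closed[OF g kap_closed[OF _ z]] by simp
  have "kap 0 (act TN g z) = (\<Oplus>\<^sub>T l\<in>{..0}. B (0 - l) g \<odot>\<^sub>T act T g (kap l z))"
    by (rule kap_act[OF _ g z]) simp
  also have "\<dots> = act T g (kap 0 z)"
    using c B_0[OF g] by (simp add: tg.smult_one Pi_def)
  finally show ?thesis .
qed

lemma ph_act: "g \<in> carrier G ==> t \<in> carrier T ==> ph (act T g t) = act TN g (ph t)"
  using kap0_act[of g "ph t"] ph_kap[of "act TN g (ph t)"] act_closed[OF _ ph_closed] ph_closed kap_ph by simp

lemma ph_minus: "t \<in> carrier T ==> u \<in> carrier T ==> ph (t \<ominus>\<^sub>T u) = ph t \<ominus>\<^sub>TN ph u"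
proof -
  assume t: "t \<in> carrier T" and u: "u \<in> carrier T"
  have "ph (\<ominus>\<^sub>T u) = \<ominus>\<^sub>TN ph u"
    by (rule additive_minus[OF tg.M.abelian_group_axioms module_is_abelian_group[OF TN_module]])
      (use ph_closed ph_add u in auto)
  then show ?thesis using t u ph_add[of t "\<ominus>\<^sub>T u"] by (simp add: a_minus_def)
qed

lemma ph_continuous:
  assumes "continuous_map X (mod_top T) b"
  shows "continuous_map X (mod_top TN) (\<lambda>y. ph (b y))"
proof -
  have "continuous_map X (mod_top TN) (\<lambda>y. vec (\<lambda>k. b y))"
    by (rule vec_continuous) (rule assms)
  moreover have "vec (\<lambda>k. b y) = ph (b y)" if "y \<in> topspace X" for y
    by (rule ph_vec[symmetric]) (use continuous_map_image_subset_topspace[OF assms] tg.top_T that in blast)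
  ultimately show ?thesis
    by (rule continuous_map_eq)
qed

lemma kap0_continuous:
  assumes "continuous_map X (mod_top TN) b"
  shows "continuous_map X (mod_top T) (\<lambda>y. kap 0 (b y))"
  using continuous_map_compose[OF assms kap_continuous[of 0]] by (simp add: o_def)

lemma TN_Z2_eval: "c \<in> Z2 G TN ==> s \<in> GG ==> c s \<in> carrier TN"
proof -
  assume c: "c \<in> Z2 G TN" and s: "s \<in> GG"
  then have "continuous_map (prod_topology (grp_top G) (grp_top G)) (mod_top TN) c"
    by (simp add: Z2_def C2_def)
  from continuous_map_image_subset_topspace[OF this] show ?thesis
    unfolding tg.top_GG topspace_TN using s by (rule subsetD[OF _ imageI])
qed

lemma lift_Z2:
  assumes c: "c \<in> Z2 G T"
  shows "(\<lambda>s\<in>GG. ph (c s)) \<in> Z2 G TN"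
proof -
  note ev = tg.Z2_eval[OF c]
  have "continuous_map (prod_topology (grp_top G) (grp_top G)) (mod_top TN) (\<lambda>s\<in>GG. ph (c s))"
    by (rule continuous_map_eq[OF ph_continuous[OF tg.Z2_D(1)[OF c]]]) (simp add: tg.top_G)
  moreover have "act TN g (ph (c (h, k))) \<oplus>\<^sub>TN ph (c (g, h \<otimes>\<^sub>G k)) = ph (c (g \<otimes>\<^sub>G h, k)) \<oplus>\<^sub>TN ph (c (g, h))"
    if "g \<in> carrier G" "h \<in> carrier G" "k \<in> carrier G" for g h k
    using tg.Z2_D(2)[OF c that] that ev
    by (simp add: ph_act[symmetric] ph_add[symmetric] tg.act_closed)
  ultimately show ?thesis
    unfolding Z2_def C2_def by simp
qed

lemma descend_Z2:
  assumes a: "a' \<in> Z2 G TN"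
  shows "(\<lambda>s\<in>GG. kap 0 (a' s)) \<in> Z2 G T"
proof (rule tg.Z2_I)
  note ev = TN_Z2_eval[OF a]
  have "continuous_map (prod_topology (grp_top G) (grp_top G)) (mod_top TN) a'"
    using a by (simp add: Z2_def C2_def)
  then show "continuous_map (prod_topology (grp_top G) (grp_top G)) (mod_top T) (\<lambda>s. kap 0 (a' s))"
    by (rule kap0_continuous)
  fix g h k assume ghk: "g \<in> carrier G" "h \<in> carrier G" "k \<in> carrier G"
  have "act TN g (a' (h, k)) \<oplus>\<^sub>TN a' (g, h \<otimes>\<^sub>G k) = a' (g \<otimes>\<^sub>G h, k) \<oplus>\<^sub>TN a' (g, h)"
    using a ghk by (simp add: Z2_def)
  from arg_cong[OF this, of "kap 0"]
  show "act T g (kap 0 (a' (h, k))) \<oplus>\<^sub>T kap 0 (a' (g, h \<otimes>\<^sub>G k)) = kap 0 (a' (g \<otimes>\<^sub>G h, k)) \<oplus>\<^sub>T kap 0 (a' (g, h))"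
    using ghk ev by (simp add: kap_add kap0_act act_closed)
qed

lemma lift_descend:
  assumes a: "a' \<in> Z2 G TN"
  shows "a' = (\<lambda>s\<in>GG. ph ((\<lambda>s\<in>GG. kap 0 (a' s)) s))"
proof -
  have "(\<lambda>s\<in>GG. a' s) = (\<lambda>s\<in>GG. ph ((\<lambda>s\<in>GG. kap 0 (a' s)) s))"
    by (rule restrict_ext) (simp add: ph_kap TN_Z2_eval[OF a])
  moreover have "(\<lambda>s\<in>GG. a' s) = a'"
    using a unfolding Z2_def C2_def by (auto intro: extensional_restrict)
  ultimately show ?thesis by simp
qed

lemma coboundary1_ph:
  assumes "\<And>g. g \<in> carrier G ==> f g \<in> carrier T"
  shows "coboundary1 G TN (\<lambda>g\<in>carrier G. ph (f g)) = (\<lambda>s\<in>GG. ph (coboundary1 G T f s))"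
  unfolding coboundary1_def
  by (rule restrict_ext)
    (use assms in \<open>auto simp: ph_add ph_minus ph_act tg.act_closed\<close>)

text \<open>\<open>ph\<close> has the continuous inverse \<open>kap 0\<close>, so every cochain in
  \<open>TN\<close> comes from one in T and coboundaries correspond exactly. An inclusion alone
  would make \<open>lift_class\<close> of a class only a part of one.\<close>

lemma B2_TN: "B2 G TN = (\<lambda>c. \<lambda>s\<in>GG. ph (c s)) ` B2 G T"
proof
  show "(\<lambda>c. \<lambda>s\<in>GG. ph (c s)) ` B2 G T \<subseteq> B2 G TN"
  proof
    fix b assume "b \<in> (\<lambda>c. \<lambda>s\<in>GG. ph (c s)) ` B2 G T"
    then obtain c where c: "c \<in> B2 G T" "b = (\<lambda>s\<in>GG. ph (c s))" by blast
    obtain f where f: "f \<in> C1 G T" "continuous_map (grp_top G) (mod_top T) f" "c = coboundary1 G T f"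
      using tg.B2_E[OF c(1)] .
    have "(\<lambda>g\<in>carrier G. ph (f g)) \<in> C1 G TN"
      unfolding C1_def using continuous_map_eq[OF ph_continuous[OF f(2)], of "\<lambda>g\<in>carrier G. ph (f g)"]
      by (simp add: tg.top_G)
    moreover have "b = coboundary1 G TN (\<lambda>g\<in>carrier G. ph (f g))"
      unfolding c(2) f(3) by (rule coboundary1_ph[OF tg.C1_eval[OF f(1)], symmetric])
    ultimately show "b \<in> B2 G TN"
      unfolding B2_def by blast
  qed
  show "B2 G TN \<subseteq> (\<lambda>c. \<lambda>s\<in>GG. ph (c s)) ` B2 G T"
  proof
    fix b assume "b \<in> B2 G TN"
    then obtain f where f: "f \<in> C1 G TN" "b = coboundary1 G TN f" unfolding B2_def by blast
    have fc: "continuous_map (grp_top G) (mod_top TN) f" "f \<in> extensional (carrier G)"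
      using f(1) by (auto simp: C1_def)
    have ev: "f g \<in> carrier TN" if "g \<in> carrier G" for g
      using continuous_map_image_subset_topspace[OF fc(1)] that tg.top_G topspace_TN by auto
    let ?f = "\<lambda>g. kap 0 (f g)"
    have "(\<lambda>g\<in>carrier G. ph (?f g)) = (\<lambda>g\<in>carrier G. f g)"
      by (rule restrict_ext) (simp add: ph_kap ev)
    also have "\<dots> = f" using fc(2) by (rule extensional_restrict)
    finally have "b = (\<lambda>s\<in>GG. ph (coboundary1 G T ?f s))"
      using coboundary1_ph[of ?f] kap_closed ev f(2) by simp
    moreover have "coboundary1 G T ?f \<in> B2 G T"
      by (rule tg.B2_I[OF kap0_continuous[OF fc(1)]])
    ultimately show "b \<in> (\<lambda>c. \<lambda>s\<in>GG. ph (c s)) ` B2 G T" by blast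
  qed
qed

lemma class2_ph:
  assumes c: "c \<in> Z2 G T"
  shows "class2 G TN (\<lambda>s\<in>GG. ph (c s)) = lift_class (class2 G T c)"
proof -
  have add: "(\<lambda>s\<in>GG. (\<lambda>s\<in>GG. ph (b s)) s \<oplus>\<^sub>TN (\<lambda>s\<in>GG. ph (c s)) s) = (\<lambda>s\<in>GG. ph ((\<lambda>s\<in>GG. b s \<oplus>\<^sub>T c s) s))"
    if "b \<in> B2 G T" for b
  proof -
    have "b \<in> Z2 G T" using tg.coboundary1_Z2 that by (auto elim!: tg.B2_E)
    then show ?thesis
      by (intro restrict_ext) (simp add: ph_add tg.Z2_eval c)
  qed
  show ?thesis
    unfolding class2_def lift_class_def a_r_coset_def' B2_TN fun_module_def using add by (auto simp: image_UN)
qed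

text \<open>Taking the coordinate \<open>kap 0\<close> of every member recovers the original
  class.\<close>

lemma lift_class_inj:
  assumes "c \<in> Z2 G T" "d \<in> Z2 G T" "lift_class (class2 G T c) = lift_class (class2 G T d)"
  shows "class2 G T c = class2 G T d"
proof -
  have desc: "(\<lambda>b. \<lambda>s\<in>GG. kap 0 (b s)) ` lift_class (class2 G T c) = class2 G T c" if c: "c \<in> Z2 G T" for c
  proof -
    have "(\<lambda>s\<in>GG. kap 0 ((\<lambda>s\<in>GG. ph (b s)) s)) = b" if b: "b \<in> class2 G T c" for b
    proof -
      have bZ: "b \<in> Z2 G T"
      proof -
        obtain e' where e': "continuous_map (grp_top G) (mod_top T) e'" "b = (\<lambda>s\<in>GG. coboundary1 G T e' s \<oplus>\<^sub>T c s)"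
          using tg.class2_elem[OF c b] .
        show ?thesis unfolding e'(2) by (rule tg.Z2_add[OF tg.coboundary1_Z2[OF e'(1)] c])
      qed
      then have "(\<lambda>s\<in>GG. kap 0 ((\<lambda>s\<in>GG. ph (b s)) s)) = (\<lambda>s\<in>GG. b s)"
        by (intro restrict_ext) (simp add: kap_ph tg.Z2_eval)
      then show ?thesis using tg.Z2_ext[OF bZ] by simp
    qed
    then show ?thesis unfolding lift_class_def image_image by (simp cong: image_cong)
  qed
  show ?thesis
    by (rule trans[OF desc[OF assms(1), symmetric] trans[OF arg_cong[OF assms(3), of "image (\<lambda>b. \<lambda>s\<in>GG. kap 0 (b s))"] desc[OF assms(2)]]])
qed

text \<open>\<open>H2_tensor_map\<close> in the generality of any N free of rank one with trivial
  action.\<close>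

definition HT :: "(('g \<times> 'g => 'm) set \<times> 'n => 'r) set => ('g \<times> 'g => ('m \<times> 'n => 'r) set) set" where
  "HT = tensor_lift R (H2 G T) N (H2 G TN) (\<lambda>X m. H2_map G TN (\<lambda>t. pt t m) X)"

lemma H2_based: "tensor_based R (H2 G T) N 1 e eps"
  by (intro tensor_based.intro tensor_based_axioms.intro tg.H2_module tb.based_module_axioms)

interpretation H: tensor_based R "H2 G T" N 1 e eps by (rule H2_based)

text \<open>\<open>H2_map\<close> is \<open>the_elem\<close> of an image over all cocycles of the
  class, so each of them must give the same value. This follows from t \<otimes> m = ph (eps 0 m t),
  which moves the second factor to the basis vector.\<close>

lemma H2_map_eq:
  assumes c: "c \<in> Z2 G T" and m: "m \<in> carrier N"
  shows "H2_map G TN (\<lambda>t. pt t m) (class2 G T c) = lift_class (eps 0 m \<odot>\<^sub>(H2 G T) class2 G T c)"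
proof -
  have r: "eps 0 m \<in> carrier R" using tb.eps_closed[of 0 m] m by simp
  have me: "pt t m = ph (eps 0 m \<odot>\<^sub>T t)" if "t \<in> carrier T" for t
  proof (rule TN_eqI)
    fix k assume "k < (1::nat)"
    then show "kap k (pt t m) = kap k (ph (eps 0 m \<odot>\<^sub>T t))"
      using kap_ph[of "eps 0 m \<odot>\<^sub>T t"] tb.kap_pure[of 0 t m] that m r by simp
  qed (use that m r in \<open>auto intro: pt_closed ph_closed\<close>)
  have val: "class2 G TN (\<lambda>s\<in>GG. pt (d s) m) = lift_class (eps 0 m \<odot>\<^sub>(H2 G T) class2 G T c)"
    if d: "d \<in> class2 G T c" for d
  proof -
    obtain e' where e': "continuous_map (grp_top G) (mod_top T) e'" "d = (\<lambda>s\<in>GG. coboundary1 G T e' s \<oplus>\<^sub>T c s)"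
      using tg.class2_elem[OF c d] .
    have dZ: "d \<in> Z2 G T" unfolding e'(2) by (rule tg.Z2_add[OF tg.coboundary1_Z2[OF e'(1)] c])
    have cd: "class2 G T d = class2 G T c"
      by (rule tg.class2_eqI[OF dZ c e'(1)]) (simp add: e'(2))
    have 1: "(\<lambda>s\<in>GG. pt (d s) m) = (\<lambda>s\<in>GG. ph ((\<lambda>s\<in>GG. eps 0 m \<odot>\<^sub>T d s) s))"
      by (rule restrict_ext) (simp add: me tg.Z2_eval[OF dZ])
    have "class2 G TN (\<lambda>s\<in>GG. pt (d s) m) = lift_class (class2 G T (\<lambda>s\<in>GG. eps 0 m \<odot>\<^sub>T d s))"
      unfolding 1 by (rule class2_ph[OF tg.Z2_smult[OF dZ r]])
    also have "\<dots> = lift_class (eps 0 m \<odot>\<^sub>(H2 G T) class2 G T c)"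
      using tg.H2_smult[OF r dZ] cd by simp
    finally show ?thesis .
  qed
  have "c \<in> class2 G T c"
  proof -
    have "\<zero>\<^sub>tg.Z2m \<in> B2 G T" using subgroup.one_closed[OF tg.B2_subgroup] by simp
    moreover have "\<zero>\<^sub>tg.Z2m \<oplus>\<^sub>tg.Z2m c = c"
      using abelian_monoid.l_zero[OF module_is_abelian_monoid[OF tg.Z2m_module]] c by (simp add: tg.fun_module_simps(1))
    ultimately show ?thesis unfolding class2_def a_r_coset_def' by force
  qed
  then have "(\<lambda>d. class2 G TN (\<lambda>s\<in>GG. pt (d s) m)) ` class2 G T c = {lift_class (eps 0 m \<odot>\<^sub>(H2 G T) class2 G T c)}"
    using val by blast
  then show ?thesis unfolding H2_map_def by simp
qed

text \<open>The canonical map is the coordinate of H^2(G, T) \<otimes> N followed by the injective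
  \<open>lift_class\<close>. Classes add as sets, so additivity is verified on their
  members.\<close>

lemma HT_eq: "HT = (\<lambda>z\<in>carrier (tensor R (H2 G T) N). lift_class (H.kap 0 z))"
  unfolding HT_def
proof (rule H.tm.tensor_lift_eqI)
  fix z assume z: "z \<in> carrier (tensor R (H2 G T) N)"
  have k: "H.kap 0 z \<in> carrier (H2 G T)" using module_homD(1)[OF H.kap_hom z] by simp
  then obtain c where c: "c \<in> Z2 G T" "H.kap 0 z = class2 G T c" by (auto simp: tg.H2_carrier)
  have "carrier (H2 G TN) = class2 G TN ` Z2 G TN"
    unfolding H2_def quot_module_simps class2_def by (simp add: fun_module_def)
  then show "(\<lambda>z\<in>carrier (tensor R (H2 G T) N). lift_class (H.kap 0 z)) z \<in> carrier (H2 G TN)"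
    using z c class2_ph[OF c(1)] lift_Z2[OF c(1)] by auto
  fix y assume y: "y \<in> carrier (tensor R (H2 G T) N)"
  have ky: "H.kap 0 y \<in> carrier (H2 G T)" using module_homD(1)[OF H.kap_hom y] by simp
  then obtain c' where c': "c' \<in> Z2 G T" "H.kap 0 y = class2 G T c'" by (auto simp: tg.H2_carrier)
  have zy: "y \<oplus>\<^sub>(tensor R (H2 G T) N) z \<in> carrier (tensor R (H2 G T) N)"
    using y z abelian_monoid.a_closed[OF module_is_abelian_monoid[OF H.tm.tensor_module]] by simp
  have elem: "b \<in> Z2 G T" if "b \<in> class2 G T c''" "c'' \<in> Z2 G T" for b c''
    using tg.class2_elem[OF that(2,1)] tg.Z2_add[OF tg.coboundary1_Z2 that(2)] by metis
  have "lift_class (H.kap 0 (y \<oplus>\<^sub>(tensor R (H2 G T) N) z)) = lift_class (class2 G T c' <+>\<^sub>tg.Z2m class2 G T c)"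
    using module_homD(2)[OF H.kap_hom y z] c c' by (simp add: H2_def quot_module_simps)
  also have "\<dots> = lift_class (class2 G T c') <+>\<^sub>(fun_module TN GG (Z2 G TN)) lift_class (class2 G T c)"
  proof -
    have pw: "(\<lambda>s\<in>GG. ph ((\<lambda>s\<in>GG. b' s \<oplus>\<^sub>T b s) s)) = (\<lambda>s\<in>GG. (\<lambda>s\<in>GG. ph (b' s)) s \<oplus>\<^sub>TN (\<lambda>s\<in>GG. ph (b s)) s)"
      if "b' \<in> class2 G T c'" "b \<in> class2 G T c" for b b'
      by (rule restrict_ext) (simp add: ph_add tg.Z2_eval[OF elem[OF that(1) c'(1)]] tg.Z2_eval[OF elem[OF that(2) c(1)]])
    show ?thesis
      unfolding lift_class_def set_add_def' fun_module_def using pw by (auto simp: image_UN)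
  qed
  finally show "(\<lambda>z\<in>carrier (tensor R (H2 G T) N). lift_class (H.kap 0 z)) (y \<oplus>\<^sub>(tensor R (H2 G T) N) z) =
      (\<lambda>z\<in>carrier (tensor R (H2 G T) N). lift_class (H.kap 0 z)) y \<oplus>\<^sub>(H2 G TN)
      (\<lambda>z\<in>carrier (tensor R (H2 G T) N). lift_class (H.kap 0 z)) z"
    using y z zy c(2) c'(2) by (simp add: H2_def[of G TN] quot_module_simps)
next
  fix X m assume X: "X \<in> carrier (H2 G T)" and m: "m \<in> carrier N"
  obtain c where c: "c \<in> Z2 G T" "X = class2 G T c" using X by (auto simp: tg.H2_carrier)
  show "(\<lambda>z\<in>carrier (tensor R (H2 G T) N). lift_class (H.kap 0 z)) (pure_tensor R (H2 G T) N X m) =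
      H2_map G TN (\<lambda>t. pt t m) X"
    using H2_map_eq[OF c(1) m] c(2) X m H.kap_pure[of 0 X m] H.tm.pt_closed[OF X m] by simp
qed simp

lemma HT_inj: "inj_on HT (carrier (tensor R (H2 G T) N))"
proof (rule inj_onI)
  fix y z assume y: "y \<in> carrier (tensor R (H2 G T) N)" and z: "z \<in> carrier (tensor R (H2 G T) N)"
    and eq: "HT y = HT z"
  have "H.kap 0 y \<in> carrier (H2 G T)" "H.kap 0 z \<in> carrier (H2 G T)"
    using module_homD(1)[OF H.kap_hom] y z by auto
  then obtain c d where "c \<in> Z2 G T" "H.kap 0 y = class2 G T c" "d \<in> Z2 G T" "H.kap 0 z = class2 G T d"
    by (auto simp: tg.H2_carrier)
  then have "H.kap 0 y = H.kap 0 z"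
    using eq y z lift_class_inj by (simp add: HT_eq)
  then show "y = z" by (intro H.tensor_eqI[OF y z]) simp
qed

text \<open>By injectivity \<open>inv_into\<close> returns the one preimage, and it is the class
  tensored with the basis vector. This makes precise the identification of H^2(G, T \<otimes> R x^n)
  with H^2(G, T) x^n.\<close>

lemma HT_inv:
  assumes c: "c \<in> Z2 G T"
  shows "inv_into (carrier (tensor R (H2 G T) N)) HT (lift_class (class2 G T c)) =
    pure_tensor R (H2 G T) N (class2 G T c) (e 0)"
proof -
  have X: "class2 G T c \<in> carrier (H2 G T)" using c by (simp add: tg.H2_carrier)
  have p: "pure_tensor R (H2 G T) N (class2 G T c) (e 0) \<in> carrier (tensor R (H2 G T) N)"
    by (rule H.tm.pt_closed[OF X e0_closed])
  have "HT (pure_tensor R (H2 G T) N (class2 G T c) (e 0)) = lift_class (class2 G T c)"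
    using p X e0_closed H.kap_pure[of 0 "class2 G T c" "e 0"] tb.eps_e[of 0 0] module.smult_one[OF tg.H2_module X]
    by (simp add: HT_eq)
  then show ?thesis using inv_into_f_f[OF HT_inj p] by simp
qed

end

section \<open>The connecting map\<close>

text \<open>\<open>N1\<close>, \<open>N0\<close> and \<open>Ng\<close> stand for \<Omega>/I^(n+1),
  \<Omega>/I^n and I^n/I^(n+1). The exact sequence is encoded by coordinates: \<open>pr\<close>
  forgets the last one, and \<open>Ng\<close> is spanned by the last basis vector. One sequence
  \<open>B\<close> describes all three actions.\<close>

locale connecting_setup =
  A1: tensor_action R G T N1 "Suc n" e1 eps1 a1 B +
  A0: tensor_action R G T N0 n e0 eps0 a0 B +
  Ag: tensor_line R G T Ng "\<lambda>_. e1 n" "\<lambda>_. eps1 n" a1 B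
  for R :: "('r, 'x) topring_scheme" and G :: "('g, 'y) topgroup_scheme"
    and T :: "('r, 'm, 'g, 'z) gmodule_scheme" and N1 :: "('r, 'n, 'w) module_scheme"
    and n e1 eps1 a1 B
    and N0 :: "('r, 'k, 'v) module_scheme" and e0 eps0 a0
    and Ng :: "('r, 'n, 'u) module_scheme" +
  fixes pr :: "'n => 'k"
  assumes Ng_sub: "carrier Ng \<subseteq> carrier N1" and Ng_add: "add Ng = add N1" and Ng_smult: "smult Ng = smult N1"
    and pr_closed: "\<nu> \<in> carrier N1 ==> pr \<nu> \<in> carrier N0"
    and pr_add: "\<nu> \<in> carrier N1 ==> \<mu> \<in> carrier N1 ==> pr (\<nu> \<oplus>\<^sub>N1 \<mu>) = pr \<nu> \<oplus>\<^sub>N0 pr \<mu>"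
    and pr_smult: "r \<in> carrier R ==> \<nu> \<in> carrier N1 ==> pr (r \<odot>\<^sub>N1 \<nu>) = r \<odot>\<^sub>N0 pr \<nu>"
    and pr_eps: "k < n ==> \<nu> \<in> carrier N1 ==> eps0 k (pr \<nu>) = eps1 k \<nu>"
    and a1_mult: "g \<in> carrier G ==> h \<in> carrier G ==> \<nu> \<in> carrier N1 ==> a1 (g \<otimes>\<^sub>G h) \<nu> = a1 g (a1 h \<nu>)"
begin

abbreviation "GG \<equiv> carrier G \<times> carrier G"

definition incl where "incl = tensor_lift R T Ng A1.TN (pure_tensor R T N1)"

definition proj where "proj = tensor_lift R T N1 A0.TN (\<lambda>t X. pure_tensor R T N0 t (pr X))"

lemma incl:
  shows incl_hom: "incl \<in> module_hom R Ag.TN A1.TN"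
    and incl_pure: "\<And>t \<nu>. t \<in> carrier T ==> \<nu> \<in> carrier Ng ==> incl (Ag.pt t \<nu>) = A1.pt t \<nu>"
proof -
  have sub: "\<nu> \<in> carrier N1" if "\<nu> \<in> carrier Ng" for \<nu> using Ng_sub that by blast
  have "incl \<in> module_hom R (tensor R T Ng) A1.TN"
    unfolding incl_def
    by (rule Ag.tb.tm.tensor_lift_hom[OF A1.TN_module])
      (simp_all add: sub A1.pt_closed A1.TN_simps(3,4) A1.tb.tm.pt_add_left A1.tb.tm.pt_add_right
        A1.tb.tm.pt_smult_left A1.tb.tm.pt_smult_right Ng_add Ng_smult)
  then show "incl \<in> module_hom R Ag.TN A1.TN" unfolding module_hom_def Ag.TN_simps(1,3,4) .
  show "incl (Ag.pt t \<nu>) = A1.pt t \<nu>" if "t \<in> carrier T" "\<nu> \<in> carrier Ng" for t \<nu>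
    unfolding incl_def
    by (rule Ag.tb.tm.tensor_lift_pure[OF A1.TN_module _ _ _ _ _ that])
      (simp_all add: sub A1.pt_closed A1.TN_simps(3,4) A1.tb.tm.pt_add_left A1.tb.tm.pt_add_right
        A1.tb.tm.pt_smult_left A1.tb.tm.pt_smult_right Ng_add Ng_smult)
qed

lemma proj:
  shows proj_hom: "proj \<in> module_hom R A1.TN A0.TN"
    and proj_pure: "\<And>t \<nu>. t \<in> carrier T ==> \<nu> \<in> carrier N1 ==> proj (A1.pt t \<nu>) = A0.pt t (pr \<nu>)"
proof -
  have "proj \<in> module_hom R (tensor R T N1) A0.TN"
    unfolding proj_def
    by (rule A1.tb.tm.tensor_lift_hom[OF A0.TN_module])
      (simp_all add: pr_closed pr_add pr_smult A0.pt_closed A0.TN_simps(3,4) A0.tb.tm.pt_add_left A0.tb.tm.pt_add_right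
        A0.tb.tm.pt_smult_left A0.tb.tm.pt_smult_right)
  then show "proj \<in> module_hom R A1.TN A0.TN" unfolding module_hom_def A1.TN_simps(1,3,4) .
  show "proj (A1.pt t \<nu>) = A0.pt t (pr \<nu>)" if "t \<in> carrier T" "\<nu> \<in> carrier N1" for t \<nu>
    unfolding proj_def
    by (rule A1.tb.tm.tensor_lift_pure[OF A0.TN_module _ _ _ _ _ that])
      (simp_all add: pr_closed pr_add pr_smult A0.pt_closed A0.TN_simps(3,4) A0.tb.tm.pt_add_left A0.tb.tm.pt_add_right
        A0.tb.tm.pt_smult_left A0.tb.tm.pt_smult_right)
qed

lemma kap_proj:
  assumes k: "k < n" and z: "z \<in> carrier A1.TN"
  shows "A0.kap k (proj z) = A1.kap k z"
proof -
  have k': "k < Suc n" using k by simp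
  have z': "z \<in> carrier (tensor R T N1)" using z by (simp add: A1.TN_simps)
  show ?thesis
  proof (rule A1.tb.tm.tensor_maps_eq[of "\<lambda>z. A0.kap k (proj z)" T "A1.kap k" z, OF _ _ _ z'])
    fix y w assume yw: "y \<in> carrier (tensor R T N1)" "w \<in> carrier (tensor R T N1)"
    then have yw': "y \<in> carrier A1.TN" "w \<in> carrier A1.TN" by (simp_all add: A1.TN_simps)
    show "A0.kap k (proj (y \<oplus>\<^sub>(tensor R T N1) w)) = A0.kap k (proj y) \<oplus>\<^sub>T A0.kap k (proj w)"
      using module_homD(2)[OF proj_hom yw'] A0.kap_add[OF k] module_homD(1)[OF proj_hom] yw'
      by (simp add: A1.TN_simps(3))
    show "A1.kap k (y \<oplus>\<^sub>(tensor R T N1) w) = A1.kap k y \<oplus>\<^sub>T A1.kap k w"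
      using A1.kap_add[OF k' yw'] by (simp add: A1.TN_simps(3))
  next
    fix t \<nu> assume "t \<in> carrier T" "\<nu> \<in> carrier N1"
    then show "A0.kap k (proj (A1.pt t \<nu>)) = A1.kap k (A1.pt t \<nu>)"
      using k k' by (simp add: proj_pure A0.tb.kap_pure A1.tb.kap_pure pr_closed pr_eps)
  qed
qed

lemma kap_incl_ph:
  assumes "k < Suc n" "t \<in> carrier T"
  shows "A1.kap k (incl (Ag.ph t)) = (if k = n then t else \<zero>\<^sub>T)"
  using assms A1.tb.kap_pure[of k t "e1 n"] A1.tb.e_closed[of n] A1.tb.eps_e[of k n] Ag.e0_closed
  by (auto simp: Ag.ph_def incl_pure A1.tg.smult_one A1.tg.smult_l_null)

lemma incl_closed: "z \<in> carrier Ag.TN ==> incl z \<in> carrier A1.TN"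
  by (rule module_homD(1)[OF incl_hom])

lemma gmod1: "gmod G A1.TN"
  by (rule A1.TN_gmod[OF a1_mult])

interpretation gm: gmod G A1.TN by (rule gmod1)

lemma kap_coboundary:
  assumes k: "k < Suc n" and b: "\<And>g. g \<in> carrier G ==> b g \<in> carrier A1.TN"
    and g: "g \<in> carrier G" and h: "h \<in> carrier G"
  shows "A1.kap k (coboundary1 G A1.TN b (g, h)) =
    ((\<Oplus>\<^sub>T l\<in>{..k}. B (k - l) g \<odot>\<^sub>T act T g (A1.kap l (b h))) \<ominus>\<^sub>T A1.kap k (b (g \<otimes>\<^sub>G h))) \<oplus>\<^sub>T A1.kap k (b g)"
proof -
  have c: "b g \<in> carrier A1.TN" "b h \<in> carrier A1.TN" "b (g \<otimes>\<^sub>G h) \<in> carrier A1.TN"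
    "act A1.TN g (b h) \<in> carrier A1.TN"
    using b g h A1.act_closed by auto
  have "coboundary1 G A1.TN b (g, h) = (act A1.TN g (b h) \<ominus>\<^sub>A1.TN b (g \<otimes>\<^sub>G h)) \<oplus>\<^sub>A1.TN b g"
    using g h by (simp add: coboundary1_def)
  then show ?thesis
    using c k g by (simp add: A1.kap_add A1.kap_minus A1.kap_act)
qed

section \<open>The explicit lift of f and its coboundary\<close>

context
  fixes f :: "'g => ('m \<times> 'k => 'r) set" and lam :: "nat => 'g => 'm"
  assumes f: "f \<in> Z1 G A0.TN"
    and lam: "\<And>k g. k < n ==> g \<in> carrier G ==> lam k g \<in> carrier T"
    and f_lam: "\<And>g. g \<in> carrier G ==> f g = A0.vec (\<lambda>k. lam k g)"
begin

lemma f_cont: "continuous_map (grp_top G) (mod_top A0.TN) f"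
  using f by (simp add: Z1_def C1_def)

lemma f_closed: "g \<in> carrier G ==> f g \<in> carrier A0.TN"
  using continuous_map_image_subset_topspace[OF f_cont] A1.tg.top_G A0.topspace_TN by auto

lemma lam_eq: "k < n ==> g \<in> carrier G ==> lam k g = A0.kap k (f g)"
  using f_lam A0.kap_vec[of "\<lambda>k. lam k g" k] lam by simp

lemma lam_cont:
  assumes "k < n" shows "continuous_map (grp_top G) (mod_top T) (lam k)"
proof -
  have "continuous_map (grp_top G) (mod_top T) (\<lambda>g. A0.kap k (f g))"
    using continuous_map_compose[OF f_cont A0.kap_continuous[OF assms]] by (simp add: o_def)
  then show ?thesis
    by (rule continuous_map_eq) (use lam_eq[OF assms] A1.tg.top_G in auto)
qed

lemma lam_cocycle:
  assumes k: "k < n" and g: "g \<in> carrier G" and h: "h \<in> carrier G"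
  shows "lam k (g \<otimes>\<^sub>G h) = lam k g \<oplus>\<^sub>T (\<Oplus>\<^sub>T l\<in>{..k}. B (k - l) g \<odot>\<^sub>T act T g (lam l h))"
proof -
  have "f (g \<otimes>\<^sub>G h) = f g \<oplus>\<^sub>A0.TN act A0.TN g (f h)"
    using f g h by (simp add: Z1_def)
  then have "lam k (g \<otimes>\<^sub>G h) = A0.kap k (f g) \<oplus>\<^sub>T A0.kap k (act A0.TN g (f h))"
    using k g h f_closed by (simp add: lam_eq A0.kap_add A0.act_closed)
  also have "A0.kap k (act A0.TN g (f h)) = (\<Oplus>\<^sub>T l\<in>{..k}. B (k - l) g \<odot>\<^sub>T act T g (A0.kap l (f h)))"
    by (rule A0.kap_act[OF k g f_closed[OF h]])
  also have "\<dots> = (\<Oplus>\<^sub>T l\<in>{..k}. B (k - l) g \<odot>\<^sub>T act T g (lam l h))"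
    by (rule A1.tg.M.finsum_cong')
      (use k g h lam A1.B_closed A1.tg.act_closed in \<open>auto simp: lam_eq\<close>)
  finally show ?thesis using lam_eq[OF k g] by simp
qed

definition b0 :: "'g => ('m \<times> 'n => 'r) set" where
  "b0 g = A1.vec (\<lambda>k. if k < n then lam k g else \<zero>\<^sub>T)"

definition cc :: "'g \<times> 'g => 'm" where
  "cc = (\<lambda>(g, h)\<in>GG. \<Oplus>\<^sub>T l\<in>{..<n}. B (n - l) g \<odot>\<^sub>T act T g (lam l h))"

lemma b0_closed: "g \<in> carrier G ==> b0 g \<in> carrier A1.TN"
  unfolding b0_def using lam by (intro A1.vec_closed) auto

lemma kap_b0: "k < Suc n ==> g \<in> carrier G ==> A1.kap k (b0 g) = (if k < n then lam k g else \<zero>\<^sub>T)"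
  unfolding b0_def using lam by (intro A1.kap_vec) auto

lemma b0_cont: "continuous_map (grp_top G) (mod_top A1.TN) b0"
  unfolding b0_def
proof (rule A1.vec_continuous)
  fix k
  show "continuous_map (grp_top G) (mod_top T) (\<lambda>g. if k < n then lam k g else \<zero>\<^sub>T)"
    using lam_cont[of k] A1.tg.continuous_const[of "\<zero>\<^sub>T"] by (cases "k < n") auto
qed

lemma cc_eval: "g \<in> carrier G ==> h \<in> carrier G ==>
    cc (g, h) = (\<Oplus>\<^sub>T l\<in>{..<n}. B (n - l) g \<odot>\<^sub>T act T g (lam l h))"
  by (simp add: cc_def)

lemma cc_closed: "g \<in> carrier G ==> h \<in> carrier G ==> cc (g, h) \<in> carrier T"
  unfolding cc_eval using lam A1.B_closed A1.tg.act_closed by (intro A1.tg.M.finsum_closed) auto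

text \<open>Below n the coordinate is the cocycle relation \<open>lam_cocycle\<close>. At n the
  coordinate of \<open>b0\<close> itself is zero, so only the contributions of the lower coordinates
  through the action survive.\<close>

lemma kap_delta_b0:
  assumes k: "k < Suc n" and g: "g \<in> carrier G" and h: "h \<in> carrier G"
  shows "A1.kap k (coboundary1 G A1.TN b0 (g, h)) = (if k = n then cc (g, h) else \<zero>\<^sub>T)"
proof -
  have gh: "g \<otimes>\<^sub>G h \<in> carrier G" using g h by simp
  have Bc: "B (k - l) g \<in> carrier R" for l using A1.B_closed[of "k - l" g] k g by simp
  let ?S = "\<lambda>A. \<Oplus>\<^sub>T l\<in>A. B (k - l) g \<odot>\<^sub>T act T g (lam l h)"
  have Sc: "?S A \<in> carrier T" if "A \<subseteq> {..<n}" for A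
    using that lam Bc A1.tg.act_closed g h by (intro A1.tg.M.finsum_closed) auto
  have "(\<Oplus>\<^sub>T l\<in>{..k}. B (k - l) g \<odot>\<^sub>T act T g (A1.kap l (b0 h))) = ?S ({..k} \<inter> {..<n})"
    by (rule A1.tg.M.add.finprod_mono_neutral_cong_right)
      (use k g h lam Bc A1.tg.act_closed A1.tg.act_zero in \<open>auto simp: kap_b0\<close>)
  then have *: "A1.kap k (coboundary1 G A1.TN b0 (g, h)) = (?S ({..k} \<inter> {..<n}) \<ominus>\<^sub>T A1.kap k (b0 (g \<otimes>\<^sub>G h))) \<oplus>\<^sub>T A1.kap k (b0 g)"
    using kap_coboundary[OF k b0_closed g h] by simp
  show ?thesis
  proof (cases "k = n")
    case True
    have "{..n} \<inter> {..<n} = {..<n}" by auto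
    then show ?thesis
      using * True Sc[of "{..<n}"] g h gh by (simp add: kap_b0 cc_eval a_minus_def)
  next
    case False
    then have kn: "k < n" using k by simp
    have "{..k} \<inter> {..<n} = {..k}" using kn by auto
    then have "A1.kap k (coboundary1 G A1.TN b0 (g, h)) = (?S {..k} \<ominus>\<^sub>T (lam k g \<oplus>\<^sub>T ?S {..k})) \<oplus>\<^sub>T lam k g"
      using * kn g h gh by (simp add: kap_b0 lam_cocycle)
    also have "\<dots> = (?S {..k} \<oplus>\<^sub>T \<ominus>\<^sub>T ?S {..k}) \<oplus>\<^sub>T (lam k g \<oplus>\<^sub>T \<ominus>\<^sub>T lam k g)"
      using Sc[of "{..k}"] lam[OF kn g] kn by (simp add: a_minus_def A1.tg.M.minus_add A1.tg.M.a_ac subset_eq)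
    also have "\<dots> = \<zero>\<^sub>T"
      using Sc[of "{..k}"] lam[OF kn g] kn by (simp add: A1.tg.M.r_neg subset_eq)
    finally show ?thesis using False by simp
  qed
qed

text \<open>The coboundary of \<open>b0\<close> is a cocycle all of whose coordinates but the last
  vanish. On such vectors g acts on the last coordinate without twist, because B 0 g = 1, so the
  relation read there is the cocycle relation for \<open>cc\<close>.\<close>

lemma cc_Z2: "cc \<in> Z2 G T"
proof -
  let ?c = "\<lambda>s. \<Oplus>\<^sub>T l\<in>{..<n}. B (n - l) (fst s) \<odot>\<^sub>T act T (fst s) (lam l (snd s))"
  have eq: "cc = (\<lambda>s\<in>GG. ?c s)"
    unfolding cc_def by (rule restrict_ext) (simp add: case_prod_beta)
  show ?thesis
    unfolding eq
  proof (rule A1.tg.Z2_I)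
    note fs = continuous_map_fst[of "grp_top G" "grp_top G"] continuous_map_snd[of "grp_top G" "grp_top G"]
    show "continuous_map (prod_topology (grp_top G) (grp_top G)) (mod_top T) ?c"
    proof (intro A1.tg.continuous_finsum A1.tg.continuous_smult A1.tg.continuous_act fs)
      fix l assume l: "l \<in> {..<n}"
      show "continuous_map (prod_topology (grp_top G) (grp_top G)) (ring_top R) (\<lambda>s. B (n - l) (fst s))"
        using continuous_map_compose[OF fs(1) A1.B_cont[of "n - l"]] by (simp add: o_def)
      show "continuous_map (prod_topology (grp_top G) (grp_top G)) (mod_top T) (\<lambda>s. lam l (snd s))"
        using continuous_map_compose[OF fs(2) lam_cont[of l]] l by (simp add: o_def)
    qed simp
    fix g h k assume ghk: "g \<in> carrier G" "h \<in> carrier G" "k \<in> carrier G"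
    let ?D = "coboundary1 G A1.TN b0"
    have Dc: "?D (g, h) \<in> carrier A1.TN" if "g \<in> carrier G" "h \<in> carrier G" for g h
      by (rule gm.coboundary1_closed[OF b0_closed that])
    have act: "A1.kap n (act A1.TN g (?D (h, k))) = act T g (cc (h, k))"
    proof -
      have "A1.kap n (act A1.TN g (?D (h, k))) = (\<Oplus>\<^sub>T l\<in>{..n}. B (n - l) g \<odot>\<^sub>T act T g (A1.kap l (?D (h, k))))"
        using ghk Dc by (intro A1.kap_act) auto
      also have "\<dots> = (\<Oplus>\<^sub>T l\<in>{..n}. if n = l then act T g (cc (h, k)) else \<zero>\<^sub>T)"
        by (rule A1.tg.M.finsum_cong')
          (use ghk A1.B_closed[of _ g] cc_closed A1.tg.act_closed A1.tg.act_zero Ag.B_0 in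
            \<open>auto simp: kap_delta_b0 A1.tg.smult_one\<close>)
      also have "\<dots> = act T g (cc (h, k))"
        using A1.tg.M.finsum_singleton[of n "{..n}" "\<lambda>_. act T g (cc (h, k))"] ghk cc_closed A1.tg.act_closed by simp
      finally show ?thesis .
    qed
    have "act A1.TN g (?D (h, k)) \<oplus>\<^sub>A1.TN ?D (g, h \<otimes>\<^sub>G k) = ?D (g \<otimes>\<^sub>G h, k) \<oplus>\<^sub>A1.TN ?D (g, h)"
      by (rule gm.cocycle[OF b0_closed ghk])
    from arg_cong[OF this, of "A1.kap n"]
    have "act T g (cc (h, k)) \<oplus>\<^sub>T cc (g, h \<otimes>\<^sub>G k) = cc (g \<otimes>\<^sub>G h, k) \<oplus>\<^sub>T cc (g, h)"
      using ghk Dc act by (simp add: A1.kap_add A1.act_closed kap_delta_b0)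
    then show "act T g (?c (h, k)) \<oplus>\<^sub>T ?c (g, h \<otimes>\<^sub>G k) = ?c (g \<otimes>\<^sub>G h, k) \<oplus>\<^sub>T ?c (g, h)"
      using ghk by (simp add: cc_eval)
  qed
qed

text \<open>\<open>connecting\<close> ranges over all lifts of all cocycles in the class. Any lift b
  is \<open>b0\<close> plus the coboundary of a vector plus some b' concentrated in the last
  coordinate; that coordinate, \<open>en\<close>, alters the resulting 2-cocycle by its own
  coboundary.\<close>

lemma connecting_unique:
  assumes a: "a \<in> Z2 G Ag.TN" and b: "b \<in> C1 G A1.TN"
    and fb: "(\<lambda>g\<in>carrier G. proj (b g)) \<in> class1 G A0.TN f"
    and eq: "(\<lambda>s\<in>GG. incl (a s)) = coboundary1 G A1.TN b"
  shows "class2 G Ag.TN a = Ag.lift_class (class2 G T cc)"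
proof -
  have b_cont: "continuous_map (grp_top G) (mod_top A1.TN) b" using b by (simp add: C1_def)
  have bc: "b g \<in> carrier A1.TN" if "g \<in> carrier G" for g
    using continuous_map_image_subset_topspace[OF b_cont] that A1.tg.top_G A1.topspace_TN by auto
  obtain m where m: "m \<in> carrier A0.TN"
    "(\<lambda>g\<in>carrier G. proj (b g)) = (\<lambda>g\<in>carrier G. coboundary0 G A0.TN m g \<oplus>\<^sub>A0.TN f g)"
    using fb unfolding class1_def B1_def a_r_coset_def' fun_module_def by auto
  have pb: "proj (b g) = (act A0.TN g m \<ominus>\<^sub>A0.TN m) \<oplus>\<^sub>A0.TN f g" if "g \<in> carrier G" for g
    using fun_cong[OF m(2), of g] that by (simp add: coboundary0_def)
  \<comment> \<open>\<open>m\<close> is the vector whose coboundary separates the projection of b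
    from f; it is lifted to the larger module with last coordinate zero.\<close>
  define mt where "mt = A1.vec (\<lambda>k. if k < n then A0.kap k m else \<zero>\<^sub>T)"
  have kc: "A0.kap k m \<in> carrier T" if "k < n" for k using A0.kap_closed[OF that m(1)] .
  have mtc: "mt \<in> carrier A1.TN" unfolding mt_def using kc by (intro A1.vec_closed) auto
  have kmt: "A1.kap k mt = (if k < n then A0.kap k m else \<zero>\<^sub>T)" if "k < Suc n" for k
    unfolding mt_def using kc that by (intro A1.kap_vec) auto
  define w where "w g = b0 g \<oplus>\<^sub>A1.TN (act A1.TN g mt \<ominus>\<^sub>A1.TN mt)" for g
  define b' where "b' g = b g \<ominus>\<^sub>A1.TN w g" for g
  have wc: "w g \<in> carrier A1.TN" if "g \<in> carrier G" for g
    unfolding w_def using that b0_closed mtc A1.act_closed by simp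
  have b'c: "b' g \<in> carrier A1.TN" if "g \<in> carrier G" for g
    unfolding b'_def using that bc wc by simp
  have kw: "A1.kap k (w g) = (if k < n then lam k g else \<zero>\<^sub>T) \<oplus>\<^sub>T
      ((\<Oplus>\<^sub>T l\<in>{..k}. B (k - l) g \<odot>\<^sub>T act T g (A1.kap l mt)) \<ominus>\<^sub>T A1.kap k mt)" if "k < Suc n" "g \<in> carrier G" for k g
    unfolding w_def using that b0_closed mtc A1.act_closed
    by (simp add: A1.kap_add A1.kap_minus A1.kap_act kap_b0)
  \<comment> \<open>\<open>b\<close> and \<open>w\<close> have the same projection, that of
    \<open>b0\<close> plus the coboundary of \<open>mt\<close>, so their difference has only a last
    coordinate.\<close>
  have low: "A1.kap k (b' g) = \<zero>\<^sub>T" if k: "k < n" and g: "g \<in> carrier G" for k g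
  proof -
    have k': "k < Suc n" using k by simp
    have "A1.kap k (b g) = A0.kap k (proj (b g))" using kap_proj[OF k bc[OF g]] by simp
    also have "\<dots> = ((\<Oplus>\<^sub>T l\<in>{..k}. B (k - l) g \<odot>\<^sub>T act T g (A0.kap l m)) \<ominus>\<^sub>T A0.kap k m) \<oplus>\<^sub>T lam k g"
      unfolding pb[OF g] using k g m(1) A0.act_closed f_closed abelian_group.minus_closed[OF module_is_abelian_group[OF A0.TN_module]]
      by (simp add: A0.kap_add A0.kap_minus A0.kap_act lam_eq)
    also have "(\<Oplus>\<^sub>T l\<in>{..k}. B (k - l) g \<odot>\<^sub>T act T g (A0.kap l m)) =
        (\<Oplus>\<^sub>T l\<in>{..k}. B (k - l) g \<odot>\<^sub>T act T g (A1.kap l mt))"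
      by (rule A1.tg.M.finsum_cong') (use k g kc kmt A1.B_closed A1.tg.act_closed in auto)
    finally have "A1.kap k (b g) = A1.kap k (w g)"
    proof -
      assume 1: "A1.kap k (b g) = ((\<Oplus>\<^sub>T l\<in>{..k}. B (k - l) g \<odot>\<^sub>T act T g (A1.kap l mt)) \<ominus>\<^sub>T A0.kap k m) \<oplus>\<^sub>T lam k g"
      have c: "(\<Oplus>\<^sub>T l\<in>{..k}. B (k - l) g \<odot>\<^sub>T act T g (A1.kap l mt)) \<in> carrier T"
        using k g kc kmt A1.B_closed A1.tg.act_closed by (intro A1.tg.M.finsum_closed) auto
      show ?thesis
        unfolding 1 kw[OF k' g] using k kmt[OF k'] c kc[OF k] lam[OF k g] by (simp add: A1.tg.M.a_comm)
    qed
    then show ?thesis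
      unfolding b'_def using A1.kap_minus[OF k' bc[OF g] wc[OF g]] A1.kap_closed[OF k' wc[OF g]]
      by (simp add: A1.tg.M.minus_eq_zero_iff)
  qed
  define en where "en g = A1.kap n (b' g)" for g
  have ec: "en g \<in> carrier T" if "g \<in> carrier G" for g
    unfolding en_def using A1.kap_closed[OF _ b'c[OF that]] by simp
  have en_eq: "en g = A1.kap n (b g) \<ominus>\<^sub>T (\<zero>\<^sub>T \<oplus>\<^sub>T
      ((\<Oplus>\<^sub>T l\<in>{..n}. B (n - l) g \<odot>\<^sub>T act T g (A1.kap l mt)) \<ominus>\<^sub>T A1.kap n mt))" if "g \<in> carrier G" for g
    unfolding en_def b'_def using A1.kap_minus[OF _ bc[OF that] wc[OF that], of n] kw[OF _ that, of n] by simp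
  have kmtc: "A1.kap l mt \<in> carrier T" if "l < Suc n" for l using A1.kap_closed[OF that mtc] .
  have "continuous_map (grp_top G) (mod_top T) (\<lambda>g. A1.kap n (b g) \<ominus>\<^sub>T (\<zero>\<^sub>T \<oplus>\<^sub>T
      ((\<Oplus>\<^sub>T l\<in>{..n}. B (n - l) g \<odot>\<^sub>T act T g (A1.kap l mt)) \<ominus>\<^sub>T A1.kap n mt)))"
  proof (intro A1.tg.continuous_minus A1.tg.continuous_add A1.tg.continuous_const A1.tg.continuous_finsum
      A1.tg.continuous_smult A1.tg.continuous_act)
    show "continuous_map (grp_top G) (mod_top T) (\<lambda>g. A1.kap n (b g))"
      using continuous_map_compose[OF b_cont A1.kap_continuous[of n]] by (simp add: o_def)
  qed (use kmtc A1.B_cont in auto)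
  then have e_cont: "continuous_map (grp_top G) (mod_top T) en"
    by (rule continuous_map_eq) (simp add: en_eq A1.tg.top_G)
  have a1: "(\<lambda>s\<in>GG. Ag.kap 0 (a s)) \<in> Z2 G T" (is "?a1 \<in> _") by (rule Ag.descend_Z2[OF a])
  have "?a1 (g, h) = coboundary1 G T en (g, h) \<oplus>\<^sub>T cc (g, h)" if g: "g \<in> carrier G" and h: "h \<in> carrier G" for g h
  proof -
    have gh: "g \<otimes>\<^sub>G h \<in> carrier G" using g h by simp
    have as: "a (g, h) \<in> carrier Ag.TN" using Ag.TN_Z2_eval[OF a] g h by simp
    have "incl (a (g, h)) = coboundary1 G A1.TN b (g, h)"
      using fun_cong[OF eq, of "(g, h)"] g h by simp
    moreover have "A1.kap n (incl (a (g, h))) = Ag.kap 0 (a (g, h))"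
      using kap_incl_ph[of n "Ag.kap 0 (a (g, h))"] Ag.ph_kap[OF as] Ag.kap_closed[OF _ as] by simp
    ultimately have 1: "?a1 (g, h) = A1.kap n (coboundary1 G A1.TN b (g, h))"
      using g h by simp
    have b_split: "b g = b' g \<oplus>\<^sub>A1.TN w g" if "g \<in> carrier G" for g
      unfolding b'_def using bc[OF that] wc[OF that] by (simp add: a_minus_def gm.M.a_assoc gm.M.l_neg)
    let ?D = "coboundary1 G A1.TN"
    have m0c: "act A1.TN g mt \<ominus>\<^sub>A1.TN mt \<in> carrier A1.TN" if "g \<in> carrier G" for g
      using that mtc A1.act_closed by simp
    have Dc: "?D b' (g, h) \<in> carrier A1.TN" "?D b0 (g, h) \<in> carrier A1.TN"
      using gm.coboundary1_closed[OF b'c g h] gm.coboundary1_closed[OF b0_closed g h] by auto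
    have "?D b (g, h) = ?D (\<lambda>g. b' g \<oplus>\<^sub>A1.TN w g) (g, h)"
      by (rule gm.coboundary1_cong'[OF b_split g h])
    also have "\<dots> = ?D b' (g, h) \<oplus>\<^sub>A1.TN ?D w (g, h)"
      by (rule gm.coboundary1_add[OF b'c wc g h])
    also have "?D w (g, h) = ?D b0 (g, h) \<oplus>\<^sub>A1.TN ?D (\<lambda>g. act A1.TN g mt \<ominus>\<^sub>A1.TN mt) (g, h)"
      unfolding w_def by (rule gm.coboundary1_add[OF b0_closed m0c g h])
    also have "\<dots> = ?D b0 (g, h)"
      using gm.coboundary1_coboundary0[OF mtc g h] Dc by simp
    finally have "A1.kap n (?D b (g, h)) = A1.kap n (?D b' (g, h)) \<oplus>\<^sub>T cc (g, h)"
      using Dc kap_delta_b0[of n g h] g h by (simp add: A1.kap_add)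
    moreover have "A1.kap n (?D b' (g, h)) = coboundary1 G T en (g, h)"
    proof -
      have "(\<Oplus>\<^sub>T l\<in>{..n}. B (n - l) g \<odot>\<^sub>T act T g (A1.kap l (b' h))) =
          (\<Oplus>\<^sub>T l\<in>{..n}. if n = l then act T g (en h) else \<zero>\<^sub>T)"
        by (rule A1.tg.M.finsum_cong')
          (use g h A1.B_closed[of _ g] ec A1.tg.act_closed A1.tg.act_zero Ag.B_0 low in
            \<open>auto simp: A1.tg.smult_one en_def\<close>)
      also have "\<dots> = act T g (en h)"
        using A1.tg.M.finsum_singleton[of n "{..n}" "\<lambda>_. act T g (en h)"] g h ec A1.tg.act_closed by simp
      finally show ?thesis
        using kap_coboundary[of n b', OF _ b'c g h] g h by (simp add: coboundary1_def en_def)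
    qed
    ultimately show ?thesis using 1 by simp
  qed
  then have "class2 G T ?a1 = class2 G T cc"
    by (rule A1.tg.class2_eqI[OF a1 cc_Z2 e_cont])
  moreover have "class2 G Ag.TN a = Ag.lift_class (class2 G T ?a1)"
    by (subst Ag.lift_descend[OF a]) (rule Ag.class2_ph[OF a1])
  ultimately show ?thesis by simp
qed

lemma connecting_eq:
  "connecting G Ag.TN A1.TN incl proj (class1 G A0.TN f) = Ag.lift_class (class2 G T cc)"
proof -
  let ?a = "\<lambda>s\<in>GG. Ag.ph (cc s)" and ?b = "\<lambda>g\<in>carrier G. b0 g"
  have aZ: "?a \<in> Z2 G Ag.TN" by (rule Ag.lift_Z2[OF cc_Z2])
  have bC: "?b \<in> C1 G A1.TN"
    unfolding C1_def using continuous_map_eq[OF b0_cont, of ?b] by (simp add: A1.tg.top_G)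
  have pf: "proj (b0 g) = f g" if g: "g \<in> carrier G" for g
    by (rule A0.TN_eqI) (use g f_closed b0_closed module_homD(1)[OF proj_hom] in \<open>auto simp: kap_proj kap_b0 lam_eq\<close>)
  \<comment> \<open>The explicit lift projects to f itself, which as a member of the coset is the
    coboundary of zero plus f.\<close>
  have fb: "(\<lambda>g\<in>carrier G. proj (?b g)) \<in> class1 G A0.TN f"
  proof -
    interpret M0: module R A0.TN by (rule A0.TN_module)
    have z: "act A0.TN g \<zero>\<^sub>A0.TN = \<zero>\<^sub>A0.TN" if "g \<in> carrier G" for g
      by (rule module_hom_zero[OF A0.TN_module A0.TN_module A0.act_hom[OF that]])
    have "(\<lambda>g\<in>carrier G. proj (?b g)) = (\<lambda>g\<in>carrier G. coboundary0 G A0.TN \<zero>\<^sub>A0.TN g \<oplus>\<^sub>A0.TN f g)"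
      by (rule restrict_ext) (simp add: pf coboundary0_def z f_closed a_minus_def M0.M.r_neg)
    then show ?thesis
      unfolding class1_def B1_def a_r_coset_def' fun_module_def using M0.M.zero_closed by auto
  qed
  have eq: "(\<lambda>s\<in>GG. incl (?a s)) = coboundary1 G A1.TN ?b"
  proof -
    have "coboundary1 G A1.TN ?b = (\<lambda>s\<in>GG. coboundary1 G A1.TN b0 s)"
      unfolding coboundary1_def by (rule restrict_ext) auto
    also have "\<dots> = (\<lambda>s\<in>GG. incl (?a s))"
    proof (rule restrict_ext)
      fix s assume "s \<in> GG"
      then obtain g h where s: "s = (g, h)" "g \<in> carrier G" "h \<in> carrier G" by auto
      have c: "cc (g, h) \<in> carrier T" using cc_closed s by simp
      have "coboundary1 G A1.TN b0 (g, h) = incl (Ag.ph (cc (g, h)))"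
        by (rule A1.TN_eqI)
          (use s c gm.coboundary1_closed[OF b0_closed] incl_closed Ag.ph_closed in \<open>auto simp: kap_delta_b0 kap_incl_ph\<close>)
      then show "coboundary1 G A1.TN b0 s = incl (?a s)" using s by simp
    qed
    finally show ?thesis by simp
  qed
  have "{class2 G Ag.TN a | a b. a \<in> Z2 G Ag.TN \<and> b \<in> C1 G A1.TN \<and>
      (\<lambda>g\<in>carrier G. proj (b g)) \<in> class1 G A0.TN f \<and> (\<lambda>s\<in>GG. incl (a s)) = coboundary1 G A1.TN b} =
      {Ag.lift_class (class2 G T cc)}" (is "?S = _")
  proof
    show "?S \<subseteq> {Ag.lift_class (class2 G T cc)}" using connecting_unique by blast
    have "Ag.lift_class (class2 G T cc) \<in> ?S"
      using aZ bC fb eq Ag.class2_ph[OF cc_Z2] by blast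
    then show "{Ag.lift_class (class2 G T cc)} \<subseteq> ?S" by blast
  qed
  then show ?thesis unfolding connecting_def by simp
qed

end

end

section \<open>The modules \<open>\<Omega>/I^m\<close>\<close>

context Zp_tower_trunc
begin

abbreviation "JJ m \<equiv> aug_pow R H m"

definition cl :: "nat => ('h set => 'h set => 'r) => ('h set => 'h set => 'r) set" where
  "cl m a = JJ m +>\<^sub>CG a"

text \<open>By \<open>cl_eq_iff\<close> the value does not depend on the chosen representative as
  long as k < m \<le> n + 1.\<close>

definition ec :: "nat => nat => ('h set => 'h set => 'r) set => 'r" where
  "ec m k X = AT.cf (SOME a. a \<in> carrier CG \<and> X = cl m a) k"

definition oact :: "nat => 'h => ('h set => 'h set => 'r) set => ('h set => 'h set => 'r) set" where
  "oact m C X = cl m (cgr_elt R H C) \<otimes>\<^sub>(CG Quot JJ m) X"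

text \<open>I is generated by x according to \<open>aug_divisible\<close>. A product of ideals
  consists of sums of products, and a sum of multiples of x^(m+1) is again one.\<close>

lemma aug_pow_eq: "JJ m = {xx [^]\<^sub>CG m \<otimes>\<^sub>CG y | y. y \<in> carrier CG}"
proof (induction m)
  case 0
  then show ?case by auto (metis OC.l_one)
next
  case (Suc m)
  have I: "a \<in> aug_ideal R H \<longleftrightarrow> (\<exists>y\<in>carrier CG. a = xx \<otimes>\<^sub>CG y)" for a
    using aug_divisible[of a] AR.aug_simps(3)[OF xx_closed] augm_xx xx_closed AR.aug_simps(1)
    unfolding aug_ideal_def augm_def[symmetric] by auto
  have le: "a \<in> JJ (Suc m) ==> \<exists>y\<in>carrier CG. a = xx [^]\<^sub>CG Suc m \<otimes>\<^sub>CG y" for a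
    unfolding ideal_pow.simps
  proof (induction a rule: ideal_prod.induct)
    case (prod i j)
    obtain y z where yz: "y \<in> carrier CG" "i = xx [^]\<^sub>CG m \<otimes>\<^sub>CG y" "z \<in> carrier CG" "j = xx \<otimes>\<^sub>CG z"
      using prod Suc I by auto
    then have "i \<otimes>\<^sub>CG j = xx [^]\<^sub>CG Suc m \<otimes>\<^sub>CG (y \<otimes>\<^sub>CG z)"
      using xx_closed by (simp add: OC.m_ac)
    then show ?case using yz by blast
  next
    case (sum a b)
    then obtain y z where yz: "y \<in> carrier CG" "a = xx [^]\<^sub>CG Suc m \<otimes>\<^sub>CG y" "z \<in> carrier CG" "b = xx [^]\<^sub>CG Suc m \<otimes>\<^sub>CG z"
      by blast
    then have "a \<oplus>\<^sub>CG b = xx [^]\<^sub>CG Suc m \<otimes>\<^sub>CG (y \<oplus>\<^sub>CG z)"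
      using xx_closed by (simp add: OC.r_distr del: OC.nat_pow_Suc)
    then show ?case using yz by blast
  qed
  have ge: "xx [^]\<^sub>CG Suc m \<otimes>\<^sub>CG y \<in> JJ (Suc m)" if y: "y \<in> carrier CG" for y
  proof -
    have "xx [^]\<^sub>CG m \<otimes>\<^sub>CG y \<in> JJ m" using Suc y by blast
    moreover have "xx \<in> aug_ideal R H" using I[of xx] xx_closed OC.one_closed OC.r_one by metis
    ultimately have "(xx [^]\<^sub>CG m \<otimes>\<^sub>CG y) \<otimes>\<^sub>CG xx \<in> JJ (Suc m)"
      unfolding ideal_pow.simps by (rule ideal_prod.prod)
    then show ?thesis using y xx_closed by (simp add: OC.m_ac)
  qed
  show ?case
  proof (intro equalityI subsetI)
    fix a assume "a \<in> JJ (Suc m)"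
    from le[OF this] show "a \<in> {xx [^]\<^sub>CG Suc m \<otimes>\<^sub>CG y | y. y \<in> carrier CG}" by blast
  next
    fix a assume "a \<in> {xx [^]\<^sub>CG Suc m \<otimes>\<^sub>CG y | y. y \<in> carrier CG}"
    then show "a \<in> JJ (Suc m)" using ge by blast
  qed
qed

lemma JJ_ideal: "ideal (JJ m) CG"
proof -
  have "JJ m = PIdl\<^bsub>CG\<^esub> (xx [^]\<^sub>CG m)"
    unfolding aug_pow_eq cgenideal_def using xx_closed by auto (metis OC.m_comm OC.nat_pow_closed)+
  then show ?thesis using OC.cgenideal_ideal xx_closed by simp
qed

lemma JJ_subgroup: "subgroup (JJ m) (add_monoid CG)"
  by (rule additive_subgroup.a_subgroup[OF ideal.axioms(1)[OF JJ_ideal]])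

lemma JJ_iff: "m \<le> Suc n ==> a \<in> JJ m \<longleftrightarrow> a \<in> carrier CG \<and> (\<forall>k<m. AT.cf a k = \<zero>\<^sub>R)"
  using AT.cf_vanish[of a m] xx_closed unfolding aug_pow_eq by auto

lemma cl_add: "a \<in> carrier CG ==> b \<in> carrier CG ==> cl m a <+>\<^sub>CG cl m b = cl m (a \<oplus>\<^sub>CG b)"
  unfolding cl_def by (rule coset_add[OF OC.abelian_group_axioms JJ_subgroup])

lemma cl_mult: "a \<in> carrier CG ==> b \<in> carrier CG ==> cl m a \<otimes>\<^sub>(CG Quot JJ m) cl m b = cl m (a \<otimes>\<^sub>CG b)"
  unfolding cl_def using ideal.rcoset_mult_add[OF JJ_ideal] by (simp add: FactRing_def)

lemma cl_eq_iff: "m \<le> Suc n ==> a \<in> carrier CG ==> b \<in> carrier CG ==>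
    cl m a = cl m b \<longleftrightarrow> (\<forall>k<m. AT.cf a k = AT.cf b k)"
proof -
  assume m: "m \<le> Suc n" and ab: "a \<in> carrier CG" "b \<in> carrier CG"
  have "AT.cf (a \<ominus>\<^sub>CG b) k = \<zero>\<^sub>R \<longleftrightarrow> AT.cf a k = AT.cf b k" if "k < m" for k
    using AT.cf_minus[OF ab, of k] AT.cf_closed ab that m by (simp add: R.minus_eq_zero_iff)
  then show ?thesis
    unfolding cl_def coset_eq_iff[OF OC.abelian_group_axioms JJ_subgroup ab] using JJ_iff[OF m] ab by auto
qed

lemma ec_cl:
  assumes "m \<le> Suc n" "k < m" "a \<in> carrier CG"
  shows "ec m k (cl m a) = AT.cf a k"
proof -
  have "\<exists>b. b \<in> carrier CG \<and> cl m a = cl m b" using assms(3) by blast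
  note b = someI_ex[OF this]
  show ?thesis
    unfolding ec_def
    using iffD1[OF cl_eq_iff[OF assms(1,3) conjunct1[OF b]] conjunct2[OF b]] assms(2) by simp
qed

abbreviation "OQ m \<equiv> omega_quot R H m"

lemma OQ_simps:
  "carrier (OQ m) = cl m ` carrier CG" "zero (OQ m) = cl m \<zero>\<^sub>CG" "add (OQ m) = set_add CG"
proof -
  have "JJ m +>\<^sub>CG \<zero>\<^sub>CG = JJ m"
    using OC.a_coset_add_zero[of "JJ m"] subgroup.subset[OF JJ_subgroup] by simp
  then show "zero (OQ m) = cl m \<zero>\<^sub>CG"
    by (simp add: omega_quot_def Let_def FactRing_def cl_def)
qed (simp_all add: omega_quot_def Let_def FactRing_def coset_carrier_eq cl_def[abs_def])

lemma OQ_smult: "r \<in> carrier R ==> a \<in> carrier CG ==> r \<odot>\<^sub>(OQ m) cl m a = cl m (cgr_const R H r \<otimes>\<^sub>CG a)"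
  using cl_mult[OF const_closed] by (simp add: omega_quot_def Let_def cl_def)

lemma OQ_add: "a \<in> carrier CG ==> b \<in> carrier CG ==> cl m a \<oplus>\<^sub>(OQ m) cl m b = cl m (a \<oplus>\<^sub>CG b)"
  by (simp add: OQ_simps cl_add)

lemma OQ_module: "module R (OQ m)"
proof -
  have ci: "cl m a \<in> cl m ` carrier CG" if "a \<in> carrier CG" for a using that by (rule imageI)
  have "abelian_group (OQ m)"
  proof (rule abelian_groupI)
    fix X assume "X \<in> carrier (OQ m)"
    then obtain a where a: "a \<in> carrier CG" "X = cl m a" by (auto simp: OQ_simps)
    have "cl m (\<ominus>\<^sub>CG a) \<oplus>\<^sub>(OQ m) X = \<zero>\<^sub>(OQ m)"
      unfolding a(2) using a(1) by (simp add: OQ_add OC.l_neg OQ_simps(2))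
    then show "\<exists>Y\<in>carrier (OQ m). Y \<oplus>\<^sub>(OQ m) X = \<zero>\<^sub>(OQ m)"
      unfolding OQ_simps(1) using ci[of "\<ominus>\<^sub>CG a"] a(1) by auto
  qed (unfold OQ_simps(1,2), ((elim imageE)?, simp add: OQ_add ci OC.a_ac)+)
  then show ?thesis
    by (rule moduleI[OF R.is_cring]; unfold OQ_simps(1); elim imageE)
      (simp_all add: OQ_add OQ_smult ci const_closed AR.io_simps OC.l_distr OC.r_distr OC.m_assoc)
qed

lemma cl_finsum:
  assumes "finite A" "f \<in> A \<rightarrow> carrier CG"
  shows "(\<Oplus>\<^sub>(OQ m)k\<in>A. cl m (f k)) = cl m (\<Oplus>\<^sub>CG k\<in>A. f k)"
  by (rule additive_finsum[OF OC.abelian_monoid_axioms module_is_abelian_monoid[OF OQ_module] assms, symmetric])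
    (auto simp: OQ_simps(1,2) OQ_add)

lemma cf_finsum:
  assumes "finite A" "f \<in> A \<rightarrow> carrier CG" "k \<le> n"
  shows "AT.cf (\<Oplus>\<^sub>CG i\<in>A. f i) k = (\<Oplus>\<^sub>R i\<in>A. AT.cf (f i) k)"
  by (rule additive_finsum[OF OC.abelian_monoid_axioms R.abelian_monoid_axioms assms(1,2), of "\<lambda>a. AT.cf a k"])
    (use assms(3) AT.cf_closed AT.cf_const[of "\<zero>\<^sub>R" k] in \<open>auto simp: AT.cf_add AR.io_simps\<close>)

lemma cf_xpow: "k \<le> n ==> AT.cf (xx [^]\<^sub>CG l) k = (if k = l then \<one>\<^sub>R else \<zero>\<^sub>R)"
  using AT.cf_x_pow[OF OC.one_closed, of k l] AT.cf_one[of "k - l"] xx_closed by auto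

text \<open>For m \<le> n + 1 two elements are congruent modulo I^m exactly if their first m
  coefficients agree, so an element and its expansion cut off at x^m define the same class.\<close>

lemma OQ_based:
  assumes m: "m \<le> Suc n"
  shows "based_module R (OQ m) m (\<lambda>k. cl m (xx [^]\<^sub>CG k)) (ec m)"
proof (intro based_module.intro based_module_axioms.intro OQ_module)
  have xc: "xx [^]\<^sub>CG k \<in> carrier CG" for k :: nat using xx_closed by simp
  fix k assume k: "k < m"
  then have kn: "k \<le> n" using m by simp
  show "cl m (xx [^]\<^sub>CG k) \<in> carrier (OQ m)" unfolding OQ_simps using xc by (rule imageI)
  {
    fix l assume "l < m"
    show "ec m k (cl m (xx [^]\<^sub>CG l)) = (if k = l then \<one>\<^sub>R else \<zero>\<^sub>R)"
      using ec_cl[OF m k xc] cf_xpow[OF kn] by simp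
  }
  fix X assume "X \<in> carrier (OQ m)"
  then obtain a where a: "a \<in> carrier CG" "X = cl m a" by (auto simp: OQ_simps)
  show "ec m k X \<in> carrier R" unfolding a(2) ec_cl[OF m k a(1)] by (rule AT.cf_closed[OF a(1)])
  {
    fix Y assume "Y \<in> carrier (OQ m)"
    then obtain b where b: "b \<in> carrier CG" "Y = cl m b" by (auto simp: OQ_simps)
    show "ec m k (X \<oplus>\<^sub>(OQ m) Y) = ec m k X \<oplus>\<^sub>R ec m k Y"
      unfolding a(2) b(2) using a(1) b(1) by (simp add: OQ_add ec_cl[OF m k] AT.cf_add[OF _ _ kn])
  }
  fix r assume r: "r \<in> carrier R"
  show "ec m k (r \<odot>\<^sub>(OQ m) X) = r \<otimes>\<^sub>R ec m k X"
    unfolding a(2) using a(1) r by (simp add: OQ_smult ec_cl[OF m k] const_closed AT.cf_smult[OF _ _ kn])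
next
  fix X assume "X \<in> carrier (OQ m)"
  then obtain a where a: "a \<in> carrier CG" "X = cl m a" by (auto simp: OQ_simps)
  have xc: "xx [^]\<^sub>CG k \<in> carrier CG" for k :: nat using xx_closed by simp
  have ac: "AT.cf a k \<in> carrier R" for k by (rule AT.cf_closed[OF a(1)])
  let ?t = "\<lambda>k. cgr_const R H (AT.cf a k) \<otimes>\<^sub>CG xx [^]\<^sub>CG k"
  have tc: "?t k \<in> carrier CG" for k using const_closed[OF ac] xc by simp
  interpret Q: module R "OQ m" by (rule OQ_module)
  have "(\<Oplus>\<^sub>(OQ m)k\<in>{..<m}. ec m k X \<odot>\<^sub>(OQ m) cl m (xx [^]\<^sub>CG k)) = (\<Oplus>\<^sub>(OQ m)k\<in>{..<m}. cl m (?t k))"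
    by (rule Q.M.finsum_cong') (use tc ac xc in \<open>auto simp: a ec_cl[OF m] OQ_smult OQ_simps(1)\<close>)
  also have "\<dots> = cl m (\<Oplus>\<^sub>CG k\<in>{..<m}. ?t k)" using tc by (intro cl_finsum) auto
  also have "\<dots> = cl m a"
  proof (subst cl_eq_iff[OF m _ a(1)])
    show "(\<Oplus>\<^sub>CG k\<in>{..<m}. ?t k) \<in> carrier CG" using tc by (intro OC.finsum_closed) auto
    show "\<forall>l<m. AT.cf (\<Oplus>\<^sub>CG k\<in>{..<m}. ?t k) l = AT.cf a l"
    proof (intro allI impI)
      fix l assume l: "l < m"
      then have ln: "l \<le> n" using m by simp
      have "AT.cf (\<Oplus>\<^sub>CG k\<in>{..<m}. ?t k) l = (\<Oplus>\<^sub>R k\<in>{..<m}. AT.cf (?t k) l)"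
        using tc ln by (intro cf_finsum) auto
      also have "\<dots> = (\<Oplus>\<^sub>R k\<in>{..<m}. if l = k then AT.cf a k else \<zero>\<^sub>R)"
        by (rule R.finsum_cong') (use ac in \<open>auto simp: AT.cf_smult[OF xc ac ln] cf_xpow[OF ln]\<close>)
      also have "\<dots> = AT.cf a l" using l ac by (intro R.finsum_singleton) auto
      finally show "AT.cf (\<Oplus>\<^sub>CG k\<in>{..<m}. ?t k) l = AT.cf a l" .
    qed
  qed
  finally show "X = (\<Oplus>\<^sub>(OQ m)k\<in>{..<m}. ec m k X \<odot>\<^sub>(OQ m) cl m (xx [^]\<^sub>CG k))" using a(2) by simp
qed

section \<open>The graded piece I^n/I^(n+1)\<close>

abbreviation "GRD \<equiv> aug_graded R H n"

lemma GRD_simps: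
  "carrier GRD = cl (Suc n) ` JJ n" "zero GRD = zero (OQ (Suc n))" "add GRD = add (OQ (Suc n))"
  "smult GRD = smult (OQ (Suc n))"
  by (simp_all add: aug_graded_def cl_def[abs_def])

lemma JJ_carrier: "a \<in> JJ m ==> a \<in> carrier CG"
  using subgroup.subset[OF JJ_subgroup] by auto

lemma GRD_module: "module R GRD"
proof -
  interpret Q: module R "OQ (Suc n)" by (rule OQ_module)
  interpret J: ideal "JJ n" CG by (rule JJ_ideal)
  have ci: "cl (Suc n) a \<in> cl (Suc n) ` JJ n" if "a \<in> JJ n" for a using that by (rule imageI)
  have "submodule (cl (Suc n) ` JJ n) R (OQ (Suc n))"
  proof (rule Q.submoduleI)
    show "cl (Suc n) ` JJ n \<subseteq> carrier (OQ (Suc n))" unfolding OQ_simps using JJ_carrier by blast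
    show "\<zero>\<^sub>(OQ (Suc n)) \<in> cl (Suc n) ` JJ n"
      unfolding OQ_simps by (rule ci) simp
  next
    fix X assume "X \<in> cl (Suc n) ` JJ n"
    then obtain a where a: "a \<in> JJ n" "X = cl (Suc n) a" by blast
    have ac: "a \<in> carrier CG" using JJ_carrier a by simp
    have "\<ominus>\<^sub>(OQ (Suc n)) X = cl (Suc n) (\<ominus>\<^sub>CG a)"
      unfolding a(2) by (rule additive_minus[OF OC.abelian_group_axioms Q.M.abelian_group_axioms _ _ ac, symmetric])
        (auto simp: OQ_simps(1) OQ_add)
    then show "\<ominus>\<^sub>(OQ (Suc n)) X \<in> cl (Suc n) ` JJ n" using ci[OF J.a_inv_closed[OF a(1)]] by simp
    {
      fix Y assume "Y \<in> cl (Suc n) ` JJ n"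
      then obtain b where b: "b \<in> JJ n" "Y = cl (Suc n) b" by blast
      then show "X \<oplus>\<^sub>(OQ (Suc n)) Y \<in> cl (Suc n) ` JJ n"
        using a ci[OF J.a_closed[OF a(1) b(1)]] JJ_carrier by (simp add: OQ_add)
    }
    fix r assume r: "r \<in> carrier R"
    show "r \<odot>\<^sub>(OQ (Suc n)) X \<in> cl (Suc n) ` JJ n"
      unfolding a(2) OQ_smult[OF r ac] by (rule ci[OF J.I_l_closed[OF a(1) const_closed[OF r]]])
  qed
  from submodule.submodule_is_module[OF this OQ_module]
  show ?thesis by (simp add: aug_graded_def cl_def[abs_def])
qed

text \<open>Elements of I^n have no coefficients below n, so modulo I^(n+1) the n-th coefficient
  alone determines them.\<close>

lemma GRD_based: "based_module R GRD 1 (\<lambda>_. cl (Suc n) (xx [^]\<^sub>CG n)) (\<lambda>_. ec (Suc n) n)"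
proof -
  interpret Q: based_module R "OQ (Suc n)" "Suc n" "\<lambda>k. cl (Suc n) (xx [^]\<^sub>CG k)" "ec (Suc n)"
    by (rule OQ_based) simp
  have xc: "xx [^]\<^sub>CG n \<in> carrier CG" using xx_closed by simp
  have sub: "X \<in> carrier (OQ (Suc n))" if "X \<in> carrier GRD" for X
    using that JJ_carrier unfolding GRD_simps OQ_simps by blast
  have mem: "cl (Suc n) (xx [^]\<^sub>CG n) \<in> carrier GRD"
  proof -
    have "xx [^]\<^sub>CG n \<otimes>\<^sub>CG \<one>\<^sub>CG \<in> JJ n" unfolding aug_pow_eq by blast
    then show ?thesis unfolding GRD_simps using xc by simp
  qed
  show ?thesis
  proof (intro based_module.intro based_module_axioms.intro GRD_module)
    fix X assume X: "X \<in> carrier GRD"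
    then obtain a where a: "a \<in> JJ n" "X = cl (Suc n) a" by (auto simp: GRD_simps)
    have ac: "a \<in> carrier CG" using JJ_carrier a by simp
    have X': "X = ec (Suc n) n X \<odot>\<^sub>(OQ (Suc n)) cl (Suc n) (xx [^]\<^sub>CG n)"
    proof -
      have e: "ec (Suc n) n X = AT.cf a n" unfolding a(2) by (rule ec_cl) (use ac in auto)
      have cfe: "\<forall>k<Suc n. AT.cf a k = AT.cf (cgr_const R H (AT.cf a n) \<otimes>\<^sub>CG xx [^]\<^sub>CG n) k"
        using a(1) AT.cf_closed[OF ac] by (auto simp: JJ_iff AT.cf_smult[OF xc] cf_xpow less_Suc_eq)
      have "cgr_const R H (AT.cf a n) \<otimes>\<^sub>CG xx [^]\<^sub>CG n \<in> carrier CG"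
        using xc const_closed[OF AT.cf_closed[OF ac]] by auto
      from iffD2[OF cl_eq_iff[OF _ ac this] cfe]
      have "cl (Suc n) a = cl (Suc n) (cgr_const R H (AT.cf a n) \<otimes>\<^sub>CG xx [^]\<^sub>CG n)" by simp
      then show ?thesis
        unfolding e OQ_smult[OF AT.cf_closed[OF ac] xc] using a(2) by (rule trans[rotated])
    qed
    interpret M: module R GRD by (rule GRD_module)
    have "(\<Oplus>\<^sub>GRD k\<in>{..<1::nat}. ec (Suc n) n X \<odot>\<^sub>GRD cl (Suc n) (xx [^]\<^sub>CG n)) = ec (Suc n) n X \<odot>\<^sub>GRD cl (Suc n) (xx [^]\<^sub>CG n)"
    proof -
      have "ec (Suc n) n X \<odot>\<^sub>GRD cl (Suc n) (xx [^]\<^sub>CG n) \<in> carrier GRD"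
        using M.smult_closed mem Q.eps_closed[of n X] sub[OF X] by simp
      moreover have "{..<1::nat} = {0}" by auto
      ultimately show ?thesis by simp
    qed
    from trans[OF X' this[unfolded GRD_simps(4), symmetric]]
    show "X = (\<Oplus>\<^sub>GRD k\<in>{..<1::nat}. ec (Suc n) n X \<odot>\<^sub>GRD cl (Suc n) (xx [^]\<^sub>CG n))"
      unfolding GRD_simps(4) .
  qed (use mem sub Q.eps_closed[of n] Q.eps_add[of n] Q.eps_smult[of n] Q.eps_e[of n n] in \<open>auto simp: GRD_simps(3,4)\<close>)
qed

lemma oact_cl: "C \<in> carrier H ==> a \<in> carrier CG ==> oact m C (cl m a) = cl m (cgr_elt R H C \<otimes>\<^sub>CG a)"
  unfolding oact_def using sig_surj[of C] elt_closed by (intro cl_mult) auto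

lemma elt_carrier: "C \<in> carrier H ==> cgr_elt R H C \<in> carrier CG"
  using sig_surj[of C] elt_closed by auto

text \<open>Multiplication by a group element has the Cauchy product as its effect on coefficients,
  which is the Toeplitz form that \<open>tensor_action\<close> asks for.\<close>

lemma oact_props:
  assumes C: "C \<in> carrier H"
  shows "X \<in> carrier (OQ m) ==> oact m C X \<in> carrier (OQ m)"
    and "X \<in> carrier (OQ m) ==> Y \<in> carrier (OQ m) ==> oact m C (X \<oplus>\<^sub>(OQ m) Y) = oact m C X \<oplus>\<^sub>(OQ m) oact m C Y"
    and "X \<in> carrier (OQ m) ==> r \<in> carrier R ==> oact m C (r \<odot>\<^sub>(OQ m) X) = r \<odot>\<^sub>(OQ m) oact m C X"
    and "X \<in> carrier (OQ m) ==> D \<in> carrier H ==> oact m (C \<otimes>\<^sub>H D) X = oact m C (oact m D X)"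
    and "X \<in> carrier (OQ m) ==> m \<le> Suc n ==> k < m ==>
      ec m k (oact m C X) = (\<Oplus>\<^sub>R l\<in>{..k}. AT.cf (cgr_elt R H C) (k - l) \<otimes>\<^sub>R ec m l X)"
    and "X \<in> carrier GRD ==> oact (Suc n) C X \<in> carrier GRD"
proof -
  note ecl = elt_carrier[OF C]
  have ci: "cl m a \<in> cl m ` carrier CG" if "a \<in> carrier CG" for a using that by (rule imageI)
  show "oact m C X \<in> carrier (OQ m)" if "X \<in> carrier (OQ m)"
    using that unfolding OQ_simps(1) by (elim imageE) (simp add: oact_cl[OF C] ecl ci)
  show "oact m C (X \<oplus>\<^sub>(OQ m) Y) = oact m C X \<oplus>\<^sub>(OQ m) oact m C Y" if "X \<in> carrier (OQ m)" "Y \<in> carrier (OQ m)"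
    using that unfolding OQ_simps(1) by (elim imageE) (simp add: oact_cl[OF C] OQ_add ecl OC.r_distr)
  show "oact m C (r \<odot>\<^sub>(OQ m) X) = r \<odot>\<^sub>(OQ m) oact m C X" if "X \<in> carrier (OQ m)" "r \<in> carrier R"
    using that unfolding OQ_simps(1) by (elim imageE) (simp add: oact_cl[OF C] OQ_smult const_closed ecl OC.m_lcomm)
  show "oact m (C \<otimes>\<^sub>H D) X = oact m C (oact m D X)" if "X \<in> carrier (OQ m)" and D: "D \<in> carrier H"
  proof -
    have "cgr_elt R H (C \<otimes>\<^sub>H D) = cgr_elt R H C \<otimes>\<^sub>CG cgr_elt R H D"
      using C D by (simp add: elt_eq single_mult)
    then show ?thesis
      using that C D unfolding OQ_simps(1)
      by (elim imageE) (simp add: oact_cl elt_carrier OC.m_assoc)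
  qed
  show "ec m k (oact m C X) = (\<Oplus>\<^sub>R l\<in>{..k}. AT.cf (cgr_elt R H C) (k - l) \<otimes>\<^sub>R ec m l X)"
    if X: "X \<in> carrier (OQ m)" and m: "m \<le> Suc n" and k: "k < m"
  proof -
    obtain a where a: "a \<in> carrier CG" "X = cl m a" using X by (auto simp: OQ_simps)
    have "ec m k (oact m C X) = AT.cf (cgr_elt R H C \<otimes>\<^sub>CG a) k"
      unfolding a(2) oact_cl[OF C a(1)] by (rule ec_cl[OF m k]) (use ecl a in simp)
    also have "\<dots> = (\<Oplus>\<^sub>R l\<in>{..k}. AT.cf (cgr_elt R H C) (k - l) \<otimes>\<^sub>R AT.cf a l)"
      using k m by (intro AT.cf_mult[OF ecl a(1)]) simp
    also have "\<dots> = (\<Oplus>\<^sub>R l\<in>{..k}. AT.cf (cgr_elt R H C) (k - l) \<otimes>\<^sub>R ec m l X)"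
      by (rule R.finsum_cong') (use k m a AT.cf_closed ecl in \<open>auto simp: ec_cl[OF m]\<close>)
    finally show ?thesis .
  qed
  show "oact (Suc n) C X \<in> carrier GRD" if "X \<in> carrier GRD"
  proof -
    obtain a where a: "a \<in> JJ n" "X = cl (Suc n) a" using \<open>X \<in> carrier GRD\<close> by (auto simp: GRD_simps)
    have "cgr_elt R H C \<otimes>\<^sub>CG a \<in> JJ n" by (rule ideal.I_l_closed[OF JJ_ideal a(1) ecl])
    then show ?thesis
      unfolding a(2) oact_cl[OF C JJ_carrier[OF a(1)]] GRD_simps by (rule imageI)
  qed
qed

lemma GRD_sub: "carrier GRD \<subseteq> carrier (OQ (Suc n))"
  unfolding GRD_simps OQ_simps using JJ_carrier by blast

text \<open>I^(n+1) is contained in I^n and contains zero, so adding I^n to a coset of I^(n+1)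
  enlarges it to the coset of I^n.\<close>

lemma reduce_cl:
  assumes a: "a \<in> carrier CG"
  shows "JJ n <+>\<^sub>CG cl (Suc n) a = cl n a"
proof -
  interpret J: ideal "JJ n" CG by (rule JJ_ideal)
  have sub: "JJ (Suc n) \<subseteq> JJ n"
    by (auto simp: JJ_iff simp del: ideal_pow.simps)
  have z: "\<zero>\<^sub>CG \<in> JJ (Suc n)" using subgroup.one_closed[OF JJ_subgroup[of "Suc n"]] by (simp del: ideal_pow.simps)
  show ?thesis
  proof (intro equalityI subsetI)
    fix y assume "y \<in> JJ n <+>\<^sub>CG cl (Suc n) a"
    then obtain i j where ij: "i \<in> JJ n" "j \<in> JJ (Suc n)" "y = i \<oplus>\<^sub>CG (j \<oplus>\<^sub>CG a)"
      unfolding set_add_def' cl_def a_r_coset_def' by blast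
    then have "y = (i \<oplus>\<^sub>CG j) \<oplus>\<^sub>CG a" using a JJ_carrier[of i n] JJ_carrier[of j "Suc n"] by (simp add: OC.a_assoc del: ideal_pow.simps)
    moreover have "i \<oplus>\<^sub>CG j \<in> JJ n" using ij sub J.a_closed by blast
    ultimately show "y \<in> cl n a" unfolding cl_def a_r_coset_def' by blast
  next
    fix y assume "y \<in> cl n a"
    then obtain i where i: "i \<in> JJ n" "y = i \<oplus>\<^sub>CG a" unfolding cl_def a_r_coset_def' by blast
    then have "y = i \<oplus>\<^sub>CG (\<zero>\<^sub>CG \<oplus>\<^sub>CG a)" using a by simp
    then show "y \<in> JJ n <+>\<^sub>CG cl (Suc n) a"
      unfolding set_add_def' cl_def a_r_coset_def' using i z by blast
  qed
qed

lemma reduce_props: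
  "X \<in> carrier (OQ (Suc n)) ==> JJ n <+>\<^sub>CG X \<in> carrier (OQ n)"
  "X \<in> carrier (OQ (Suc n)) ==> Y \<in> carrier (OQ (Suc n)) ==>
    JJ n <+>\<^sub>CG (X \<oplus>\<^sub>(OQ (Suc n)) Y) = (JJ n <+>\<^sub>CG X) \<oplus>\<^sub>(OQ n) (JJ n <+>\<^sub>CG Y)"
  "X \<in> carrier (OQ (Suc n)) ==> r \<in> carrier R ==>
    JJ n <+>\<^sub>CG (r \<odot>\<^sub>(OQ (Suc n)) X) = r \<odot>\<^sub>(OQ n) (JJ n <+>\<^sub>CG X)"
  "X \<in> carrier (OQ (Suc n)) ==> k < n ==> ec n k (JJ n <+>\<^sub>CG X) = ec (Suc n) k X"
proof -
  have ci: "cl m a \<in> cl m ` carrier CG" if "a \<in> carrier CG" for a m using that by (rule imageI)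
  show "JJ n <+>\<^sub>CG X \<in> carrier (OQ n)" if "X \<in> carrier (OQ (Suc n))"
    using that unfolding OQ_simps(1) by (elim imageE) (simp add: reduce_cl ci)
  show "JJ n <+>\<^sub>CG (X \<oplus>\<^sub>(OQ (Suc n)) Y) = (JJ n <+>\<^sub>CG X) \<oplus>\<^sub>(OQ n) (JJ n <+>\<^sub>CG Y)"
    if "X \<in> carrier (OQ (Suc n))" "Y \<in> carrier (OQ (Suc n))"
    using that unfolding OQ_simps(1) by (elim imageE) (simp add: reduce_cl OQ_add)
  show "JJ n <+>\<^sub>CG (r \<odot>\<^sub>(OQ (Suc n)) X) = r \<odot>\<^sub>(OQ n) (JJ n <+>\<^sub>CG X)"
    if "X \<in> carrier (OQ (Suc n))" "r \<in> carrier R"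
    using that unfolding OQ_simps(1) by (elim imageE) (simp add: reduce_cl OQ_smult const_closed)
  show "ec n k (JJ n <+>\<^sub>CG X) = ec (Suc n) k X" if "X \<in> carrier (OQ (Suc n))" "k < n"
    using that unfolding OQ_simps(1) by (elim imageE) (simp add: reduce_cl ec_cl)
qed

end

section \<open>The coimage of a character\<close>

lemma Zp_topspace: "topspace (ring_top (Zp p)) = carrier (Zp p)"
  by (simp add: Zp_def)

lemma Zp_comp_continuous: "continuous_map (ring_top (Zp p)) (discrete_topology UNIV) (\<lambda>z. F (z j))"
proof -
  have "continuous_map (ring_top (Zp p)) (discrete_topology UNIV) (\<lambda>z. z j)"
    unfolding Zp_def using continuous_map_product_projection[of j UNIV "\<lambda>_. discrete_topology UNIV"]
    by (auto intro: continuous_map_from_subtopology)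
  moreover have "continuous_map (discrete_topology UNIV) (discrete_topology UNIV) F" by simp
  ultimately show ?thesis using continuous_map_compose[of _ _ "\<lambda>z. z j" _ F] by (simp add: o_def)
qed

lemma Zp_comp_open: "openin (ring_top (Zp p)) {z \<in> carrier (Zp p). z j \<in> V}"
  using openin_continuous_map_preimage[OF Zp_comp_continuous[where F="\<lambda>i. i"], of V p j]
  by (simp add: Zp_topspace)

text \<open>Each component of the binomial is a function of a single component of z, with
  \<open>vfact k\<close> more digits.\<close>

lemma (in p_adic) Zp_binom_continuous: "continuous_map (ring_top (Zp p)) (ring_top (Zp p)) (\<lambda>z. Zp_binom p z k)"
proof -
  have "continuous_map (ring_top (Zp p)) (discrete_topology UNIV) (\<lambda>z. Zp_binom p z k m)" for m
    by (rule continuous_map_eq[OF Zp_comp_continuous[where j="m + vfact k"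
        and F="\<lambda>i. int (nat i choose k) mod int p ^ m"]])
      (simp add: Zp_topspace Zp_binom_comp[OF _ le_refl])
  then have "continuous_map (ring_top (Zp p)) (product_topology (\<lambda>_. discrete_topology UNIV) UNIV) (\<lambda>z. Zp_binom p z k)"
    by (simp add: continuous_map_componentwise_UNIV)
  moreover have "(\<lambda>z. Zp_binom p z k) \<in> topspace (ring_top (Zp p)) \<rightarrow> Zp_carrier p"
    using Zp_binom_closed[of _ k] by (auto simp: Zp_topspace Zp_simps(1))
  ultimately have "continuous_map (ring_top (Zp p))
      (subtopology (product_topology (\<lambda>_. discrete_topology UNIV) UNIV) (Zp_carrier p)) (\<lambda>z. Zp_binom p z k)"
    unfolding continuous_map_in_subtopology by blast
  then show ?thesis by (simp add: Zp_def)
qed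

lemma (in p_adic) Zp_int_p_power_nonzero: "Zp_int p (int p ^ a) \<noteq> \<zero>\<^sub>(Zp p)"
proof
  assume "Zp_int p (int p ^ a) = \<zero>\<^sub>(Zp p)"
  then have "Zp_int p (int p ^ a) (Suc a) = 0" by (simp add: Zp_simps)
  then have "int p ^ a mod int p ^ Suc a = 0" by (simp add: Zp_int_def)
  moreover have "int p ^ a mod int p ^ Suc a = int p ^ a"
    using p_gt_1 by (intro mod_pos_pos_trivial) (auto intro: power_strict_increasing)
  ultimately show False using p_gt_1 by simp
qed

text \<open>From k binom(p^a, k) = p^a binom(p^a - 1, k - 1) the binomial is divisible by p^(a - v),
  v the valuation of k. Since p^v \<le> k \<le> n, the size bound gives p^(v + r) < p^(a + 1), that
  is v + r \<le> a.\<close>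

lemma (in p_adic) prime_power_dvd_binomial:
  assumes k: "1 \<le> k" "k \<le> n" and size: "n * p ^ r < p * p ^ a"
  shows "p ^ r dvd (p ^ a choose k)"
proof -
  define v where "v = multiplicity p k"
  obtain u where u: "k = p ^ v * u" "\<not> p dvd u"
    using multiplicity_decompose'[of k p] k prime_p p_gt_1 unfolding v_def
    by (metis less_irrefl not_one_le_zero nat_dvd_1_iff_1)
  have "p ^ v \<le> k" using u k by (cases u) auto
  then have "p ^ v * p ^ r \<le> n * p ^ r" using k by (intro mult_right_mono) auto
  from le_less_trans[OF this size] have "p ^ (v + r) < p ^ Suc a" by (simp only: power_add power_Suc)
  from power_less_imp_less_exp[OF p_gt_1 this] have vr: "v + r \<le> a" by simp
  have "k * (p ^ a choose k) = p ^ a * (p ^ a - 1 choose (k - 1))"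
    using times_binomial_minus1_eq[of k "p ^ a"] k by simp
  moreover have "p ^ a = p ^ v * p ^ (a - v)" using vr by (simp flip: power_add)
  ultimately have "p ^ v * (u * (p ^ a choose k)) = p ^ v * (p ^ (a - v) * (p ^ a - 1 choose (k - 1)))"
    using u(1) by (metis mult.assoc)
  then have "u * (p ^ a choose k) = p ^ (a - v) * (p ^ a - 1 choose (k - 1))"
    using p_gt_1 by simp
  then have "p ^ (a - v) dvd u * (p ^ a choose k)" by simp
  moreover have "coprime (p ^ (a - v)) u"
    using u(2) prime_p by (simp add: prime_imp_coprime)
  ultimately have "p ^ (a - v) dvd (p ^ a choose k)" by (simp add: coprime_dvd_mult_right_iff)
  moreover have "p ^ r dvd p ^ (a - v)" using vr by (intro le_imp_power_dvd) simp
  ultimately show ?thesis by (rule dvd_trans[rotated])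
qed

lemma (in Zp_quotient) q_eq_iff:
  assumes "z \<in> carrier (Zp p)" "w \<in> carrier (Zp p)"
  shows "q z = q w \<longleftrightarrow> q (z \<ominus>\<^sub>(Zp p) w) = \<zero>\<^sub>R"
proof -
  have "z = (z \<ominus>\<^sub>(Zp p) w) \<oplus>\<^sub>(Zp p) w" using assms by (simp add: a_minus_def Z.a_assoc Z.l_neg)
  then have "q z = q (z \<ominus>\<^sub>(Zp p) w) \<oplus>\<^sub>R q w" using q_simps(2)[of "z \<ominus>\<^sub>(Zp p) w" w] assms by simp
  then show ?thesis using assms by (simp add: q_simps R.add.l_cancel_one)
qed

text \<open>The integers from 0 to p^a - 1 represent the quotient. This converts the bound on
  cardinalities into one on exponents of p.\<close>

lemma (in Zp_quotient) card_carrier: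
  assumes ker: "\<forall>z\<in>carrier (Zp p). q z = \<zero>\<^sub>R \<longleftrightarrow> z a = 0"
  shows "card (carrier R) = p ^ a"
proof -
  have eq: "q z = q w \<longleftrightarrow> z a = w a" if "z \<in> carrier (Zp p)" "w \<in> carrier (Zp p)" for z w
  proof -
    have "(z a - w a) mod int p ^ a = 0 \<longleftrightarrow> z a mod int p ^ a = w a mod int p ^ a"
      by (simp add: mod_eq_dvd_iff mod_eq_0_iff_dvd)
    then show ?thesis
      using that ker by (simp add: q_eq_iff Zp_minus ZpD(1))
  qed
  have "bij_betw (\<lambda>i. q (Zp_int p i)) {0..<int p ^ a} (carrier R)"
    unfolding bij_betw_def
  proof (intro conjI equalityI subsetI)
    show "inj_on (\<lambda>i. q (Zp_int p i)) {0..<int p ^ a}"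
      by (rule inj_onI) (simp add: eq Zp_int_closed, simp add: Zp_int_def)
    fix r assume "r \<in> carrier R"
    then obtain z where z: "z \<in> carrier (Zp p)" "q z = r" by (rule q_surjE)
    have "q (Zp_int p (z a)) = r" using z eq[OF Zp_int_closed z(1)] by (simp add: Zp_int_def ZpD(1))
    then show "r \<in> (\<lambda>i. q (Zp_int p i)) ` {0..<int p ^ a}" using ZpD(3,4)[OF z(1), of a] by force
  qed (auto simp: q_simps Zp_int_closed)
  from bij_betw_same_card[OF this] show ?thesis by (simp flip: of_nat_power)
qed

locale Zp_character = p_adic p
  for p :: nat +
  fixes n :: nat and G :: "('g, 'x) topgroup_scheme" and A :: "('a, 'y) topring_scheme"
    and R :: "('r, 'z) topring_scheme" and q :: "(nat => int) => 'a" and \<pi> :: "'a => 'r" and chi :: "'g => 'a"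
  assumes G: "profinite_group G" and A: "topring_quotient (Zp p) A q" and R: "topring_quotient A R \<pi>"
    and size: "q \<in> ring_iso (Zp p) A \<or> finite (carrier A) \<and> n * card (carrier R) < p * card (carrier A)"
    and chi_hom: "chi \<in> hom G (add_monoid A)" and chi_surj: "chi ` carrier G = carrier A"
    and chi_cont: "continuous_map (grp_top G) (ring_top A) chi"
begin

abbreviation "K \<equiv> kernel G (add_monoid A) chi"
abbreviation "H \<equiv> quot_topgroup G K"

text \<open>The coset of K on which chi takes the value q z: the composite of q with the inverse of
  the isomorphism from H to A.\<close>

definition sig :: "(nat => int) => 'g set" where "sig z = {g \<in> carrier G. chi g = q z}"

sublocale QA: Zp_quotient p A q
  using A quotient_imp_surjective_map[of "ring_top (Zp p)" "ring_top A" q]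
  by (intro Zp_quotient.intro Zp_quotient_axioms.intro p_adic_axioms) (auto simp: topring_quotient_def Zp_topspace)

lemma pi_props: "cring R" "\<pi> \<in> ring_hom A R" "\<pi> ` carrier A = carrier R" "topspace (ring_top R) = carrier R"
  "continuous_map (ring_top A) (ring_top R) \<pi>"
  using R A quotient_imp_surjective_map[of "ring_top A" "ring_top R" \<pi>]
    quotient_imp_continuous_map[of "ring_top A" "ring_top R" \<pi>]
  by (auto simp: topring_quotient_def)

sublocale QR: Zp_quotient p R "\<pi> \<circ> q"
proof (intro Zp_quotient.intro Zp_quotient_axioms.intro p_adic_axioms pi_props(1))
  show "\<pi> \<circ> q \<in> ring_hom (Zp p) R" by (rule ring_hom_trans[OF QA.q_hom pi_props(2)])
  show "(\<pi> \<circ> q) ` carrier (Zp p) = carrier R" using QA.q_surj pi_props(3) by (metis image_comp)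
qed

sublocale GH: group_hom G "add_monoid A" chi
  using profinite_groupD(1)[OF G] chi_hom QA.R.add.group_axioms
  by (simp add: group_hom_def group_hom_axioms_def)

lemma chi_simps:
  "g \<in> carrier G ==> chi g \<in> carrier A"
  "g \<in> carrier G ==> g' \<in> carrier G ==> chi (g \<otimes>\<^sub>G g') = chi g \<oplus>\<^sub>A chi g'"
  using GH.hom_closed[of g] GH.hom_mult[of g g'] by auto

lemma chi_lift:
  assumes "z \<in> carrier (Zp p)"
  obtains g where "g \<in> carrier G" "chi g = q z"
proof -
  have "q z \<in> chi ` carrier G" unfolding chi_surj by (rule QA.q_simps(1)[OF assms])
  then show ?thesis using that by auto
qed

lemma coset_eq:
  assumes g: "g \<in> carrier G"
  shows "K #>\<^sub>G g = {g' \<in> carrier G. chi g' = chi g}"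
proof (intro equalityI subsetI)
  fix y assume "y \<in> K #>\<^sub>G g"
  then obtain k where "k \<in> K" "y = k \<otimes>\<^sub>G g" by (auto simp: r_coset_def)
  then show "y \<in> {g' \<in> carrier G. chi g' = chi g}" using g by (simp add: kernel_def chi_simps)
next
  fix y assume y: "y \<in> {g' \<in> carrier G. chi g' = chi g}"
  then have "K #>\<^sub>G y = K #>\<^sub>G g"
    using g GH.hom_mult[of y "inv\<^bsub>G\<^esub> g"] GH.hom_mult[of g "inv\<^bsub>G\<^esub> g"] GH.hom_one
    by (subst GH.G.rcos_eq_iff[OF GH.subgroup_kernel]) (auto simp: kernel_def)
  then show "y \<in> K #>\<^sub>G g" using GH.G.rcos_self[OF _ GH.subgroup_kernel, of y] y by simp
qed

lemma coset_sig: "g \<in> carrier G ==> chi g = q z ==> K #>\<^sub>G g = sig z"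
  by (simp add: coset_eq sig_def)

lemma H_simps: "carrier H = carrier (G Mod K)" "mult H = mult (G Mod K)" "one H = K"
  by (simp_all add: quot_topgroup_def)

lemma H_carrier: "carrier H = (\<lambda>g. K #>\<^sub>G g) ` carrier G"
  by (auto simp: H_simps FactGroup_def RCOSETS_def)

lemma H_mult: "g \<in> carrier G ==> g' \<in> carrier G ==>
    (K #>\<^sub>G g) \<otimes>\<^sub>H (K #>\<^sub>G g') = K #>\<^sub>G (g \<otimes>\<^sub>G g')"
  unfolding H_simps mult_FactGroup by (rule normal.rcos_sum[OF GH.normal_kernel])

lemma sig_closed: "z \<in> carrier (Zp p) ==> sig z \<in> carrier H"
  by (rule chi_lift[of z]) (auto simp: H_carrier coset_sig[symmetric])

lemma sig_surj: "C \<in> carrier H ==> \<exists>z\<in>carrier (Zp p). sig z = C"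
proof -
  assume "C \<in> carrier H"
  then obtain g where g: "g \<in> carrier G" "C = K #>\<^sub>G g" by (auto simp: H_carrier)
  obtain z where "z \<in> carrier (Zp p)" "q z = chi g" by (rule QA.q_surjE[OF chi_simps(1)[OF g(1)]])
  then show ?thesis using coset_sig[of g z] g by auto
qed

lemma sig_add:
  assumes "z \<in> carrier (Zp p)" "w \<in> carrier (Zp p)"
  shows "sig (z \<oplus>\<^sub>(Zp p) w) = sig z \<otimes>\<^sub>H sig w"
proof -
  obtain g where g: "g \<in> carrier G" "chi g = q z" by (rule chi_lift[OF assms(1)])
  obtain g' where g': "g' \<in> carrier G" "chi g' = q w" by (rule chi_lift[OF assms(2)])
  have "K #>\<^sub>G (g \<otimes>\<^sub>G g') = sig (z \<oplus>\<^sub>(Zp p) w)"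
    using g g' assms by (intro coset_sig) (simp_all add: chi_simps QA.q_simps)
  then show ?thesis using H_mult[OF g(1) g'(1)] by (simp add: coset_sig g g')
qed

lemma H_group: "group H"
proof -
  have "group (G Mod K)" by (rule normal.factorgroup_is_group[OF GH.normal_kernel])
  then show ?thesis
    unfolding group_def group_axioms_def monoid_def Units_def by (simp add: H_simps)
qed

lemma H_comm_group: "comm_group H"
proof (rule group.group_comm_groupI[OF H_group])
  fix C D assume "C \<in> carrier H" "D \<in> carrier H"
  then obtain z w where "z \<in> carrier (Zp p)" "C = sig z" "w \<in> carrier (Zp p)" "D = sig w"
    using sig_surj by metis
  then show "C \<otimes>\<^sub>H D = D \<otimes>\<^sub>H C" using sig_add[of z w] sig_add[of w z] by (simp add: Z.a_comm)
qed

sublocale HC: comm_group H by (rule H_comm_group)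

lemma sig_one_iff:
  assumes z: "z \<in> carrier (Zp p)"
  shows "sig z = \<one>\<^sub>H \<longleftrightarrow> q z = \<zero>\<^sub>A"
proof -
  obtain g where g: "g \<in> carrier G" "chi g = q z" by (rule chi_lift[OF z])
  show ?thesis
  proof
    assume "sig z = \<one>\<^sub>H"
    moreover have "g \<in> sig z" using g by (simp add: sig_def)
    ultimately have "g \<in> K" unfolding H_simps(3) by blast
    then show "q z = \<zero>\<^sub>A" using g by (simp add: kernel_def)
  next
    assume "q z = \<zero>\<^sub>A"
    then show "sig z = \<one>\<^sub>H" unfolding H_simps(3) by (simp add: sig_def kernel_def)
  qed
qed

lemma openin_H: "openin (grp_top H) U \<longleftrightarrow> U \<subseteq> carrier H \<and> openin (grp_top G) {g \<in> carrier G. K #>\<^sub>G g \<in> U}"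
  using profinite_groupD(2)[OF G] by (simp add: quot_topgroup_def openin_quot_topology H_carrier[unfolded H_simps(1)])

text \<open>Compactness of G is applied directly to the composite of G, H and H/N: its fibres are
  open in G, so it has finitely many values.\<close>

lemma H_cgr_base: "cgr_base H R"
proof (intro cgr_base.intro cgr_base_axioms.intro H_group pi_props(1))
  fix N assume "N \<in> open_normals H"
  then have N: "subgroup N H" "openin (grp_top G) {g \<in> carrier G. K #>\<^sub>G g \<in> N}"
    by (auto simp: open_normals_def normal_imp_subgroup openin_H)
  have "finite ((\<lambda>g. N #>\<^sub>H (K #>\<^sub>G g)) ` topspace (grp_top G))"
  proof (rule compact_open_fibres_finite[OF profinite_groupD(3)[OF G]])
    fix x assume "x \<in> topspace (grp_top G)"
    then have x: "x \<in> carrier G" using profinite_groupD(2)[OF G] by simp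
    have inv: "inv\<^bsub>H\<^esub> (K #>\<^sub>G x) = K #>\<^sub>G inv\<^bsub>G\<^esub> x"
    proof (rule HC.inv_equality)
      show "(K #>\<^sub>G inv\<^bsub>G\<^esub> x) \<otimes>\<^sub>H (K #>\<^sub>G x) = \<one>\<^sub>H"
        using x GH.G.coset_mult_one[OF subgroup.subset[OF GH.subgroup_kernel]] by (simp add: H_mult H_simps(3))
    qed (use x in \<open>simp_all add: H_carrier\<close>)
    have iff: "N #>\<^sub>H (K #>\<^sub>G y) = N #>\<^sub>H (K #>\<^sub>G x) \<longleftrightarrow> K #>\<^sub>G (y \<otimes>\<^sub>G inv\<^bsub>G\<^esub> x) \<in> N"
      if y: "y \<in> carrier G" for y
      using HC.rcos_eq_iff[OF N(1), of "K #>\<^sub>G y" "K #>\<^sub>G x"] x y by (simp add: H_carrier inv H_mult)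
    have "openin (grp_top G) {y \<in> topspace (grp_top G). y \<otimes>\<^sub>G inv\<^bsub>G\<^esub> x \<in> {g \<in> carrier G. K #>\<^sub>G g \<in> N}}"
      using x by (intro openin_continuous_map_preimage[OF profinite_translation[OF G] N(2)]) simp
    also have "{y \<in> topspace (grp_top G). y \<otimes>\<^sub>G inv\<^bsub>G\<^esub> x \<in> {g \<in> carrier G. K #>\<^sub>G g \<in> N}} =
        {y \<in> topspace (grp_top G). N #>\<^sub>H (K #>\<^sub>G y) = N #>\<^sub>H (K #>\<^sub>G x)}"
      using iff x unfolding profinite_groupD(2)[OF G] by auto
    finally show "openin (grp_top G) {y \<in> topspace (grp_top G). N #>\<^sub>H (K #>\<^sub>G y) = N #>\<^sub>H (K #>\<^sub>G x)}" .
  qed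
  moreover have "carrier (H Mod N) = (\<lambda>g. N #>\<^sub>H (K #>\<^sub>G g)) ` topspace (grp_top G)"
    unfolding FactGroup_def RCOSETS_def H_carrier profinite_groupD(2)[OF G] by auto
  ultimately show "finite (carrier (H Mod N))" by simp
next
  have "{g \<in> carrier G. K #>\<^sub>G g \<in> carrier H} = topspace (grp_top G)"
    unfolding H_carrier profinite_groupD(2)[OF G] by auto
  then have "openin (grp_top H) (carrier H)" unfolding openin_H by simp
  then show "carrier H \<in> open_normals H"
    unfolding open_normals_def using HC.normal_iff_subgroup HC.subgroup_self by simp
qed

lemma sig_hom: "group_hom (add_monoid (Zp p)) H sig"
  unfolding group_hom_def group_hom_axioms_def hom_def
  using Z.add.group_axioms H_group sig_closed sig_add by auto

text \<open>An open normal subgroup has finite index m, so its preimage in Z_p contains m Z_p and is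
  some p^i Z_p. Conversely q maps p^j Z_p onto an open subset of A, whose preimage under the
  continuous chi is open.\<close>

lemma ON_eq: "open_normals H = range (\<lambda>j. sig ` Zp_ker p j)"
proof (intro equalityI subsetI)
  fix N assume N: "N \<in> open_normals H"
  then have nN: "normal N H" by (simp add: open_normals_def)
  have fin: "finite (carrier (H Mod N))" by (rule cgr_base.finQ[OF H_cgr_base N])
  interpret F: group "H Mod N" by (rule normal.factorgroup_is_group[OF nN])
  interpret S: group_hom "add_monoid (Zp p)" H sig by (rule sig_hom)
  interpret C: group_hom H "H Mod N" "\<lambda>C. N #>\<^sub>H C"
    using normal.r_coset_hom_Mod[OF nN] by unfold_locales
  define B where "B = {z \<in> carrier (Zp p). sig z \<in> N}"
  have sub: "subgroup N H" by (rule normal_imp_subgroup[OF nN])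
  have m: "0 < order (H Mod N)" using F.order_gt_0_iff_finite fin by simp
  have "Zp_int p (int (order (H Mod N))) \<otimes>\<^sub>(Zp p) z \<in> B" if z: "z \<in> carrier (Zp p)" for z
  proof -
    have s: "sig ([order (H Mod N)] \<cdot>\<^sub>(Zp p) z) = sig z [^]\<^sub>H order (H Mod N)"
      using S.hom_nat_pow[of z "order (H Mod N)"] z by (simp add: add_pow_def)
    have "N #>\<^sub>H (sig z [^]\<^sub>H order (H Mod N)) = (N #>\<^sub>H sig z) [^]\<^sub>(H Mod N) order (H Mod N)"
      using C.hom_nat_pow[OF sig_closed[OF z]] by simp
    also have "\<dots> = N" using F.pow_order_eq_1[OF C.hom_closed[OF sig_closed[OF z]]] by simp
    finally have "sig z [^]\<^sub>H order (H Mod N) \<in> N"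
      using HC.rcos_self[OF HC.nat_pow_closed[OF sig_closed[OF z]] sub] by blast
    then show ?thesis using s z by (simp add: B_def Zp_add_pow Zp_int_closed)
  qed
  then obtain j where "Zp_ker p j \<subseteq> B" using Zp_finite_index[OF m] by blast
  then obtain i where "B = Zp_ker p i"
    using Zp_subgroup_eq_ker[of B j] subgroup.m_closed[OF sub] by (auto simp: B_def sig_add)
  moreover have "N = sig ` B" using sig_surj subgroup.subset[OF sub] unfolding B_def by blast
  ultimately show "N \<in> range (\<lambda>j. sig ` Zp_ker p j)" by blast
next
  fix N assume "N \<in> range (\<lambda>j. sig ` Zp_ker p j)"
  then obtain j where j: "N = sig ` Zp_ker p j" by blast
  have "subgroup (Zp_ker p j) (add_monoid (Zp p))"
  proof (rule Z.add.subgroupI)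
    show "Zp_ker p j \<noteq> {}" using Z.zero_closed by (force simp: Zp_ker_def Zp_simps)
  qed (auto simp: Zp_ker_def Zp_simps(2) Zp_neg a_inv_def[symmetric])
  then have "subgroup N H" unfolding j by (rule group_hom.subgroup_img_is_subgroup[OF sig_hom])
  then have nN: "normal N H" using HC.normal_iff_subgroup by simp
  have iff: "K #>\<^sub>G g \<in> N \<longleftrightarrow> chi g \<in> q ` Zp_ker p j" if g: "g \<in> carrier G" for g
  proof
    assume "K #>\<^sub>G g \<in> N"
    then obtain z where z: "z \<in> Zp_ker p j" "K #>\<^sub>G g = sig z" using j by blast
    have "g \<in> sig z" using GH.G.rcos_self[OF g GH.subgroup_kernel] z(2) by simp
    then show "chi g \<in> q ` Zp_ker p j" using z(1) by (auto simp: sig_def)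
  qed (use coset_sig[OF g] j in blast)
  have "openin (ring_top A) (q ` Zp_ker p j)"
  proof -
    define Y where "Y = {z \<in> carrier (Zp p). q z \<in> q ` Zp_ker p j}"
    \<comment> \<open>\<open>Y\<close>, the full preimage of q(p^j Z_p), depends only on the j-th
      component, so it is open in Z_p. As q is a quotient map, its image is open in A.\<close>
    have "Y = {z \<in> carrier (Zp p). z j \<in> (\<lambda>z. z j) ` Y}"
    proof (intro equalityI subsetI)
      fix z assume "z \<in> {z \<in> carrier (Zp p). z j \<in> (\<lambda>z. z j) ` Y}"
      then obtain y where y: "z \<in> carrier (Zp p)" "y \<in> Y" "z j = y j" by blast
      then obtain w where w: "y \<in> carrier (Zp p)" "w \<in> Zp_ker p j" "q y = q w" by (auto simp: Y_def)
      have wc: "w \<in> carrier (Zp p)" using w by (simp add: Zp_ker_def)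
      have "z \<ominus>\<^sub>(Zp p) y \<oplus>\<^sub>(Zp p) w \<in> Zp_ker p j"
        using y w wc by (simp add: Zp_ker_def Zp_minus Zp_simps(2))
      moreover have "q (z \<ominus>\<^sub>(Zp p) y \<oplus>\<^sub>(Zp p) w) = q z"
      proof -
        have "q z = q (z \<ominus>\<^sub>(Zp p) y \<oplus>\<^sub>(Zp p) y)" using y w by (simp add: a_minus_def Z.a_assoc Z.l_neg)
        then show ?thesis using y w wc by (simp add: QA.q_simps)
      qed
      ultimately show "z \<in> Y" using y(1) unfolding Y_def by (metis (mono_tags, lifting) image_eqI mem_Collect_eq)
    qed (auto simp: Y_def)
    then have "openin (ring_top (Zp p)) Y" using Zp_comp_open[of p j "(\<lambda>z. z j) ` Y"] by simp
    moreover have "q ` Zp_ker p j \<subseteq> carrier A" using QA.q_simps(1) by (auto simp: Zp_ker_def)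
    ultimately show ?thesis
      using A unfolding topring_quotient_def quotient_map_def Y_def by (simp add: Zp_topspace)
  qed
  from openin_continuous_map_preimage[OF chi_cont this]
  have "openin (grp_top G) {g \<in> carrier G. chi g \<in> q ` Zp_ker p j}"
    unfolding profinite_groupD(2)[OF G] .
  then have "openin (grp_top G) {g \<in> carrier G. K #>\<^sub>G g \<in> N}"
    using iff by (metis (mono_tags, lifting) Collect_cong)
  then show "N \<in> open_normals H"
    unfolding open_normals_def openin_H using nN subgroup.subset[OF normal_imp_subgroup[OF nN]] by simp
qed

text \<open>The premise says that A has order p^a. Then q is not injective, so the bound on n is in
  force, and R = Z/p^r with p^r dividing the binomial by
  \<open>prime_power_dvd_binomial\<close>.\<close>

lemma binomial_vanish:
  assumes ker: "\<forall>z\<in>carrier (Zp p). sig z = \<one>\<^sub>H \<longleftrightarrow> z a = 0" and k: "1 \<le> k" "k \<le> n"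
  shows "QR.nu (int (p ^ a choose k)) = \<zero>\<^sub>R"
proof -
  have ker: "\<forall>z\<in>carrier (Zp p). q z = \<zero>\<^sub>A \<longleftrightarrow> z a = 0" using ker by (simp add: sig_one_iff)
  have pa: "q (Zp_int p (int p ^ a)) = \<zero>\<^sub>A" using ker Zp_int_closed by (simp add: Zp_int_def)
  have "q \<notin> ring_iso (Zp p) A"
  proof
    assume "q \<in> ring_iso (Zp p) A"
    then have "inj_on q (carrier (Zp p))" by (simp add: ring_iso_def bij_betw_def)
    from inj_onD[OF this _ Zp_int_closed Z.zero_closed, of "int p ^ a"]
    show False using pa Zp_int_p_power_nonzero by (simp add: QA.q_simps)
  qed
  then have sz: "n * card (carrier R) < p * card (carrier A)" using size by blast
  \<comment> \<open>p^a is nonzero in Z_p but dies in A and hence in R, which leaves only the finite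
    case for R.\<close>
  have "\<not> (\<forall>z\<in>carrier (Zp p). (\<pi> \<circ> q) z = \<zero>\<^sub>R \<longrightarrow> z = \<zero>\<^sub>(Zp p))"
    using Zp_int_p_power_nonzero[of a] Zp_int_closed[of "int p ^ a"] pa
      ring_hom_zero[OF pi_props(2) QA.R.ring_axioms QR.R.ring_axioms] by (metis comp_apply)
  then obtain r where r: "\<forall>z\<in>carrier (Zp p). (\<pi> \<circ> q) z = \<zero>\<^sub>R \<longleftrightarrow> z r = 0"
    using QR.q_ker_cases by blast
  have "p ^ r dvd (p ^ a choose k)"
    using prime_power_dvd_binomial[OF k, of r a] sz QA.card_carrier[OF ker] QR.card_carrier[OF r] by simp
  then have "Zp_int p (int (p ^ a choose k)) r = 0"
    unfolding Zp_int_def by (metis dvd_imp_mod_0 int_dvd_int_iff of_nat_power)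
  then show ?thesis using r Zp_int_closed by (simp add: QR.nu_def)
qed

sublocale ZT: Zp_tower_trunc H R p "\<pi> \<circ> q" sig n
proof (intro Zp_tower_trunc.intro Zp_tower_trunc_axioms.intro Zp_tower.intro Zp_tower_axioms.intro
    H_cgr_base QR.Zp_quotient_axioms H_comm_group sig_closed sig_add sig_surj ON_eq)
  show "(\<forall>z\<in>carrier (Zp p). sig z = \<one>\<^sub>H \<longrightarrow> z = \<zero>\<^sub>(Zp p)) \<or>
      (\<exists>a. \<forall>z\<in>carrier (Zp p). sig z = \<one>\<^sub>H \<longleftrightarrow> z a = 0)"
    using QA.q_ker_cases by (simp add: sig_one_iff)
qed (assumption | rule binomial_vanish)+

text \<open>These are the binomials of chi(g), but introduced as coefficients of the group element,
  so that multiplicativity comes from the ring structure of \<Omega>.\<close>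

definition B :: "nat => 'g => 'r" where "B k g = ZT.AT.cf (cgr_elt R H (K #>\<^sub>G g)) k"

lemma coset_closed: "g \<in> carrier G ==> K #>\<^sub>G g \<in> carrier H" by (auto simp: H_carrier)

lemma B_closed: "g \<in> carrier G ==> B k g \<in> carrier R"
  unfolding B_def by (rule ZT.AT.cf_closed[OF ZT.elt_carrier[OF coset_closed]])

lemma B_eq: "g \<in> carrier G ==> z \<in> carrier (Zp p) ==> q z = chi g ==> k \<le> n ==> B k g = \<pi> (q (Zp_binom p z k))"
  unfolding B_def using ZT.cf_elt[of z k] coset_sig[of g z] by simp

text \<open>All p-adic lifts of chi(g) have the same coset as image under \<open>sig\<close>, hence
  the same coefficients. So the image in \<open>quot_binom\<close> is a singleton: the binomial of
  chi(g) is well defined in R.\<close>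

lemma quot_binom_eq:
  assumes g: "g \<in> carrier G" and k: "k \<le> n"
  shows "quot_binom p q \<pi> (chi g) k = B k g"
proof -
  obtain z where "z \<in> carrier (Zp p)" "q z = chi g" by (rule QA.q_surjE[OF chi_simps(1)[OF g]])
  then have "(\<lambda>z. \<pi> (q (Zp_binom p z k))) ` {z \<in> carrier (Zp p). q z = chi g} = {B k g}"
    using B_eq[OF g _ _ k, symmetric] by (intro equalityI subsetI) auto
  then show ?thesis by (simp add: quot_binom_def)
qed

text \<open>Vandermonde's convolution, obtained from [gh] = [g][h] in \<Omega> instead of from
  binomial identities.\<close>

lemma B_mult:
  assumes g: "g \<in> carrier G" and h: "h \<in> carrier G" and k: "k \<le> n"
  shows "B k (g \<otimes>\<^sub>G h) = (\<Oplus>\<^sub>R l\<in>{..k}. B (k - l) g \<otimes>\<^sub>R B l h)"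
proof -
  have "cgr_elt R H (K #>\<^sub>G (g \<otimes>\<^sub>G h)) = cgr_elt R H (K #>\<^sub>G g) \<otimes>\<^sub>(completed_group_ring R H) cgr_elt R H (K #>\<^sub>G h)"
    using ZT.single_mult[OF QR.R.one_closed QR.R.one_closed coset_closed[OF g] coset_closed[OF h]] H_mult[OF g h]
    by (simp add: ZT.elt_eq)
  then show ?thesis
    unfolding B_def using ZT.AT.cf_mult[OF ZT.elt_carrier[OF coset_closed[OF g]] ZT.elt_carrier[OF coset_closed[OF h]] k] by simp
qed

lemma B_0: "g \<in> carrier G ==> B 0 g = \<one>\<^sub>R"
proof -
  assume g: "g \<in> carrier G"
  obtain z where z: "z \<in> carrier (Zp p)" "q z = chi g" by (rule QA.q_surjE[OF chi_simps(1)[OF g]])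
  have "Zp_binom p z 0 = \<one>\<^sub>(Zp p)"
    by (rule ext) (simp add: Zp_binom_comp[OF z(1) le_refl] Zp_simps)
  then show ?thesis using B_eq[OF g z, of 0] QR.q_simps(4) by simp
qed

text \<open>Continuity is clear for the p-adic binomial on Z_p; it descends to A because q is a
  quotient map, and is then composed with chi.\<close>

lemma B_cont:
  assumes k: "k \<le> n"
  shows "continuous_map (grp_top G) (ring_top R) (B k)"
proof -
  have q: "quotient_map (ring_top (Zp p)) (ring_top A) q" using A by (simp add: topring_quotient_def)
  have "continuous_map (ring_top (Zp p)) (ring_top R) (\<pi> \<circ> (q \<circ> (\<lambda>z. Zp_binom p z k)))"
    by (intro continuous_map_compose[OF _ pi_props(5)] continuous_map_compose[OF Zp_binom_continuous]
        quotient_imp_continuous_map[OF q])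
  moreover have "(\<pi> \<circ> (q \<circ> (\<lambda>z. Zp_binom p z k))) z = ((\<lambda>c. quot_binom p q \<pi> c k) \<circ> q) z"
    if z: "z \<in> topspace (ring_top (Zp p))" for z
  proof -
    have z': "z \<in> carrier (Zp p)" using z by (simp add: Zp_topspace)
    obtain g where g: "g \<in> carrier G" "chi g = q z" by (rule chi_lift[OF z'])
    show ?thesis using B_eq[OF g(1) z' g(2)[symmetric] k] quot_binom_eq[OF g(1) k] g(2) by simp
  qed
  ultimately have "continuous_map (ring_top (Zp p)) (ring_top R) ((\<lambda>c. quot_binom p q \<pi> c k) \<circ> q)"
    by (rule continuous_map_eq)
  then have "continuous_map (ring_top A) (ring_top R) (\<lambda>c. quot_binom p q \<pi> c k)"
    by (rule continuous_compose_quotient_map[OF q])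
  from continuous_map_compose[OF chi_cont this]
  show ?thesis
    by (rule continuous_map_eq) (simp add: quot_binom_eq k profinite_groupD(2)[OF G])
qed

end

section \<open>The defining system attached to a cocycle\<close>

text \<open>An entry of a product of upper triangular matrices receives contributions from i \<le> k
  \<le> j only; the substitution l = j - k brings them into the form of a Cauchy product.\<close>

lemma (in abelian_monoid) finsum_band:
  assumes "1 \<le> i" "i \<le> j" "j \<le> (m::nat)" "\<And>k. i \<le> k ==> k \<le> j ==> F k \<in> carrier G"
    and f: "\<And>k. 1 \<le> k ==> k \<le> m ==> f k = (if i \<le> k \<and> k \<le> j then F k else \<zero>)"
  shows "(\<Oplus>k\<in>{1..m}. f k) = (\<Oplus>l\<in>{..j - i}. F (j - l))"
proof -
  have img: "(\<lambda>l. j - l) ` {..j - i} = {i..j}"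
  proof (intro equalityI subsetI)
    fix k assume "k \<in> {i..j}"
    then show "k \<in> (\<lambda>l. j - l) ` {..j - i}" by (intro image_eqI[of _ _ "j - k"]) auto
  qed (use assms(2) in auto)
  have "(\<Oplus>k\<in>{i..j}. F k) = (\<Oplus>k\<in>{1..m}. f k)"
    using assms by (intro add.finprod_mono_neutral_cong_left) auto
  moreover have "(\<Oplus>k\<in>{i..j}. F k) = (\<Oplus>l\<in>{..j - i}. F (j - l))"
    unfolding img[symmetric]
  proof (rule finsum_reindex)
    show "inj_on (\<lambda>l. j - l) {..j - i}" by (rule inj_onI) (use assms(2) in auto)
  qed (use assms in auto)
  ultimately show ?thesis by simp
qed

lemma quot_topology_continuous: "continuous_map X (quot_topology X f) f"
  by (auto simp: continuous_map_def topspace_quot_topology openin_quot_topology)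

section \<open>The block group modulo its corner\<close>

context top_gmodule
begin

abbreviation "BG m \<equiv> block_group R T m"

lemma BG_carrier: "(P, v) \<in> carrier (BG m) \<longleftrightarrow> P \<in> unitriangular R m \<and> v \<in> {1..m} \<rightarrow>\<^sub>E carrier T"
  by (simp add: block_group_def)

lemma corner_mult:
  assumes c: "c \<in> block_corner R T m" and u: "(P, v) \<in> carrier (BG m)"
  shows "c \<otimes>\<^sub>(BG m) (P, v) = (P, \<lambda>i\<in>{1..m}. v i \<oplus>\<^sub>T snd c i)"
proof -
  have P: "P \<in> {1..m} \<times> {1..m} \<rightarrow>\<^sub>E carrier R" using u by (simp add: BG_carrier unitriangular_def)
  have v: "v \<in> {1..m} \<rightarrow>\<^sub>E carrier T" using u by (simp add: BG_carrier)
  have Pc: "P (i, j) \<in> carrier R" if "Suc 0 \<le> i" "i \<le> m" "Suc 0 \<le> j" "j \<le> m" for i j using PiE_mem[OF P, of "(i, j)"] that by simp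
  have vc: "v i \<in> carrier T" if "Suc 0 \<le> i" "i \<le> m" for i using PiE_mem[OF v, of i] that by simp
  define D where "D = (\<lambda>(i, j)\<in>{1..m} \<times> {1..m}. if i = j then \<one>\<^sub>R else \<zero>\<^sub>R)"
  have D: "c = (D, snd c)" using c by (simp add: block_corner_def block_group_def D_def prod_eq_iff)
  have 1: "(\<Oplus>\<^sub>R k\<in>{1..m}. D (i, k) \<otimes>\<^sub>R P (k, j)) = P (i, j)" if "i \<in> {1..m}" "j \<in> {1..m}" for i j
  proof -
    have "(\<Oplus>\<^sub>R k\<in>{1..m}. D (i, k) \<otimes>\<^sub>R P (k, j)) = (\<Oplus>\<^sub>R k\<in>{1..m}. if i = k then P (k, j) else \<zero>\<^sub>R)"
      using that by (intro R.finsum_cong') (auto simp: D_def Pc)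
    also have "\<dots> = P (i, j)" by (rule R.finsum_singleton[of i "{1..m}" "\<lambda>k. P (k, j)"]) (use that Pc in auto)
    finally show ?thesis .
  qed
  have 2: "(\<Oplus>\<^sub>T k\<in>{1..m}. D (i, k) \<odot>\<^sub>T v k) = v i" if "i \<in> {1..m}" for i
  proof -
    have "(\<Oplus>\<^sub>T k\<in>{1..m}. D (i, k) \<odot>\<^sub>T v k) = (\<Oplus>\<^sub>T k\<in>{1..m}. if i = k then v k else \<zero>\<^sub>T)"
      using that by (intro M.finsum_cong') (auto simp: D_def vc)
    also have "\<dots> = v i" by (rule M.finsum_singleton[of i "{1..m}" v]) (use that vc in auto)
    finally show ?thesis .
  qed
  have "c \<otimes>\<^sub>(BG m) (P, v) = (\<lambda>(i, j)\<in>{1..m} \<times> {1..m}. \<Oplus>\<^sub>R k\<in>{1..m}. D (i, k) \<otimes>\<^sub>R P (k, j),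
         \<lambda>i\<in>{1..m}. (\<Oplus>\<^sub>T k\<in>{1..m}. D (i, k) \<odot>\<^sub>T v k) \<oplus>\<^sub>T snd c i)"
    by (subst D) (simp add: block_group_def)
  also have "\<dots> = (P, \<lambda>i\<in>{1..m}. v i \<oplus>\<^sub>T snd c i)"
  proof -
    have "(\<lambda>(i, j)\<in>{1..m} \<times> {1..m}. \<Oplus>\<^sub>R k\<in>{1..m}. D (i, k) \<otimes>\<^sub>R P (k, j)) = P"
    proof (rule extensionalityI[of _ "{1..m} \<times> {1..m}"])
      show "P \<in> extensional ({1..m} \<times> {1..m})" using P by (simp add: PiE_def)
    qed (use 1 in auto)
    moreover have "(\<lambda>i\<in>{1..m}. (\<Oplus>\<^sub>T k\<in>{1..m}. D (i, k) \<odot>\<^sub>T v k) \<oplus>\<^sub>T snd c i) = (\<lambda>i\<in>{1..m}. v i \<oplus>\<^sub>T snd c i)"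
      using 2 by (intro restrict_ext) simp
    ultimately show ?thesis by simp
  qed
  finally show ?thesis .
qed

text \<open>A corner element changes the first entry of the column by an arbitrary amount and
  nothing else, so a coset amounts to P and the entries of the column from the second on.\<close>

lemma corner_coset:
  assumes u: "(P, v) \<in> carrier (BG m)"
  shows "block_corner R T m #>\<^sub>(BG m) (P, v) =
    {(P, w) | w. w \<in> {1..m} \<rightarrow>\<^sub>E carrier T \<and> (\<forall>i\<in>{2..m}. w i = v i)}"
proof (intro equalityI subsetI)
  have v: "v \<in> {1..m} \<rightarrow>\<^sub>E carrier T" using u by (simp add: BG_carrier)
  fix y assume "y \<in> block_corner R T m #>\<^sub>(BG m) (P, v)"
  then obtain c where c: "c \<in> block_corner R T m" "y = (P, \<lambda>i\<in>{1..m}. v i \<oplus>\<^sub>T snd c i)"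
    using corner_mult[OF _ u] by (auto simp: r_coset_def)
  then have "snd c \<in> {1..m} \<rightarrow>\<^sub>E carrier T" "\<forall>i\<in>{2..m}. snd c i = \<zero>\<^sub>T"
    by (auto simp: block_corner_def block_group_def)
  then show "y \<in> {(P, w) | w. w \<in> {1..m} \<rightarrow>\<^sub>E carrier T \<and> (\<forall>i\<in>{2..m}. w i = v i)}"
    unfolding c(2) using v PiE_mem[OF v] by (auto simp: PiE_mem)
next
  have v: "v \<in> {1..m} \<rightarrow>\<^sub>E carrier T" using u by (simp add: BG_carrier)
  fix y assume "y \<in> {(P, w) | w. w \<in> {1..m} \<rightarrow>\<^sub>E carrier T \<and> (\<forall>i\<in>{2..m}. w i = v i)}"
  then obtain w where w: "y = (P, w)" "w \<in> {1..m} \<rightarrow>\<^sub>E carrier T" "\<forall>i\<in>{2..m}. w i = v i" by blast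
  define c where "c = (fst \<one>\<^sub>(BG m), \<lambda>i\<in>{1..m}. if i = 1 then w i \<ominus>\<^sub>T v i else \<zero>\<^sub>T)"
  have "c \<in> block_corner R T m"
    using PiE_mem[OF w(2), of 1] PiE_mem[OF v, of 1] by (auto simp: c_def block_corner_def block_group_def unitriangular_def PiE_mem)
  moreover have "(\<lambda>i\<in>{1..m}. v i \<oplus>\<^sub>T snd c i) = w"
  proof (rule extensionalityI[of _ "{1..m}"])
    show "w \<in> extensional {1..m}" using w by (simp add: PiE_def)
    fix i assume i: "i \<in> {1..m}"
    have vw: "v i \<in> carrier T" "w i \<in> carrier T" using v w i by (auto simp: PiE_mem)
    then have "v i \<oplus>\<^sub>T (w i \<ominus>\<^sub>T v i) = w i"
      using M.a_lcomm[of "v i" "w i" "\<ominus>\<^sub>T v i"] by (simp add: a_minus_def M.r_neg)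
    then show "(\<lambda>i\<in>{1..m}. v i \<oplus>\<^sub>T snd c i) i = w i"
      using i vw w(3) by (cases "i = 1") (auto simp: c_def)
  qed auto
  ultimately show "y \<in> block_corner R T m #>\<^sub>(BG m) (P, v)"
    unfolding r_coset_def w(1) using corner_mult[OF _ u] by fastforce
qed

lemma corner_zero_lift_coset:
  assumes u: "(P, v) \<in> carrier (BG m)" and v1: "v 1 = \<zero>\<^sub>T" and m: "1 \<le> m"
  shows "corner_zero_lift T (block_corner R T m #>\<^sub>(BG m) (P, v)) = (P, v)"
  unfolding corner_zero_lift_def corner_coset[OF u]
proof (rule the_equality)
  have v: "v \<in> {1..m} \<rightarrow>\<^sub>E carrier T" using u by (simp add: BG_carrier)
  then show "(P, v) \<in> {(P, w) | w. w \<in> {1..m} \<rightarrow>\<^sub>E carrier T \<and> (\<forall>i\<in>{2..m}. w i = v i)} \<and> snd (P, v) 1 = \<zero>\<^sub>T"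
    using v1 by simp
  fix y assume y: "y \<in> {(P, w) | w. w \<in> {1..m} \<rightarrow>\<^sub>E carrier T \<and> (\<forall>i\<in>{2..m}. w i = v i)} \<and> snd y 1 = \<zero>\<^sub>T"
  then obtain w where w: "y = (P, w)" "w \<in> {1..m} \<rightarrow>\<^sub>E carrier T" "\<forall>i\<in>{2..m}. w i = v i" "w 1 = \<zero>\<^sub>T" by auto
  have "w = v"
  proof (rule PiE_ext[OF w(2) v])
    fix i assume "i \<in> {1..m}"
    then show "w i = v i" using w(3,4) v1 by (cases "i = 1") auto
  qed
  then show "y = (P, v)" using w(1) by simp
qed

end

text \<open>\<open>B k\<close> plays the role of the \<open>k\<close>-th binomial coefficient of the character: comultiplicativity of the
  sequence \<open>B\<close> makes the Toeplitz matrices \<open>\<theta> g\<close> a homomorphism, and the twisted cocycle rule for \<open>lam\<close> is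
  the cocycle rule for the last column.\<close>

locale toeplitz_system = top_gmodule R G T
  for R :: "('r, 'x) topring_scheme" and G :: "('g, 'y) topgroup_scheme"
    and T :: "('r, 'm, 'g, 'z) gmodule_scheme" +
  fixes n :: nat and B :: "nat => 'g => 'r" and lam :: "nat => 'g => 'm" and \<theta> :: "'g => nat \<times> nat => 'r"
  assumes B_closed: "g \<in> carrier G ==> B k g \<in> carrier R"
    and B_0: "g \<in> carrier G ==> B 0 g = \<one>\<^sub>R"
    and B_mult: "g \<in> carrier G ==> h \<in> carrier G ==> k \<le> n ==>
      B k (g \<otimes>\<^sub>G h) = (\<Oplus>\<^sub>R l\<in>{..k}. B (k - l) g \<otimes>\<^sub>R B l h)"
    and B_cont: "k \<le> n ==> continuous_map (grp_top G) (ring_top R) (B k)"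
    and lam_closed: "k < n ==> g \<in> carrier G ==> lam k g \<in> carrier T"
    and lam_cont: "k < n ==> continuous_map (grp_top G) (mod_top T) (lam k)"
    and lam_cocycle: "k < n ==> g \<in> carrier G ==> h \<in> carrier G ==>
      lam k (g \<otimes>\<^sub>G h) = lam k g \<oplus>\<^sub>T (\<Oplus>\<^sub>T l\<in>{..k}. B (k - l) g \<odot>\<^sub>T act T g (lam l h))"
    and theta: "g \<in> carrier G ==>
      \<theta> g = (\<lambda>(i, j)\<in>{1..n+1} \<times> {1..n+1}. if i \<le> j then B (j - i) g else \<zero>\<^sub>R)"
begin

definition col :: "'g => nat => 'm" where
  "col g = (\<lambda>i\<in>{1..n+1}. if i = 1 then \<zero>\<^sub>T else lam (n + 1 - i) g)"

abbreviation "rho \<equiv> attached_system R T n \<theta> lam"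

lemma col_mem: "g \<in> carrier G ==> col g \<in> {1..n+1} \<rightarrow>\<^sub>E carrier T"
  using lam_closed by (auto simp: col_def)

lemma theta_entry: "g \<in> carrier G ==> i \<in> {1..n+1} ==> j \<in> {1..n+1} ==>
    \<theta> g (i, j) = (if i \<le> j then B (j - i) g else \<zero>\<^sub>R)"
  by (simp add: theta)

lemma theta_closed: "g \<in> carrier G ==> i \<in> {1..n+1} ==> j \<in> {1..n+1} ==> \<theta> g (i, j) \<in> carrier R"
  by (simp add: theta_entry B_closed)

lemma theta_unitriangular: "g \<in> carrier G ==> \<theta> g \<in> unitriangular R (n+1)"
  unfolding unitriangular_def using theta_closed by (auto simp: theta B_0 B_closed)

lemma lift_mem: "g \<in> carrier G ==> (\<theta> g, col g) \<in> carrier (BG (n+1))"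
  unfolding BG_carrier using theta_unitriangular col_mem by blast

lemma rho_eq: "g \<in> carrier G ==>
    rho g = {(\<theta> g, w) | w. w \<in> {1..n+1} \<rightarrow>\<^sub>E carrier T \<and> (\<forall>i\<in>{2..n+1}. w i = lam (n + 1 - i) g)}"
proof -
  assume g: "g \<in> carrier G"
  have "rho g = block_corner R T (n+1) #>\<^sub>(BG (n+1)) (\<theta> g, col g)"
    by (simp add: attached_system_def col_def)
  also have "\<dots> = {(\<theta> g, w) | w. w \<in> {1..n+1} \<rightarrow>\<^sub>E carrier T \<and> (\<forall>i\<in>{2..n+1}. w i = col g i)}"
    by (rule corner_coset[OF lift_mem[OF g]])
  finally show ?thesis by (simp add: col_def)
qed

lemma rho_lift: "g \<in> carrier G ==> corner_zero_lift T (rho g) = (\<theta> g, col g)"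
  using corner_zero_lift_coset[OF lift_mem] by (simp add: attached_system_def col_def)

lemma theta_mult:
  assumes g: "g \<in> carrier G" and h: "h \<in> carrier G"
  shows "(\<lambda>(i, j)\<in>{1..n+1} \<times> {1..n+1}. \<Oplus>\<^sub>R k\<in>{1..n+1}. \<theta> g (i, k) \<otimes>\<^sub>R \<theta> h (k, j)) = \<theta> (g \<otimes>\<^sub>G h)"
proof -
  have gh: "g \<otimes>\<^sub>G h \<in> carrier G" using g h by simp
  have "(\<Oplus>\<^sub>R k\<in>{1..n+1}. \<theta> g (i, k) \<otimes>\<^sub>R \<theta> h (k, j)) = (if i \<le> j then B (j - i) (g \<otimes>\<^sub>G h) else \<zero>\<^sub>R)"
    if ij: "i \<in> {1..n+1}" "j \<in> {1..n+1}" for i j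
  proof (cases "i \<le> j")
    case True
    have "(\<Oplus>\<^sub>R k\<in>{1..n+1}. \<theta> g (i, k) \<otimes>\<^sub>R \<theta> h (k, j)) =
        (\<Oplus>\<^sub>R l\<in>{..j - i}. B ((j - l) - i) g \<otimes>\<^sub>R B (j - (j - l)) h)"
      using True ij g h
      by (intro R.finsum_band[where F="\<lambda>k. B (k - i) g \<otimes>\<^sub>R B (j - k) h"]) (auto simp: theta_entry B_closed)
    also have "\<dots> = (\<Oplus>\<^sub>R l\<in>{..j - i}. B ((j - i) - l) g \<otimes>\<^sub>R B l h)"
      using True g h by (intro R.finsum_cong') (auto simp: B_closed diff_diff_eq add.commute)
    also have "\<dots> = B (j - i) (g \<otimes>\<^sub>G h)"
    proof -
      have "j - i \<le> n" using ij by auto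
      from B_mult[OF g h this] show ?thesis by simp
    qed
    finally show ?thesis using True by simp
  next
    case False
    have "(\<Oplus>\<^sub>R k\<in>{1..n+1}. \<theta> g (i, k) \<otimes>\<^sub>R \<theta> h (k, j)) = (\<Oplus>\<^sub>R k\<in>{1..n+1}. \<zero>\<^sub>R)"
      using False ij g h by (intro R.finsum_cong') (auto simp: theta_entry B_closed)
    then show ?thesis using False by simp
  qed
  then show ?thesis unfolding theta[OF gh] by (intro restrict_ext) auto
qed

text \<open>For i \<ge> 2 the undetermined first entry of \<open>w\<close> meets a zero of the
  matrix. The rest of row i is the sum of \<open>lam_cocycle\<close> at index n + 1 - i, after the
  substitution l = n + 1 - k.\<close>

lemma row_sum:
  assumes g: "g \<in> carrier G" and h: "h \<in> carrier G" and i: "i \<in> {2..n+1}"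
    and w: "w \<in> {1..n+1} \<rightarrow> carrier T" "\<forall>k\<in>{2..n+1}. w k = act T g (lam (n + 1 - k) h)"
  shows "(\<Oplus>\<^sub>T k\<in>{1..n+1}. \<theta> g (i, k) \<odot>\<^sub>T w k) \<oplus>\<^sub>T lam (n + 1 - i) g = lam (n + 1 - i) (g \<otimes>\<^sub>G h)"
proof -
  have ac: "act T g (lam l h) \<in> carrier T" if "l < n" for l using lam_closed[OF that h] act_closed[OF g] by blast
  have wc: "w k \<in> carrier T" if "Suc 0 \<le> k" "k \<le> Suc n" for k using w(1) that by auto
  have "(\<Oplus>\<^sub>T k\<in>{1..n+1}. \<theta> g (i, k) \<odot>\<^sub>T w k) =
      (\<Oplus>\<^sub>T l\<in>{..(n + 1) - i}. B ((n + 1 - l) - i) g \<odot>\<^sub>T act T g (lam (n + 1 - (n + 1 - l)) h))"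
    using i g w ac
    by (intro M.finsum_band[where F="\<lambda>k. B (k - i) g \<odot>\<^sub>T act T g (lam (n + 1 - k) h)"])
      (auto simp: theta_entry B_closed wc)
  also have "\<dots> = (\<Oplus>\<^sub>T l\<in>{..n + 1 - i}. B ((n + 1 - i) - l) g \<odot>\<^sub>T act T g (lam l h))"
    using i g ac by (intro M.finsum_cong') (auto simp: B_closed diff_diff_eq add.commute)
  finally have eq: "(\<Oplus>\<^sub>T k\<in>{1..n+1}. \<theta> g (i, k) \<odot>\<^sub>T w k) =
    (\<Oplus>\<^sub>T l\<in>{..n + 1 - i}. B ((n + 1 - i) - l) g \<odot>\<^sub>T act T g (lam l h))" .
  have "(\<Oplus>\<^sub>T l\<in>{..n + 1 - i}. B ((n + 1 - i) - l) g \<odot>\<^sub>T act T g (lam l h)) \<in> carrier T"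
    using i g ac by (intro M.finsum_closed) (auto simp: B_closed)
  moreover have "n + 1 - i < n" using i by auto
  ultimately show ?thesis
    unfolding eq using lam_cocycle[OF _ g h, of "n + 1 - i"] lam_closed[OF _ g, of "n + 1 - i"]
    by (simp add: M.a_comm)
qed

lemma block_mult: "(P, v) \<otimes>\<^sub>(BG m) (Q, w) =
    (\<lambda>(i, j)\<in>{1..m} \<times> {1..m}. \<Oplus>\<^sub>R k\<in>{1..m}. P (i, k) \<otimes>\<^sub>R Q (k, j),
     \<lambda>i\<in>{1..m}. (\<Oplus>\<^sub>T k\<in>{1..m}. P (i, k) \<odot>\<^sub>T w k) \<oplus>\<^sub>T v i)"
  by (simp add: block_group_def)

lemma row_closed: "g \<in> carrier G ==> i \<in> {1..n+1} ==> w \<in> {1..n+1} \<rightarrow> carrier T ==>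
    (\<Oplus>\<^sub>T k\<in>{1..n+1}. \<theta> g (i, k) \<odot>\<^sub>T w k) \<in> carrier T"
  using theta_closed[of g i] by (intro M.finsum_closed) auto

text \<open>Values of \<open>rho\<close> are cosets and their product is the product of sets, so the
  identity is an equality of two sets of pairs: from the second entry on it is
  \<open>row_sum\<close>, and the first entry is free.\<close>

lemma rho_cocycle:
  assumes g: "g \<in> carrier G" and h: "h \<in> carrier G"
  shows "rho (g \<otimes>\<^sub>G h) = rho g <#>\<^sub>(BG (n+1)) (block_act T (n+1) g ` rho h)"
proof (intro equalityI subsetI)
  have gh: "g \<otimes>\<^sub>G h \<in> carrier G" using g h by simp
  fix y assume "y \<in> rho (g \<otimes>\<^sub>G h)"
  then obtain v where y: "y = (\<theta> (g \<otimes>\<^sub>G h), v)" "v \<in> {1..n+1} \<rightarrow>\<^sub>E carrier T"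
    "\<forall>i\<in>{2..n+1}. v i = lam (n + 1 - i) (g \<otimes>\<^sub>G h)"
    unfolding rho_eq[OF gh] by blast
  define w where "w = (\<lambda>i\<in>{1..n+1}. act T g (col h i))"
  have w: "w \<in> {1..n+1} \<rightarrow> carrier T" using col_mem[OF h] act_closed[OF g] by (auto simp: w_def PiE_mem)
  have w2: "\<forall>k\<in>{2..n+1}. w k = act T g (lam (n + 1 - k) h)" by (simp add: w_def col_def)
  define s where "s i = (\<Oplus>\<^sub>T k\<in>{1..n+1}. \<theta> g (i, k) \<odot>\<^sub>T w k)" for i
  have s: "s i \<in> carrier T" if "i \<in> {1..n+1}" for i unfolding s_def by (rule row_closed[OF g that w])
  \<comment> \<open>The first entry of \<open>u\<close> is solved for from the prescribed first
    entry of \<open>v\<close>; membership in the coset \<open>rho g\<close> leaves it free.\<close>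
  define u where "u = (\<lambda>i\<in>{1..n+1}. if i = 1 then v i \<ominus>\<^sub>T s i else lam (n + 1 - i) g)"
  have "u \<in> {1..n+1} \<rightarrow>\<^sub>E carrier T" using PiE_mem[OF y(2)] s lam_closed[OF _ g] by (auto simp: u_def)
  then have ur: "(\<theta> g, u) \<in> rho g" unfolding rho_eq[OF g] by (auto simp: u_def)
  have "(\<theta> h, col h) \<in> rho h" unfolding rho_eq[OF h] using col_mem[OF h] by (auto simp: col_def)
  then have wr: "(\<theta> h, w) \<in> block_act T (n+1) g ` rho h"
    by (rule rev_image_eqI) (simp add: block_act_def w_def)
  have "(\<lambda>i\<in>{1..n+1}. s i \<oplus>\<^sub>T u i) = v"
  proof (rule extensionalityI[of _ "{1..n+1}"])
    show "v \<in> extensional {1..n+1}" using y(2) by (simp add: PiE_def)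
    fix i assume i: "i \<in> {1..n+1}"
    show "(\<lambda>i\<in>{1..n+1}. s i \<oplus>\<^sub>T u i) i = v i"
    proof (cases "i = 1")
      case True
      have "v i \<in> carrier T" using y(2) i by auto
      then have "s i \<oplus>\<^sub>T (v i \<ominus>\<^sub>T s i) = v i" using s[OF i] M.a_lcomm[of "s i" "v i" "\<ominus>\<^sub>T s i"] by (simp add: a_minus_def M.r_neg)
      then show ?thesis using True i by (simp add: u_def)
    next
      case False
      then have "i \<in> {2..n+1}" using i by auto
      from row_sum[OF g h this w w2] show ?thesis using y(3) \<open>i \<in> {2..n+1}\<close> False by (simp add: s_def u_def)
    qed
  qed auto
  then have "(\<theta> g, u) \<otimes>\<^sub>(BG (n+1)) (\<theta> h, w) = y"
    unfolding block_mult theta_mult[OF g h] y(1) s_def by simp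
  then show "y \<in> rho g <#>\<^sub>(BG (n+1)) (block_act T (n+1) g ` rho h)"
    unfolding set_mult_def using ur wr by blast
next
  have gh: "g \<otimes>\<^sub>G h \<in> carrier G" using g h by simp
  fix y assume "y \<in> rho g <#>\<^sub>(BG (n+1)) (block_act T (n+1) g ` rho h)"
  then obtain a b where ab: "a \<in> rho g" "b \<in> rho h" "y = a \<otimes>\<^sub>(BG (n+1)) block_act T (n+1) g b"
    unfolding set_mult_def by blast
  obtain u where u: "a = (\<theta> g, u)" "u \<in> {1..n+1} \<rightarrow>\<^sub>E carrier T" "\<forall>i\<in>{2..n+1}. u i = lam (n + 1 - i) g"
    using ab(1) unfolding rho_eq[OF g] by blast
  obtain v where v: "b = (\<theta> h, v)" "v \<in> {1..n+1} \<rightarrow>\<^sub>E carrier T" "\<forall>i\<in>{2..n+1}. v i = lam (n + 1 - i) h"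
    using ab(2) unfolding rho_eq[OF h] by blast
  define w where "w = (\<lambda>i\<in>{1..n+1}. act T g (v i))"
  have w: "w \<in> {1..n+1} \<rightarrow> carrier T" using v(2) act_closed[OF g] by (auto simp: w_def PiE_mem)
  have w2: "\<forall>k\<in>{2..n+1}. w k = act T g (lam (n + 1 - k) h)" using v(3) by (simp add: w_def)
  have "y = (\<theta> (g \<otimes>\<^sub>G h), \<lambda>i\<in>{1..n+1}. (\<Oplus>\<^sub>T k\<in>{1..n+1}. \<theta> g (i, k) \<odot>\<^sub>T w k) \<oplus>\<^sub>T u i)"
    unfolding ab(3) u(1) v(1) block_act_def fst_conv snd_conv w_def[symmetric] block_mult theta_mult[OF g h] ..
  moreover have "(\<lambda>i\<in>{1..n+1}. (\<Oplus>\<^sub>T k\<in>{1..n+1}. \<theta> g (i, k) \<odot>\<^sub>T w k) \<oplus>\<^sub>T u i) \<in> {1..n+1} \<rightarrow>\<^sub>E carrier T"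
    using row_closed[OF g _ w] u(2) by (auto simp: PiE_mem)
  moreover have "\<forall>i\<in>{2..n+1}. (\<lambda>i\<in>{1..n+1}. (\<Oplus>\<^sub>T k\<in>{1..n+1}. \<theta> g (i, k) \<odot>\<^sub>T w k) \<oplus>\<^sub>T u i) i =
      lam (n + 1 - i) (g \<otimes>\<^sub>G h)"
    using row_sum[OF g h _ w w2] u(3) by simp
  ultimately show "y \<in> rho (g \<otimes>\<^sub>G h)" unfolding rho_eq[OF gh] by blast
qed

text \<open>\<open>rho\<close> is this lift with zero corner followed by the projection, and
  inherits its continuity. The lift itself is in general no cocycle; its failure is measured by the
  Massey product.\<close>

lemma lift_cont: "continuous_map (grp_top G) (grp_top (BG (n+1))) (\<lambda>g. (\<theta> g, col g))"
proof -
  have R0: "continuous_map (grp_top G) (ring_top R) (\<lambda>g. \<zero>\<^sub>R)" using top_R by simp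
  have 1: "continuous_map (grp_top G) (ring_top R) (\<lambda>g. \<theta> g (i, j))" if "i \<in> {1..n+1}" "j \<in> {1..n+1}" for i j
    by (rule continuous_map_eq[of _ _ "\<lambda>g. if i \<le> j then B (j - i) g else \<zero>\<^sub>R"])
      (use that B_cont[of "j - i"] R0 in \<open>auto simp: top_G theta_entry\<close>)
  have 2: "continuous_map (grp_top G) (mod_top T) (\<lambda>g. col g i)" if "i \<in> {1..n+1}" for i
    using that lam_cont[of "n + 1 - i"] continuous_const[of "\<zero>\<^sub>T"] by (auto simp: col_def)
  have "\<theta> g \<in> extensional ({1..n+1} \<times> {1..n+1})" "col g \<in> extensional {1..n+1}" if "g \<in> carrier G" for g
    using theta_unitriangular[OF that] col_mem[OF that] by (auto simp: unitriangular_def PiE_def)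
  then have "continuous_map (grp_top G) (prod_topology (product_topology (\<lambda>_. ring_top R) ({1..n+1} \<times> {1..n+1}))
      (product_topology (\<lambda>_. mod_top T) {1..n+1})) (\<lambda>g. (\<theta> g, col g))"
    using 1 2 by (intro continuous_map_pairedI) (auto simp: continuous_map_componentwise top_G)
  then show ?thesis
    using theta_unitriangular col_mem
    by (auto simp: block_group_def continuous_map_in_subtopology top_G)
qed

theorem attached_proper: "proper_defining_system R G T n \<theta> rho"
  unfolding proper_defining_system_def
proof (intro conjI ballI)
  have "continuous_map (grp_top G) (quot_topology (grp_top (BG (n+1))) (\<lambda>u. block_corner R T (n+1) #>\<^sub>(BG (n+1)) u))
      ((\<lambda>u. block_corner R T (n+1) #>\<^sub>(BG (n+1)) u) \<circ> (\<lambda>g. (\<theta> g, col g)))"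
    by (rule continuous_map_compose[OF lift_cont quot_topology_continuous])
  moreover have "(\<lambda>u. block_corner R T (n+1) #>\<^sub>(BG (n+1)) u) \<circ> (\<lambda>g. (\<theta> g, col g)) = rho"
    by (rule ext) (simp add: attached_system_def col_def)
  ultimately show "continuous_map (grp_top G) (grp_top (block_quot R T (n+1))) rho"
    by (simp add: block_quot_def quot_topgroup_def)
next
  fix g assume g: "g \<in> carrier G"
  have "rho g = block_corner R T (n+1) #>\<^sub>(BG (n+1)) (\<theta> g, col g)"
    by (simp add: attached_system_def col_def)
  then show "rho g \<in> carrier (block_quot R T (n+1))"
    using lift_mem[OF g] by (auto simp: block_quot_def quot_topgroup_def FactGroup_def RCOSETS_def)
next
  fix g h assume "g \<in> carrier G" "h \<in> carrier G"
  then show "rho (g \<otimes>\<^sub>G h) = rho g \<otimes>\<^sub>(block_quot R T (n+1)) (block_act T (n+1) g ` rho h)"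
    using rho_cocycle by (simp add: block_quot_def quot_topgroup_def FactGroup_def)
next
  fix g u assume "g \<in> carrier G" "u \<in> rho g"
  then show "fst u = \<theta> g" by (auto simp: rho_eq)
qed

text \<open>With i = n + 1 - l the entry (1, i) is B (n - l), and the column entry at i is lam l, so
  the Massey sum becomes the last coordinate of the coboundary of the explicit lift.\<close>

lemma massey_eq: "massey_product G T n rho =
    class2 G T (\<lambda>(g, h)\<in>carrier G \<times> carrier G. \<Oplus>\<^sub>T l\<in>{..<n}. B (n - l) g \<odot>\<^sub>T act T g (lam l h))"
proof -
  have "(\<Oplus>\<^sub>T i\<in>{2..n+1}. fst (corner_zero_lift T (rho g)) (1, i) \<odot>\<^sub>T act T g (snd (corner_zero_lift T (rho h)) i)) =
      (\<Oplus>\<^sub>T l\<in>{..<n}. B (n - l) g \<odot>\<^sub>T act T g (lam l h))"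
    if g: "g \<in> carrier G" and h: "h \<in> carrier G" for g h
  proof -
    have ac: "act T g (lam l h) \<in> carrier T" if "l < n" for l using lam_closed[OF that h] act_closed[OF g] by blast
    have img: "{2..n+1} = (\<lambda>l. n + 1 - l) ` {..<n}"
    proof (intro equalityI subsetI)
      fix i assume "i \<in> {2..n+1}"
      then show "i \<in> (\<lambda>l. n + 1 - l) ` {..<n}" by (intro image_eqI[of _ _ "n + 1 - i"]) auto
    qed auto
    have "(\<Oplus>\<^sub>T i\<in>{2..n+1}. fst (corner_zero_lift T (rho g)) (1, i) \<odot>\<^sub>T act T g (snd (corner_zero_lift T (rho h)) i)) =
        (\<Oplus>\<^sub>T i\<in>{2..n+1}. B (i - 1) g \<odot>\<^sub>T act T g (lam (n + 1 - i) h))"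
      using g h ac by (intro M.finsum_cong') (auto simp: rho_lift theta_entry col_def B_closed)
    also have "\<dots> = (\<Oplus>\<^sub>T l\<in>{..<n}. B ((n + 1 - l) - 1) g \<odot>\<^sub>T act T g (lam (n + 1 - (n + 1 - l)) h))"
      unfolding img
    proof (rule M.finsum_reindex)
      show "inj_on (\<lambda>l. n + 1 - l) {..<n}" by (rule inj_onI) auto
    qed (use g ac in \<open>auto simp: B_closed\<close>)
    also have "\<dots> = (\<Oplus>\<^sub>T l\<in>{..<n}. B (n - l) g \<odot>\<^sub>T act T g (lam l h))"
      using g ac by (intro M.finsum_cong') (auto simp: B_closed)
    finally show ?thesis .
  qed
  then show ?thesis unfolding massey_product_def by (intro arg_cong[where f="class2 G T"] restrict_ext) auto
qed

end

section \<open>The abstract connecting map specialised to T \<otimes> \<Omega>/I^j\<close>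

locale Zp_character_module = Zp_character p n G A R q \<pi> chi + TG: top_gmodule R G T
  for p n and G :: "('g, 'x) topgroup_scheme" and A :: "('a, 'y) topring_scheme"
    and R :: "('r, 'z) topring_scheme" and q and \<pi> and chi and T :: "('r, 'm, 'g, 'w) gmodule_scheme"
begin

lemma omega_act_eq: "omega_act R G K j g X = ZT.oact j (K #>\<^sub>G g) X"
  by (simp add: omega_act_def ZT.oact_def ZT.cl_def Let_def)

abbreviation "ee m k \<equiv> ZT.cl m (ZT.xx [^]\<^sub>(completed_group_ring R H) (k::nat))"

lemma omega_tensor_action:
  assumes m: "m \<le> Suc n"
  shows "tensor_action R G T (ZT.OQ m) m (ee m) (ZT.ec m) (omega_act R G K m) B"
proof (intro tensor_action.intro tensor_based.intro tensor_based_axioms.intro tensor_action_axioms.intro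
    ZT.OQ_based[OF m] TG.module_axioms TG.top_gmodule_axioms)
  fix k assume k: "k < m"
  show "continuous_map (grp_top G) (ring_top R) (B k)" by (rule B_cont) (use k m in simp)
qed (use m B_closed[unfolded B_def] in \<open>simp_all add: omega_act_eq ZT.oact_props coset_closed B_def\<close>)

text \<open>On I^n all coefficients below n vanish, so of the Toeplitz sum for the n-th coefficient
  only the term with B 0 = 1 is left: G acts trivially on I^n/I^(n+1).\<close>

lemma graded_tensor_line:
  "tensor_line R G T ZT.GRD (\<lambda>_. ee (Suc n) n) (\<lambda>_. ZT.ec (Suc n) n) (omega_act R G K (Suc n)) B"
proof (intro tensor_line.intro tensor_line_axioms.intro tensor_action.intro tensor_based.intro
    tensor_based_axioms.intro tensor_action_axioms.intro ZT.GRD_based TG.module_axioms TG.top_gmodule_axioms B_0)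
  fix k :: nat assume k: "k < 1"
  show "continuous_map (grp_top G) (ring_top R) (B k)" by (rule B_cont) (use k in simp)
  fix g X assume g: "g \<in> carrier G" and X: "X \<in> carrier ZT.GRD"
  obtain a where a: "a \<in> ZT.JJ n" "X = ZT.cl (Suc n) a" using X unfolding ZT.GRD_simps by blast
  have ac: "a \<in> carrier (completed_group_ring R H)" by (rule ZT.JJ_carrier[OF a(1)])
  have X1: "X \<in> carrier (ZT.OQ (Suc n))" using X ZT.GRD_sub by blast
  have e: "ZT.ec (Suc n) l X = ZT.AT.cf a l" if "l \<le> n" for l
    unfolding a(2) by (rule ZT.ec_cl) (use that ac in auto)
  have v: "ZT.ec (Suc n) l X = \<zero>\<^sub>R" if "l < n" for l
    using a(1) that ZT.JJ_iff[of n a] e[of l] by simp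
  have ec: "ZT.ec (Suc n) n X \<in> carrier R" unfolding e[OF le_refl] by (rule ZT.AT.cf_closed[OF ac])
  have "ZT.ec (Suc n) n (omega_act R G K (Suc n) g X) = (\<Oplus>\<^sub>R l\<in>{..n}. B (n - l) g \<otimes>\<^sub>R ZT.ec (Suc n) l X)"
    unfolding omega_act_eq B_def by (rule ZT.oact_props(5)[OF coset_closed[OF g] X1]) auto
  also have "\<dots> = (\<Oplus>\<^sub>R l\<in>{..n}. if n = l then B 0 g \<otimes>\<^sub>R ZT.ec (Suc n) n X else \<zero>\<^sub>R)"
    using ec g by (intro QR.R.finsum_cong') (auto simp: B_closed v)
  also have "\<dots> = B 0 g \<otimes>\<^sub>R ZT.ec (Suc n) n X"
    by (rule QR.R.finsum_singleton[of n "{..n}" "\<lambda>_. B 0 g \<otimes>\<^sub>R ZT.ec (Suc n) n X"]) (use ec g in \<open>auto simp: B_closed\<close>)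
  finally show "ZT.ec (Suc n) n (omega_act R G K (Suc n) g X) =
      (\<Oplus>\<^sub>R l\<in>{..k}. B (k - l) g \<otimes>\<^sub>R ZT.ec (Suc n) n X)"
    using k ec g by (simp add: B_closed)
next
  fix g X Y assume "g \<in> carrier G" "X \<in> carrier ZT.GRD" "Y \<in> carrier ZT.GRD"
  then show "omega_act R G K (Suc n) g (X \<oplus>\<^sub>ZT.GRD Y) =
      omega_act R G K (Suc n) g X \<oplus>\<^sub>ZT.GRD omega_act R G K (Suc n) g Y"
    using ZT.oact_props(2)[OF coset_closed, of g X "Suc n" Y] ZT.GRD_sub by (auto simp: ZT.GRD_simps(3) omega_act_eq)
next
  fix g r X assume "g \<in> carrier G" "r \<in> carrier R" "X \<in> carrier ZT.GRD"
  then show "omega_act R G K (Suc n) g (r \<odot>\<^sub>ZT.GRD X) = r \<odot>\<^sub>ZT.GRD omega_act R G K (Suc n) g X"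
    using ZT.oact_props(3)[OF coset_closed, of g X "Suc n" r] ZT.GRD_sub by (auto simp: ZT.GRD_simps(4) omega_act_eq)
qed (simp_all add: omega_act_eq ZT.oact_props(6) coset_closed B_closed)

sublocale CS: connecting_setup R G T "ZT.OQ (Suc n)" n "ee (Suc n)" "ZT.ec (Suc n)" "omega_act R G K (Suc n)" B
  "ZT.OQ n" "ee n" "ZT.ec n" "omega_act R G K n" ZT.GRD "\<lambda>X. ZT.JJ n <+>\<^sub>(completed_group_ring R H) X"
proof (intro connecting_setup.intro connecting_setup_axioms.intro graded_tensor_line omega_tensor_action)
  fix g h X assume "g \<in> carrier G" "h \<in> carrier G" "X \<in> carrier (ZT.OQ (Suc n))"
  then show "omega_act R G K (Suc n) (g \<otimes>\<^sub>G h) X = omega_act R G K (Suc n) g (omega_act R G K (Suc n) h X)"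
    using ZT.oact_props(4)[OF coset_closed _ coset_closed, of g X "Suc n" h] by (simp add: omega_act_eq H_mult)
qed (simp_all add: ZT.GRD_sub ZT.GRD_simps(3,4) ZT.reduce_props)

context
  fixes f :: "'g => ('m \<times> ('g set set => 'g set set => 'r) set => 'r) set" and lam :: "nat => 'g => 'm"
  assumes f: "f \<in> Z1 G (T_omega R G K T n)"
    and lam: "\<And>k g. k < n ==> g \<in> carrier G ==> lam k g \<in> carrier T"
    and f_lam: "\<And>g. g \<in> carrier G ==>
      f g = (\<Oplus>\<^sub>(T_omega R G K T n)k\<in>{..<n}. pure_tensor R T (omega_quot R H n) (lam k g) (ee n k))"
begin

lemma f_vec: "g \<in> carrier G ==> f g = CS.A0.vec (\<lambda>k. lam k g)"
  using f_lam by (simp add: CS.A0.vec_def CS.A0.TN_finsum)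

lemma toeplitz: "toeplitz_system R G T n B lam (\<lambda>g. binom_mat R p q \<pi> n (chi g))"
proof (intro toeplitz_system.intro toeplitz_system_axioms.intro TG.top_gmodule_axioms B_closed B_0 B_mult B_cont lam
    CS.lam_cont[OF f lam f_vec] CS.lam_cocycle[OF f lam f_vec])
  fix g assume g: "g \<in> carrier G"
  show "binom_mat R p q \<pi> n (chi g) =
      (\<lambda>(i, j)\<in>{1..n+1} \<times> {1..n+1}. if i \<le> j then B (j - i) g else \<zero>\<^sub>R)"
    unfolding binom_mat_def by (intro restrict_ext) (auto simp: quot_binom_eq[OF g])
qed

text \<open>\<open>Psi\<close> unfolds to the abstract maps \<open>incl\<close>, \<open>proj\<close>
  and \<open>HT\<close>. The class computed by \<open>connecting_eq\<close> lies in the image of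
  \<open>HT\<close>, so its inverse there is the pure tensor with x^n.\<close>

lemma Psi_eq:
  "Psi R G K T n (class1 G (T_omega R G K T n) f) =
    pure_tensor R (H2 G T) (aug_graded R H n)
      (massey_product G T n (attached_system R T n (\<lambda>g. binom_mat R p q \<pi> n (chi g)) lam)) (ee (Suc n) n)"
proof -
  have "Psi R G K T n (class1 G (T_omega R G K T n) f) =
      inv_into (carrier (tensor R (H2 G T) ZT.GRD)) CS.Ag.HT
        (connecting G CS.Ag.TN CS.A1.TN CS.incl CS.proj (class1 G CS.A0.TN f))"
    by (simp add: Psi_def CS.Ag.HT_def H2_tensor_map_def T_incl_def T_proj_def CS.incl_def CS.proj_def Let_def)
  also have "connecting G CS.Ag.TN CS.A1.TN CS.incl CS.proj (class1 G CS.A0.TN f) =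
      CS.Ag.lift_class (class2 G T (CS.cc lam))"
    by (rule CS.connecting_eq[OF f lam f_vec])
  also have "inv_into (carrier (tensor R (H2 G T) ZT.GRD)) CS.Ag.HT \<dots> =
      pure_tensor R (H2 G T) ZT.GRD (class2 G T (CS.cc lam)) (ee (Suc n) n)"
    by (rule CS.Ag.HT_inv[OF CS.cc_Z2[OF f lam f_vec]])
  also have "class2 G T (CS.cc lam) =
      massey_product G T n (attached_system R T n (\<lambda>g. binom_mat R p q \<pi> n (chi g)) lam)"
    unfolding toeplitz_system.massey_eq[OF toeplitz]
    by (rule arg_cong[OF CS.cc_def[OF f lam f_vec]])
  finally show ?thesis .
qed

end

end

text \<open>chi is constant on a coset of its kernel, and its value 1 on h is the image of the
  p-adic integer 1.\<close>

lemma (in Zp_character) generator_eq: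
  assumes h: "h \<in> carrier H" "the_elem (chi ` h) = \<one>\<^sub>A"
  shows "h = sig \<one>\<^sub>(Zp p)"
proof -
  obtain g where g: "g \<in> carrier G" "h = K #>\<^sub>G g" using h(1) by (auto simp: H_carrier)
  then have "h = {g' \<in> carrier G. chi g' = chi g}" by (simp add: coset_eq)
  then have "chi ` h = {chi g}" using g(1) by auto
  then have "chi g = q \<one>\<^sub>(Zp p)" using h(2) by (simp add: QA.q_simps)
  then show ?thesis using coset_sig[OF g(1)] g(2) by simp
qed

theorem theorem4p4:
  fixes p n :: nat
    and G :: "'g topgroup"
    and A :: "'a topring" and R :: "'r topring"
    and q :: "(nat \<Rightarrow> int) \<Rightarrow> 'a" and \<pi> :: "'a \<Rightarrow> 'r"
    and chi :: "'g \<Rightarrow> 'a"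
    and K :: "'g set" and H :: "'g set topgroup" and h :: "'g set"
    and \<Omega> :: "('g set set \<Rightarrow> 'g set set \<Rightarrow> 'r) topring"
    and x :: "'g set set \<Rightarrow> 'g set set \<Rightarrow> 'r"
    and M :: "('g set \<Rightarrow> 'g set \<Rightarrow> 'r, 't) topmodule"
    and T :: "('r, 't, 'g) gmodule"
    and f :: "'g \<Rightarrow> ('t \<times> ('g set set \<Rightarrow> 'g set set \<Rightarrow> 'r) set \<Rightarrow> 'r) set"
    and lam :: "nat \<Rightarrow> 'g \<Rightarrow> 't"
    and \<theta> :: "'g \<Rightarrow> (nat \<times> nat \<Rightarrow> 'r)"
    and \<rho> :: "'g \<Rightarrow> ((nat \<times> nat \<Rightarrow> 'r) \<times> (nat \<Rightarrow> 't)) set"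
  assumes p: "prime p" and n: "1 \<le> n"
    and G: "profinite_group G"
    and A: "topring_quotient (Zp p) A q" "\<one>\<^bsub>A\<^esub> \<noteq> \<zero>\<^bsub>A\<^esub>"
    and R: "topring_quotient A R \<pi>" "\<one>\<^bsub>R\<^esub> \<noteq> \<zero>\<^bsub>R\<^esub>"
    and size: "q \<in> ring_iso (Zp p) A \<or>
               finite (carrier A) \<and> n * card (carrier R) < p * card (carrier A)"
    and chi: "chi \<in> hom G (add_monoid A)" "chi ` carrier G = carrier A"
            "continuous_map (grp_top G) (ring_top A) chi"
    and K: "K = kernel G (add_monoid A) chi" and H: "H = quot_topgroup G K"
    and \<Omega>: "\<Omega> = completed_group_ring R H"
    and h: "h \<in> carrier H" "the_elem (chi ` h) = \<one>\<^bsub>A\<^esub>"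
    and x: "x = cgr_elt R H h \<ominus>\<^bsub>\<Omega>\<^esub> \<one>\<^bsub>\<Omega>\<^esub>"
    and M: "compact_module (completed_group_ring R G) M"
    and T: "T = coeff_module R G M" "fin_gen_over R T"
    and f: "f \<in> Z1 G (T_omega R G K T n)"
    and lam: "\<And>k g. k < n \<Longrightarrow> g \<in> carrier G \<Longrightarrow> lam k g \<in> carrier T"
    and f_lam: "\<And>g. g \<in> carrier G \<Longrightarrow>
       f g = (\<Oplus>\<^bsub>T_omega R G K T n\<^esub>k\<in>{..<n}.
                pure_tensor R T (omega_quot R H n) (lam k g)
                  (aug_pow R H n +>\<^bsub>\<Omega>\<^esub> (x [^]\<^bsub>\<Omega>\<^esub> k)))"
    and \<theta>: "\<theta> = (\<lambda>g. binom_mat R p q \<pi> n (chi g))"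
    and \<rho>: "\<rho> = attached_system R T n \<theta> lam"
  shows "proper_defining_system R G T n \<theta> \<rho> \<and>
         Psi R G K T n (class1 G (T_omega R G K T n) f) =
           pure_tensor R (H2 G T) (aug_graded R H n) (massey_product G T n \<rho>)
             (aug_pow R H (Suc n) +>\<^bsub>\<Omega>\<^esub> (x [^]\<^bsub>\<Omega>\<^esub> n))"
proof -
  interpret Zp_character p n G A R q \<pi> chi
    by unfold_locales (use p G A(1) R(1) size chi in auto)
  have T_gmodule: "top_gmodule R G T"
    unfolding T(1) by (rule coeff_module_top_gmodule[OF G pi_props(1,4) M])
  interpret Zp_character_module p n G A R q \<pi> chi T
    by (intro Zp_character_module.intro Zp_character_axioms T_gmodule)
  note H' = H[unfolded K]
  \<comment> \<open>The condition on the value of chi at h pins down h as \<open>sig\<close> of 1,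
    so the x of the statement is the generator \<open>xx\<close>.\<close>
  have x': "x = ZT.xx"
    unfolding x \<Omega> H' ZT.xx_def using generator_eq[OF h[unfolded H']] by simp
  have f': "f \<in> Z1 G (T_omega R G (kernel G (add_monoid A) chi) T n)" using f unfolding K .
  have f_lam': "f g = (\<Oplus>\<^bsub>T_omega R G (kernel G (add_monoid A) chi) T n\<^esub>k\<in>{..<n}.
      pure_tensor R T (omega_quot R (quot_topgroup G (kernel G (add_monoid A) chi)) n) (lam k g)
        (ZT.cl n (ZT.xx [^]\<^bsub>completed_group_ring R (quot_topgroup G (kernel G (add_monoid A) chi))\<^esub> k)))"
    if "g \<in> carrier G" for g
    using f_lam[OF that] unfolding x' \<Omega> H' K ZT.cl_def .
  have "proper_defining_system R G T n \<theta> \<rho>"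
    unfolding \<rho> \<theta> by (rule toeplitz_system.attached_proper) (rule toeplitz[OF f' lam f_lam'])
  moreover have "Psi R G K T n (class1 G (T_omega R G K T n) f) =
      pure_tensor R (H2 G T) (aug_graded R H n) (massey_product G T n \<rho>)
        (aug_pow R H (Suc n) +>\<^bsub>\<Omega>\<^esub> (x [^]\<^bsub>\<Omega>\<^esub> n))"
    unfolding \<rho> \<theta> x' \<Omega> H' K ZT.cl_def[symmetric] by (rule Psi_eq[OF f' lam f_lam'])
  ultimately show ?thesis ..
qed

end
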